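(* Let $A=\mathbb{K}Q/J^2$ be a radical square zero algebra, with $Q$ having $n$ vertices, of maximal $\phi$-dimension, i.e. $\phi\dim(A)=n$ if the member $M(Q)$ is empty, or $\phi\dim(A)=n-1$ if $M(Q)$ is not empty. Then there is an $A$-module $M=M_1\oplus M_2$ with $M_1$ and $M_2$ indecomposable such that $\phi(M)=\phi\dim(A)$.
   Context: $\mathbb{K}$ is a field, $Q$ is a finite connected quiver, $J$ is the ideal of $\mathbb{K}Q$ generated by the arrows. Modules are finitely generated right modules, with the convention that the simple modules $S_i$ (one per vertex) satisfy $\Omega(S_i)=\bigoplus_{\alpha:i\to j}S_j$. $A_0$ is the direct sum of all simple modules $S_i$. The heart $C(Q)$ is the full subquiver of $Q$ on the vertices whose simple modules lie both in the support of $\Omega^n(A_0)$ and in the support of $\Omega^{-n}(A_0)$ ($\Omega^{-n}$ is the $n$-th cosyzygy); the member $M(Q)$ is the full subquiver on the vertices not in the heart. $K_0(A)$ is the abelian group generated by symbols $[M]$, one for each isomorphism class of finitely generated $A$-modules, modulo the relations $[M]-[M']-[M'']$ whenever $M\cong M'\oplus M''$ and $[P]$ for each projective $P$. The syzygy $\Omega$ induces a group endomorphism $\overline{\Omega}:K_0(A)\to K_0(A)$. For a module $M$, $\langle \mathrm{add}\, M\rangle$ is the subgroup of $K_0(A)$ generated by the classes of the indecomposable direct summands of $M$, and $\phi(M)=\min\{l\in\mathbb{N}: \overline{\Omega}|_{\overline{\Omega}^{l+s}\langle \mathrm{add}\, M\rangle}\text{ is injective for all } s\in\mathbb{N}\}$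 ($0\in\mathbb{N}$). $\phi\dim(A)=\sup\{\phi(M): M\in \mathrm{mod}\,A\}$. *)

theory Defs
  imports
    "HOL-Algebra.Module"
    "HOL-Algebra.QuotRing"
    "HOL-Algebra.Ideal_Product"
    "HOL-Algebra.Generated_Groups"
    "HOL-Algebra.Free_Abelian_Groups"
    "HOL-Library.Extended_Nat"
    "Graph_Theory.Digraph_Component"
begin

section \<open>Right modules over a not necessarily commutative ring\<close>

text \<open>
  The record \<^type>\<open>module\<close> is used with \<open>a \<odot>\<^bsub>M\<^esub> x\<close> standing for the right action \<open>x \<cdot> a\<close>;
  the fields \<open>mult\<close> and \<open>one\<close> of the record are irrelevant.
\<close>

locale right_module = R?: ring R + M?: abelian_group M
  for R :: "('r, 'x) ring_scheme" (structure) and M :: "('r, 'm) module" (structure) +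
  assumes smult_closed:
      "\<lbrakk>a \<in> carrier R; x \<in> carrier M\<rbrakk> \<Longrightarrow> a \<odot>\<^bsub>M\<^esub> x \<in> carrier M"
    and smult_add_left:
      "\<lbrakk>a \<in> carrier R; b \<in> carrier R; x \<in> carrier M\<rbrakk>
        \<Longrightarrow> (a \<oplus>\<^bsub>R\<^esub> b) \<odot>\<^bsub>M\<^esub> x = a \<odot>\<^bsub>M\<^esub> x \<oplus>\<^bsub>M\<^esub> b \<odot>\<^bsub>M\<^esub> x"
    and smult_add_right:
      "\<lbrakk>a \<in> carrier R; x \<in> carrier M; y \<in> carrier M\<rbrakk>
        \<Longrightarrow> a \<odot>\<^bsub>M\<^esub> (x \<oplus>\<^bsub>M\<^esub> y) = a \<odot>\<^bsub>M\<^esub> x \<oplus>\<^bsub>M\<^esub> a \<odot>\<^bsub>M\<^esub> y"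
    and smult_mult:
      "\<lbrakk>a \<in> carrier R; b \<in> carrier R; x \<in> carrier M\<rbrakk>
        \<Longrightarrow> (a \<otimes>\<^bsub>R\<^esub> b) \<odot>\<^bsub>M\<^esub> x = b \<odot>\<^bsub>M\<^esub> (a \<odot>\<^bsub>M\<^esub> x)"
    and smult_one:
      "x \<in> carrier M \<Longrightarrow> \<one>\<^bsub>R\<^esub> \<odot>\<^bsub>M\<^esub> x = x"

text \<open>
  Below, \<open>fg_modules R\<close> is the category mod R as seen inside one fixed carrier type \<open>'m\<close>;
  all notions that quantify over modules quantify over this set.  They have their intended
  meaning when \<open>'m\<close> is large enough to carry a copy of every finitely generated module.
\<close>

definition finitely_generated :: "('r, 'x) ring_scheme \<Rightarrow> ('r, 'm) module \<Rightarrow> bool" where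
  "finitely_generated R M \<longleftrightarrow>
    (\<exists>X. finite X \<and> X \<subseteq> carrier M \<and> (\<forall>N. submodule N R M \<and> X \<subseteq> N \<longrightarrow> N = carrier M))"

definition fg_modules :: "('r, 'x) ring_scheme \<Rightarrow> ('r, 'm) module set" where
  "fg_modules R = {M. right_module R M \<and> finitely_generated R M}"

definition mod_hom ::
    "('r, 'x) ring_scheme \<Rightarrow> ('r, 'm) module \<Rightarrow> ('r, 'n) module \<Rightarrow> ('m \<Rightarrow> 'n) set" where
  "mod_hom R M N = {h \<in> hom (add_monoid M) (add_monoid N).
     \<forall>a\<in>carrier R. \<forall>x\<in>carrier M. h (a \<odot>\<^bsub>M\<^esub> x) = a \<odot>\<^bsub>N\<^esub> h x}"

definition mod_iso :: "('r, 'x) ring_scheme \<Rightarrow> ('r, 'm) module \<Rightarrow> ('r, 'n) module \<Rightarrow> bool" where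
  "mod_iso R M N \<longleftrightarrow> (\<exists>h\<in>mod_hom R M N. bij_betw h (carrier M) (carrier N))"

definition mod_sum2 :: "('r, 'm) module \<Rightarrow> ('r, 'n) module \<Rightarrow> ('r, 'm \<times> 'n) module" where
  "mod_sum2 M N = \<lparr>carrier = carrier M \<times> carrier N, monoid.mult = undefined, one = undefined,
     ring.zero = (\<zero>\<^bsub>M\<^esub>, \<zero>\<^bsub>N\<^esub>),
     add = (\<lambda>(x, y) (x', y'). (x \<oplus>\<^bsub>M\<^esub> x', y \<oplus>\<^bsub>N\<^esub> y')),
     smult = (\<lambda>a (x, y). (a \<odot>\<^bsub>M\<^esub> x, a \<odot>\<^bsub>N\<^esub> y))\<rparr>"

text \<open>The direct sum of a family; only meant for finite index sets, where it is the product.\<close>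

definition mod_sum :: "'i set \<Rightarrow> ('i \<Rightarrow> ('r, 'm) module) \<Rightarrow> ('r, 'i \<Rightarrow> 'm) module" where
  "mod_sum I F = \<lparr>carrier = (\<Pi>\<^sub>E i\<in>I. carrier (F i)), monoid.mult = undefined, one = undefined,
     ring.zero = (\<lambda>i\<in>I. \<zero>\<^bsub>F i\<^esub>),
     add = (\<lambda>x y. \<lambda>i\<in>I. x i \<oplus>\<^bsub>F i\<^esub> y i),
     smult = (\<lambda>a x. \<lambda>i\<in>I. a \<odot>\<^bsub>F i\<^esub> x i)\<rparr>"

definition indecomposable :: "('r, 'x) ring_scheme \<Rightarrow> ('r, 'm) module \<Rightarrow> bool" where
  "indecomposable R M \<longleftrightarrow> carrier M \<noteq> {\<zero>\<^bsub>M\<^esub>} \<and>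
    (\<forall>M'\<in>fg_modules R. \<forall>M''\<in>fg_modules R.
       mod_iso R M (mod_sum2 (M' :: ('r, 'm) module) (M'' :: ('r, 'm) module)) \<longrightarrow>
       carrier M' = {\<zero>\<^bsub>M'\<^esub>} \<or> carrier M'' = {\<zero>\<^bsub>M''\<^esub>})"

definition direct_summand ::
    "('r, 'x) ring_scheme \<Rightarrow> ('r, 'm) module \<Rightarrow> ('r, 'm) module \<Rightarrow> bool" where
  "direct_summand R N M \<longleftrightarrow>
    (\<exists>N'\<in>fg_modules R. mod_iso R M (mod_sum2 N (N' :: ('r, 'm) module)))"

definition projective_mod :: "('r, 'x) ring_scheme \<Rightarrow> ('r, 'm) module \<Rightarrow> bool" where
  "projective_mod R P \<longleftrightarrow>
    (\<forall>X\<in>fg_modules R. \<forall>Y\<in>fg_modules R.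
     \<forall>p\<in>mod_hom R (X :: ('r, 'm) module) (Y :: ('r, 'm) module). \<forall>g\<in>mod_hom R P Y.
       p ` carrier X = carrier Y \<longrightarrow> (\<exists>h\<in>mod_hom R P X. \<forall>x\<in>carrier P. p (h x) = g x))"

definition injective_mod :: "('r, 'x) ring_scheme \<Rightarrow> ('r, 'm) module \<Rightarrow> bool" where
  "injective_mod R I \<longleftrightarrow>
    (\<forall>X\<in>fg_modules R. \<forall>Y\<in>fg_modules R.
     \<forall>j\<in>mod_hom R (X :: ('r, 'm) module) (Y :: ('r, 'm) module). \<forall>g\<in>mod_hom R X I.
       inj_on j (carrier X) \<longrightarrow> (\<exists>h\<in>mod_hom R Y I. \<forall>x\<in>carrier X. h (j x) = g x))"

text \<open>A projective cover is an epimorphism from a projective module with superfluous kernel.\<close>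

definition projective_cover ::
    "('r, 'x) ring_scheme \<Rightarrow> ('r, 'm) module \<Rightarrow> ('m \<Rightarrow> 'm) \<Rightarrow> ('r, 'm) module \<Rightarrow> bool" where
  "projective_cover R P f M \<longleftrightarrow> P \<in> fg_modules R \<and> projective_mod R P \<and>
     f \<in> mod_hom R P M \<and> f ` carrier P = carrier M \<and>
     (\<forall>N. submodule N R P \<and> N <+>\<^bsub>P\<^esub> a_kernel P M f = carrier P \<longrightarrow> N = carrier P)"

text \<open>An injective envelope is a monomorphism into an injective module with essential image.\<close>

definition injective_envelope ::
    "('r, 'x) ring_scheme \<Rightarrow> ('r, 'm) module \<Rightarrow> ('m \<Rightarrow> 'm) \<Rightarrow> ('r, 'm) module \<Rightarrow> bool" where
  "injective_envelope R M f I \<longleftrightarrow> I \<in> fg_modules R \<and> injective_mod R I \<and>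
     f \<in> mod_hom R M I \<and> inj_on f (carrier M) \<and>
     (\<forall>N. submodule N R I \<and> N \<inter> f ` carrier M = {\<zero>\<^bsub>I\<^esub>} \<longrightarrow> N = {\<zero>\<^bsub>I\<^esub>})"

text \<open>
  The syzygy is the kernel of a projective cover and the cosyzygy the cokernel of an injective
  envelope, that is, the target \<open>N\<close> of an epimorphism \<open>I \<rightarrow> N\<close> whose kernel is the image of
  \<open>M\<close>.  Both are determined up to isomorphism; a representative is chosen.
\<close>

definition syzygy :: "('r, 'x) ring_scheme \<Rightarrow> ('r, 'm) module \<Rightarrow> ('r, 'm) module" where
  "syzygy R M = (SOME N. N \<in> fg_modules R \<and>
     (\<exists>P f. projective_cover R P f M \<and> N = P\<lparr>carrier := a_kernel P M f\<rparr>))"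

definition cosyzygy :: "('r, 'x) ring_scheme \<Rightarrow> ('r, 'm) module \<Rightarrow> ('r, 'm) module" where
  "cosyzygy R M = (SOME N. N \<in> fg_modules R \<and>
     (\<exists>I f g. injective_envelope R M f I \<and> g \<in> mod_hom R I N \<and>
        g ` carrier I = carrier N \<and> a_kernel I N g = f ` carrier M))"


section \<open>The group \<open>K\<^sub>0\<close> and the Igusa-Todorov function\<close>

definition iso_class :: "('r, 'x) ring_scheme \<Rightarrow> ('r, 'm) module \<Rightarrow> ('r, 'm) module set" where
  "iso_class R M = {N \<in> fg_modules R. mod_iso R M N}"

definition K0_free ::
    "('r, 'x) ring_scheme \<Rightarrow> (('r, 'm) module set \<Rightarrow>\<^sub>0 int) monoid" where
  "K0_free R = free_Abelian_group (iso_class R ` fg_modules R)"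

definition K0_relations ::
    "('r, 'x) ring_scheme \<Rightarrow> (('r, 'm) module set \<Rightarrow>\<^sub>0 int) set" where
  "K0_relations R = generate (K0_free R)
     ({frag_of (iso_class R M) - frag_of (iso_class R M') - frag_of (iso_class R M'') | M M' M''.
         M \<in> fg_modules R \<and> M' \<in> fg_modules R \<and> M'' \<in> fg_modules R \<and>
         mod_iso R M (mod_sum2 M' M'')}
      \<union> {frag_of (iso_class R P) | P. P \<in> fg_modules R \<and> projective_mod R P})"

definition K0 ::
    "('r, 'x) ring_scheme \<Rightarrow> (('r, 'm) module set \<Rightarrow>\<^sub>0 int) set monoid" where
  "K0 R = K0_free R Mod K0_relations R"

definition K0_class ::
    "('r, 'x) ring_scheme \<Rightarrow> ('r, 'm) module \<Rightarrow> (('r, 'm) module set \<Rightarrow>\<^sub>0 int) set" where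
  "K0_class R M = K0_relations R #>\<^bsub>K0_free R\<^esub> frag_of (iso_class R M)"

definition Omega_bar ::
    "('r, 'x) ring_scheme \<Rightarrow> (('r, 'm) module set \<Rightarrow>\<^sub>0 int) set
      \<Rightarrow> (('r, 'm) module set \<Rightarrow>\<^sub>0 int) set" where
  "Omega_bar R = (THE h. h \<in> hom (K0 R) (K0 R) \<and> h \<in> extensional (carrier (K0 R)) \<and>
     (\<forall>M\<in>fg_modules R. h (K0_class R M) = K0_class R (syzygy R M)))"

definition add_span ::
    "('r, 'x) ring_scheme \<Rightarrow> ('r, 'm) module \<Rightarrow> (('r, 'm) module set \<Rightarrow>\<^sub>0 int) set set" where
  "add_span R M = generate (K0 R)
     {K0_class R N | N. N \<in> fg_modules R \<and> indecomposable R N \<and> direct_summand R N M}"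

definition phi :: "('r, 'x) ring_scheme \<Rightarrow> ('r, 'm) module \<Rightarrow> nat" where
  "phi R M = (LEAST l. \<forall>s. inj_on (Omega_bar R) ((Omega_bar R ^^ (l + s)) ` add_span R M))"


section \<open>Path algebras and radical square zero algebras\<close>

text \<open>
  A quiver is a directed multigraph, with source map \<^const>\<open>tail\<close> and target map \<^const>\<open>head\<close>.
  A path is a pair of its starting vertex and its list of arrows in the order of traversal, so
  the trivial path at \<open>i\<close> is \<open>(i, [])\<close>.
\<close>

definition quiver_paths :: "('v, 'a) pre_digraph \<Rightarrow> ('v \<times> 'a list) set" where
  "quiver_paths Q = {(u, p). \<exists>v. pre_digraph.awalk Q u p v}"

text \<open>
  The product \<open>p q\<close> of two paths is \<open>p\<close> followed by \<open>q\<close> (and zero if \<open>q\<close> does not start where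
  \<open>p\<close> ends).  With right modules this gives \<open>\<Omega>(S\<^sub>i) = \<Oplus>\<^bsub>\<alpha>: i \<rightarrow> j\<^esub> S\<^sub>j\<close>.  The elements are the
  finitely supported functions on paths, so a coefficient of a product is the sum over all ways
  of cutting a path in two.
\<close>

definition path_algebra ::
    "'k::field itself \<Rightarrow> ('v, 'a) pre_digraph \<Rightarrow> ('v \<times> 'a list \<Rightarrow> 'k) ring" where
  "path_algebra K Q =
    \<lparr>carrier = {f. finite {p. f p \<noteq> 0} \<and> {p. f p \<noteq> 0} \<subseteq> quiver_paths Q},
     monoid.mult = (\<lambda>f g (u, p).
       \<Sum>k\<le>length p. f (u, take k p) * g (pre_digraph.awlast Q u (take k p), drop k p)),
     one = (\<lambda>(u, p). if u \<in> verts Q \<and> p = [] then 1 else 0),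
     ring.zero = (\<lambda>p. 0),
     add = (\<lambda>f g p. f p + g p)\<rparr>"

definition path_elem :: "'v \<times> 'a list \<Rightarrow> 'v \<times> 'a list \<Rightarrow> 'k::field" where
  "path_elem p = (\<lambda>q. if q = p then 1 else 0)"

definition arrow_ideal ::
    "'k::field itself \<Rightarrow> ('v, 'a) pre_digraph \<Rightarrow> ('v \<times> 'a list \<Rightarrow> 'k) set" where
  "arrow_ideal K Q =
    genideal (path_algebra K Q) ((\<lambda>\<alpha>. path_elem (tail Q \<alpha>, [\<alpha>])) ` arcs Q)"

definition arrow_ideal_sq ::
    "'k::field itself \<Rightarrow> ('v, 'a) pre_digraph \<Rightarrow> ('v \<times> 'a list \<Rightarrow> 'k) set" where
  "arrow_ideal_sq K Q = ideal_prod (path_algebra K Q) (arrow_ideal K Q) (arrow_ideal K Q)"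

definition rad_sq_zero_algebra ::
    "'k::field itself \<Rightarrow> ('v, 'a) pre_digraph \<Rightarrow> ('v \<times> 'a list \<Rightarrow> 'k) set ring" where
  "rad_sq_zero_algebra K Q = path_algebra K Q Quot arrow_ideal_sq K Q"

definition vertex_idem ::
    "'k::field itself \<Rightarrow> ('v, 'a) pre_digraph \<Rightarrow> 'v \<Rightarrow> ('v \<times> 'a list \<Rightarrow> 'k) set" where
  "vertex_idem K Q i = arrow_ideal_sq K Q +>\<^bsub>path_algebra K Q\<^esub> path_elem (i, [])"

text \<open>
  Finitely generated modules over this algebra are finite-dimensional over the field, hence each of
  them is isomorphic to one whose carrier is a subset of the type \<open>nat \<Rightarrow> 'k\<close>.
\<close>

type_synonym ('v, 'a, 'k) quiver_module = "(('v \<times> 'a list \<Rightarrow> 'k) set, nat \<Rightarrow> 'k) module"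

text \<open>
  \<open>S\<^sub>i\<close> is the field with an element of the algebra acting through its coefficient at the trivial path
  at \<open>i\<close>, which is the same for all representatives of a coset of the squared arrow ideal.
\<close>

definition simple_mod ::
    "'k::field itself \<Rightarrow> 'v \<Rightarrow> (('v \<times> 'a list \<Rightarrow> 'k) set, 'k) module" where
  "simple_mod K i =
    \<lparr>carrier = UNIV, monoid.mult = undefined, one = undefined, ring.zero = 0, add = (+),
     smult = (\<lambda>a x. x * the_elem ((\<lambda>f. f (i, [])) ` a))\<rparr>"

definition A0_mod ::
    "'k::field itself \<Rightarrow> ('v, 'a) pre_digraph \<Rightarrow> ('v, 'a, 'k) quiver_module" where
  "A0_mod K Q = (SOME M. M \<in> fg_modules (rad_sq_zero_algebra K Q) \<and>
     mod_iso (rad_sq_zero_algebra K Q) M (mod_sum (verts Q) (simple_mod K)))"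

text \<open>The vertices \<open>i\<close> with \<open>M e\<^sub>i \<noteq> 0\<close>, that is, those whose \<open>S\<^sub>i\<close> is a composition factor of \<open>M\<close>.\<close>

definition module_support ::
    "'k::field itself \<Rightarrow> ('v, 'a) pre_digraph \<Rightarrow> ('v, 'a, 'k) quiver_module \<Rightarrow> 'v set" where
  "module_support K Q M =
    {i \<in> verts Q. \<exists>x\<in>carrier M. vertex_idem K Q i \<odot>\<^bsub>M\<^esub> x \<noteq> \<zero>\<^bsub>M\<^esub>}"

definition heart_quiver ::
    "'k::field itself \<Rightarrow> ('v, 'a) pre_digraph \<Rightarrow> ('v, 'a) pre_digraph" where
  "heart_quiver K Q =
    (let A = rad_sq_zero_algebra K Q; n = card (verts Q) in
     Q \<restriction> (module_support K Q ((syzygy A ^^ n) (A0_mod K Q)) \<inter>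
          module_support K Q ((cosyzygy A ^^ n) (A0_mod K Q))))"

definition member_quiver ::
    "'k::field itself \<Rightarrow> ('v, 'a) pre_digraph \<Rightarrow> ('v, 'a) pre_digraph" where
  "member_quiver K Q = Q \<restriction> (verts Q - verts (heart_quiver K Q))"

definition phi_dim ::
    "'k::field itself \<Rightarrow> ('v, 'a) pre_digraph \<Rightarrow> enat" where
  "phi_dim K Q =
    (let A = rad_sq_zero_algebra K Q in
     SUP M\<in>(fg_modules A :: ('v, 'a, 'k) quiver_module set). enat (phi A M))"

end

theory Submission
  imports Defs
begin

text \<open>
  Over a radical square zero algebra syzygies are semisimple, so \<open>\<Omega>\<close> factors on \<open>K\<^sub>0\<close> as
  \<open>g \<mapsto> \<Sum>\<^sub>i om\<^sub>i(g) [S\<^sub>i]\<close> with integral functionals \<open>om\<^sub>i\<close>, where only the vertices \<open>i\<close> that are neither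
  sinks nor sources contribute: at a source \<open>om\<^sub>i\<close> vanishes and at a sink \<open>[S\<^sub>i] = 0\<close>.  The number of
  these vertices is at most the \<open>\<phi>\<close>-dimension \<open>D\<close> in question, since a quiver without sinks and sources
  is its own heart.  A module attaining \<open>D \<ge> 2\<close> gives \<open>v\<close> in the span of classes of indecomposables \<open>N\<^sub>k\<close>
  with \<open>\<Omega>\<^sup>D v = 0 \<noteq> \<Omega>\<^sup>D\<^sup>-\<^sup>1 v\<close>.  Some \<open>N\<^sub>1\<close> has \<open>\<Omega>\<^sup>D\<^sup>-\<^sup>1 [N\<^sub>1] \<noteq> 0\<close>; if no single \<open>N\<^sub>k\<close> can replace \<open>v\<close>, then
  for each \<open>k\<close> the \<open>D + 1\<close> elements \<open>[N\<^sub>1], [N\<^sub>k], v, \<Omega> v, \<dots>, \<Omega>\<^sup>D\<^sup>-\<^sup>2 v\<close> satisfy a relation modulo the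
  kernel of \<open>\<Omega>\<close>, hence \<open>\<Omega>\<^sup>D\<close> kills a nontrivial combination of \<open>[N\<^sub>1]\<close> and \<open>[N\<^sub>k]\<close>.  If all these relations
  came from ones already holding for \<open>\<Omega>\<^sup>D\<^sup>-\<^sup>1\<close>, then \<open>\<Omega>\<^sup>D\<^sup>-\<^sup>1 v\<close> would be a rational multiple of \<open>\<Omega>\<^sup>D\<^sup>-\<^sup>1 [N\<^sub>1]\<close>,
  which \<open>\<Omega>\<close> does not kill; so some combination \<open>p [N\<^sub>1] + q [N\<^sub>k]\<close> is killed by \<open>\<Omega>\<^sup>D\<close> but not by \<open>\<Omega>\<^sup>D\<^sup>-\<^sup>1\<close>, which shows
  \<open>\<phi>(N\<^sub>1 \<oplus> N\<^sub>k) = D\<close>.  For \<open>D = 1\<close> the same is done with one simple module and one \<open>N\<^sub>k\<close>, the two being told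
  apart by the multiplicity of \<open>S\<^sub>i\<close> as a direct summand, which is the socle minus the radical in degree \<open>i\<close>.
\<close>

section \<open>Right modules\<close>

text \<open>\<open>K0\<close> is a quotient by relations and no basis of it is at hand, so
  nontriviality of an element has to be witnessed by homomorphisms out of the group. The functionals
  \<open>om i\<close> and \<open>mu i\<close> are such witnesses. Since \<open>mu i\<close> is dual
  to the classes of the simple modules at the vertices that count, the kernel of \<Omega> is the
  common zero set of the \<open>om i\<close>, and its image is torsion-free; all counting of
  relations rests on this. It also explains why D = 1 is separate: there the lower power of \<Omega>
  is the identity, and torsion in \<open>K0\<close> itself has not been excluded.

  A second obstacle is that all notions quantify over modules carried by
  \<open>nat \<Rightarrow> 'k\<close>, while the natural projective and injective modules live on
  products and function spaces. Structural lemmas are therefore stated for arbitrary carrier types,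
  and finite-dimensionality allows the results to be copied back. Syzygies and cosyzygies are
  arbitrary choices, so their properties are shown for every admissible cover and envelope.\<close>

context right_module
begin

lemma smult_zero_left [simp]: "x \<in> carrier M \<Longrightarrow> \<zero>\<^bsub>R\<^esub> \<odot>\<^bsub>M\<^esub> x = \<zero>\<^bsub>M\<^esub>"
  by (metis M.add.r_cancel_one' R.add.l_one R.zero_closed smult_add_left smult_closed)

lemma smult_zero_right [simp]: "a \<in> carrier R \<Longrightarrow> a \<odot>\<^bsub>M\<^esub> \<zero>\<^bsub>M\<^esub> = \<zero>\<^bsub>M\<^esub>"
  by (metis M.add.r_cancel_one' M.add.l_one M.zero_closed smult_add_right smult_closed)

lemma smult_minus_one: "x \<in> carrier M \<Longrightarrow> (\<ominus>\<^bsub>R\<^esub> \<one>\<^bsub>R\<^esub>) \<odot>\<^bsub>M\<^esub> x = \<ominus>\<^bsub>M\<^esub> x"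
  by (metis M.minus_equality R.add.inv_closed R.l_neg R.one_closed smult_add_left smult_closed
      smult_one smult_zero_left)

lemma diff_zero_imp_eq:
  assumes "x \<in> carrier M" "y \<in> carrier M" "x \<ominus>\<^bsub>M\<^esub> y = \<zero>\<^bsub>M\<^esub>"
  shows "x = y"
  using assms M.minus_equality[of x "\<ominus>\<^bsub>M\<^esub> y"] by (simp add: a_minus_def)

lemma neg_zero: "\<ominus>\<^bsub>M\<^esub> \<zero>\<^bsub>M\<^esub> = \<zero>\<^bsub>M\<^esub>"
  using M.minus_equality[of "\<zero>\<^bsub>M\<^esub>" "\<zero>\<^bsub>M\<^esub>"] by simp

lemma smult_minus_right:
  assumes "a \<in> carrier R" "x \<in> carrier M"
  shows "a \<odot>\<^bsub>M\<^esub> (\<ominus>\<^bsub>M\<^esub> x) = \<ominus>\<^bsub>M\<^esub> (a \<odot>\<^bsub>M\<^esub> x)"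
proof (rule M.minus_equality[symmetric])
  show "a \<odot>\<^bsub>M\<^esub> (\<ominus>\<^bsub>M\<^esub> x) \<oplus>\<^bsub>M\<^esub> a \<odot>\<^bsub>M\<^esub> x = \<zero>\<^bsub>M\<^esub>"
    using assms smult_add_right[of a "\<ominus>\<^bsub>M\<^esub> x" x] by (simp add: M.l_neg)
qed (use assms smult_closed in auto)

lemma smult_finsum:
  assumes "a \<in> carrier R" "finite I" "f \<in> I \<rightarrow> carrier M"
  shows "a \<odot>\<^bsub>M\<^esub> (\<Oplus>\<^bsub>M\<^esub>i\<in>I. f i) = (\<Oplus>\<^bsub>M\<^esub>i\<in>I. a \<odot>\<^bsub>M\<^esub> f i)"
  using assms(2,3)
proof (induction I)
  case (insert i I)
  have *: "f \<in> I \<rightarrow> carrier M" "f i \<in> carrier M" "(\<lambda>i. a \<odot>\<^bsub>M\<^esub> f i) \<in> I \<rightarrow> carrier M"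
    using insert.prems assms(1) smult_closed by auto
  show ?case
    using * insert assms(1) by (simp add: M.finsum_insert smult_add_right smult_closed)
qed (use assms in simp)

end

lemma right_moduleI:
  assumes "ring R"
    and "\<zero>\<^bsub>M\<^esub> \<in> carrier M"
    and "\<And>x y. \<lbrakk>x \<in> carrier M; y \<in> carrier M\<rbrakk> \<Longrightarrow> x \<oplus>\<^bsub>M\<^esub> y \<in> carrier M"
    and "\<And>x y z. \<lbrakk>x \<in> carrier M; y \<in> carrier M; z \<in> carrier M\<rbrakk>
      \<Longrightarrow> (x \<oplus>\<^bsub>M\<^esub> y) \<oplus>\<^bsub>M\<^esub> z = x \<oplus>\<^bsub>M\<^esub> (y \<oplus>\<^bsub>M\<^esub> z)"
    and "\<And>x y. \<lbrakk>x \<in> carrier M; y \<in> carrier M\<rbrakk> \<Longrightarrow> x \<oplus>\<^bsub>M\<^esub> y = y \<oplus>\<^bsub>M\<^esub> x"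
    and "\<And>x. x \<in> carrier M \<Longrightarrow> \<zero>\<^bsub>M\<^esub> \<oplus>\<^bsub>M\<^esub> x = x"
    and "\<And>x. x \<in> carrier M \<Longrightarrow> \<exists>y\<in>carrier M. y \<oplus>\<^bsub>M\<^esub> x = \<zero>\<^bsub>M\<^esub>"
    and "\<And>a x. \<lbrakk>a \<in> carrier R; x \<in> carrier M\<rbrakk> \<Longrightarrow> a \<odot>\<^bsub>M\<^esub> x \<in> carrier M"
    and "\<And>a b x. \<lbrakk>a \<in> carrier R; b \<in> carrier R; x \<in> carrier M\<rbrakk>
      \<Longrightarrow> (a \<oplus>\<^bsub>R\<^esub> b) \<odot>\<^bsub>M\<^esub> x = a \<odot>\<^bsub>M\<^esub> x \<oplus>\<^bsub>M\<^esub> b \<odot>\<^bsub>M\<^esub> x"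
    and "\<And>a x y. \<lbrakk>a \<in> carrier R; x \<in> carrier M; y \<in> carrier M\<rbrakk>
      \<Longrightarrow> a \<odot>\<^bsub>M\<^esub> (x \<oplus>\<^bsub>M\<^esub> y) = a \<odot>\<^bsub>M\<^esub> x \<oplus>\<^bsub>M\<^esub> a \<odot>\<^bsub>M\<^esub> y"
    and "\<And>a b x. \<lbrakk>a \<in> carrier R; b \<in> carrier R; x \<in> carrier M\<rbrakk>
      \<Longrightarrow> (a \<otimes>\<^bsub>R\<^esub> b) \<odot>\<^bsub>M\<^esub> x = b \<odot>\<^bsub>M\<^esub> (a \<odot>\<^bsub>M\<^esub> x)"
    and "\<And>x. x \<in> carrier M \<Longrightarrow> \<one>\<^bsub>R\<^esub> \<odot>\<^bsub>M\<^esub> x = x"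
  shows "right_module R M"
proof -
  have "abelian_group M"
    by (rule abelian_groupI) (use assms in auto)
  then show ?thesis
    unfolding right_module_def right_module_axioms_def using assms by auto
qed

text \<open>All axioms are checked after applying the injection \<open>f\<close>; the additive
  inverse of \<open>x\<close> is \<open>x\<close> acted on by minus one. This covers submodules,
  with \<open>f = id\<close>, as well as transported structures.\<close>

lemma right_module_embed:
  assumes "right_module R M"
    and f: "\<And>x. x \<in> carrier N \<Longrightarrow> f x \<in> carrier M" "inj_on f (carrier N)"
    and z: "\<zero>\<^bsub>N\<^esub> \<in> carrier N" "f \<zero>\<^bsub>N\<^esub> = \<zero>\<^bsub>M\<^esub>"
    and a: "\<And>x y. \<lbrakk>x \<in> carrier N; y \<in> carrier N\<rbrakk> \<Longrightarrow> x \<oplus>\<^bsub>N\<^esub> y \<in> carrier N \<and> f (x \<oplus>\<^bsub>N\<^esub> y) = f x \<oplus>\<^bsub>M\<^esub> f y"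
    and s: "\<And>a x. \<lbrakk>a \<in> carrier R; x \<in> carrier N\<rbrakk> \<Longrightarrow> a \<odot>\<^bsub>N\<^esub> x \<in> carrier N \<and> f (a \<odot>\<^bsub>N\<^esub> x) = a \<odot>\<^bsub>M\<^esub> f x"
  shows "right_module R N"
proof -
  interpret M: right_module R M by fact
  have eq: "x = y" if "f x = f y" "x \<in> carrier N" "y \<in> carrier N" for x y
    using f(2) that by (auto dest: inj_onD)
  show ?thesis
  proof (rule right_moduleI)
    show "\<exists>y\<in>carrier N. y \<oplus>\<^bsub>N\<^esub> x = \<zero>\<^bsub>N\<^esub>" if "x \<in> carrier N" for x
    proof (intro bexI)
      show "(\<ominus>\<^bsub>R\<^esub> \<one>\<^bsub>R\<^esub>) \<odot>\<^bsub>N\<^esub> x \<in> carrier N" using s that by simp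
      then show "(\<ominus>\<^bsub>R\<^esub> \<one>\<^bsub>R\<^esub>) \<odot>\<^bsub>N\<^esub> x \<oplus>\<^bsub>N\<^esub> x = \<zero>\<^bsub>N\<^esub>"
        by (intro eq) (use a s z f(1) that in \<open>simp_all add: M.smult_minus_one M.l_neg\<close>)
    qed
  qed (use assms M.ring_axioms in \<open>auto intro!: eq simp: M.M.add.m_ac
     M.smult_add_left M.smult_add_right M.smult_mult M.smult_one M.smult_closed\<close>)
qed

text \<open>Closure under negation comes from the action of minus one.\<close>

lemma submoduleI:
  assumes "right_module R M" "U \<subseteq> carrier M" "\<zero>\<^bsub>M\<^esub> \<in> U"
    "\<And>x y. \<lbrakk>x \<in> U; y \<in> U\<rbrakk> \<Longrightarrow> x \<oplus>\<^bsub>M\<^esub> y \<in> U"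
    "\<And>a x. \<lbrakk>a \<in> carrier R; x \<in> U\<rbrakk> \<Longrightarrow> a \<odot>\<^bsub>M\<^esub> x \<in> U"
  shows "submodule U R M"
proof -
  interpret M: right_module R M by fact
  have "\<ominus>\<^bsub>M\<^esub> x \<in> U" if "x \<in> U" for x
    using assms(2,5) that by (metis M.R.add.inv_closed M.R.one_closed M.smult_minus_one subsetD)
  then have "subgroup U (add_monoid M)"
    by (intro M.add.subgroupI) (use assms in \<open>auto simp: a_inv_def\<close>)
  then show ?thesis
    unfolding submodule_def submodule_axioms_def using assms by auto
qed

lemma submoduleD:
  assumes "submodule U R M"
  shows "U \<subseteq> carrier M" "\<And>x. x \<in> U \<Longrightarrow> x \<in> carrier M" "\<zero>\<^bsub>M\<^esub> \<in> U"
    "\<And>x y. \<lbrakk>x \<in> U; y \<in> U\<rbrakk> \<Longrightarrow> x \<oplus>\<^bsub>M\<^esub> y \<in> U"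
    "\<And>x. x \<in> U \<Longrightarrow> \<ominus>\<^bsub>M\<^esub> x \<in> U"
    "\<And>a x. \<lbrakk>a \<in> carrier R; x \<in> U\<rbrakk> \<Longrightarrow> a \<odot>\<^bsub>M\<^esub> x \<in> U"
proof -
  have "subgroup U (add_monoid M)" using assms by (simp add: submodule_def)
  then show "U \<subseteq> carrier M" "\<And>x. x \<in> U \<Longrightarrow> x \<in> carrier M" "\<zero>\<^bsub>M\<^esub> \<in> U"
    "\<And>x y. \<lbrakk>x \<in> U; y \<in> U\<rbrakk> \<Longrightarrow> x \<oplus>\<^bsub>M\<^esub> y \<in> U"
    "\<And>x. x \<in> U \<Longrightarrow> \<ominus>\<^bsub>M\<^esub> x \<in> U"
    using subgroup.subset subgroup.one_closed subgroup.m_closed subgroup.m_inv_closed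
    by (fastforce simp: a_inv_def)+
qed (use assms in \<open>auto simp: submodule_def submodule_axioms_def\<close>)

lemma right_module_sub:
  assumes "right_module R M" "submodule U R M"
  shows "right_module R (M\<lparr>carrier := U\<rparr>)"
  by (rule right_module_embed[OF assms(1), where f = id]) (use submoduleD[OF assms(2)] in auto)

lemma submodule_UNIV:
  assumes "right_module R M"
  shows "submodule (carrier M) R M"
proof -
  interpret M: right_module R M by fact
  show ?thesis using assms by (rule submoduleI) (auto simp: M.smult_closed)
qed

section \<open>Homomorphisms, kernels and images\<close>

lemma mod_homI:
  assumes "\<And>x. x \<in> carrier M \<Longrightarrow> h x \<in> carrier N"
    "\<And>x y. \<lbrakk>x \<in> carrier M; y \<in> carrier M\<rbrakk> \<Longrightarrow> h (x \<oplus>\<^bsub>M\<^esub> y) = h x \<oplus>\<^bsub>N\<^esub> h y"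
    "\<And>a x. \<lbrakk>a \<in> carrier R; x \<in> carrier M\<rbrakk> \<Longrightarrow> h (a \<odot>\<^bsub>M\<^esub> x) = a \<odot>\<^bsub>N\<^esub> h x"
  shows "h \<in> mod_hom R M N"
  using assms by (auto simp: mod_hom_def hom_def)

lemma mod_homD:
  assumes "h \<in> mod_hom R M N"
  shows "\<And>x. x \<in> carrier M \<Longrightarrow> h x \<in> carrier N"
    "\<And>x y. \<lbrakk>x \<in> carrier M; y \<in> carrier M\<rbrakk> \<Longrightarrow> h (x \<oplus>\<^bsub>M\<^esub> y) = h x \<oplus>\<^bsub>N\<^esub> h y"
    "\<And>a x. \<lbrakk>a \<in> carrier R; x \<in> carrier M\<rbrakk> \<Longrightarrow> h (a \<odot>\<^bsub>M\<^esub> x) = a \<odot>\<^bsub>N\<^esub> h x"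
  using assms by (auto simp: mod_hom_def hom_def)

lemma mod_hom_zero:
  assumes "h \<in> mod_hom R M N" "right_module R M" "right_module R N"
  shows "h \<zero>\<^bsub>M\<^esub> = \<zero>\<^bsub>N\<^esub>"
proof -
  interpret M: right_module R M by fact
  interpret N: right_module R N by fact
  show ?thesis
    using mod_homD[OF assms(1)]
    by (metis M.M.add.l_one M.M.zero_closed N.M.add.r_cancel_one')
qed

lemma mod_hom_minus:
  assumes "h \<in> mod_hom R M N" "right_module R M" "right_module R N" "x \<in> carrier M"
  shows "h (\<ominus>\<^bsub>M\<^esub> x) = \<ominus>\<^bsub>N\<^esub> h x"
proof -
  interpret M: right_module R M by fact
  interpret N: right_module R N by fact
  show ?thesis
    using mod_homD[OF assms(1)] assms(4) M.smult_minus_one N.smult_minus_one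
    by (metis M.R.add.inv_closed M.R.one_closed)
qed

lemma mod_hom_diff:
  assumes "h \<in> mod_hom R M N" "right_module R M" "right_module R N" "x \<in> carrier M" "y \<in> carrier M"
  shows "h (x \<ominus>\<^bsub>M\<^esub> y) = h x \<ominus>\<^bsub>N\<^esub> h y"
proof -
  interpret M: right_module R M by fact
  show ?thesis
    using assms mod_hom_minus[OF assms(1-3,5)] mod_homD(2)[OF assms(1)]
    by (simp add: a_minus_def)
qed

lemma mod_hom_finsum:
  assumes "h \<in> mod_hom R M N" "right_module R M" "right_module R N" "finite I" "f \<in> I \<rightarrow> carrier M"
  shows "h (\<Oplus>\<^bsub>M\<^esub>i\<in>I. f i) = (\<Oplus>\<^bsub>N\<^esub>i\<in>I. h (f i))"
proof -
  interpret M: right_module R M by fact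
  interpret N: right_module R N by fact
  note h = mod_homD[OF assms(1)]
  show ?thesis using assms(4,5)
  proof (induction I)
    case empty
    then show ?case using mod_hom_zero[OF assms(1-3)] by simp
  next
    case (insert i I)
    have *: "f \<in> I \<rightarrow> carrier M" "f i \<in> carrier M" "(\<lambda>i. h (f i)) \<in> I \<rightarrow> carrier N"
      using insert.prems h(1) by (auto simp: Pi_iff)
    show ?case using * insert h by simp
  qed
qed

lemma mod_hom_id: "id \<in> mod_hom R M M"
  by (auto intro: mod_homI)

lemma mod_hom_comp:
  assumes "h \<in> mod_hom R M N" "g \<in> mod_hom R N P"
  shows "(\<lambda>x. g (h x)) \<in> mod_hom R M P"
  using mod_homD[OF assms(1)] mod_homD[OF assms(2)] by (auto intro!: mod_homI)

lemma mod_hom_inv: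
  assumes "h \<in> mod_hom R M N" "bij_betw h (carrier M) (carrier N)" "right_module R M"
  shows "inv_into (carrier M) h \<in> mod_hom R N M"
proof -
  interpret M: right_module R M by fact
  note h = mod_homD[OF assms(1)]
  have c: "inv_into (carrier M) h y \<in> carrier M" "h (inv_into (carrier M) h y) = y"
    if "y \<in> carrier N" for y
    using assms(2) that by (auto simp: bij_betw_def inv_into_into f_inv_into_f)
  have u: "inv_into (carrier M) h y = x" if "h x = y" "x \<in> carrier M" for x y
    using assms(2) that by (auto simp: bij_betw_def inv_into_f_eq)
  show ?thesis by (rule mod_homI) (auto intro!: u c simp: c h M.smult_closed)
qed

lemma mod_iso_refl: "mod_iso R M M"
  unfolding mod_iso_def by (rule bexI[OF _ mod_hom_id]) auto

lemma mod_iso_sym: "mod_iso R M N \<Longrightarrow> right_module R M \<Longrightarrow> mod_iso R N M"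
  unfolding mod_iso_def using mod_hom_inv bij_betw_inv_into by blast

lemma mod_iso_trans: "mod_iso R M N \<Longrightarrow> mod_iso R N P \<Longrightarrow> mod_iso R M P"
  unfolding mod_iso_def using mod_hom_comp bij_betw_trans by (fastforce simp: comp_def)

lemma mod_isoI:
  assumes "h \<in> mod_hom R M N" "right_module R M" "right_module R N"
    "\<And>x. \<lbrakk>x \<in> carrier M; h x = \<zero>\<^bsub>N\<^esub>\<rbrakk> \<Longrightarrow> x = \<zero>\<^bsub>M\<^esub>" "h ` carrier M = carrier N"
  shows "mod_iso R M N"
proof -
  interpret M: right_module R M by fact
  interpret N: right_module R N by fact
  have "inj_on h (carrier M)"
  proof (rule inj_onI)
    fix x y assume *: "x \<in> carrier M" "y \<in> carrier M" "h x = h y"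
    then have "h (x \<ominus>\<^bsub>M\<^esub> y) = \<zero>\<^bsub>N\<^esub>"
      using mod_hom_diff[OF assms(1-3)] mod_homD(1)[OF assms(1)]
      by (simp add: N.M.r_neg a_minus_def)
    then show "x = y" using * assms(4) by (metis M.M.minus_closed M.diff_zero_imp_eq)
  qed
  then show ?thesis using assms(1,5) unfolding mod_iso_def bij_betw_def by blast
qed

lemma mod_iso_identity:
  assumes "carrier M = carrier N"
    "\<And>x y. \<lbrakk>x \<in> carrier N; y \<in> carrier N\<rbrakk> \<Longrightarrow> x \<oplus>\<^bsub>M\<^esub> y = x \<oplus>\<^bsub>N\<^esub> y"
    "\<And>a x. \<lbrakk>a \<in> carrier R; x \<in> carrier N\<rbrakk> \<Longrightarrow> a \<odot>\<^bsub>M\<^esub> x = a \<odot>\<^bsub>N\<^esub> x"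
  shows "mod_iso R M N"
  unfolding mod_iso_def
  by (rule bexI[of _ id]) (use assms in \<open>auto intro!: mod_homI\<close>)

lemma submodule_kernel:
  assumes "h \<in> mod_hom R M N" "right_module R M" "right_module R N"
  shows "submodule (a_kernel M N h) R M"
proof -
  interpret M: right_module R M by fact
  interpret N: right_module R N by fact
  show ?thesis
    by (rule submoduleI[OF assms(2)])
      (use mod_homD[OF assms(1)] mod_hom_zero[OF assms] in \<open>auto simp: a_kernel_def' M.smult_closed\<close>)
qed

lemma submodule_image:
  assumes "h \<in> mod_hom R M N" "right_module R M" "right_module R N" "submodule U R M"
  shows "submodule (h ` U) R N"
proof -
  note h = mod_homD[OF assms(1)] and U = submoduleD[OF assms(4)]
  show ?thesis
  proof (rule submoduleI[OF assms(3)])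
    show "\<zero>\<^bsub>N\<^esub> \<in> h ` U" using mod_hom_zero[OF assms(1-3)] U(3) by (metis imageI)
    show "x \<oplus>\<^bsub>N\<^esub> y \<in> h ` U" if xy: "x \<in> h ` U" "y \<in> h ` U" for x y
    proof -
      obtain u v where "u \<in> U" "v \<in> U" "x = h u" "y = h v" using xy by blast
      then show ?thesis using h(2)[of u v] U(2,4) by (metis imageI)
    qed
    show "a \<odot>\<^bsub>N\<^esub> y \<in> h ` U" if ay: "a \<in> carrier R" "y \<in> h ` U" for a y
    proof -
      obtain u where "u \<in> U" "y = h u" using ay by blast
      then show ?thesis using h(3)[of a u] ay(1) U(2,6) by (metis imageI)
    qed
  qed (use h(1) U in auto)
qed

lemma submodule_vimage:
  assumes "h \<in> mod_hom R M N" "right_module R M" "right_module R N" "submodule U R N"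
  shows "submodule {x \<in> carrier M. h x \<in> U} R M"
proof -
  interpret M: right_module R M by fact
  show ?thesis
    by (rule submoduleI[OF assms(2)])
      (use mod_homD[OF assms(1)] submoduleD[OF assms(4)] mod_hom_zero[OF assms(1-3)]
        in \<open>auto simp: M.smult_closed\<close>)
qed

section \<open>Binary direct sums\<close>

lemma mod_sum2_simps [simp]:
  "carrier (mod_sum2 M N) = carrier M \<times> carrier N"
  "\<zero>\<^bsub>mod_sum2 M N\<^esub> = (\<zero>\<^bsub>M\<^esub>, \<zero>\<^bsub>N\<^esub>)"
  "p \<oplus>\<^bsub>mod_sum2 M N\<^esub> q = (fst p \<oplus>\<^bsub>M\<^esub> fst q, snd p \<oplus>\<^bsub>N\<^esub> snd q)"
  "a \<odot>\<^bsub>mod_sum2 M N\<^esub> p = (a \<odot>\<^bsub>M\<^esub> fst p, a \<odot>\<^bsub>N\<^esub> snd p)"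
  by (auto simp: mod_sum2_def split: prod.splits)

lemma right_module_mod_sum2:
  assumes "right_module R M" "right_module R N"
  shows "right_module R (mod_sum2 M N)"
proof -
  interpret M: right_module R M by fact
  interpret N: right_module R N by fact
  show ?thesis
  proof (rule right_moduleI)
    show "\<exists>y\<in>carrier (mod_sum2 M N). y \<oplus>\<^bsub>mod_sum2 M N\<^esub> x = \<zero>\<^bsub>mod_sum2 M N\<^esub>"
      if "x \<in> carrier (mod_sum2 M N)" for x
      by (rule bexI[of _ "(\<ominus>\<^bsub>M\<^esub> fst x, \<ominus>\<^bsub>N\<^esub> snd x)"]) (use that in \<open>auto simp: M.M.l_neg N.M.l_neg\<close>)
  qed (auto simp: M.R.ring_axioms M.smult_closed N.smult_closed M.M.add.m_ac N.M.add.m_ac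
        M.smult_add_left N.smult_add_left M.smult_add_right
        N.smult_add_right M.smult_mult N.smult_mult M.smult_one N.smult_one)
qed

lemma mod_iso_sum2_cong:
  assumes "mod_iso R M M'" "mod_iso R N N'"
  shows "mod_iso R (mod_sum2 M N) (mod_sum2 M' N')"
proof -
  obtain f g where f: "f \<in> mod_hom R M M'" "bij_betw f (carrier M) (carrier M')"
    and g: "g \<in> mod_hom R N N'" "bij_betw g (carrier N) (carrier N')"
    using assms unfolding mod_iso_def by blast
  show ?thesis unfolding mod_iso_def
  proof (intro bexI)
    show "map_prod f g \<in> mod_hom R (mod_sum2 M N) (mod_sum2 M' N')"
      by (rule mod_homI) (use mod_homD[OF f(1)] mod_homD[OF g(1)] in auto)
    show "bij_betw (map_prod f g) (carrier (mod_sum2 M N)) (carrier (mod_sum2 M' N'))"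
      using bij_betw_map_prod[OF f(2) g(2)] by simp
  qed
qed

lemma mod_iso_sum2_swap: "mod_iso R (mod_sum2 M N) (mod_sum2 N M)"
  unfolding mod_iso_def
  by (rule bexI[of _ prod.swap]) (auto intro!: mod_homI simp: bij_betw_def)

lemma mod_iso_sum2_zero:
  assumes "right_module R M" "right_module R Z" "carrier Z = {\<zero>\<^bsub>Z\<^esub>}"
  shows "mod_iso R (mod_sum2 M Z) M"
  by (rule mod_isoI[of fst]) (use assms right_module_mod_sum2[OF assms(1,2)] in \<open>auto intro!: mod_homI\<close>)

text \<open>For a split epimorphism every x is the sum of g (h x) and x - g (h x), the latter in the
  kernel. Simple summands are later split off in this way.\<close>

lemma mod_iso_sum2_split:
  assumes "right_module R M" "right_module R N" "h \<in> mod_hom R M N" "g \<in> mod_hom R N M"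
    "\<And>n. n \<in> carrier N \<Longrightarrow> h (g n) = n"
  shows "mod_iso R M (mod_sum2 N (M\<lparr>carrier := a_kernel M N h\<rparr>))"
proof -
  interpret M: right_module R M by fact
  interpret N: right_module R N by fact
  note h = mod_homD[OF assms(3)] and g = mod_homD[OF assms(4)]
  let ?K = "M\<lparr>carrier := a_kernel M N h\<rparr>"
  have K: "right_module R ?K"
    by (intro right_module_sub submodule_kernel assms)
  have "mod_iso R (mod_sum2 N ?K) M"
  proof (rule mod_isoI[of "\<lambda>p. g (fst p) \<oplus>\<^bsub>M\<^esub> snd p"])
    show "(\<lambda>p. g (fst p) \<oplus>\<^bsub>M\<^esub> snd p) \<in> mod_hom R (mod_sum2 N ?K) M"
      by (rule mod_homI)
        (auto simp: a_kernel_def' g M.M.add.m_ac M.smult_add_right M.smult_closed)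
    show "x = \<zero>\<^bsub>mod_sum2 N ?K\<^esub>"
      if "x \<in> carrier (mod_sum2 N ?K)" "g (fst x) \<oplus>\<^bsub>M\<^esub> snd x = \<zero>\<^bsub>M\<^esub>" for x
    proof -
      have x: "fst x \<in> carrier N" "snd x \<in> carrier M" "h (snd x) = \<zero>\<^bsub>N\<^esub>"
        using that by (auto simp: a_kernel_def')
      have "h (g (fst x) \<oplus>\<^bsub>M\<^esub> snd x) = fst x" using x h g assms(5) by simp
      then have "fst x = \<zero>\<^bsub>N\<^esub>" using that mod_hom_zero[OF assms(3,1,2)] by simp
      then show ?thesis using that x mod_hom_zero[OF assms(4,2,1)] by (auto simp: prod_eq_iff)
    qed
    show "(\<lambda>p. g (fst p) \<oplus>\<^bsub>M\<^esub> snd p) ` carrier (mod_sum2 N ?K) = carrier M"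
    proof (intro equalityI subsetI)
      fix x assume x: "x \<in> carrier M"
      have "x = g (h x) \<oplus>\<^bsub>M\<^esub> (x \<ominus>\<^bsub>M\<^esub> g (h x))"
        using x h g by (simp add: a_minus_def M.M.add.m_lcomm M.M.r_neg)
      moreover have "h (x \<ominus>\<^bsub>M\<^esub> g (h x)) = \<zero>\<^bsub>N\<^esub>"
        using x h g assms(5) mod_hom_diff[OF assms(3,1,2)] by (simp add: N.M.r_neg a_minus_def)
      ultimately show "x \<in> (\<lambda>p. g (fst p) \<oplus>\<^bsub>M\<^esub> snd p) ` carrier (mod_sum2 N ?K)"
        using x h g by (intro image_eqI[where x = "(h x, x \<ominus>\<^bsub>M\<^esub> g (h x))"]) (auto simp: a_kernel_def')
    qed (use g in \<open>auto simp: a_kernel_def'\<close>)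
  qed (use K assms right_module_mod_sum2 in auto)
  then show ?thesis by (rule mod_iso_sym) (intro right_module_mod_sum2 assms K)
qed

text \<open>Transport of structure along an injection into another type. It carries modules built on
  products and function spaces back to the fixed carrier type over which the notions of the theorem
  quantify.\<close>

lemma right_module_copy:
  fixes \<phi> :: "'m \<Rightarrow> 'n"
  assumes M: "right_module R (M :: ('r, 'm) module)" and inj: "inj_on \<phi> (carrier M)"
  shows "\<exists>N :: ('r, 'n) module. right_module R N \<and> mod_iso R M N"
proof -
  interpret M: right_module R M by (rule M)
  define \<psi> where "\<psi> = inv_into (carrier M) \<phi>"
  have \<psi>: "\<psi> (\<phi> x) = x" if "x \<in> carrier M" for x using inj that by (simp add: \<psi>_def)
  define N :: "('r, 'n) module" where
    "N = \<lparr>carrier = \<phi> ` carrier M, monoid.mult = undefined, one = undefined, ring.zero = \<phi> \<zero>\<^bsub>M\<^esub>,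
      add = (\<lambda>x y. \<phi> (\<psi> x \<oplus>\<^bsub>M\<^esub> \<psi> y)), smult = (\<lambda>a x. \<phi> (a \<odot>\<^bsub>M\<^esub> \<psi> x))\<rparr>"
  have "right_module R N"
    by (rule right_module_embed[OF M, where f = \<psi>])
      (auto simp: N_def \<psi> M.smult_closed intro!: inj_onI)
  moreover have "mod_iso R M N" unfolding mod_iso_def
    by (rule bexI[of _ \<phi>]) (auto intro!: mod_homI simp: N_def \<psi> inj bij_betw_def)
  ultimately show ?thesis by blast
qed

section \<open>Finite generation\<close>

lemma finitely_generatedI:
  assumes "finite X" "X \<subseteq> carrier M"
    "\<And>U. \<lbrakk>submodule U R M; X \<subseteq> U\<rbrakk> \<Longrightarrow> U = carrier M"
  shows "finitely_generated R M"
  using assms unfolding finitely_generated_def by (intro exI[of _ X]) blast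

lemma finitely_generated_image:
  assumes "right_module R M" "right_module R N" "h \<in> mod_hom R M N" "h ` carrier M = carrier N"
    "finitely_generated R M"
  shows "finitely_generated R N"
proof -
  obtain X where X: "finite X" "X \<subseteq> carrier M"
    "\<forall>U. submodule U R M \<and> X \<subseteq> U \<longrightarrow> U = carrier M"
    using assms(5) unfolding finitely_generated_def by blast
  show ?thesis
  proof (rule finitely_generatedI)
    fix U assume U: "submodule U R N" "h ` X \<subseteq> U"
    have "submodule {x \<in> carrier M. h x \<in> U} R M"
      by (rule submodule_vimage[OF assms(3,1,2) U(1)])
    moreover have "X \<subseteq> {x \<in> carrier M. h x \<in> U}" using U(2) X(2) by auto
    ultimately have "{x \<in> carrier M. h x \<in> U} = carrier M" using X(3) by metis
    then have "h ` carrier M \<subseteq> U" by auto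
    then show "U = carrier N" using assms(4) submoduleD(1)[OF U(1)] by simp
  qed (use X(1,2) mod_homD(1)[OF assms(3)] in auto)
qed

lemma finitely_generated_iso:
  assumes "right_module R M" "right_module R N" "mod_iso R M N" "finitely_generated R M"
  shows "finitely_generated R N"
proof -
  obtain h where "h \<in> mod_hom R M N" "bij_betw h (carrier M) (carrier N)"
    using assms(3) unfolding mod_iso_def by blast
  then show ?thesis
    using finitely_generated_image[OF assms(1,2) _ _ assms(4)] by (auto simp: bij_betw_def)
qed

lemma finitely_generated_mod_sum2:
  assumes "right_module R M" "right_module R N" "finitely_generated R M" "finitely_generated R N"
  shows "finitely_generated R (mod_sum2 M N)"
proof -
  interpret M: right_module R M by fact
  interpret N: right_module R N by fact
  obtain X where X: "finite X" "X \<subseteq> carrier M"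
    "\<forall>U. submodule U R M \<and> X \<subseteq> U \<longrightarrow> U = carrier M"
    using assms(3) unfolding finitely_generated_def by blast
  obtain Y where Y: "finite Y" "Y \<subseteq> carrier N"
    "\<forall>U. submodule U R N \<and> Y \<subseteq> U \<longrightarrow> U = carrier N"
    using assms(4) unfolding finitely_generated_def by blast
  let ?Z = "(\<lambda>x. (x, \<zero>\<^bsub>N\<^esub>)) ` X \<union> (\<lambda>y. (\<zero>\<^bsub>M\<^esub>, y)) ` Y"
  have "U = carrier (mod_sum2 M N)" if U: "submodule U R (mod_sum2 M N)" "?Z \<subseteq> U" for U
  proof -
    have i1: "(\<lambda>x. (x, \<zero>\<^bsub>N\<^esub>)) \<in> mod_hom R M (mod_sum2 M N)" by (rule mod_homI) auto
    have i2: "(\<lambda>y. (\<zero>\<^bsub>M\<^esub>, y)) \<in> mod_hom R N (mod_sum2 M N)" by (rule mod_homI) auto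
    have "{x \<in> carrier M. (x, \<zero>\<^bsub>N\<^esub>) \<in> U} = carrier M"
      using U X(2)
      by (intro X(3)[rule_format] conjI submodule_vimage[OF i1 assms(1) right_module_mod_sum2[OF assms(1,2)]]) auto
    moreover have "{y \<in> carrier N. (\<zero>\<^bsub>M\<^esub>, y) \<in> U} = carrier N"
      using U Y(2)
      by (intro Y(3)[rule_format] conjI submodule_vimage[OF i2 assms(2) right_module_mod_sum2[OF assms(1,2)]]) auto
    ultimately have "(x, y) \<in> U" if "x \<in> carrier M" "y \<in> carrier N" for x y
      using submoduleD(4)[OF U(1), of "(x, \<zero>\<^bsub>N\<^esub>)" "(\<zero>\<^bsub>M\<^esub>, y)"] that by auto
    then show ?thesis using submoduleD(1)[OF U(1)] by auto
  qed
  then show ?thesis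
    using X(1,2) Y(1,2) by (intro finitely_generatedI[of ?Z]) auto
qed

section \<open>Sums of submodules and projections\<close>

lemma submodule_zero:
  assumes "right_module R M"
  shows "submodule {\<zero>\<^bsub>M\<^esub>} R M"
proof -
  interpret M: right_module R M by fact
  show ?thesis by (rule submoduleI[OF assms]) auto
qed

lemma set_addI: "u \<in> U \<Longrightarrow> w \<in> W \<Longrightarrow> x = u \<oplus>\<^bsub>M\<^esub> w \<Longrightarrow> x \<in> U <+>\<^bsub>M\<^esub> W"
  unfolding set_add_def' by blast

lemma set_addE:
  assumes "x \<in> U <+>\<^bsub>M\<^esub> W"
  obtains u w where "u \<in> U" "w \<in> W" "x = u \<oplus>\<^bsub>M\<^esub> w"
  using assms unfolding set_add_def' by blast

lemma submodule_set_add: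
  assumes "right_module R M" "submodule U R M" "submodule W R M"
  shows "submodule (U <+>\<^bsub>M\<^esub> W) R M"
proof -
  interpret M: right_module R M by fact
  note U = submoduleD[OF assms(2)] and W = submoduleD[OF assms(3)]
  show ?thesis
  proof (rule submoduleI[OF assms(1)])
    show "U <+>\<^bsub>M\<^esub> W \<subseteq> carrier M" using U(2) W(2) by (auto simp: set_add_def')
    show "\<zero>\<^bsub>M\<^esub> \<in> U <+>\<^bsub>M\<^esub> W"
      by (rule set_addI[OF U(3) W(3)]) simp
    fix x y assume "x \<in> U <+>\<^bsub>M\<^esub> W" "y \<in> U <+>\<^bsub>M\<^esub> W"
    then obtain u w u' w' where *: "u \<in> U" "w \<in> W" "x = u \<oplus>\<^bsub>M\<^esub> w" "u' \<in> U" "w' \<in> W" "y = u' \<oplus>\<^bsub>M\<^esub> w'"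
      by (auto simp: set_add_def')
    then have "x \<oplus>\<^bsub>M\<^esub> y = (u \<oplus>\<^bsub>M\<^esub> u') \<oplus>\<^bsub>M\<^esub> (w \<oplus>\<^bsub>M\<^esub> w')"
      using U(2) W(2) by (simp add: M.M.add.m_ac)
    then show "x \<oplus>\<^bsub>M\<^esub> y \<in> U <+>\<^bsub>M\<^esub> W"
      using * U(4) W(4) by (intro set_addI[of "u \<oplus>\<^bsub>M\<^esub> u'" U "w \<oplus>\<^bsub>M\<^esub> w'"]) auto
  next
    fix a x assume a: "a \<in> carrier R" and "x \<in> U <+>\<^bsub>M\<^esub> W"
    then obtain u w where *: "u \<in> U" "w \<in> W" "x = u \<oplus>\<^bsub>M\<^esub> w"
      by (auto simp: set_add_def')
    then have "a \<odot>\<^bsub>M\<^esub> x = a \<odot>\<^bsub>M\<^esub> u \<oplus>\<^bsub>M\<^esub> a \<odot>\<^bsub>M\<^esub> w"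
      using U(2) W(2) a by (simp add: M.smult_add_right)
    then show "a \<odot>\<^bsub>M\<^esub> x \<in> U <+>\<^bsub>M\<^esub> W"
      using * a U(6) W(6) by (intro set_addI[of "a \<odot>\<^bsub>M\<^esub> u" U "a \<odot>\<^bsub>M\<^esub> w"]) auto
  qed
qed

lemma set_add_left:
  assumes "right_module R M" "submodule U R M" "submodule W R M" "u \<in> U"
  shows "u \<in> U <+>\<^bsub>M\<^esub> W"
proof -
  interpret M: right_module R M by fact
  show ?thesis
    using assms(4) submoduleD(2)[OF assms(2)] submoduleD(3)[OF assms(3)]
    by (intro set_addI[of u U "\<zero>\<^bsub>M\<^esub>" W]) auto
qed

lemma set_add_right:
  assumes "right_module R M" "submodule U R M" "submodule W R M" "w \<in> W"
  shows "w \<in> U <+>\<^bsub>M\<^esub> W"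
proof -
  interpret M: right_module R M by fact
  show ?thesis
    using assms(4) submoduleD(2)[OF assms(3)] submoduleD(3)[OF assms(2)]
    by (intro set_addI[of "\<zero>\<^bsub>M\<^esub>" U w W]) auto
qed

text \<open>\<open>p\<close> is the projection onto W along U, chosen pointwise. Uniqueness of the
  W-part, which is where the trivial intersection enters, turns the choice into a linear
  map.\<close>

lemma mod_projection:
  assumes M: "right_module R M" and U: "submodule U R M" and W: "submodule W R M"
    and sum: "U <+>\<^bsub>M\<^esub> W = carrier M" and int: "U \<inter> W \<subseteq> {\<zero>\<^bsub>M\<^esub>}"
  shows "\<exists>p\<in>mod_hom R M M. (\<forall>u\<in>U. p u = \<zero>\<^bsub>M\<^esub>) \<and> (\<forall>w\<in>W. p w = w) \<and>
    (\<forall>x\<in>carrier M. p x \<in> W \<and> x \<ominus>\<^bsub>M\<^esub> p x \<in> U)"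
proof -
  interpret M: right_module R M by fact
  note U' = submoduleD[OF U] and W' = submoduleD[OF W]
  define p where "p x = (SOME w. w \<in> W \<and> x \<ominus>\<^bsub>M\<^esub> w \<in> U)" for x
  have p: "p x \<in> W \<and> x \<ominus>\<^bsub>M\<^esub> p x \<in> U" if x: "x \<in> carrier M" for x
  proof -
    obtain u w where *: "u \<in> U" "w \<in> W" "x = u \<oplus>\<^bsub>M\<^esub> w"
      using x sum set_addE[of x M U W] by metis
    then have "x \<ominus>\<^bsub>M\<^esub> w = u"
      using U'(2) W'(2) by (simp add: a_minus_def M.M.add.m_assoc M.M.r_neg)
    then show ?thesis unfolding p_def by (rule_tac someI[of _ w]) (use * in auto)
  qed
  have unique: "p x = w" if x: "x \<in> carrier M" and w: "w \<in> W" "x \<ominus>\<^bsub>M\<^esub> w \<in> U" for x w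
  proof -
    have c: "p x \<in> carrier M" "w \<in> carrier M" using p x w W'(2) by auto
    \<comment> \<open>Two candidates for the W-part differ by an element of U as well as of
      W.\<close>
    have "(x \<ominus>\<^bsub>M\<^esub> w) \<ominus>\<^bsub>M\<^esub> (x \<ominus>\<^bsub>M\<^esub> p x) = (x \<ominus>\<^bsub>M\<^esub> x) \<oplus>\<^bsub>M\<^esub> (p x \<ominus>\<^bsub>M\<^esub> w)"
      using c x unfolding a_minus_def by (simp only: M.M.minus_add M.M.minus_minus M.M.add.m_ac
        M.M.add.inv_closed M.M.add.m_closed)
    also have "\<dots> = p x \<ominus>\<^bsub>M\<^esub> w" using c x by (simp add: a_minus_def M.M.r_neg)
    finally have "(x \<ominus>\<^bsub>M\<^esub> w) \<ominus>\<^bsub>M\<^esub> (x \<ominus>\<^bsub>M\<^esub> p x) = p x \<ominus>\<^bsub>M\<^esub> w" .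
    moreover have "(x \<ominus>\<^bsub>M\<^esub> w) \<ominus>\<^bsub>M\<^esub> (x \<ominus>\<^bsub>M\<^esub> p x) \<in> U"
      using w(2) p[OF x] U'(4)[OF w(2) U'(5)] by (simp add: a_minus_def)
    moreover have "p x \<ominus>\<^bsub>M\<^esub> w \<in> W" using p[OF x] W'(4)[OF _ W'(5)[OF w(1)]] by (simp add: a_minus_def)
    ultimately have "p x \<ominus>\<^bsub>M\<^esub> w = \<zero>\<^bsub>M\<^esub>" using int by auto
    then show ?thesis using c M.diff_zero_imp_eq by blast
  qed
  have "p \<in> mod_hom R M M"
  proof (rule mod_homI)
    fix x assume "x \<in> carrier M" then show "p x \<in> carrier M" using p W'(2) by blast
  next
    fix x y assume xy: "x \<in> carrier M" "y \<in> carrier M"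
    note px = p[OF xy(1)] and py = p[OF xy(2)]
    have c: "p x \<in> carrier M" "p y \<in> carrier M" using px py W'(2) by auto
    have "(x \<oplus>\<^bsub>M\<^esub> y) \<ominus>\<^bsub>M\<^esub> (p x \<oplus>\<^bsub>M\<^esub> p y) = (x \<ominus>\<^bsub>M\<^esub> p x) \<oplus>\<^bsub>M\<^esub> (y \<ominus>\<^bsub>M\<^esub> p y)"
      using xy c by (simp add: a_minus_def M.M.minus_add M.M.add.m_ac)
    then show "p (x \<oplus>\<^bsub>M\<^esub> y) = p x \<oplus>\<^bsub>M\<^esub> p y"
      using xy px py U'(4) W'(4) by (intro unique) auto
  next
    fix a x assume ax: "a \<in> carrier R" "x \<in> carrier M"
    note px = p[OF ax(2)]
    have c: "p x \<in> carrier M" using px W'(2) by auto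
    have "a \<odot>\<^bsub>M\<^esub> x \<ominus>\<^bsub>M\<^esub> a \<odot>\<^bsub>M\<^esub> p x = a \<odot>\<^bsub>M\<^esub> (x \<ominus>\<^bsub>M\<^esub> p x)"
      using ax c by (simp add: a_minus_def M.smult_add_right M.smult_minus_right)
    then show "p (a \<odot>\<^bsub>M\<^esub> x) = a \<odot>\<^bsub>M\<^esub> p x"
      using ax px U'(6) W'(6) by (intro unique) (auto simp: M.smult_closed)
  qed
  moreover have "p u = \<zero>\<^bsub>M\<^esub>" if "u \<in> U" for u
    using that U'(2) W'(3) by (intro unique) (auto simp: a_minus_def M.neg_zero)
  moreover have "p w = w" if "w \<in> W" for w
    using that W'(2) U'(3) by (intro unique) (auto simp: a_minus_def M.M.r_neg)
  ultimately show ?thesis using p by blast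
qed

section \<open>Rings with vertex and arrow coefficients\<close>

text \<open>An algebra with J^2 = 0 seen only through coefficients: \<open>cv a i\<close> at the
  trivial path at \<open>i\<close>, \<open>ca a \<alpha>\<close> at the arrow \<alpha>, with
  \<open>mk\<close> as inverse. The law \<open>ca_mult\<close> is the multiplication of paths
  truncated after length one. Modules are studied over this interface; cosets of the path algebra
  appear only when it is instantiated at the end.\<close>

locale rad_square_zero = ring R
  for R :: "('r, 'x) ring_scheme" (structure) +
  fixes V :: "'v set" and E :: "'a set" and src tgt :: "'a \<Rightarrow> 'v"
    and cv :: "'r \<Rightarrow> 'v \<Rightarrow> 'k::field" and ca :: "'r \<Rightarrow> 'a \<Rightarrow> 'k"
    and mk :: "('v \<Rightarrow> 'k) \<Rightarrow> ('a \<Rightarrow> 'k) \<Rightarrow> 'r"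
  assumes finite_V [simp]: "finite V" and finite_E [simp]: "finite E"
    and src_V [simp]: "\<alpha> \<in> E \<Longrightarrow> src \<alpha> \<in> V" and tgt_V [simp]: "\<alpha> \<in> E \<Longrightarrow> tgt \<alpha> \<in> V"
    and mk_closed [simp]: "mk f g \<in> carrier R"
    and cv_mk [simp]: "i \<in> V \<Longrightarrow> cv (mk f g) i = f i"
    and ca_mk [simp]: "\<alpha> \<in> E \<Longrightarrow> ca (mk f g) \<alpha> = g \<alpha>"
    and coeff_eqI: "\<lbrakk>a \<in> carrier R; b \<in> carrier R; \<And>i. i \<in> V \<Longrightarrow> cv a i = cv b i;
        \<And>\<alpha>. \<alpha> \<in> E \<Longrightarrow> ca a \<alpha> = ca b \<alpha>\<rbrakk> \<Longrightarrow> a = b"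
    and cv_add [simp]: "\<lbrakk>a \<in> carrier R; b \<in> carrier R; i \<in> V\<rbrakk> \<Longrightarrow> cv (a \<oplus> b) i = cv a i + cv b i"
    and ca_add [simp]: "\<lbrakk>a \<in> carrier R; b \<in> carrier R; \<alpha> \<in> E\<rbrakk> \<Longrightarrow> ca (a \<oplus> b) \<alpha> = ca a \<alpha> + ca b \<alpha>"
    and cv_mult [simp]: "\<lbrakk>a \<in> carrier R; b \<in> carrier R; i \<in> V\<rbrakk> \<Longrightarrow> cv (a \<otimes> b) i = cv a i * cv b i"
    and ca_mult [simp]: "\<lbrakk>a \<in> carrier R; b \<in> carrier R; \<alpha> \<in> E\<rbrakk>
        \<Longrightarrow> ca (a \<otimes> b) \<alpha> = cv a (src \<alpha>) * ca b \<alpha> + ca a \<alpha> * cv b (tgt \<alpha>)"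
    and cv_one [simp]: "i \<in> V \<Longrightarrow> cv \<one> i = 1"
    and ca_one [simp]: "\<alpha> \<in> E \<Longrightarrow> ca \<one> \<alpha> = 0"
begin

lemma cv_zero [simp]: "i \<in> V \<Longrightarrow> cv \<zero> i = 0"
  by (metis add_cancel_right_right cv_add l_zero zero_closed)

lemma ca_zero [simp]: "\<alpha> \<in> E \<Longrightarrow> ca \<zero> \<alpha> = 0"
  by (metis add_cancel_right_right ca_add l_zero zero_closed)

lemma mk_cong:
  "(\<And>i. i \<in> V \<Longrightarrow> f i = f' i) \<Longrightarrow> (\<And>\<alpha>. \<alpha> \<in> E \<Longrightarrow> g \<alpha> = g' \<alpha>) \<Longrightarrow> mk f g = mk f' g'"
  by (rule coeff_eqI) auto

lemma mk_coeffs: "a \<in> carrier R \<Longrightarrow> mk (cv a) (ca a) = a"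
  by (rule coeff_eqI) auto

lemma mk_one: "mk (\<lambda>_. 1) (\<lambda>_. 0) = \<one>"
  by (rule coeff_eqI) auto

lemma mk_zero: "mk (\<lambda>_. 0) (\<lambda>_. 0) = \<zero>"
  by (rule coeff_eqI) auto

text \<open>\<open>diag\<close> projects the algebra onto the semisimple subalgebra spanned by the
  trivial paths. Being multiplicative, it allows every module to be pulled back along it.
  \<open>sca\<close>, \<open>idem\<close> and \<open>arr\<close> are the scalars, the vertex
  idempotents and the arrows as elements of the algebra.\<close>

definition "diag a = mk (cv a) (\<lambda>_. 0)"
definition "sca k = mk (\<lambda>_. k) (\<lambda>_. 0)"
definition "idem i = mk (\<lambda>j. if j = i then 1 else 0) (\<lambda>_. 0)"
definition "arr \<alpha> = mk (\<lambda>_. 0) (\<lambda>\<beta>. if \<beta> = \<alpha> then 1 else 0)"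

lemma elem_closed [simp]: "diag a \<in> carrier R" "sca k \<in> carrier R" "idem i \<in> carrier R" "arr \<alpha> \<in> carrier R"
  by (auto simp: diag_def sca_def idem_def arr_def)

lemmas elem_defs = diag_def sca_def idem_def arr_def

lemma diag_add: "a \<in> carrier R \<Longrightarrow> b \<in> carrier R \<Longrightarrow> diag (a \<oplus> b) = diag a \<oplus> diag b"
  by (rule coeff_eqI) (auto simp: diag_def)

lemma diag_mult: "a \<in> carrier R \<Longrightarrow> b \<in> carrier R \<Longrightarrow> diag (a \<otimes> b) = diag a \<otimes> diag b"
  by (rule coeff_eqI) (auto simp: diag_def)

lemma diag_elem [simp]:
  "diag \<one> = \<one>" "diag (diag a) = diag a" "diag (sca k) = sca k" "diag (idem i) = idem i"
  "diag (arr \<alpha>) = \<zero>"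
proof -
  show "diag \<one> = \<one>" by (rule coeff_eqI) (auto simp: diag_def)
  show "diag (diag a) = diag a" by (rule coeff_eqI) (auto simp: diag_def)
  show "diag (sca k) = sca k" by (rule coeff_eqI) (auto simp: diag_def sca_def)
  show "diag (idem i) = idem i" by (rule coeff_eqI) (auto simp: diag_def idem_def)
  show "diag (arr \<alpha>) = \<zero>" by (rule coeff_eqI) (auto simp: diag_def arr_def)
qed

lemma sca_add: "sca (k + l) = sca k \<oplus> sca l"
  by (rule coeff_eqI) (auto simp: sca_def)

lemma sca_mult: "sca (k * l) = sca k \<otimes> sca l"
  by (rule coeff_eqI) (auto simp: sca_def)

lemma sca_one: "sca 1 = \<one>"
  by (rule coeff_eqI) (auto simp: sca_def)

lemma sca_zero: "sca 0 = \<zero>"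
  by (rule coeff_eqI) (auto simp: sca_def)

lemma sca_central: "a \<in> carrier R \<Longrightarrow> sca k \<otimes> a = a \<otimes> sca k"
  by (rule coeff_eqI) (auto simp: sca_def mult.commute)

end

text \<open>The same vector space with all arrows acting as zero, that is, M pulled back along
  \<open>diag\<close>. It retains the grading by vertices and makes the linear algebra of semisimple
  modules applicable to any M.\<close>

definition (in rad_square_zero) deg :: "('r, 'm) module \<Rightarrow> ('r, 'm) module" where
  "deg M = M\<lparr>smult := \<lambda>a x. diag a \<odot>\<^bsub>M\<^esub> x\<rparr>"

text \<open>Semisimplicity, expressed as the action factoring through \<open>diag\<close>.\<close>

definition (in rad_square_zero) ss :: "('r, 'm) module \<Rightarrow> bool" where
  "ss M \<longleftrightarrow> right_module R M \<and> (\<forall>a\<in>carrier R. \<forall>x\<in>carrier M. a \<odot>\<^bsub>M\<^esub> x = diag a \<odot>\<^bsub>M\<^esub> x)"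

definition (in rad_square_zero) simp_mod :: "'v \<Rightarrow> ('r, 'k) module" where
  "simp_mod i = \<lparr>carrier = UNIV, monoid.mult = undefined, one = undefined, ring.zero = 0, add = (+),
     smult = (\<lambda>a x. x * cv a i)\<rparr>"

text \<open>The direct sum of \<open>d i\<close> copies of the simple module at each vertex
  \<open>i\<close>, realised by functions so that all multiplicity vectors share one carrier
  type.\<close>

definition (in rad_square_zero) std_mod :: "('v \<Rightarrow> nat) \<Rightarrow> ('r, 'v \<times> nat \<Rightarrow> 'k) module" where
  "std_mod d = \<lparr>carrier = {f. \<forall>i n. f (i, n) \<noteq> 0 \<longrightarrow> i \<in> V \<and> n < d i},
     monoid.mult = undefined, one = undefined, ring.zero = (\<lambda>_. 0),
     add = (\<lambda>f g p. f p + g p), smult = (\<lambda>a f p. f p * cv a (fst p))\<rparr>"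

context rad_square_zero
begin

lemma ssD:
  assumes "ss M"
  shows "right_module R M" "\<And>a x. \<lbrakk>a \<in> carrier R; x \<in> carrier M\<rbrakk> \<Longrightarrow> a \<odot>\<^bsub>M\<^esub> x = diag a \<odot>\<^bsub>M\<^esub> x"
  using assms unfolding ss_def by blast+

lemma simp_mod_simps [simp]:
  "carrier (simp_mod i) = UNIV" "\<zero>\<^bsub>simp_mod i\<^esub> = 0" "x \<oplus>\<^bsub>simp_mod i\<^esub> y = x + y"
  "a \<odot>\<^bsub>simp_mod i\<^esub> x = x * cv a i"
  by (auto simp: simp_mod_def)

lemma std_mod_simps [simp]:
  "f \<in> carrier (std_mod d) \<longleftrightarrow> (\<forall>i n. f (i, n) \<noteq> 0 \<longrightarrow> i \<in> V \<and> n < d i)"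
  "\<zero>\<^bsub>std_mod d\<^esub> = (\<lambda>_. 0)" "f \<oplus>\<^bsub>std_mod d\<^esub> g = (\<lambda>p. f p + g p)"
  "a \<odot>\<^bsub>std_mod d\<^esub> f = (\<lambda>p. f p * cv a (fst p))"
  by (auto simp: std_mod_def)

lemma ss_simp_mod: "i \<in> V \<Longrightarrow> ss (simp_mod i)"
  unfolding ss_def
proof (intro conjI ballI)
  assume i: "i \<in> V"
  show "right_module R (simp_mod i)"
  proof (rule right_moduleI)
    show "\<exists>y\<in>carrier (simp_mod i). y \<oplus>\<^bsub>simp_mod i\<^esub> x = \<zero>\<^bsub>simp_mod i\<^esub>" for x :: 'k
      by (rule bexI[of _ "- x"]) auto
  qed (use i in \<open>auto simp: ring_axioms algebra_simps\<close>)
qed (auto simp: diag_def)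

lemma std_mod_zero_outside: "f \<in> carrier (std_mod d) \<Longrightarrow> i \<notin> V \<or> \<not> n < d i \<Longrightarrow> f (i, n) = 0"
  by auto

text \<open>The laws for \<open>cv\<close> hold at the vertices in V only. Elsewhere elements of
  \<open>std_mod d\<close> vanish, so agreement of the coefficients on V is enough.\<close>

lemma std_mod_smult_cong:
  assumes "f \<in> carrier (std_mod d)" "\<And>i. i \<in> V \<Longrightarrow> u i = v i"
  shows "f p * u (fst p) = f p * v (fst p)"
  using assms by (cases p) (metis fst_conv mult_zero_left std_mod_zero_outside)

lemma ss_std_mod: "ss (std_mod d)"
  unfolding ss_def
proof (intro conjI ballI)
  show "right_module R (std_mod d)"
  proof (rule right_moduleI)
    show "\<exists>y\<in>carrier (std_mod d). y \<oplus>\<^bsub>std_mod d\<^esub> x = \<zero>\<^bsub>std_mod d\<^esub>" if "x \<in> carrier (std_mod d)" for x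
      by (rule bexI[of _ "\<lambda>p. - x p"]) (use that in auto)
    show "x \<oplus>\<^bsub>std_mod d\<^esub> y \<in> carrier (std_mod d)"
      if "x \<in> carrier (std_mod d)" "y \<in> carrier (std_mod d)" for x y
      using that by (auto) (metis add_0)+
    fix a b x assume ab: "a \<in> carrier R" "b \<in> carrier R" and x: "x \<in> carrier (std_mod d)"
    show "(a \<oplus> b) \<odot>\<^bsub>std_mod d\<^esub> x = a \<odot>\<^bsub>std_mod d\<^esub> x \<oplus>\<^bsub>std_mod d\<^esub> b \<odot>\<^bsub>std_mod d\<^esub> x"
      using std_mod_smult_cong[OF x, of "cv (a \<oplus> b)" "\<lambda>i. cv a i + cv b i"] ab by (simp add: fun_eq_iff algebra_simps)
    show "(a \<otimes> b) \<odot>\<^bsub>std_mod d\<^esub> x = b \<odot>\<^bsub>std_mod d\<^esub> (a \<odot>\<^bsub>std_mod d\<^esub> x)"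
      using std_mod_smult_cong[OF x, of "cv (a \<otimes> b)" "\<lambda>i. cv a i * cv b i"] ab by (simp add: fun_eq_iff algebra_simps)
  next
    fix x assume x: "x \<in> carrier (std_mod d)"
    show "\<one> \<odot>\<^bsub>std_mod d\<^esub> x = x"
      using std_mod_smult_cong[OF x, of "cv \<one>" "\<lambda>i. 1"] by (simp add: fun_eq_iff)
  qed (auto simp: ring_axioms algebra_simps)
next
  fix a x assume "a \<in> carrier R" and x: "x \<in> carrier (std_mod d)"
  show "a \<odot>\<^bsub>std_mod d\<^esub> x = diag a \<odot>\<^bsub>std_mod d\<^esub> x"
    unfolding std_mod_simps
    by (rule ext, rule std_mod_smult_cong[OF x, symmetric]) (simp add: diag_def)
qed

lemma deg_simps [simp]:
  "carrier (deg M) = carrier M" "\<zero>\<^bsub>deg M\<^esub> = \<zero>\<^bsub>M\<^esub>" "x \<oplus>\<^bsub>deg M\<^esub> y = x \<oplus>\<^bsub>M\<^esub> y"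
  "a \<odot>\<^bsub>deg M\<^esub> x = diag a \<odot>\<^bsub>M\<^esub> x"
  by (auto simp: deg_def)

lemma ss_deg:
  assumes "right_module R M"
  shows "ss (deg M)"
  unfolding ss_def
proof (intro conjI ballI)
  interpret M: right_module R M by fact
  show "right_module R (deg M)"
  proof (rule right_moduleI)
    show "\<exists>y\<in>carrier (deg M). y \<oplus>\<^bsub>deg M\<^esub> x = \<zero>\<^bsub>deg M\<^esub>" if "x \<in> carrier (deg M)" for x
      by (rule bexI[of _ "\<ominus>\<^bsub>M\<^esub> x"]) (use that in \<open>auto simp: M.M.l_neg\<close>)
  qed (auto simp: ring_axioms M.smult_closed M.M.add.m_ac diag_add diag_mult M.smult_add_left
      M.smult_add_right M.smult_mult M.smult_one)
qed auto

lemmas right_module_deg = ssD(1)[OF ss_deg]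

lemma submodule_deg:
  assumes "right_module R M" "submodule U R M"
  shows "submodule U R (deg M)"
  using submoduleD[OF assms(2)] by (intro submoduleI right_module_deg assms) auto

lemma mod_hom_deg: "h \<in> mod_hom R M N \<Longrightarrow> h \<in> mod_hom R (deg M) (deg N)"
  using mod_homD[of h R M N] by (auto intro!: mod_homI)

lemma mod_iso_deg: "mod_iso R M N \<Longrightarrow> mod_iso R (deg M) (deg N)"
  unfolding mod_iso_def using mod_hom_deg by (metis deg_simps(1))

lemma deg_ss:
  assumes "ss M"
  shows "mod_iso R (deg M) M"
proof (rule mod_iso_identity)
  fix a x assume "a \<in> carrier R" "x \<in> carrier M"
  then show "a \<odot>\<^bsub>deg M\<^esub> x = a \<odot>\<^bsub>M\<^esub> x"
    using ssD(2)[OF assms, of a x] by (metis deg_simps(4))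
qed auto

lemma ssI:
  assumes "right_module R M" "\<And>a x. \<lbrakk>a \<in> carrier R; x \<in> carrier M\<rbrakk> \<Longrightarrow> a \<odot>\<^bsub>M\<^esub> x = diag a \<odot>\<^bsub>M\<^esub> x"
  shows "ss M"
  unfolding ss_def using assms by blast

lemma ss_iso:
  assumes "ss M" "right_module R N" "mod_iso R M N"
  shows "ss N"
proof -
  obtain h where h: "h \<in> mod_hom R M N" "bij_betw h (carrier M) (carrier N)"
    using assms(3) unfolding mod_iso_def by blast
  have "a \<odot>\<^bsub>N\<^esub> y = diag a \<odot>\<^bsub>N\<^esub> y" if ay: "a \<in> carrier R" "y \<in> carrier N" for a y
  proof -
    obtain x where x: "x \<in> carrier M" "y = h x" using h(2) ay by (auto simp: bij_betw_def)
    have "a \<odot>\<^bsub>N\<^esub> h x = h (a \<odot>\<^bsub>M\<^esub> x)" using mod_homD(3)[OF h(1)] ay(1) x(1) by simp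
    also have "a \<odot>\<^bsub>M\<^esub> x = diag a \<odot>\<^bsub>M\<^esub> x" by (rule ssD(2)[OF assms(1) ay(1) x(1)])
    also have "h (diag a \<odot>\<^bsub>M\<^esub> x) = diag a \<odot>\<^bsub>N\<^esub> h x" using mod_homD(3)[OF h(1)] x(1) by simp
    finally show ?thesis unfolding x(2) .
  qed
  then show ?thesis by (rule ssI[OF assms(2)])
qed

lemma ss_sub:
  assumes "ss M" "submodule U R M"
  shows "ss (M\<lparr>carrier := U\<rparr>)"
proof (rule ssI)
  show "right_module R (M\<lparr>carrier := U\<rparr>)" by (rule right_module_sub[OF ssD(1)[OF assms(1)] assms(2)])
  fix a x assume "a \<in> carrier R" "x \<in> carrier (M\<lparr>carrier := U\<rparr>)"
  then have "a \<odot>\<^bsub>M\<^esub> x = diag a \<odot>\<^bsub>M\<^esub> x"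
    by (intro ssD(2)[OF assms(1)]) (auto intro: submoduleD(2)[OF assms(2)])
  then show "a \<odot>\<^bsub>M\<lparr>carrier := U\<rparr>\<^esub> x = diag a \<odot>\<^bsub>M\<lparr>carrier := U\<rparr>\<^esub> x"
    unfolding module.simps module.update_convs by simp
qed

lemma ss_mod_sum2:
  assumes "ss M" "ss N"
  shows "ss (mod_sum2 M N)"
proof (rule ssI)
  show "right_module R (mod_sum2 M N)" by (intro right_module_mod_sum2 ssD(1) assms)
  fix a x assume "a \<in> carrier R" "x \<in> carrier (mod_sum2 M N)"
  then have "a \<odot>\<^bsub>M\<^esub> fst x = diag a \<odot>\<^bsub>M\<^esub> fst x" "a \<odot>\<^bsub>N\<^esub> snd x = diag a \<odot>\<^bsub>N\<^esub> snd x"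
    by (auto intro!: ssD(2) assms)
  then show "a \<odot>\<^bsub>mod_sum2 M N\<^esub> x = diag a \<odot>\<^bsub>mod_sum2 M N\<^esub> x"
    unfolding mod_sum2_simps by (intro prod_eqI) (unfold fst_conv snd_conv)
qed

lemma idem_mult: "idem i \<otimes> idem j = (if i = j then idem i else \<zero>)"
  unfolding elem_defs by (rule coeff_eqI) auto

lemma idem_idem:
  assumes "right_module R M" "x \<in> carrier M"
  shows "idem i \<odot>\<^bsub>M\<^esub> (idem j \<odot>\<^bsub>M\<^esub> x) = (if i = j then idem i \<odot>\<^bsub>M\<^esub> x else \<zero>\<^bsub>M\<^esub>)"
  using right_module.smult_mult[OF assms(1), of "idem j" "idem i" x] assms
    right_module.smult_zero_left[OF assms] by (auto simp: idem_mult)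

lemma sca_smult:
  assumes "right_module R M" "a \<in> carrier R" "x \<in> carrier M"
  shows "a \<odot>\<^bsub>M\<^esub> (sca k \<odot>\<^bsub>M\<^esub> x) = sca k \<odot>\<^bsub>M\<^esub> (a \<odot>\<^bsub>M\<^esub> x)"
  using assms right_module.smult_mult[OF assms(1) elem_closed(2) assms(2,3)]
    right_module.smult_mult[OF assms(1,2) elem_closed(2) assms(3)] by (simp add: sca_central)

lemma sca_sca:
  assumes "right_module R M" "x \<in> carrier M"
  shows "sca k \<odot>\<^bsub>M\<^esub> (sca l \<odot>\<^bsub>M\<^esub> x) = sca (l * k) \<odot>\<^bsub>M\<^esub> x"
  using assms right_module.smult_mult[OF assms(1), of "sca l" "sca k" x] by (simp add: sca_mult)

text \<open>The induction runs over subsets of V, with \<open>f\<close> cut off outside them. The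
  case f = 1 decomposes x into its components at the vertices.\<close>

lemma idem_decomp:
  assumes "right_module R M" "x \<in> carrier M"
  shows "mk f (\<lambda>_. 0) \<odot>\<^bsub>M\<^esub> x = (\<Oplus>\<^bsub>M\<^esub>i\<in>V. sca (f i) \<odot>\<^bsub>M\<^esub> (idem i \<odot>\<^bsub>M\<^esub> x))"
proof -
  interpret M: right_module R M by fact
  have "(\<Oplus>\<^bsub>M\<^esub>i\<in>B. sca (f i) \<odot>\<^bsub>M\<^esub> (idem i \<odot>\<^bsub>M\<^esub> x)) = mk (\<lambda>i. if i \<in> B then f i else 0) (\<lambda>_. 0) \<odot>\<^bsub>M\<^esub> x"
    if "finite B" "B \<subseteq> V" for B
    using that
  proof (induction B)
    case empty
    then show ?case using assms(2) by (simp add: mk_zero)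
  next
    case (insert j B)
    have "(\<Oplus>\<^bsub>M\<^esub>i\<in>insert j B. sca (f i) \<odot>\<^bsub>M\<^esub> (idem i \<odot>\<^bsub>M\<^esub> x))
        = (sca (f j) \<odot>\<^bsub>M\<^esub> (idem j \<odot>\<^bsub>M\<^esub> x)) \<oplus>\<^bsub>M\<^esub> mk (\<lambda>i. if i \<in> B then f i else 0) (\<lambda>_. 0) \<odot>\<^bsub>M\<^esub> x"
      using insert assms(2) by (simp add: M.smult_closed)
    also have "\<dots> = ((idem j \<otimes> sca (f j)) \<oplus> mk (\<lambda>i. if i \<in> B then f i else 0) (\<lambda>_. 0)) \<odot>\<^bsub>M\<^esub> x"
      using assms(2) by (simp add: M.smult_add_left M.smult_mult)
    also have "(idem j \<otimes> sca (f j)) \<oplus> mk (\<lambda>i. if i \<in> B then f i else 0) (\<lambda>_. 0) =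
        mk (\<lambda>i. if i \<in> insert j B then f i else 0) (\<lambda>_. 0)"
      unfolding elem_defs by (rule coeff_eqI) (use insert.hyps in auto)
    finally show ?case .
  qed
  from this[of V] show ?thesis
    using mk_cong[of "\<lambda>i. if i \<in> V then f i else 0" f "\<lambda>_. 0" "\<lambda>_. 0"] by simp
qed

text \<open>Arrows are added one at a time to the coefficients of \<open>diag a\<close>. This
  reduces linearity over the algebra to the grading and the behaviour of single arrows.\<close>

lemma arr_decomp:
  assumes "right_module R M" "x \<in> carrier M" "a \<in> carrier R"
  shows "a \<odot>\<^bsub>M\<^esub> x = diag a \<odot>\<^bsub>M\<^esub> x \<oplus>\<^bsub>M\<^esub> (\<Oplus>\<^bsub>M\<^esub>\<alpha>\<in>E. sca (ca a \<alpha>) \<odot>\<^bsub>M\<^esub> (arr \<alpha> \<odot>\<^bsub>M\<^esub> x))"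
proof -
  interpret M: right_module R M by fact
  have "diag a \<odot>\<^bsub>M\<^esub> x \<oplus>\<^bsub>M\<^esub> (\<Oplus>\<^bsub>M\<^esub>\<alpha>\<in>B. sca (ca a \<alpha>) \<odot>\<^bsub>M\<^esub> (arr \<alpha> \<odot>\<^bsub>M\<^esub> x)) =
      mk (cv a) (\<lambda>\<alpha>. if \<alpha> \<in> B then ca a \<alpha> else 0) \<odot>\<^bsub>M\<^esub> x"
    if "finite B" "B \<subseteq> E" for B
    using that
  proof (induction B)
    case empty
    have "mk (cv a) (\<lambda>_. 0) \<odot>\<^bsub>M\<^esub> x \<in> carrier M"
      using assms(2) by (intro M.smult_closed) auto
    then show ?case by (simp add: diag_def)
  next
    case (insert \<beta> B)
    have eq: "(arr \<beta> \<otimes> sca (ca a \<beta>)) \<oplus> mk (cv a) (\<lambda>\<alpha>. if \<alpha> \<in> B then ca a \<alpha> else 0) =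
        mk (cv a) (\<lambda>\<alpha>. if \<alpha> \<in> insert \<beta> B then ca a \<alpha> else 0)"
      unfolding elem_defs by (rule coeff_eqI) (use insert.hyps in auto)
    let ?t = "\<lambda>\<alpha>. sca (ca a \<alpha>) \<odot>\<^bsub>M\<^esub> (arr \<alpha> \<odot>\<^bsub>M\<^esub> x)"
    have t: "?t \<alpha> \<in> carrier M" for \<alpha> using assms(2) by (simp add: M.smult_closed)
    have "finsum M ?t (insert \<beta> B) = ?t \<beta> \<oplus>\<^bsub>M\<^esub> finsum M ?t B"
      using insert.hyps t by simp
    moreover have "finsum M ?t B \<in> carrier M" "diag a \<odot>\<^bsub>M\<^esub> x \<in> carrier M"
      using t assms(2) by (auto intro!: M.M.finsum_closed M.smult_closed)
    ultimately have "diag a \<odot>\<^bsub>M\<^esub> x \<oplus>\<^bsub>M\<^esub> finsum M ?t (insert \<beta> B) =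
        ?t \<beta> \<oplus>\<^bsub>M\<^esub> (diag a \<odot>\<^bsub>M\<^esub> x \<oplus>\<^bsub>M\<^esub> finsum M ?t B)"
      using t[of \<beta>] by (simp only: M.M.add.m_lcomm)
    also have "diag a \<odot>\<^bsub>M\<^esub> x \<oplus>\<^bsub>M\<^esub> finsum M ?t B = mk (cv a) (\<lambda>\<alpha>. if \<alpha> \<in> B then ca a \<alpha> else 0) \<odot>\<^bsub>M\<^esub> x"
      using insert.IH insert.prems by simp
    also have "?t \<beta> \<oplus>\<^bsub>M\<^esub> mk (cv a) (\<lambda>\<alpha>. if \<alpha> \<in> B then ca a \<alpha> else 0) \<odot>\<^bsub>M\<^esub> x = ((arr \<beta> \<otimes> sca (ca a \<beta>)) \<oplus> mk (cv a) (\<lambda>\<alpha>. if \<alpha> \<in> B then ca a \<alpha> else 0)) \<odot>\<^bsub>M\<^esub> x"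
      using assms(2) by (simp add: M.smult_add_left M.smult_mult)
    finally show ?case unfolding eq .
  qed
  note main = this[OF finite_E order_refl]
  have "mk (cv a) (\<lambda>\<alpha>. if \<alpha> \<in> E then ca a \<alpha> else 0) = mk (cv a) (ca a)"
    by (rule mk_cong) auto
  then have "mk (cv a) (\<lambda>\<alpha>. if \<alpha> \<in> E then ca a \<alpha> else 0) = a"
    unfolding mk_coeffs[OF assms(3)] .
  with main show ?thesis by simp
qed

end

section \<open>Graded linear algebra\<close>

text \<open>Gaussian elimination, by induction on the equations. It is applied over the base field
  to compare dimensions and over the rationals to find relations in \<open>K0\<close>.\<close>

lemma nontrivial_solution:
  fixes a :: "'i \<Rightarrow> 'j \<Rightarrow> 'k::field"
  assumes "finite I" "finite J" "card I < card J"
  shows "\<exists>x. (\<exists>j\<in>J. x j \<noteq> 0) \<and> (\<forall>i\<in>I. (\<Sum>j\<in>J. a i j * x j) = 0)"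
  using assms
proof (induction I arbitrary: J a)
  case empty
  then have "J \<noteq> {}" by auto
  then show ?case by (intro exI[of _ "\<lambda>_. 1"]) auto
next
  case (insert i I)
  show ?case
  proof (cases "\<forall>j\<in>J. a i j = 0")
    case True
    obtain x where x: "\<exists>j\<in>J. x j \<noteq> 0" "\<forall>i\<in>I. (\<Sum>j\<in>J. a i j * x j) = 0"
      using insert.IH[of J a] insert.hyps insert.prems by auto
    have "(\<Sum>j\<in>J. a i j * x j) = 0" using True by (intro sum.neutral) auto
    with x show ?thesis by (intro exI[of _ x]) auto
  next
    case False
    then obtain j0 where j0: "j0 \<in> J" "a i j0 \<noteq> 0" by blast
    let ?J = "J - {j0}"
    \<comment> \<open>Elimination with the pivot \<open>a i j0\<close> leaves one equation and one
      unknown fewer.\<close>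
    have "finite ?J" "card I < card ?J"
      using insert.hyps insert.prems j0(1) by auto
    then obtain x where x: "\<exists>j\<in>?J. x j \<noteq> 0"
        "\<forall>i'\<in>I. (\<Sum>j\<in>?J. (a i' j - a i' j0 * a i j / a i j0) * x j) = 0"
      using insert.IH[of ?J "\<lambda>i' j. a i' j - a i' j0 * a i j / a i j0"] by blast
    define S where "S = (\<Sum>j\<in>?J. a i j * x j)"
    \<comment> \<open>The pivot unknown is the one that solves equation \<open>i\<close>.\<close>
    define y where "y = x(j0 := - S / a i j0)"
    have split: "(\<Sum>j\<in>J. a i' j * y j) = a i' j0 * (- S / a i j0) + (\<Sum>j\<in>?J. a i' j * x j)" for i'
    proof -
      have "(\<Sum>j\<in>J. a i' j * y j) = a i' j0 * y j0 + (\<Sum>j\<in>?J. a i' j * y j)"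
        using insert.prems(1) j0(1) by (rule sum.remove)
      moreover have "(\<Sum>j\<in>?J. a i' j * y j) = (\<Sum>j\<in>?J. a i' j * x j)"
        by (rule sum.cong) (auto simp: y_def)
      ultimately show ?thesis by (simp add: y_def)
    qed
    have "(\<Sum>j\<in>J. a i j * y j) = 0" using j0(2) split[of i] by (simp add: S_def)
    moreover have "(\<Sum>j\<in>J. a i' j * y j) = 0" if i': "i' \<in> I" for i'
    proof -
      have "(\<Sum>j\<in>?J. (a i' j - a i' j0 * a i j / a i j0) * x j) =
          (\<Sum>j\<in>?J. a i' j * x j) - (\<Sum>j\<in>?J. a i' j0 / a i j0 * (a i j * x j))"
        by (simp add: algebra_simps sum_subtractf)
      also have "\<dots> = (\<Sum>j\<in>?J. a i' j * x j) - a i' j0 / a i j0 * S"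
        by (simp add: S_def sum_distrib_left)
      finally show ?thesis using x(2) i' split[of i'] by simp
    qed
    moreover have "\<exists>j\<in>J. y j \<noteq> 0"
      using x(1) by (auto simp: y_def)
    ultimately show ?thesis by (intro exI[of _ y]) auto
  qed
qed

lemma finsum_in_submodule:
  assumes "right_module R M" "submodule U R M" "finite I" "\<And>i. i \<in> I \<Longrightarrow> f i \<in> U"
  shows "(\<Oplus>\<^bsub>M\<^esub>i\<in>I. f i) \<in> U"
proof -
  interpret M: right_module R M by fact
  note U = submoduleD[OF assms(2)]
  show ?thesis using assms(3,4)
  proof (induction I)
    case (insert i I)
    then have "f i \<in> carrier M" "f \<in> I \<rightarrow> carrier M" using U(2) by auto
    then have "(\<Oplus>\<^bsub>M\<^esub>j\<in>insert i I. f j) = f i \<oplus>\<^bsub>M\<^esub> (\<Oplus>\<^bsub>M\<^esub>j\<in>I. f j)"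
      using insert.hyps by simp
    then show ?case using insert U(4) by simp
  qed (simp add: U(3))
qed

lemma mod_hom_minus_hom:
  assumes "h \<in> mod_hom R M N" "g \<in> mod_hom R M N" "right_module R M" "right_module R N"
  shows "(\<lambda>x. h x \<ominus>\<^bsub>N\<^esub> g x) \<in> mod_hom R M N"
proof -
  interpret N: right_module R N by fact
  note h = mod_homD[OF assms(1)] and g = mod_homD[OF assms(2)]
  show ?thesis
    by (rule mod_homI)
      (auto simp: h g a_minus_def N.smult_add_right N.smult_minus_right N.M.minus_add N.M.add.m_ac)
qed

lemma mod_hom_into_sub:
  assumes "h \<in> mod_hom R M N" "\<And>x. x \<in> carrier M \<Longrightarrow> h x \<in> U"
  shows "h \<in> mod_hom R M (N\<lparr>carrier := U\<rparr>)"
  using mod_homD[OF assms(1)] assms(2) by (intro mod_homI) auto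

lemma mod_hom_sub:
  assumes "h \<in> mod_hom R M N" "submodule U R M"
  shows "h \<in> mod_hom R (M\<lparr>carrier := U\<rparr>) N"
  using mod_homD[OF assms(1)] submoduleD(2)[OF assms(2)] by (intro mod_homI) auto

section \<open>Complete reducibility of finitely generated semisimple modules\<close>

context rad_square_zero
begin

lemma idem_sum:
  assumes "right_module R M" "x \<in> carrier M"
  shows "x = (\<Oplus>\<^bsub>M\<^esub>i\<in>V. idem i \<odot>\<^bsub>M\<^esub> x)"
proof -
  interpret M: right_module R M by fact
  have "x = mk (\<lambda>_. 1) (\<lambda>_. 0) \<odot>\<^bsub>M\<^esub> x" using assms(2) by (simp add: mk_one M.smult_one)
  also have "\<dots> = (\<Oplus>\<^bsub>M\<^esub>i\<in>V. sca 1 \<odot>\<^bsub>M\<^esub> (idem i \<odot>\<^bsub>M\<^esub> x))"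
    by (rule idem_decomp[OF assms])
  also have "\<dots> = (\<Oplus>\<^bsub>M\<^esub>i\<in>V. idem i \<odot>\<^bsub>M\<^esub> x)"
    using assms(2) by (intro M.M.finsum_cong') (auto simp: sca_one M.smult_one M.smult_closed)
  finally show ?thesis .
qed

lemma in_submodule_components:
  assumes "right_module R M" "submodule U R M" "x \<in> carrier M" "\<And>i. i \<in> V \<Longrightarrow> idem i \<odot>\<^bsub>M\<^esub> x \<in> U"
  shows "x \<in> U"
  using finsum_in_submodule[OF assms(1,2) finite_V, of "\<lambda>i. idem i \<odot>\<^bsub>M\<^esub> x"] assms(4)
    idem_sum[OF assms(1,3)] by simp

text \<open>On the component at \<open>i\<close> the algebra acts through a single number, so the
  line through a homogeneous element is a submodule.\<close>

lemma homogeneous_smult: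
  assumes "ss M" "x \<in> carrier M" "idem i \<odot>\<^bsub>M\<^esub> x = x" "i \<in> V" "a \<in> carrier R"
  shows "a \<odot>\<^bsub>M\<^esub> x = sca (cv a i) \<odot>\<^bsub>M\<^esub> x"
proof -
  interpret M: right_module R M by (rule ssD(1)[OF assms(1)])
  have "idem i \<otimes> diag a = idem i \<otimes> sca (cv a i)"
    unfolding elem_defs by (rule coeff_eqI) auto
  then have "diag a \<odot>\<^bsub>M\<^esub> (idem i \<odot>\<^bsub>M\<^esub> x) = sca (cv a i) \<odot>\<^bsub>M\<^esub> (idem i \<odot>\<^bsub>M\<^esub> x)"
    using assms(2) by (simp flip: M.smult_mult)
  then show ?thesis using ssD(2)[OF assms(1,5,2)] assms(3) by simp
qed

lemma line_hom:
  assumes "ss M" "b \<in> carrier M" "idem i \<odot>\<^bsub>M\<^esub> b = b" "i \<in> V"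
  shows "(\<lambda>k. sca k \<odot>\<^bsub>M\<^esub> b) \<in> mod_hom R (simp_mod i) M"
proof (rule mod_homI)
  interpret M: right_module R M by (rule ssD(1)[OF assms(1)])
  fix k l show "sca k \<odot>\<^bsub>M\<^esub> b \<in> carrier M" using assms(2) by (simp add: M.smult_closed)
  show "sca (k \<oplus>\<^bsub>simp_mod i\<^esub> l) \<odot>\<^bsub>M\<^esub> b = sca k \<odot>\<^bsub>M\<^esub> b \<oplus>\<^bsub>M\<^esub> sca l \<odot>\<^bsub>M\<^esub> b"
    using assms(2) by (simp add: sca_add M.smult_add_left)
  fix a assume a: "a \<in> carrier R"
  have "a \<odot>\<^bsub>M\<^esub> (sca k \<odot>\<^bsub>M\<^esub> b) = sca k \<odot>\<^bsub>M\<^esub> (sca (cv a i) \<odot>\<^bsub>M\<^esub> b)"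
    using sca_smult[OF M.right_module_axioms a assms(2)] homogeneous_smult[OF assms a] by simp
  then show "sca (a \<odot>\<^bsub>simp_mod i\<^esub> k) \<odot>\<^bsub>M\<^esub> b = a \<odot>\<^bsub>M\<^esub> (sca k \<odot>\<^bsub>M\<^esub> b)"
    using sca_sca[OF M.right_module_axioms assms(2)] by (simp add: mult.commute)
qed

lemma submodule_line:
  assumes "ss M" "b \<in> carrier M" "idem i \<odot>\<^bsub>M\<^esub> b = b" "i \<in> V"
  shows "submodule (range (\<lambda>k. sca k \<odot>\<^bsub>M\<^esub> b)) R M"
  using submodule_image[OF line_hom[OF assms] ssD(1)[OF ss_simp_mod[OF assms(4)]] ssD(1)[OF assms(1)]
      submodule_UNIV[OF ssD(1)[OF ss_simp_mod[OF assms(4)]]]] by simp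

lemma sca_cancel:
  assumes "right_module R M" "submodule U R M" "b \<in> carrier M" "sca k \<odot>\<^bsub>M\<^esub> b \<in> U" "k \<noteq> 0"
  shows "b \<in> U"
proof -
  have "sca (inverse k) \<odot>\<^bsub>M\<^esub> (sca k \<odot>\<^bsub>M\<^esub> b) \<in> U"
    using submoduleD(6)[OF assms(2) _ assms(4)] by simp
  then show ?thesis
    using assms right_module.smult_one[OF assms(1,3)] by (simp add: sca_sca sca_one)
qed

text \<open>A submodule containing all components of x contains x, so the components of generators
  generate. The constructions below add or remove such homogeneous generators one at a time.\<close>

lemma fg_homogeneous:
  assumes "right_module R M" "finitely_generated R M"
  shows "\<exists>Y. finite Y \<and> Y \<subseteq> carrier M \<and> (\<forall>y\<in>Y. \<exists>i\<in>V. idem i \<odot>\<^bsub>M\<^esub> y = y) \<and>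
    (\<forall>U. submodule U R M \<and> Y \<subseteq> U \<longrightarrow> U = carrier M)"
proof -
  interpret M: right_module R M by fact
  obtain X where X: "finite X" "X \<subseteq> carrier M"
    "\<forall>U. submodule U R M \<and> X \<subseteq> U \<longrightarrow> U = carrier M"
    using assms(2) unfolding finitely_generated_def by blast
  let ?Y = "(\<lambda>(i, x). idem i \<odot>\<^bsub>M\<^esub> x) ` (V \<times> X)"
  have "finite ?Y" using X(1) by simp
  moreover have "?Y \<subseteq> carrier M" using X(2) by (auto simp: M.smult_closed)
  moreover have "\<forall>y\<in>?Y. \<exists>i\<in>V. idem i \<odot>\<^bsub>M\<^esub> y = y"
  proof
    fix y assume "y \<in> ?Y"
    then obtain i x where "i \<in> V" "x \<in> X" "y = idem i \<odot>\<^bsub>M\<^esub> x" by auto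
    then show "\<exists>i\<in>V. idem i \<odot>\<^bsub>M\<^esub> y = y"
      using X(2) idem_idem[OF assms(1), of x i i] by (intro bexI[of _ i]) auto
  qed
  moreover have "U = carrier M" if U: "submodule U R M" "?Y \<subseteq> U" for U
  proof -
    have "X \<subseteq> U"
    proof
      fix x assume x: "x \<in> X"
      show "x \<in> U"
        by (rule in_submodule_components[OF assms(1) U(1)]) (use x X(2) U(2) in auto)
    qed
    then show ?thesis using X(3) U(1) by simp
  qed
  ultimately show ?thesis by (intro exI[of _ ?Y] conjI) auto
qed

text \<open>The complement grows along the finitely many homogeneous generators: whenever a
  generator \<open>b\<close> is missing from U + W, its line is added to W.\<close>

lemma ss_complement:
  assumes T: "ss T" and fg: "finitely_generated R T" and U: "submodule U R T"
  shows "\<exists>W. submodule W R T \<and> U <+>\<^bsub>T\<^esub> W = carrier T \<and> U \<inter> W \<subseteq> {\<zero>\<^bsub>T\<^esub>}"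
proof -
  have rm: "right_module R T" by (rule ssD(1)[OF T])
  interpret T: right_module R T by (rule rm)
  obtain Y where Y: "finite Y" "Y \<subseteq> carrier T" "\<forall>y\<in>Y. \<exists>i\<in>V. idem i \<odot>\<^bsub>T\<^esub> y = y"
    "\<forall>U. submodule U R T \<and> Y \<subseteq> U \<longrightarrow> U = carrier T"
    using fg_homogeneous[OF rm fg] by blast
  have "\<exists>W. submodule W R T \<and> U \<inter> W \<subseteq> {\<zero>\<^bsub>T\<^esub>} \<and> Y \<subseteq> U <+>\<^bsub>T\<^esub> W"
    using Y(1-3)
  proof (induction Y)
    case empty
    show ?case by (rule exI[of _ "{\<zero>\<^bsub>T\<^esub>}"]) (simp add: submodule_zero[OF rm])
  next
    case (insert b Y)
    obtain W where W: "submodule W R T" "U \<inter> W \<subseteq> {\<zero>\<^bsub>T\<^esub>}" "Y \<subseteq> U <+>\<^bsub>T\<^esub> W"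
      using insert.IH insert.prems by auto
    show ?case
    proof (cases "b \<in> U <+>\<^bsub>T\<^esub> W")
      case True
      with W show ?thesis by blast
    next
      case False
      obtain i where b: "b \<in> carrier T" "idem i \<odot>\<^bsub>T\<^esub> b = b" "i \<in> V"
        using insert.prems by auto
      let ?L = "range (\<lambda>k. sca k \<odot>\<^bsub>T\<^esub> b)"
      let ?W = "W <+>\<^bsub>T\<^esub> ?L"
      have L: "submodule ?L R T" by (rule submodule_line[OF T b])
      have W': "submodule ?W R T" by (rule submodule_set_add[OF rm W(1) L])
      have UW: "submodule (U <+>\<^bsub>T\<^esub> W) R T" by (rule submodule_set_add[OF rm U W(1)])
      have sub: "U <+>\<^bsub>T\<^esub> W \<subseteq> U <+>\<^bsub>T\<^esub> ?W"
      proof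
        fix x assume "x \<in> U <+>\<^bsub>T\<^esub> W"
        then obtain u w where "u \<in> U" "w \<in> W" "x = u \<oplus>\<^bsub>T\<^esub> w" by (rule set_addE)
        then show "x \<in> U <+>\<^bsub>T\<^esub> ?W"
          by (intro set_addI[of u U w ?W]) (auto intro: set_add_left[OF rm W(1) L])
      qed
      have bL: "b \<in> ?L" using b(1) by (intro image_eqI[of _ _ 1]) (auto simp: sca_one T.smult_one)
      have "b \<in> U <+>\<^bsub>T\<^esub> ?W"
        by (intro set_add_right[OF rm U W'] set_add_right[OF rm W(1) L] bL)
      moreover have "U \<inter> ?W \<subseteq> {\<zero>\<^bsub>T\<^esub>}"
      proof
        fix x assume "x \<in> U \<inter> ?W"
        then have xU: "x \<in> U" and "x \<in> ?W" by auto
        from \<open>x \<in> ?W\<close> obtain w l where wl: "w \<in> W" "l \<in> ?L" "x = w \<oplus>\<^bsub>T\<^esub> l" by (rule set_addE)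
        from wl(2) obtain k where k: "l = sca k \<odot>\<^bsub>T\<^esub> b" by auto
        have c: "x \<in> carrier T" "w \<in> carrier T" "l \<in> carrier T"
          using submoduleD(2)[OF U xU] submoduleD(2)[OF W(1) wl(1)] submoduleD(2)[OF L wl(2)] by auto
        \<comment> \<open>The line part of an element of U that lies in W plus the line belongs to U
          + W, so a nonzero coefficient would put \<open>b\<close> there.\<close>
        have "l = x \<oplus>\<^bsub>T\<^esub> (\<ominus>\<^bsub>T\<^esub> w)"
          using c wl(3) by (simp add: T.M.add.m_ac T.M.r_neg2 T.M.r_neg1 T.M.r_neg)
        then have "l \<in> U <+>\<^bsub>T\<^esub> W"
          using xU submoduleD(5)[OF W(1) wl(1)] by (intro set_addI)
        then have "k = 0" using False sca_cancel[OF rm UW b(1)] k by blast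
        then have "x = w" using c wl(3) k b(1) by (simp add: sca_zero)
        then show "x \<in> {\<zero>\<^bsub>T\<^esub>}" using xU wl(1) W(2) by blast
      qed
      ultimately show ?thesis using W' W(3) sub by (intro exI[of _ ?W]) auto
    qed
  qed
  then obtain W where W: "submodule W R T" "U \<inter> W \<subseteq> {\<zero>\<^bsub>T\<^esub>}" "Y \<subseteq> U <+>\<^bsub>T\<^esub> W" by blast
  moreover have "U <+>\<^bsub>T\<^esub> W = carrier T"
    using Y(4) W(3) submodule_set_add[OF rm U W(1)] by blast
  ultimately show ?thesis by blast
qed

lemma set_add_commute:
  assumes "right_module R M" "submodule U R M" "submodule W R M"
  shows "U <+>\<^bsub>M\<^esub> W = W <+>\<^bsub>M\<^esub> U"
proof -
  interpret M: right_module R M by fact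
  have "x \<in> B <+>\<^bsub>M\<^esub> A" if A: "submodule A R M" and B: "submodule B R M" and x: "x \<in> A <+>\<^bsub>M\<^esub> B" for x A B
  proof -
    obtain a b where "a \<in> A" "b \<in> B" "x = a \<oplus>\<^bsub>M\<^esub> b" using x by (rule set_addE)
    then show ?thesis
      using submoduleD(2)[OF A] submoduleD(2)[OF B] by (intro set_addI[of b B a]) (auto simp: M.M.add.m_comm)
  qed
  then show ?thesis using assms(2,3) by blast
qed

lemma ss_projection:
  assumes T: "ss T" and fg: "finitely_generated R T" and U: "submodule U R T"
  shows "\<exists>p\<in>mod_hom R T T. (\<forall>u\<in>U. p u = u) \<and> (\<forall>x\<in>carrier T. p x \<in> U)"
proof -
  have rm: "right_module R T" by (rule ssD(1)[OF T])
  obtain W where W: "submodule W R T" "U <+>\<^bsub>T\<^esub> W = carrier T" "U \<inter> W \<subseteq> {\<zero>\<^bsub>T\<^esub>}"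
    using ss_complement[OF assms] by blast
  then have "W <+>\<^bsub>T\<^esub> U = carrier T" "W \<inter> U \<subseteq> {\<zero>\<^bsub>T\<^esub>}"
    using set_add_commute[OF rm U W(1)] by auto
  from mod_projection[OF rm W(1) U this] show ?thesis by blast
qed

lemma ss_extension:
  assumes T: "ss T" and fg: "finitely_generated R T" and U: "submodule U R T"
    and g: "g \<in> mod_hom R (T\<lparr>carrier := U\<rparr>) N"
  shows "\<exists>h\<in>mod_hom R T N. \<forall>u\<in>U. h u = g u"
proof -
  obtain p where p: "p \<in> mod_hom R T T" "\<forall>u\<in>U. p u = u" "\<forall>x\<in>carrier T. p x \<in> U"
    using ss_projection[OF T fg U] by blast
  have "p \<in> mod_hom R T (T\<lparr>carrier := U\<rparr>)" using p by (intro mod_hom_into_sub) auto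
  from mod_hom_comp[OF this g] p(2) show ?thesis by (intro bexI[of _ "\<lambda>x. g (p x)"]) auto
qed

text \<open>\<open>h\<close> is bijective on a complement of its kernel; the section is the inverse
  of this restriction.\<close>

lemma ss_section:
  assumes T: "ss T" and fg: "finitely_generated R T" and N: "right_module R N"
    and h: "h \<in> mod_hom R T N" "h ` carrier T = carrier N"
  shows "\<exists>g\<in>mod_hom R N T. \<forall>n\<in>carrier N. h (g n) = n"
proof -
  have rm: "right_module R T" by (rule ssD(1)[OF T])
  interpret T: right_module R T by (rule rm)
  interpret N: right_module R N by (rule N)
  let ?K = "a_kernel T N h"
  have K: "submodule ?K R T" by (rule submodule_kernel[OF h(1) rm N])
  obtain W where W: "submodule W R T" "?K <+>\<^bsub>T\<^esub> W = carrier T" "?K \<inter> W \<subseteq> {\<zero>\<^bsub>T\<^esub>}"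
    using ss_complement[OF T fg K] by blast
  have hW: "h \<in> mod_hom R (T\<lparr>carrier := W\<rparr>) N" by (rule mod_hom_sub[OF h(1) W(1)])
  have "mod_iso R (T\<lparr>carrier := W\<rparr>) N \<and> bij_betw h W (carrier N)"
  proof -
    have inj: "inj_on h W"
    proof (rule inj_onI)
      fix x y assume xy: "x \<in> W" "y \<in> W" "h x = h y"
      have c: "x \<in> carrier T" "y \<in> carrier T" using xy submoduleD(2)[OF W(1)] by auto
      have "h (x \<ominus>\<^bsub>T\<^esub> y) = h x \<ominus>\<^bsub>N\<^esub> h y" by (rule mod_hom_diff[OF h(1) rm N c])
      also have "\<dots> = \<zero>\<^bsub>N\<^esub>" using xy(3) mod_homD(1)[OF h(1) c(2)] by (simp add: a_minus_def N.M.r_neg)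
      finally have "x \<ominus>\<^bsub>T\<^esub> y \<in> ?K" using c by (simp add: a_kernel_def')
      moreover have "x \<ominus>\<^bsub>T\<^esub> y \<in> W"
        unfolding a_minus_def by (intro submoduleD(4,5)[OF W(1)] xy(1,2))
      ultimately have "x \<ominus>\<^bsub>T\<^esub> y = \<zero>\<^bsub>T\<^esub>" using W(3) by blast
      then show "x = y" by (rule T.diff_zero_imp_eq[OF c])
    qed
    moreover have "h ` W = carrier N"
    proof
      show "h ` W \<subseteq> carrier N" using submoduleD(2)[OF W(1)] mod_homD(1)[OF h(1)] by auto
      show "carrier N \<subseteq> h ` W"
      proof
        fix n assume "n \<in> carrier N"
        then obtain x where x: "x \<in> carrier T" "n = h x" using h(2) by blast
        then obtain k w where kw: "k \<in> ?K" "w \<in> W" "x = k \<oplus>\<^bsub>T\<^esub> w" using W(2) set_addE by metis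
        then have "k \<in> carrier T" "h k = \<zero>\<^bsub>N\<^esub>" "w \<in> carrier T"
          using submoduleD(2)[OF W(1)] by (auto simp: a_kernel_def')
        then have "n = h w" using x(2) kw(3) mod_homD(1,2)[OF h(1)] by simp
        then show "n \<in> h ` W" using kw(2) by blast
      qed
    qed
    ultimately have "bij_betw h W (carrier N)" by (simp add: bij_betw_def)
    then show ?thesis using hW unfolding mod_iso_def by (intro conjI bexI[of _ h]) auto
  qed
  then have bij: "bij_betw h W (carrier N)" by blast
  have "inv_into W h \<in> mod_hom R N (T\<lparr>carrier := W\<rparr>)"
    using mod_hom_inv[OF hW _ right_module_sub[OF rm W(1)]] bij by simp
  then have "inv_into W h \<in> mod_hom R N T"
    using mod_homD[of "inv_into W h" R N "T\<lparr>carrier := W\<rparr>"] submoduleD(2)[OF W(1)]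
    by (intro mod_homI) auto
  moreover have "\<forall>n\<in>carrier N. h (inv_into W h n) = n"
    using bij by (auto simp: bij_betw_def f_inv_into_f)
  ultimately show ?thesis by blast
qed

text \<open>A submodule is a quotient of T by way of the projection onto it, and so inherits finite
  generation.\<close>

lemma ss_sub_fg:
  assumes T: "ss T" and fg: "finitely_generated R T" and U: "submodule U R T"
  shows "finitely_generated R (T\<lparr>carrier := U\<rparr>)"
proof -
  have rm: "right_module R T" by (rule ssD(1)[OF T])
  obtain p where p: "p \<in> mod_hom R T T" "\<forall>u\<in>U. p u = u" "\<forall>x\<in>carrier T. p x \<in> U"
    using ss_projection[OF T fg U] by blast
  have "p \<in> mod_hom R T (T\<lparr>carrier := U\<rparr>)" using p by (intro mod_hom_into_sub) auto
  moreover have "p ` carrier T = carrier (T\<lparr>carrier := U\<rparr>)"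
    using p submoduleD(1)[OF U] by force
  ultimately show ?thesis
    using finitely_generated_image[OF rm right_module_sub[OF rm U]] fg by blast
qed

text \<open>The functional is defined first on U plus the line of \<open>b\<close>, by projecting to
  the line and reading off the coefficient, and then extended to T. It is the coordinate by which a
  line is split off.\<close>

lemma ss_hyperplane:
  assumes T: "ss T" and fg: "finitely_generated R T" and U: "submodule U R T"
    and b: "b \<in> carrier T" "idem i \<odot>\<^bsub>T\<^esub> b = b" "i \<in> V" "b \<notin> U"
  shows "\<exists>h\<in>mod_hom R T (simp_mod i). (\<forall>u\<in>U. h u = 0) \<and> h b = 1"
proof -
  have rm: "right_module R T" by (rule ssD(1)[OF T])
  interpret T: right_module R T by (rule rm)
  let ?L = "range (\<lambda>k. sca k \<odot>\<^bsub>T\<^esub> b)"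
  have L: "submodule ?L R T" by (rule submodule_line[OF T b(1-3)])
  have bL: "b \<in> ?L" using b(1) by (intro image_eqI[of _ _ 1]) (auto simp: sca_one T.smult_one)
  let ?X = "U <+>\<^bsub>T\<^esub> ?L"
  have X: "submodule ?X R T" by (rule submodule_set_add[OF rm U L])
  have rX: "right_module R (T\<lparr>carrier := ?X\<rparr>)" by (rule right_module_sub[OF rm X])
  have sU: "submodule U R (T\<lparr>carrier := ?X\<rparr>)"
    using submoduleD[OF U] set_add_left[OF rm U L] by (intro submoduleI[OF rX]) auto
  have sL: "submodule ?L R (T\<lparr>carrier := ?X\<rparr>)"
    using submoduleD[OF L] set_add_right[OF rm U L] by (intro submoduleI[OF rX]) auto
  have int: "U \<inter> ?L \<subseteq> {\<zero>\<^bsub>T\<lparr>carrier := ?X\<rparr>\<^esub>}"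
  proof
    fix x assume "x \<in> U \<inter> ?L"
    then obtain k where k: "x = sca k \<odot>\<^bsub>T\<^esub> b" "sca k \<odot>\<^bsub>T\<^esub> b \<in> U" by auto
    then have "k = 0" using sca_cancel[OF rm U b(1)] b(4) by blast
    then show "x \<in> {\<zero>\<^bsub>T\<lparr>carrier := ?X\<rparr>\<^esub>}" using k b(1) by (simp add: sca_zero)
  qed
  have "U <+>\<^bsub>T\<lparr>carrier := ?X\<rparr>\<^esub> ?L = carrier (T\<lparr>carrier := ?X\<rparr>)"
    by (simp add: set_add_def')
  from mod_projection[OF rX sU sL this int] obtain p where
    p: "p \<in> mod_hom R (T\<lparr>carrier := ?X\<rparr>) (T\<lparr>carrier := ?X\<rparr>)" "\<forall>u\<in>U. p u = \<zero>\<^bsub>T\<^esub>"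
      "\<forall>l\<in>?L. p l = l" "\<forall>x\<in>?X. p x \<in> ?L"
    by auto
  have pL: "p \<in> mod_hom R (T\<lparr>carrier := ?X\<rparr>) (T\<lparr>carrier := ?L\<rparr>)"
    using mod_homD[OF p(1)] p(4) by (intro mod_homI) auto
  let ?l = "\<lambda>k. sca k \<odot>\<^bsub>T\<^esub> b"
  \<comment> \<open>Being outside U, \<open>b\<close> is nonzero, so the coefficient of a multiple
    of \<open>b\<close> can be read off.\<close>
  have inj: "inj ?l"
  proof (rule injI)
    fix k l assume kl: "?l k = ?l l"
    have "?l (k - l) \<oplus>\<^bsub>T\<^esub> ?l l = \<zero>\<^bsub>T\<^esub> \<oplus>\<^bsub>T\<^esub> ?l l"
      using b(1) kl sca_add[of "k - l" l] by (simp add: T.smult_closed flip: T.smult_add_left)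
    then have "?l (k - l) = \<zero>\<^bsub>T\<^esub>" using b(1) by (simp add: T.smult_closed)
    then show "k = l"
      using sca_cancel[OF rm U b(1), of "k - l"] submoduleD(3)[OF U] b(4) by auto
  qed
  have lh: "?l \<in> mod_hom R (simp_mod i) (T\<lparr>carrier := ?L\<rparr>)"
    by (rule mod_hom_into_sub[OF line_hom[OF T b(1-3)]]) auto
  have "inv_into UNIV ?l \<in> mod_hom R (T\<lparr>carrier := ?L\<rparr>) (simp_mod i)"
    using mod_hom_inv[OF lh _ ssD(1)[OF ss_simp_mod[OF b(3)]]] inj by (simp add: bij_betw_def)
  from mod_hom_comp[OF pL this]
  have g: "(\<lambda>x. inv_into UNIV ?l (p x)) \<in> mod_hom R (T\<lparr>carrier := ?X\<rparr>) (simp_mod i)" .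
  obtain h where h: "h \<in> mod_hom R T (simp_mod i)" "\<forall>x\<in>?X. h x = inv_into UNIV ?l (p x)"
    using ss_extension[OF T fg X g] by blast
  have inv: "inv_into UNIV ?l (?l k) = k" for k by (rule inv_into_f_f[OF inj]) simp
  have "h u = 0" if u: "u \<in> U" for u
  proof -
    have "h u = inv_into UNIV ?l (?l 0)"
      using h(2) p(2) u set_add_left[OF rm U L u] b(1) by (simp add: sca_zero)
    then show ?thesis unfolding inv .
  qed
  moreover have "h b = 1"
  proof -
    have "p b = ?l 1" using p(3) bL b(1) by (metis T.smult_one sca_one)
    then have "h b = inv_into UNIV ?l (?l 1)" using h(2) set_add_right[OF rm U L bL] by simp
    then show ?thesis unfolding inv .
  qed
  ultimately show ?thesis using h(1) by blast
qed

section \<open>Classification of semisimple modules by their multiplicities\<close>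

lemma right_module_simp_mod: "i \<in> V \<Longrightarrow> right_module R (simp_mod i)"
  by (rule ssD(1)[OF ss_simp_mod])

lemma right_module_std_mod: "right_module R (std_mod d)"
  by (rule ssD(1)[OF ss_std_mod])

text \<open>At each vertex \<open>i\<close> the copies belonging to the second summand are numbered
  from \<open>d i\<close> on.\<close>

lemma std_mod_add:
  "mod_iso R (mod_sum2 (std_mod d) (std_mod d')) (std_mod (\<lambda>i. d i + d' i))"
proof -
  define F :: "('v \<times> nat \<Rightarrow> 'k) \<times> ('v \<times> nat \<Rightarrow> 'k) \<Rightarrow> ('v \<times> nat \<Rightarrow> 'k)" where
    "F q = (\<lambda>(i, n). if n < d i then fst q (i, n) else snd q (i, n - d i))" for q
  let ?M = "mod_sum2 (std_mod d) (std_mod d')" and ?N = "std_mod (\<lambda>i. d i + d' i)"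
  have F1: "F q (i, n) = (if n < d i then fst q (i, n) else snd q (i, n - d i))" for q i n
    by (simp add: F_def)
  show ?thesis
  proof (rule mod_isoI[of F])
    show "F \<in> mod_hom R ?M ?N"
    proof (rule mod_homI)
      fix q assume q: "q \<in> carrier ?M"
      have "i \<in> V \<and> n < d i + d' i" if "F q (i, n) \<noteq> 0" for i n
      proof (cases "n < d i")
        case True then show ?thesis using that q by (auto simp: F1)
      next
        case False
        then have "snd q (i, n - d i) \<noteq> 0" using that by (simp add: F1)
        then have "i \<in> V \<and> n - d i < d' i" using q by auto
        then show ?thesis using False by auto
      qed
      then show "F q \<in> carrier ?N" by simp
    qed (auto simp: fun_eq_iff F_def)
    show "q = \<zero>\<^bsub>?M\<^esub>" if q: "q \<in> carrier ?M" "F q = \<zero>\<^bsub>?N\<^esub>" for q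
    proof -
      have z: "F q (i, n) = 0" for i n using q(2) by simp
      have "fst q (i, n) = 0" for i n
        using z[of i n] q(1) std_mod_zero_outside[of "fst q" d i n] by (auto simp: F1 split: if_splits)
      moreover have "snd q (i, n) = 0" for i n
        using z[of i "n + d i"] by (simp add: F1)
      ultimately show ?thesis by (auto simp: prod_eq_iff fun_eq_iff)
    qed
    show "F ` carrier ?M = carrier ?N"
    proof
      show "carrier ?N \<subseteq> F ` carrier ?M"
      proof
        fix f assume f: "f \<in> carrier ?N"
        define g where "g = (\<lambda>(i, n). if n < d i then f (i, n) else 0)"
        define g' where "g' = (\<lambda>(i, n). f (i, n + d i))"
        have "i \<in> V \<and> n < d' i" if "g' (i, n) \<noteq> 0" for i n
        proof -
          have "f (i, n + d i) \<noteq> 0" using that by (simp add: g'_def)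
          then have "i \<in> V \<and> n + d i < d i + d' i" using f unfolding std_mod_simps by blast
          then show ?thesis by simp
        qed
        then have "(g, g') \<in> carrier ?M" using f by (auto simp: g_def split: if_splits)
        moreover have "f = F (g, g')" by (auto simp: fun_eq_iff F1 g_def g'_def)
        ultimately show "f \<in> F ` carrier ?M" by blast
      qed
      show "F ` carrier ?M \<subseteq> carrier ?N" using mod_homD(1)[OF \<open>F \<in> mod_hom R ?M ?N\<close>] by blast
    qed
  qed (intro right_module_mod_sum2 right_module_std_mod)+
qed

lemma simp_mod_std: 
  assumes "i \<in> V"
  shows "mod_iso R (simp_mod i) (std_mod (\<lambda>j. if j = i then 1 else 0))"
proof -
  let ?N = "std_mod (\<lambda>j. if j = i then 1 else 0)"
  show ?thesis
  proof (rule mod_isoI[of "\<lambda>k p. if p = (i, 0) then k else 0"])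
    show "(\<lambda>k p. if p = (i, 0) then k else 0) \<in> mod_hom R (simp_mod i) ?N"
      by (rule mod_homI) (use assms in \<open>auto simp: fun_eq_iff split: if_splits\<close>)
    show "(\<lambda>k p. if p = (i, 0) then k else 0) ` carrier (simp_mod i) = carrier ?N"
    proof
      show "carrier ?N \<subseteq> (\<lambda>k p. if p = (i, 0) then k else 0) ` carrier (simp_mod i)"
      proof
        fix f assume f: "f \<in> carrier ?N"
        have "f (j, n) = (if (j, n) = (i, 0) then f (i, 0) else 0)" for j n
          using std_mod_zero_outside[OF f, of j n] by auto
        then have "f = (\<lambda>p. if p = (i, 0) then f (i, 0) else 0)" by auto
        then show "f \<in> (\<lambda>k p. if p = (i, 0) then k else 0) ` carrier (simp_mod i)" by auto
      qed
    qed (use assms in \<open>auto split: if_splits\<close>)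
    show "k = \<zero>\<^bsub>simp_mod i\<^esub>" if "(\<lambda>p. if p = (i, 0) then k else 0) = \<zero>\<^bsub>?N\<^esub>" for k
      using fun_cong[OF that, of "(i, 0)"] by simp
  qed (use right_module_simp_mod[OF assms] right_module_std_mod in auto)
qed

lemma std_mod_carrier_zero: "carrier (std_mod (\<lambda>_. 0)) = {\<lambda>_. 0}"
  by (auto simp: std_mod_def)

lemma zero_iso_std:
  assumes "right_module R T" "carrier T = {\<zero>\<^bsub>T\<^esub>}"
  shows "mod_iso R T (std_mod (\<lambda>_. 0))"
proof -
  interpret T: right_module R T by fact
  show ?thesis
    by (rule mod_isoI[of "\<lambda>_ _. 0"])
      (use assms right_module_std_mod std_mod_carrier_zero in \<open>auto intro!: mod_homI\<close>)
qed

lemma ss_split_line: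
  assumes T: "ss T" and b: "b \<in> carrier T" "idem i \<odot>\<^bsub>T\<^esub> b = b" "i \<in> V"
    and h: "h \<in> mod_hom R T (simp_mod i)" "h b = 1"
  shows "mod_iso R T (mod_sum2 (simp_mod i) (T\<lparr>carrier := a_kernel T (simp_mod i) h\<rparr>))"
proof (rule mod_iso_sum2_split[OF ssD(1)[OF T] right_module_simp_mod[OF b(3)] h(1) line_hom[OF T b]])
  fix n :: 'k
  have "h (sca n \<odot>\<^bsub>T\<^esub> b) = sca n \<odot>\<^bsub>simp_mod i\<^esub> h b" by (rule mod_homD(3)[OF h(1) elem_closed(2) b(1)])
  then show "h (sca n \<odot>\<^bsub>T\<^esub> b) = n" using h(2) b(3) by (simp add: sca_def)
qed

text \<open>Induction on the number of homogeneous generators. One generator \<open>b\<close> spans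
  a simple summand; its complement, the kernel of a functional with value 1 at \<open>b\<close>, is
  generated by the projections of the other generators.\<close>

lemma ss_classify_aux:
  assumes "ss T" "finite Y" "card Y \<le> n" "Y \<subseteq> carrier T" "\<forall>y\<in>Y. \<exists>i\<in>V. idem i \<odot>\<^bsub>T\<^esub> y = y"
    "\<forall>U. submodule U R T \<and> Y \<subseteq> U \<longrightarrow> U = carrier T"
  shows "\<exists>d. mod_iso R T (std_mod d)"
  using assms
proof (induction n arbitrary: T Y)
  case 0
  then have "{\<zero>\<^bsub>T\<^esub>} = carrier T" using submodule_zero[OF ssD(1)[OF 0(1)]] by (intro 0(6)[rule_format] conjI) auto
  then show ?case by (intro exI[of _ "\<lambda>_. 0"] zero_iso_std[OF ssD(1)[OF 0(1)]]) simp
next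
  case (Suc n)
  note T = Suc.prems(1)
  have rm: "right_module R T" by (rule ssD(1)[OF T])
  interpret T: right_module R T by (rule rm)
  have fg: "finitely_generated R T"
  proof (rule finitely_generatedI[OF Suc.prems(2,4)])
    fix U assume "submodule U R T" "Y \<subseteq> U"
    then show "U = carrier T" by (intro Suc.prems(6)[rule_format] conjI)
  qed
  show ?case
  proof (cases "Y = {}")
    case True
    then have "{\<zero>\<^bsub>T\<^esub>} = carrier T" using submodule_zero[OF rm] by (intro Suc.prems(6)[rule_format] conjI) auto
    then show ?thesis by (intro exI[of _ "\<lambda>_. 0"] zero_iso_std[OF rm]) simp
  next
    case False
    then obtain b where bY: "b \<in> Y" by blast
    let ?Y = "Y - {b}"
    have Y': "finite ?Y" "card ?Y \<le> n" "?Y \<subseteq> carrier T"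
      using Suc.prems(2-4) bY by auto
    obtain i where b: "b \<in> carrier T" "idem i \<odot>\<^bsub>T\<^esub> b = b" "i \<in> V"
      using Suc.prems(4,5) bY by blast
    show ?thesis
    \<comment> \<open>A zero generator spans no line and is simply dropped.\<close>
    proof (cases "b = \<zero>\<^bsub>T\<^esub>")
      case True
      have "\<forall>U. submodule U R T \<and> ?Y \<subseteq> U \<longrightarrow> U = carrier T"
      proof (intro allI impI)
        fix U assume U: "submodule U R T \<and> ?Y \<subseteq> U"
        then have "Y \<subseteq> U" using True submoduleD(3)[of U R T] by auto
        then show "U = carrier T" using U by (intro Suc.prems(6)[rule_format] conjI) auto
      qed
      moreover have "\<forall>y\<in>?Y. \<exists>i\<in>V. idem i \<odot>\<^bsub>T\<^esub> y = y" using Suc.prems(5) by simp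
      ultimately show ?thesis by (intro Suc.IH[OF T Y'])
    next
      case False
      obtain h where h: "h \<in> mod_hom R T (simp_mod i)" "h b = 1"
        using ss_hyperplane[OF T fg submodule_zero[OF rm] b] False by auto
      let ?K = "a_kernel T (simp_mod i) h"
      let ?TK = "T\<lparr>carrier := ?K\<rparr>"
      have K: "submodule ?K R T"
        by (rule submodule_kernel[OF h(1) rm right_module_simp_mod[OF b(3)]])
      have rK: "right_module R ?TK" by (rule right_module_sub[OF rm K])
      \<comment> \<open>\<open>q\<close> projects along the line of \<open>b\<close> onto the kernel
        of \<open>h\<close>.\<close>
      define q where "q x = x \<ominus>\<^bsub>T\<^esub> (sca (h x) \<odot>\<^bsub>T\<^esub> b)" for x
      have hl: "h (sca k \<odot>\<^bsub>T\<^esub> b) = k" for k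
        using mod_homD(3)[OF h(1) elem_closed(2)[of k] b(1)] h(2) b(3) by (simp add: sca_def)
      have "(\<lambda>x. id x \<ominus>\<^bsub>T\<^esub> (sca (h x) \<odot>\<^bsub>T\<^esub> b)) \<in> mod_hom R T T"
        by (rule mod_hom_minus_hom[OF mod_hom_id mod_hom_comp[OF h(1) line_hom[OF T b]] rm rm])
      then have q1: "q \<in> mod_hom R T T" by (simp add: q_def[abs_def])
      have qK: "q x \<in> ?K" if "x \<in> carrier T" for x
      proof -
        have "h (q x) = h x \<ominus>\<^bsub>simp_mod i\<^esub> h (sca (h x) \<odot>\<^bsub>T\<^esub> b)"
          unfolding q_def by (rule mod_hom_diff[OF h(1) rm right_module_simp_mod[OF b(3)] that])
            (use b(1) in \<open>simp add: T.smult_closed\<close>)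
        also have "\<dots> = 0"
          unfolding hl using right_module.smult_minus_one[OF right_module_simp_mod[OF b(3)], of "h x"]
            abelian_group.r_neg[OF right_module.axioms(2)[OF right_module_simp_mod[OF b(3)]], of "h x"]
          by (simp add: a_minus_def)
        finally show ?thesis using mod_homD(1)[OF q1 that] by (simp add: a_kernel_def')
      qed
      have q2: "q \<in> mod_hom R T ?TK" by (rule mod_hom_into_sub[OF q1 qK])
      have qfix: "q x = x" if "x \<in> ?K" for x
        using that b(1) by (simp add: q_def a_kernel_def' sca_zero a_minus_def T.neg_zero)
      have qb: "q b = \<zero>\<^bsub>T\<^esub>" using b(1) h(2) by (simp add: q_def sca_one T.smult_one a_minus_def T.M.r_neg)
      have "\<exists>d. mod_iso R ?TK (std_mod d)"
      proof (rule Suc.IH[of ?TK "q ` ?Y"])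
        show "ss ?TK" by (rule ss_sub[OF T K])
        show "finite (q ` ?Y)" using Y'(1) by simp
        show "card (q ` ?Y) \<le> n" using card_image_le[OF Y'(1), of q] Y'(2) by simp
        show "q ` ?Y \<subseteq> carrier ?TK" using qK Y'(3) by auto
        show "\<forall>y\<in>q ` ?Y. \<exists>i\<in>V. idem i \<odot>\<^bsub>?TK\<^esub> y = y"
        proof
          fix z assume "z \<in> q ` ?Y"
          then obtain y where y: "y \<in> Y" "z = q y" by blast
          then obtain j where j: "j \<in> V" "idem j \<odot>\<^bsub>T\<^esub> y = y" using Suc.prems(5) by blast
          have "q (idem j \<odot>\<^bsub>T\<^esub> y) = idem j \<odot>\<^bsub>T\<^esub> q y"
            by (rule mod_homD(3)[OF q1 elem_closed(3)]) (use y(1) Suc.prems(4) in blast)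
          then show "\<exists>i\<in>V. idem i \<odot>\<^bsub>?TK\<^esub> z = z" using j y(2) by (intro bexI[of _ j]) auto
        qed
        show "\<forall>U. submodule U R ?TK \<and> q ` ?Y \<subseteq> U \<longrightarrow> U = carrier ?TK"
        proof (intro allI impI)
          fix U assume U: "submodule U R ?TK \<and> q ` ?Y \<subseteq> U"
          have "submodule {x \<in> carrier T. q x \<in> U} R T"
            by (rule submodule_vimage[OF q2 rm rK]) (use U in blast)
          moreover have "Y \<subseteq> {x \<in> carrier T. q x \<in> U}"
          proof
            fix y assume y: "y \<in> Y"
            show "y \<in> {x \<in> carrier T. q x \<in> U}"
            proof (cases "y = b")
              case True
              then show ?thesis using qb b(1) U submoduleD(3)[of U R ?TK] by simp
            next
              case False
              then have "q y \<in> U" using y U by blast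
              then show ?thesis using y Suc.prems(4) by auto
            qed
          qed
          ultimately have all: "{x \<in> carrier T. q x \<in> U} = carrier T"
            by (intro Suc.prems(6)[rule_format] conjI)
          have "?K \<subseteq> U"
          proof
            fix x assume x: "x \<in> ?K"
            then have "x \<in> carrier T" by (simp add: a_kernel_def')
            then have "q x \<in> U" using all by blast
            then show "x \<in> U" using qfix[OF x] by simp
          qed
          then show "U = carrier ?TK" using U submoduleD(1)[of U R ?TK] by auto
        qed
      qed
      then obtain d where d: "mod_iso R ?TK (std_mod d)" by blast
      have "mod_iso R T (std_mod (\<lambda>j. (if j = i then 1 else 0) + d j))"
        by (rule mod_iso_trans[OF ss_split_line[OF T b h] mod_iso_trans[OF mod_iso_sum2_cong[OF
              simp_mod_std[OF b(3)] d] std_mod_add]])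
      then show ?thesis by blast
    qed
  qed
qed

lemma ss_classify:
  assumes "ss T" "finitely_generated R T"
  shows "\<exists>d. mod_iso R T (std_mod d)"
proof -
  obtain Y where Y: "finite Y" "Y \<subseteq> carrier T" "\<forall>y\<in>Y. \<exists>i\<in>V. idem i \<odot>\<^bsub>T\<^esub> y = y"
    "\<forall>U. submodule U R T \<and> Y \<subseteq> U \<longrightarrow> U = carrier T"
    using fg_homogeneous[OF ssD(1)[OF assms(1)] assms(2)] by blast
  show ?thesis by (rule ss_classify_aux[OF assms(1) Y(1) order_refl Y(2-4)])
qed

text \<open>Homomorphisms preserve degrees, so in degree \<open>i\<close> there is a linear map from
  \<open>d i\<close> to \<open>d' i\<close> coordinates. If the former were more, some nontrivial
  combination of unit vectors would be killed.\<close>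

lemma std_mod_unique_le:
  assumes "mod_iso R (std_mod d) (std_mod d')" "i \<in> V"
  shows "d i \<le> d' i"
proof (rule ccontr)
  assume "\<not> d i \<le> d' i"
  then have lt: "d' i < d i" by simp
  obtain h where h: "h \<in> mod_hom R (std_mod d) (std_mod d')" "bij_betw h (carrier (std_mod d)) (carrier (std_mod d'))"
    using assms(1) unfolding mod_iso_def by blast
  note hD = mod_homD[OF h(1)]
  define e where "e n = (\<lambda>p. if p = (i, n) then 1 else 0 :: 'k)" for n :: nat
  have e: "e n \<in> carrier (std_mod d)" if "n < d i" for n
    using that assms(2) by (simp add: e_def)
  obtain x :: "nat \<Rightarrow> 'k" where x: "\<exists>n\<in>{..<d i}. x n \<noteq> 0"
    "\<forall>m\<in>{..<d' i}. (\<Sum>n\<in>{..<d i}. h (e n) (i, m) * x n) = 0"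
    using nontrivial_solution[of "{..<d' i}" "{..<d i}" "\<lambda>m n. h (e n) (i, m)"] lt by auto
  \<comment> \<open>Combinations are written pointwise, so linearity of \<open>h\<close> over them
    is recovered by induction on the index set.\<close>
  have comb: "(\<lambda>p. \<Sum>n\<in>B. x n * e n p) \<in> carrier (std_mod d) \<and>
      h (\<lambda>p. \<Sum>n\<in>B. x n * e n p) = (\<lambda>p. \<Sum>n\<in>B. x n * h (e n) p)"
    if "finite B" "B \<subseteq> {..<d i}" for B
    using that
  proof (induction B)
    case empty
    then show ?case using mod_hom_zero[OF h(1) right_module_std_mod right_module_std_mod] by auto
  next
    case (insert n B)
    have n: "n < d i" using insert.prems by auto
    have IH: "(\<lambda>p. \<Sum>n\<in>B. x n * e n p) \<in> carrier (std_mod d)"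
        "h (\<lambda>p. \<Sum>n\<in>B. x n * e n p) = (\<lambda>p. \<Sum>n\<in>B. x n * h (e n) p)"
      using insert by auto
    have sc: "sca (x n) \<odot>\<^bsub>std_mod d''\<^esub> f = (\<lambda>p. x n * f p)" if f: "f \<in> carrier (std_mod d'')" for f d''
    proof
      fix p show "(sca (x n) \<odot>\<^bsub>std_mod d''\<^esub> f) p = x n * f p"
      proof -
        have "f p * cv (sca (x n)) (fst p) = f p * x n"
          by (rule std_mod_smult_cong[OF f]) (simp add: sca_def)
        then show ?thesis unfolding std_mod_simps(4) by (simp only: mult.commute)
      qed
    qed
    have m: "sca (x n) \<odot>\<^bsub>std_mod d\<^esub> e n \<in> carrier (std_mod d)"
      by (rule right_module.smult_closed[OF right_module_std_mod]) (use e[OF n] in auto)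
    have eq: "(\<lambda>p. \<Sum>n\<in>insert n B. x n * e n p) =
        (sca (x n) \<odot>\<^bsub>std_mod d\<^esub> e n) \<oplus>\<^bsub>std_mod d\<^esub> (\<lambda>p. \<Sum>n\<in>B. x n * e n p)"
      unfolding sc[OF e[OF n]] std_mod_simps(3) using insert.hyps by (simp add: fun_eq_iff)
    have "h (\<lambda>p. \<Sum>n\<in>insert n B. x n * e n p) =
        (sca (x n) \<odot>\<^bsub>std_mod d'\<^esub> h (e n)) \<oplus>\<^bsub>std_mod d'\<^esub> (\<lambda>p. \<Sum>n\<in>B. x n * h (e n) p)"
      unfolding eq hD(2)[OF m IH(1)] hD(3)[OF elem_closed(2) e[OF n]] IH(2) ..
    also have "\<dots> = (\<lambda>p. \<Sum>n\<in>insert n B. x n * h (e n) p)"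
      unfolding sc[OF hD(1)[OF e[OF n]]] using insert.hyps by (simp add: fun_eq_iff)
    finally have "h (\<lambda>p. \<Sum>n\<in>insert n B. x n * e n p) = (\<lambda>p. \<Sum>n\<in>insert n B. x n * h (e n) p)" .
    moreover have "(\<lambda>p. \<Sum>n\<in>insert n B. x n * e n p) \<in> carrier (std_mod d)"
      unfolding eq by (rule abelian_monoid.a_closed[OF abelian_group.axioms(1)[OF right_module.axioms(2)[OF
          right_module_std_mod]] m IH(1)])
    ultimately show ?case by blast
  qed
  define f where "f = (\<lambda>p. \<Sum>n\<in>{..<d i}. x n * e n p)"
  have f: "f \<in> carrier (std_mod d)" "h f = (\<lambda>p. \<Sum>n\<in>{..<d i}. x n * h (e n) p)"
    using comb[of "{..<d i}"] by (auto simp: f_def)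
  have "h f (j, m) = 0" for j m
  proof (cases "j = i \<and> m < d' i")
    case True
    then show ?thesis using x(2) f(2) by (simp add: mult.commute)
  next
    case False
    have "h (e n) (j, m) = 0" if n: "n < d i" for n
    proof (cases "j = i")
      case True
      then have "\<not> m < d' i" using False by simp
      then show ?thesis using std_mod_zero_outside[OF hD(1)[OF e[OF n]], of j m] True by blast
    next
      case ji: False
      \<comment> \<open>Outside degree \<open>i\<close> the image vanishes because
        \<open>e n\<close> is fixed by \<open>idem i\<close>.\<close>
      have ie: "idem i \<odot>\<^bsub>std_mod d\<^esub> e n = e n"
        using assms(2) by (auto simp: fun_eq_iff e_def idem_def)
      have "h (e n) = idem i \<odot>\<^bsub>std_mod d'\<^esub> h (e n)"
        using hD(3)[OF elem_closed(3) e[OF n], of i] unfolding ie .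
      then have "h (e n) (j, m) = h (e n) (j, m) * cv (idem i) j"
        by (metis fst_conv std_mod_simps(4))
      then show ?thesis
        using ji std_mod_zero_outside[OF hD(1)[OF e[OF n]], of j m] by (cases "j \<in> V") (auto simp: idem_def)
    qed
    then show ?thesis using f(2) by simp
  qed
  then have "h f = \<zero>\<^bsub>std_mod d'\<^esub>" by auto
  moreover have "h \<zero>\<^bsub>std_mod d\<^esub> = \<zero>\<^bsub>std_mod d'\<^esub>" "\<zero>\<^bsub>std_mod d\<^esub> \<in> carrier (std_mod d)"
    using mod_hom_zero[OF h(1) right_module_std_mod right_module_std_mod] by auto
  ultimately have fz: "f = \<zero>\<^bsub>std_mod d\<^esub>"
    using h(2) f(1) by (metis bij_betw_imp_inj_on inj_onD)
  obtain n where n: "n < d i" "x n \<noteq> 0" using x(1) by auto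
  have "f (i, n) = (\<Sum>m\<in>{..<d i}. if m = n then x n else 0)"
    unfolding f_def by (rule sum.cong) (auto simp: e_def)
  also have "\<dots> = x n" using n(1) by simp
  finally show False using fz n(2) by simp
qed

lemma std_mod_unique:
  assumes "mod_iso R (std_mod d) (std_mod d')" "i \<in> V"
  shows "d i = d' i"
  using std_mod_unique_le[OF assms] std_mod_unique_le[OF mod_iso_sym[OF assms(1) right_module_std_mod] assms(2)]
  by simp

text \<open>Determined on V only, since \<open>std_mod d\<close> ignores the other values of
  \<open>d\<close>; hence the recurring hypothesis \<open>i \<in> V\<close>.\<close>

definition dimv :: "('r, 'm) module \<Rightarrow> 'v \<Rightarrow> nat" where
  "dimv T = (SOME d. mod_iso R T (std_mod d))"

lemma dimv_std:
  assumes "ss T" "finitely_generated R T"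
  shows "mod_iso R T (std_mod (dimv T))"
  unfolding dimv_def using someI_ex[OF ss_classify[OF assms]] .

lemma dimv_eq:
  assumes "right_module R T" "mod_iso R T (std_mod d)" "i \<in> V"
  shows "dimv T i = d i"
proof -
  have "mod_iso R T (std_mod (dimv T))" unfolding dimv_def by (rule someI[where P = "\<lambda>d. mod_iso R T (std_mod d)", OF assms(2)])
  from mod_iso_trans[OF mod_iso_sym[OF this assms(1)] assms(2)]
  show ?thesis by (rule std_mod_unique[OF _ assms(3)])
qed

lemma dimv_iso:
  assumes "ss T" "finitely_generated R T" "right_module R T'" "mod_iso R T T'" "i \<in> V"
  shows "dimv T' i = dimv T i"
  by (rule dimv_eq[OF assms(3) mod_iso_trans[OF mod_iso_sym[OF assms(4) ssD(1)[OF assms(1)]]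
      dimv_std[OF assms(1,2)]] assms(5)])

lemma dimv_sum2:
  assumes "ss T" "finitely_generated R T" "ss T'" "finitely_generated R T'" "i \<in> V"
  shows "dimv (mod_sum2 T T') i = dimv T i + dimv T' i"
  by (rule dimv_eq[OF right_module_mod_sum2[OF ssD(1)[OF assms(1)] ssD(1)[OF assms(3)]] mod_iso_trans[OF
      mod_iso_sum2_cong[OF dimv_std[OF assms(1,2)] dimv_std[OF assms(3,4)]] std_mod_add] assms(5)])

lemma dimv_simp_mod:
  assumes "i \<in> V" "j \<in> V"
  shows "dimv (simp_mod i) j = (if j = i then 1 else 0)"
  by (rule dimv_eq[OF right_module_simp_mod[OF assms(1)] simp_mod_std[OF assms(1)] assms(2)])

lemma dimv_zero_iff:
  assumes "ss T" "finitely_generated R T" "i \<in> V"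
  shows "dimv T i = 0 \<longleftrightarrow> (\<forall>x\<in>carrier T. idem i \<odot>\<^bsub>T\<^esub> x = \<zero>\<^bsub>T\<^esub>)"
proof -
  have rm: "right_module R T" by (rule ssD(1)[OF assms(1)])
  obtain h where h: "h \<in> mod_hom R T (std_mod (dimv T))" "bij_betw h (carrier T) (carrier (std_mod (dimv T)))"
    using dimv_std[OF assms(1,2)] unfolding mod_iso_def by blast
  have tr: "(idem i \<odot>\<^bsub>T\<^esub> x = \<zero>\<^bsub>T\<^esub>) \<longleftrightarrow> (\<forall>n. h x (i, n) = 0)" if x: "x \<in> carrier T" for x
  proof -
    have c: "idem i \<odot>\<^bsub>T\<^esub> x \<in> carrier T" "\<zero>\<^bsub>T\<^esub> \<in> carrier T"
      using right_module.smult_closed[OF rm elem_closed(3) x] submoduleD(3)[OF submodule_UNIV[OF rm]] by auto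
    have "(idem i \<odot>\<^bsub>T\<^esub> x = \<zero>\<^bsub>T\<^esub>) \<longleftrightarrow> h (idem i \<odot>\<^bsub>T\<^esub> x) = h \<zero>\<^bsub>T\<^esub>"
      using h(2) c by (metis bij_betw_imp_inj_on inj_onD)
    also have "\<dots> \<longleftrightarrow> idem i \<odot>\<^bsub>std_mod (dimv T)\<^esub> h x = \<zero>\<^bsub>std_mod (dimv T)\<^esub>"
      using mod_homD(3)[OF h(1) elem_closed(3) x] mod_hom_zero[OF h(1) rm right_module_std_mod] by metis
    also have "\<dots> \<longleftrightarrow> (\<forall>j n. h x (j, n) * cv (idem i) j = 0)"
      by (auto simp: fun_eq_iff simp del: std_mod_simps(1))
    also have "\<dots> \<longleftrightarrow> (\<forall>n. h x (i, n) = 0)"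
    proof
      assume "\<forall>j n. h x (j, n) * cv (idem i) j = 0"
      then show "\<forall>n. h x (i, n) = 0" using assms(3) by (auto simp: idem_def)
    next
      assume *: "\<forall>n. h x (i, n) = 0"
      show "\<forall>j n. h x (j, n) * cv (idem i) j = 0"
      proof (intro allI)
        fix j n show "h x (j, n) * cv (idem i) j = 0"
          using * std_mod_zero_outside[OF mod_homD(1)[OF h(1) x], of j n]
          by (cases "j \<in> V"; cases "j = i") (auto simp: idem_def)
      qed
    qed
    finally show ?thesis .
  qed
  show ?thesis
  proof
    assume "dimv T i = 0"
    then show "\<forall>x\<in>carrier T. idem i \<odot>\<^bsub>T\<^esub> x = \<zero>\<^bsub>T\<^esub>"
      using tr std_mod_zero_outside[OF mod_homD(1)[OF h(1)]] by simp
  next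
    assume *: "\<forall>x\<in>carrier T. idem i \<odot>\<^bsub>T\<^esub> x = \<zero>\<^bsub>T\<^esub>"
    show "dimv T i = 0"
    proof (rule ccontr)
      assume "dimv T i \<noteq> 0"
      then have "(\<lambda>p. if p = (i, 0) then 1 else 0) \<in> carrier (std_mod (dimv T))"
        using assms(3) by simp
      then obtain x where x: "x \<in> carrier T" "h x = (\<lambda>p. if p = (i, 0) then 1 else 0)"
        using h(2) unfolding bij_betw_def by (metis imageE)
      then have "h x (i, 0) = 0" using tr[OF x(1)] * by blast
      then show False using x(2) by simp
    qed
  qed
qed

text \<open>The epimorphism splits, T being semisimple, so multiplicities add up along the
  kernel.\<close>

lemma dimv_surj:
  assumes T: "ss T" "finitely_generated R T" and N: "right_module R N"
    and h: "h \<in> mod_hom R T N" "h ` carrier T = carrier N" and i: "i \<in> V"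
  shows "dimv T i = dimv N i + dimv (T\<lparr>carrier := a_kernel T N h\<rparr>) i"
proof -
  have rm: "right_module R T" by (rule ssD(1)[OF T(1)])
  obtain g where g: "g \<in> mod_hom R N T" "\<forall>n\<in>carrier N. h (g n) = n"
    using ss_section[OF T N h] by blast
  let ?K = "T\<lparr>carrier := a_kernel T N h\<rparr>"
  have K: "submodule (a_kernel T N h) R T" by (rule submodule_kernel[OF h(1) rm N])
  have ssK: "ss ?K" "finitely_generated R ?K" using ss_sub[OF T(1) K] ss_sub_fg[OF T K] by auto
  have iso: "mod_iso R T (mod_sum2 N ?K)"
    using g(2) by (intro mod_iso_sum2_split[OF rm N h(1) g(1)]) auto
  have ssN: "ss N"
  proof (rule ssI[OF N])
    fix a n assume a: "a \<in> carrier R" and n: "n \<in> carrier N"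
    have gn: "g n \<in> carrier T" by (rule mod_homD(1)[OF g(1) n])
    have "a \<odot>\<^bsub>N\<^esub> h (g n) = h (a \<odot>\<^bsub>T\<^esub> g n)" by (rule mod_homD(3)[OF h(1) a gn, symmetric])
    also have "a \<odot>\<^bsub>T\<^esub> g n = diag a \<odot>\<^bsub>T\<^esub> g n" by (rule ssD(2)[OF T(1) a gn])
    also have "h (diag a \<odot>\<^bsub>T\<^esub> g n) = diag a \<odot>\<^bsub>N\<^esub> h (g n)" by (rule mod_homD(3)[OF h(1) elem_closed(1) gn])
    finally show "a \<odot>\<^bsub>N\<^esub> n = diag a \<odot>\<^bsub>N\<^esub> n" using g(2) n by simp
  qed
  have fgN: "finitely_generated R N" by (rule finitely_generated_image[OF rm N h T(2)])
  have "dimv (mod_sum2 N ?K) i = dimv T i"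
    by (rule dimv_iso[OF T right_module_mod_sum2[OF N ssD(1)[OF ssK(1)]] iso i])
  then show ?thesis using dimv_sum2[OF ssN fgN ssK i] by simp
qed

text \<open>If U contains the whole component at \<open>i\<close>, the kernel of a projection onto U
  has nothing in degree \<open>i\<close>.\<close>

lemma dimv_sub_eq:
  assumes T: "ss T" "finitely_generated R T" and U: "submodule U R T" and i: "i \<in> V"
    and "\<And>x. x \<in> carrier T \<Longrightarrow> idem i \<odot>\<^bsub>T\<^esub> x \<in> U"
  shows "dimv (T\<lparr>carrier := U\<rparr>) i = dimv T i"
proof -
  have rm: "right_module R T" by (rule ssD(1)[OF T(1)])
  have rU: "right_module R (T\<lparr>carrier := U\<rparr>)" by (rule right_module_sub[OF rm U])
  obtain p where p: "p \<in> mod_hom R T T" "\<forall>u\<in>U. p u = u" "\<forall>x\<in>carrier T. p x \<in> U"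
    using ss_projection[OF T U] by blast
  let ?N = "T\<lparr>carrier := U\<rparr>"
  have p': "p \<in> mod_hom R T ?N" using p by (intro mod_hom_into_sub) auto
  have surj: "p ` carrier T = carrier ?N" using p submoduleD(1)[OF U] by force
  let ?K = "T\<lparr>carrier := a_kernel T ?N p\<rparr>"
  have K: "submodule (a_kernel T ?N p) R T" by (rule submodule_kernel[OF p' rm rU])
  have "idem i \<odot>\<^bsub>?K\<^esub> x = \<zero>\<^bsub>?K\<^esub>" if x: "x \<in> carrier ?K" for x
  proof -
    have xT: "x \<in> carrier T" "p x = \<zero>\<^bsub>T\<^esub>" using x by (auto simp: a_kernel_def')
    have "idem i \<odot>\<^bsub>T\<^esub> x = p (idem i \<odot>\<^bsub>T\<^esub> x)" using assms(5)[OF xT(1)] p(2) by simp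
    also have "\<dots> = idem i \<odot>\<^bsub>T\<^esub> p x" by (rule mod_homD(3)[OF p(1) elem_closed(3) xT(1)])
    also have "\<dots> = \<zero>\<^bsub>T\<^esub>" using xT(2) right_module.smult_zero_right[OF rm] by simp
    finally show ?thesis by simp
  qed
  then have "dimv ?K i = 0"
    using dimv_zero_iff[OF ss_sub[OF T(1) K] ss_sub_fg[OF T K] i] by blast
  then show ?thesis using dimv_surj[OF T rU p' surj i] by simp
qed

end

section \<open>Direct sums of families\<close>

lemma mod_sum_simps [simp]:
  "carrier (mod_sum I F) = (\<Pi>\<^sub>E i\<in>I. carrier (F i))" "\<zero>\<^bsub>mod_sum I F\<^esub> = (\<lambda>i\<in>I. \<zero>\<^bsub>F i\<^esub>)"
  "x \<oplus>\<^bsub>mod_sum I F\<^esub> y = (\<lambda>i\<in>I. x i \<oplus>\<^bsub>F i\<^esub> y i)" "a \<odot>\<^bsub>mod_sum I F\<^esub> x = (\<lambda>i\<in>I. a \<odot>\<^bsub>F i\<^esub> x i)"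
  by (auto simp: mod_sum_def)

lemma right_module_mod_sum:
  assumes "ring R" "\<And>i. i \<in> I \<Longrightarrow> right_module R (F i)"
  shows "right_module R (mod_sum I F)"
proof -
  have ag: "abelian_group (F i)" if "i \<in> I" for i
    using assms(2)[OF that] by (rule right_module.axioms(2))
  note am = abelian_group.axioms(1)[OF ag]
  show ?thesis
  proof (rule right_moduleI[OF assms(1)], unfold mod_sum_simps)
    show "(\<lambda>i\<in>I. \<zero>\<^bsub>F i\<^esub>) \<in> (\<Pi>\<^sub>E i\<in>I. carrier (F i))"
      using abelian_monoid.zero_closed[OF am] by simp
  next
    fix x assume x: "x \<in> (\<Pi>\<^sub>E i\<in>I. carrier (F i))"
    have xi: "x i \<in> carrier (F i)" if "i \<in> I" for i using x that by (rule PiE_mem)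
    have restr: "(\<lambda>i\<in>I. x i) = x" by (rule extensional_restrict) (use x in \<open>simp add: PiE_def\<close>)
    have "(\<lambda>i\<in>I. (\<lambda>i\<in>I. \<zero>\<^bsub>F i\<^esub>) i \<oplus>\<^bsub>F i\<^esub> x i) = (\<lambda>i\<in>I. x i)"
      by (rule restrict_ext) (simp add: abelian_monoid.l_zero[OF am xi])
    then show "(\<lambda>i\<in>I. (\<lambda>i\<in>I. \<zero>\<^bsub>F i\<^esub>) i \<oplus>\<^bsub>F i\<^esub> x i) = x" unfolding restr .
    have "(\<lambda>i\<in>I. \<one>\<^bsub>R\<^esub> \<odot>\<^bsub>F i\<^esub> x i) = (\<lambda>i\<in>I. x i)"
      by (rule restrict_ext) (rule right_module.smult_one[OF assms(2) xi])
    then show "(\<lambda>i\<in>I. \<one>\<^bsub>R\<^esub> \<odot>\<^bsub>F i\<^esub> x i) = x" unfolding restr .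
    show "\<exists>y\<in>(\<Pi>\<^sub>E i\<in>I. carrier (F i)). (\<lambda>i\<in>I. y i \<oplus>\<^bsub>F i\<^esub> x i) = (\<lambda>i\<in>I. \<zero>\<^bsub>F i\<^esub>)"
    proof (rule bexI[of _ "\<lambda>i\<in>I. \<ominus>\<^bsub>F i\<^esub> x i"])
      show "(\<lambda>i\<in>I. (\<lambda>i\<in>I. \<ominus>\<^bsub>F i\<^esub> x i) i \<oplus>\<^bsub>F i\<^esub> x i) = (\<lambda>i\<in>I. \<zero>\<^bsub>F i\<^esub>)"
        by (rule restrict_ext) (simp add: abelian_group.l_neg[OF ag xi])
    qed (simp add: abelian_group.a_inv_closed[OF ag xi])
    fix a assume a: "a \<in> carrier R"
    show "(\<lambda>i\<in>I. a \<odot>\<^bsub>F i\<^esub> x i) \<in> (\<Pi>\<^sub>E i\<in>I. carrier (F i))"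
      by (simp add: right_module.smult_closed[OF assms(2) a xi])
    fix b assume b: "b \<in> carrier R"
    show "(\<lambda>i\<in>I. (a \<oplus>\<^bsub>R\<^esub> b) \<odot>\<^bsub>F i\<^esub> x i) =
        (\<lambda>i\<in>I. (\<lambda>i\<in>I. a \<odot>\<^bsub>F i\<^esub> x i) i \<oplus>\<^bsub>F i\<^esub> (\<lambda>i\<in>I. b \<odot>\<^bsub>F i\<^esub> x i) i)"
      by (rule restrict_ext) (simp add: right_module.smult_add_left[OF assms(2) a b xi])
    show "(\<lambda>i\<in>I. (a \<otimes>\<^bsub>R\<^esub> b) \<odot>\<^bsub>F i\<^esub> x i) = (\<lambda>i\<in>I. b \<odot>\<^bsub>F i\<^esub> (\<lambda>i\<in>I. a \<odot>\<^bsub>F i\<^esub> x i) i)"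
      by (rule restrict_ext) (simp add: right_module.smult_mult[OF assms(2) a b xi])
  next
    fix x y assume xy: "x \<in> (\<Pi>\<^sub>E i\<in>I. carrier (F i))" "y \<in> (\<Pi>\<^sub>E i\<in>I. carrier (F i))"
    have xi: "x i \<in> carrier (F i)" "y i \<in> carrier (F i)" if "i \<in> I" for i
      using xy that by (auto intro: PiE_mem)
    show "(\<lambda>i\<in>I. x i \<oplus>\<^bsub>F i\<^esub> y i) \<in> (\<Pi>\<^sub>E i\<in>I. carrier (F i))"
      by (simp add: abelian_monoid.a_closed[OF am] xi)
    show "(\<lambda>i\<in>I. x i \<oplus>\<^bsub>F i\<^esub> y i) = (\<lambda>i\<in>I. y i \<oplus>\<^bsub>F i\<^esub> x i)"
      by (rule restrict_ext) (rule abelian_monoid.a_comm[OF am xi])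
    show "(\<lambda>i\<in>I. a \<odot>\<^bsub>F i\<^esub> (\<lambda>i\<in>I. x i \<oplus>\<^bsub>F i\<^esub> y i) i) =
        (\<lambda>i\<in>I. (\<lambda>i\<in>I. a \<odot>\<^bsub>F i\<^esub> x i) i \<oplus>\<^bsub>F i\<^esub> (\<lambda>i\<in>I. a \<odot>\<^bsub>F i\<^esub> y i) i)"
      if a: "a \<in> carrier R" for a
      by (rule restrict_ext) (simp add: right_module.smult_add_right[OF assms(2) a xi])
    fix z assume z: "z \<in> (\<Pi>\<^sub>E i\<in>I. carrier (F i))"
    have zi: "z i \<in> carrier (F i)" if "i \<in> I" for i using z that by (rule PiE_mem)
    show "(\<lambda>i\<in>I. (\<lambda>i\<in>I. x i \<oplus>\<^bsub>F i\<^esub> y i) i \<oplus>\<^bsub>F i\<^esub> z i) =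
        (\<lambda>i\<in>I. x i \<oplus>\<^bsub>F i\<^esub> (\<lambda>i\<in>I. y i \<oplus>\<^bsub>F i\<^esub> z i) i)"
      by (rule restrict_ext) (simp add: abelian_monoid.a_assoc[OF am xi zi])
  qed
qed

text \<open>Reduces finite direct sums to binary ones, so that generators and dimension vectors can
  be treated by induction on the index set.\<close>

lemma mod_sum_insert:
  assumes "j \<notin> I"
  shows "mod_iso R (mod_sum2 (F j) (mod_sum I F)) (mod_sum (insert j I) F)"
  unfolding mod_iso_def
proof (rule bexI[of _ "\<lambda>p. \<lambda>i\<in>insert j I. if i = j then fst p else snd p i"])
  let ?g = "\<lambda>p. \<lambda>i\<in>insert j I. if i = j then fst p else snd p i"
  have mem: "?g p \<in> carrier (mod_sum (insert j I) F)" if "p \<in> carrier (mod_sum2 (F j) (mod_sum I F))" for p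
    using that assms by auto
  show "?g \<in> mod_hom R (mod_sum2 (F j) (mod_sum I F)) (mod_sum (insert j I) F)"
  proof (rule mod_homI[OF mem], unfold mod_sum_simps mod_sum2_simps)
    show "?g (fst x \<oplus>\<^bsub>F j\<^esub> fst y, \<lambda>i\<in>I. snd x i \<oplus>\<^bsub>F i\<^esub> snd y i) = (\<lambda>i\<in>insert j I. ?g x i \<oplus>\<^bsub>F i\<^esub> ?g y i)" for x y
      by (rule restrict_ext) auto
    show "?g (a \<odot>\<^bsub>F j\<^esub> fst x, \<lambda>i\<in>I. a \<odot>\<^bsub>F i\<^esub> snd x i) = (\<lambda>i\<in>insert j I. a \<odot>\<^bsub>F i\<^esub> ?g x i)" for a x
      by (rule restrict_ext) auto
  qed
  show "bij_betw ?g (carrier (mod_sum2 (F j) (mod_sum I F))) (carrier (mod_sum (insert j I) F))"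
  proof (rule bij_betw_byWitness[where f' = "\<lambda>f. (f j, restrict f I)"])
    show "\<forall>p\<in>carrier (mod_sum2 (F j) (mod_sum I F)). (?g p j, restrict (?g p) I) = p"
    proof
      fix p assume "p \<in> carrier (mod_sum2 (F j) (mod_sum I F))"
      then have "restrict (snd p) I = snd p" by (auto intro: extensional_restrict simp: PiE_def)
      moreover have "restrict (?g p) I = restrict (snd p) I" by (rule restrict_ext) (use assms in auto)
      ultimately show "(?g p j, restrict (?g p) I) = p" by (simp add: prod_eq_iff)
    qed
    show "\<forall>f\<in>carrier (mod_sum (insert j I) F). ?g (f j, restrict f I) = f"
    proof
      fix f assume "f \<in> carrier (mod_sum (insert j I) F)"
      then have "restrict f (insert j I) = f" by (auto intro: extensional_restrict simp: PiE_def)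
      moreover have "?g (f j, restrict f I) = restrict f (insert j I)" by (rule restrict_ext) auto
      ultimately show "?g (f j, restrict f I) = f" by simp
    qed
    show "?g ` carrier (mod_sum2 (F j) (mod_sum I F)) \<subseteq> carrier (mod_sum (insert j I) F)"
      using mem by blast
    show "(\<lambda>f. (f j, restrict f I)) ` carrier (mod_sum (insert j I) F) \<subseteq> carrier (mod_sum2 (F j) (mod_sum I F))"
    proof
      fix q assume "q \<in> (\<lambda>f. (f j, restrict f I)) ` carrier (mod_sum (insert j I) F)"
      then obtain f where f: "f \<in> (\<Pi>\<^sub>E i\<in>insert j I. carrier (F i))" "q = (f j, restrict f I)" by auto
      have "f i \<in> carrier (F i)" if "i \<in> insert j I" for i using f(1) that by (rule PiE_mem)
      then show "q \<in> carrier (mod_sum2 (F j) (mod_sum I F))" using f(2) by simp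
    qed
  qed
qed

lemma finitely_generated_zero:
  assumes "right_module R M" "carrier M = {\<zero>\<^bsub>M\<^esub>}"
  shows "finitely_generated R M"
proof (rule finitely_generatedI[of "{}"])
  fix U assume "submodule U R M"
  then show "U = carrier M" using submoduleD(1,3)[of U R M] assms(2) by auto
qed auto

lemma finitely_generated_mod_sum:
  assumes "ring R" "finite I" "\<And>i. i \<in> I \<Longrightarrow> right_module R (F i) \<and> finitely_generated R (F i)"
  shows "finitely_generated R (mod_sum I F)"
  using assms(2,3)
proof (induction I)
  case empty
  have "right_module R (mod_sum {} F)" by (rule right_module_mod_sum[OF assms(1)]) auto
  then show ?case by (rule finitely_generated_zero) (auto simp: restrict_def)
next
  case (insert j I)
  have rm: "right_module R (mod_sum I F)" "right_module R (mod_sum (insert j I) F)"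
    by (intro right_module_mod_sum[OF assms(1)]; use insert.prems in blast)+
  have "finitely_generated R (mod_sum2 (F j) (mod_sum I F))"
    using insert rm by (intro finitely_generated_mod_sum2) auto
  then show ?case
    using insert.prems rm
    by (intro finitely_generated_iso[OF right_module_mod_sum2 _ mod_sum_insert[OF insert.hyps(2)]]) auto
qed

section \<open>Radical and socle\<close>

lemma submodule_Inter:
  assumes "right_module R M" "\<U> \<noteq> {}" "\<And>U. U \<in> \<U> \<Longrightarrow> submodule U R M"
  shows "submodule (\<Inter>\<U>) R M"
proof (rule submoduleI[OF assms(1)])
  obtain U where U: "U \<in> \<U>" using assms(2) by blast
  show "\<Inter>\<U> \<subseteq> carrier M"
  proof
    fix x assume "x \<in> \<Inter>\<U>"
    then have "x \<in> U" using U by blast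
    then show "x \<in> carrier M" by (rule submoduleD(2)[OF assms(3)[OF U]])
  qed
  show "\<zero>\<^bsub>M\<^esub> \<in> \<Inter>\<U>" using submoduleD(3)[OF assms(3)] by simp
  show "x \<oplus>\<^bsub>M\<^esub> y \<in> \<Inter>\<U>" if "x \<in> \<Inter>\<U>" "y \<in> \<Inter>\<U>" for x y
    using that submoduleD(4)[OF assms(3)] by simp
  show "a \<odot>\<^bsub>M\<^esub> x \<in> \<Inter>\<U>" if "a \<in> carrier R" "x \<in> \<Inter>\<U>" for a x
    using that submoduleD(6)[OF assms(3)] by simp
qed

text \<open>The submodule generated by all products with arrows, that is, M J. As an intersection it
  comes with its minimality.\<close>

definition (in rad_square_zero) rad :: "('r, 'm) module \<Rightarrow> 'm set" where
  "rad M = \<Inter>{U. submodule U R M \<and> (\<forall>\<alpha>\<in>E. \<forall>x\<in>carrier M. arr \<alpha> \<odot>\<^bsub>M\<^esub> x \<in> U)}"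

text \<open>The annihilator of the arrows is the largest semisimple submodule.\<close>

definition (in rad_square_zero) soc :: "('r, 'm) module \<Rightarrow> 'm set" where
  "soc M = {x \<in> carrier M. \<forall>\<alpha>\<in>E. arr \<alpha> \<odot>\<^bsub>M\<^esub> x = \<zero>\<^bsub>M\<^esub>}"

context rad_square_zero
begin

lemma
  assumes "right_module R M"
  shows submodule_rad: "submodule (rad M) R M"
    and arr_in_rad: "\<alpha> \<in> E \<Longrightarrow> x \<in> carrier M \<Longrightarrow> arr \<alpha> \<odot>\<^bsub>M\<^esub> x \<in> rad M"
proof -
  interpret M: right_module R M by fact
  show "submodule (rad M) R M"
    unfolding rad_def using submodule_UNIV[OF assms]
    by (intro submodule_Inter[OF assms]) (auto simp: M.smult_closed)
  show "\<alpha> \<in> E \<Longrightarrow> x \<in> carrier M \<Longrightarrow> arr \<alpha> \<odot>\<^bsub>M\<^esub> x \<in> rad M"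
    unfolding rad_def by blast
qed

lemma rad_least:
  assumes "submodule U R M" "\<And>\<alpha> x. \<alpha> \<in> E \<Longrightarrow> x \<in> carrier M \<Longrightarrow> arr \<alpha> \<odot>\<^bsub>M\<^esub> x \<in> U"
  shows "rad M \<subseteq> U"
  unfolding rad_def using assms by blast

text \<open>Next to an arrow an element of the algebra counts only through its coefficient at the
  source or at the target of the arrow; its own arrow terms would give paths of length two.\<close>

lemma arr_smult:
  assumes "right_module R M" "a \<in> carrier R" "x \<in> carrier M"
  shows "arr \<alpha> \<odot>\<^bsub>M\<^esub> (a \<odot>\<^bsub>M\<^esub> x) = sca (cv a (src \<alpha>)) \<odot>\<^bsub>M\<^esub> (arr \<alpha> \<odot>\<^bsub>M\<^esub> x)"
    "a \<odot>\<^bsub>M\<^esub> (arr \<alpha> \<odot>\<^bsub>M\<^esub> x) = sca (cv a (tgt \<alpha>)) \<odot>\<^bsub>M\<^esub> (arr \<alpha> \<odot>\<^bsub>M\<^esub> x)"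
proof -
  interpret M: right_module R M by fact
  have eq: "a \<otimes> arr \<alpha> = arr \<alpha> \<otimes> sca (cv a (src \<alpha>))"
    unfolding elem_defs by (rule coeff_eqI) (use assms(2) in auto)
  show "arr \<alpha> \<odot>\<^bsub>M\<^esub> (a \<odot>\<^bsub>M\<^esub> x) = sca (cv a (src \<alpha>)) \<odot>\<^bsub>M\<^esub> (arr \<alpha> \<odot>\<^bsub>M\<^esub> x)"
    unfolding M.smult_mult[OF assms(2) elem_closed(4) assms(3), symmetric]
      M.smult_mult[OF elem_closed(4) elem_closed(2) assms(3), symmetric] eq ..
  have eq: "arr \<alpha> \<otimes> a = arr \<alpha> \<otimes> sca (cv a (tgt \<alpha>))"
    unfolding elem_defs by (rule coeff_eqI) (use assms(2) in auto)
  show "a \<odot>\<^bsub>M\<^esub> (arr \<alpha> \<odot>\<^bsub>M\<^esub> x) = sca (cv a (tgt \<alpha>)) \<odot>\<^bsub>M\<^esub> (arr \<alpha> \<odot>\<^bsub>M\<^esub> x)"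
    unfolding M.smult_mult[OF elem_closed(4) assms(2,3), symmetric]
      M.smult_mult[OF elem_closed(4) elem_closed(2) assms(3), symmetric] eq ..
qed

lemma arr_arr:
  assumes "right_module R M" "x \<in> carrier M"
  shows "arr \<alpha> \<odot>\<^bsub>M\<^esub> (arr \<beta> \<odot>\<^bsub>M\<^esub> x) = \<zero>\<^bsub>M\<^esub>"
proof -
  have eq: "arr \<beta> \<otimes> arr \<alpha> = \<zero>" unfolding elem_defs by (rule coeff_eqI) auto
  show ?thesis
    unfolding right_module.smult_mult[OF assms(1) elem_closed(4) elem_closed(4) assms(2), symmetric] eq
    by (rule right_module.smult_zero_left[OF assms])
qed

lemma submodule_soc:
  assumes "right_module R M"
  shows "submodule (soc M) R M"
proof -
  interpret M: right_module R M by fact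
  show ?thesis
    by (rule submoduleI[OF assms])
      (auto simp: soc_def M.smult_closed M.smult_add_right arr_smult(1)[OF assms])
qed

text \<open>Radical square zero in terms of modules: an arrow kills every product with an
  arrow.\<close>

lemma rad_le_soc:
  assumes "right_module R M"
  shows "rad M \<subseteq> soc M"
  by (rule rad_least[OF submodule_soc[OF assms]])
    (auto simp: soc_def arr_arr[OF assms] right_module.smult_closed[OF assms])

lemma ss_soc:
  assumes "ss M"
  shows "soc M = carrier M"
proof -
  have "arr \<alpha> \<odot>\<^bsub>M\<^esub> x = \<zero>\<^bsub>M\<^esub>" if "x \<in> carrier M" for x \<alpha>
    using ssD(2)[OF assms elem_closed(4) that, of \<alpha>] right_module.smult_zero_left[OF ssD(1)[OF assms] that] by simp
  then show ?thesis by (auto simp: soc_def)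
qed

lemma soc_smult:
  assumes "right_module R M" "x \<in> soc M" "a \<in> carrier R"
  shows "a \<odot>\<^bsub>M\<^esub> x = diag a \<odot>\<^bsub>M\<^esub> x"
proof -
  interpret M: right_module R M by fact
  have x: "x \<in> carrier M" "\<And>\<alpha>. \<alpha> \<in> E \<Longrightarrow> arr \<alpha> \<odot>\<^bsub>M\<^esub> x = \<zero>\<^bsub>M\<^esub>" using assms(2) by (auto simp: soc_def)
  have "(\<Oplus>\<^bsub>M\<^esub>\<alpha>\<in>E. sca (ca a \<alpha>) \<odot>\<^bsub>M\<^esub> (arr \<alpha> \<odot>\<^bsub>M\<^esub> x)) = (\<Oplus>\<^bsub>M\<^esub>\<alpha>\<in>E. \<zero>\<^bsub>M\<^esub>)"
    by (rule M.M.finsum_cong') (auto simp: x)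
  then show ?thesis
    using arr_decomp[OF assms(1) x(1) assms(3)] x(1) by (simp add: M.smult_closed)
qed

lemma ss_sub_soc:
  assumes "right_module R M" "submodule U R M" "U \<subseteq> soc M"
  shows "ss (M\<lparr>carrier := U\<rparr>)"
proof (rule ssI[OF right_module_sub[OF assms(1,2)]])
  fix a x assume "a \<in> carrier R" "x \<in> carrier (M\<lparr>carrier := U\<rparr>)"
  then have "a \<odot>\<^bsub>M\<^esub> x = diag a \<odot>\<^bsub>M\<^esub> x" using assms(3) by (intro soc_smult[OF assms(1)]) auto
  then show "a \<odot>\<^bsub>M\<lparr>carrier := U\<rparr>\<^esub> x = diag a \<odot>\<^bsub>M\<lparr>carrier := U\<rparr>\<^esub> x"
    unfolding module.simps module.update_convs by simp
qed

lemma rad_ss: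
  assumes "ss M"
  shows "rad M = {\<zero>\<^bsub>M\<^esub>}"
proof
  show "rad M \<subseteq> {\<zero>\<^bsub>M\<^esub>}"
    by (rule rad_least[OF submodule_zero[OF ssD(1)[OF assms]]])
      (use ss_soc[OF assms] in \<open>auto simp: soc_def\<close>)
qed (use submoduleD(3)[OF submodule_rad[OF ssD(1)[OF assms]]] in auto)

lemma hom_rad:
  assumes "h \<in> mod_hom R M N" "right_module R M" "right_module R N" "x \<in> rad M"
  shows "h x \<in> rad N"
proof -
  have "rad M \<subseteq> {x \<in> carrier M. h x \<in> rad N}"
    by (rule rad_least[OF submodule_vimage[OF assms(1-3) submodule_rad[OF assms(3)]]])
      (use mod_homD[OF assms(1)] in \<open>auto simp: arr_in_rad[OF assms(3)] right_module.smult_closed[OF assms(2)]\<close>)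
  then show ?thesis using assms(4) by blast
qed

lemma surj_rad:
  assumes "h \<in> mod_hom R M N" "right_module R M" "right_module R N" "h ` carrier M = carrier N"
  shows "h ` rad M = rad N"
proof
  show "h ` rad M \<subseteq> rad N" using hom_rad[OF assms(1-3)] by blast
  show "rad N \<subseteq> h ` rad M"
  proof (rule rad_least[OF submodule_image[OF assms(1-3) submodule_rad[OF assms(2)]]])
    fix \<alpha> y assume a: "\<alpha> \<in> E" "y \<in> carrier N"
    then obtain x where x: "x \<in> carrier M" "y = h x" using assms(4) by blast
    have "arr \<alpha> \<odot>\<^bsub>N\<^esub> y = h (arr \<alpha> \<odot>\<^bsub>M\<^esub> x)"
      unfolding x(2) by (rule mod_homD(3)[OF assms(1) elem_closed(4) x(1), symmetric])
    then show "arr \<alpha> \<odot>\<^bsub>N\<^esub> y \<in> h ` rad M" using arr_in_rad[OF assms(2) a(1) x(1)] by blast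
  qed
qed

lemma bij_soc:
  assumes "h \<in> mod_hom R M N" "right_module R M" "right_module R N" "bij_betw h (carrier M) (carrier N)"
  shows "h ` soc M = soc N"
proof -
  note h = mod_homD[OF assms(1)]
  have z: "h \<zero>\<^bsub>M\<^esub> = \<zero>\<^bsub>N\<^esub>" by (rule mod_hom_zero[OF assms(1-3)])
  have c: "\<zero>\<^bsub>M\<^esub> \<in> carrier M" by (rule submoduleD(3)[OF submodule_UNIV[OF assms(2)]])
  have iff: "h x \<in> soc N \<longleftrightarrow> x \<in> soc M" if x: "x \<in> carrier M" for x
  proof -
    have "arr \<alpha> \<odot>\<^bsub>N\<^esub> h x = \<zero>\<^bsub>N\<^esub> \<longleftrightarrow> arr \<alpha> \<odot>\<^bsub>M\<^esub> x = \<zero>\<^bsub>M\<^esub>" for \<alpha>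
    proof -
      have "arr \<alpha> \<odot>\<^bsub>N\<^esub> h x = h (arr \<alpha> \<odot>\<^bsub>M\<^esub> x)" using h(3)[OF elem_closed(4) x] by simp
      moreover have "h (arr \<alpha> \<odot>\<^bsub>M\<^esub> x) = h \<zero>\<^bsub>M\<^esub> \<longleftrightarrow> arr \<alpha> \<odot>\<^bsub>M\<^esub> x = \<zero>\<^bsub>M\<^esub>"
        by (rule inj_on_eq_iff[OF bij_betw_imp_inj_on[OF assms(4)]
              right_module.smult_closed[OF assms(2) elem_closed(4) x] c])
      ultimately show ?thesis using z by simp
    qed
    then show ?thesis using x h(1)[OF x] by (simp add: soc_def)
  qed
  show ?thesis
  proof
    show "h ` soc M \<subseteq> soc N" using iff by (auto simp: soc_def)
    show "soc N \<subseteq> h ` soc M"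
    proof
      fix y assume y: "y \<in> soc N"
      then have "y \<in> carrier N" by (simp add: soc_def)
      then obtain x where "x \<in> carrier M" "y = h x" using assms(4) unfolding bij_betw_def by blast
      then show "y \<in> h ` soc M" using iff y by blast
    qed
  qed
qed

lemma rad_sum2:
  assumes "right_module R M" "right_module R N"
  shows "rad (mod_sum2 M N) = rad M \<times> rad N"
proof
  have rm: "right_module R (mod_sum2 M N)" by (rule right_module_mod_sum2[OF assms])
  note rM = submoduleD[OF submodule_rad[OF assms(1)]] and rN = submoduleD[OF submodule_rad[OF assms(2)]]
  show "rad (mod_sum2 M N) \<subseteq> rad M \<times> rad N"
  proof (rule rad_least)
    show "submodule (rad M \<times> rad N) R (mod_sum2 M N)"
      by (rule submoduleI[OF rm]) (use rM rN in auto)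
  qed (auto simp: arr_in_rad assms)
  show "rad M \<times> rad N \<subseteq> rad (mod_sum2 M N)"
  proof
    fix p assume p: "p \<in> rad M \<times> rad N"
    have i1: "(\<lambda>x. (x, \<zero>\<^bsub>N\<^esub>)) \<in> mod_hom R M (mod_sum2 M N)"
      using right_module.smult_zero_right[OF assms(2)] submoduleD(3)[OF submodule_UNIV[OF assms(2)]]
        abelian_monoid.l_zero[OF abelian_group.axioms(1)[OF right_module.axioms(2)[OF assms(2)]]]
      by (intro mod_homI) auto
    have i2: "(\<lambda>y. (\<zero>\<^bsub>M\<^esub>, y)) \<in> mod_hom R N (mod_sum2 M N)"
      using right_module.smult_zero_right[OF assms(1)] submoduleD(3)[OF submodule_UNIV[OF assms(1)]]
        abelian_monoid.l_zero[OF abelian_group.axioms(1)[OF right_module.axioms(2)[OF assms(1)]]]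
      by (intro mod_homI) auto
    have "(fst p, \<zero>\<^bsub>N\<^esub>) \<oplus>\<^bsub>mod_sum2 M N\<^esub> (\<zero>\<^bsub>M\<^esub>, snd p) \<in> rad (mod_sum2 M N)"
      using p hom_rad[OF i1 assms(1) rm] hom_rad[OF i2 assms(2) rm]
      by (intro submoduleD(4)[OF submodule_rad[OF rm]]) auto
    moreover have "(fst p, \<zero>\<^bsub>N\<^esub>) \<oplus>\<^bsub>mod_sum2 M N\<^esub> (\<zero>\<^bsub>M\<^esub>, snd p) = p"
      using p rM(2) rN(2)
        abelian_monoid.l_zero[OF abelian_group.axioms(1)[OF right_module.axioms(2)[OF assms(2)]]]
        abelian_monoid.r_zero[OF abelian_group.axioms(1)[OF right_module.axioms(2)[OF assms(1)]]]
      by (auto simp: prod_eq_iff)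
    ultimately show "p \<in> rad (mod_sum2 M N)" by simp
  qed
qed

lemma soc_sum2: "soc (mod_sum2 M N) = soc M \<times> soc N"
  by (auto simp: soc_def)

text \<open>Every submodule of M is one of \<open>deg M\<close>, so generators of the latter
  generate the former.\<close>

lemma finitely_generated_from_deg:
  assumes "right_module R M" "finitely_generated R (deg M)"
  shows "finitely_generated R M"
proof -
  obtain X where X: "finite X" "X \<subseteq> carrier M"
    "\<forall>U. submodule U R (deg M) \<and> X \<subseteq> U \<longrightarrow> U = carrier M"
    using assms(2) unfolding finitely_generated_def by auto
  show ?thesis
    by (rule finitely_generatedI[OF X(1,2)]) (intro X(3)[rule_format] conjI submodule_deg[OF assms(1)])
qed

text \<open>As arrows act as zero in \<open>deg M\<close>, the products of the generators with the
  arrows have to be added to the generators.\<close>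

lemma finitely_generated_deg:
  assumes "right_module R M" "finitely_generated R M"
  shows "finitely_generated R (deg M)"
proof -
  interpret M: right_module R M by fact
  obtain X where X: "finite X" "X \<subseteq> carrier M"
    "\<forall>U. submodule U R M \<and> X \<subseteq> U \<longrightarrow> U = carrier M"
    using assms(2) unfolding finitely_generated_def by auto
  let ?X = "X \<union> (\<lambda>(\<alpha>, x). arr \<alpha> \<odot>\<^bsub>M\<^esub> x) ` (E \<times> X)"
  show ?thesis
  proof (rule finitely_generatedI[of ?X])
    show "finite ?X" using X(1) by simp
    show "?X \<subseteq> carrier (deg M)" using X(2) by (auto simp: M.smult_closed)
    fix U assume U: "submodule U R (deg M)" "?X \<subseteq> U"
    note Ud = submoduleD[OF U(1)]
    have Us: "sca k \<odot>\<^bsub>M\<^esub> x \<in> U" if "x \<in> U" for k x using Ud(6)[OF elem_closed(2) that, of k] by simp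
    have Uc: "x \<in> carrier M" if "x \<in> U" for x using Ud(2)[OF that] by simp
    \<comment> \<open>A submodule U of \<open>deg M\<close> need not be stable under arrows. The
      part of it that all arrows carry into U is a submodule of M and contains the original
      generators.\<close>
    let ?U = "{x \<in> U. \<forall>\<alpha>\<in>E. arr \<alpha> \<odot>\<^bsub>M\<^esub> x \<in> U}"
    have "submodule ?U R M"
    proof (rule submoduleI[OF assms(1)])
      show "?U \<subseteq> carrier M" using Uc by auto
      show "\<zero>\<^bsub>M\<^esub> \<in> ?U" using Ud(3) by simp
      show "x \<oplus>\<^bsub>M\<^esub> y \<in> ?U" if xy: "x \<in> ?U" "y \<in> ?U" for x y
        using xy Ud(4) Uc by (simp add: M.smult_add_right)
      fix a x assume a: "a \<in> carrier R" and x: "x \<in> ?U"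
      have xc: "x \<in> carrier M" using Uc x by simp
      have arr: "arr \<alpha> \<odot>\<^bsub>M\<^esub> (a \<odot>\<^bsub>M\<^esub> x) \<in> U" if "\<alpha> \<in> E" for \<alpha>
        unfolding arr_smult(1)[OF assms(1) a xc] using Us x that by simp
      have "diag a \<odot>\<^bsub>M\<^esub> x \<in> U" using Ud(6)[OF a, of x] x by simp
      moreover have "(\<Oplus>\<^bsub>deg M\<^esub>\<alpha>\<in>E. sca (ca a \<alpha>) \<odot>\<^bsub>M\<^esub> (arr \<alpha> \<odot>\<^bsub>M\<^esub> x)) \<in> U"
        using x Us by (intro finsum_in_submodule[OF right_module_deg[OF assms(1)] U(1)]) auto
      moreover have "(\<Oplus>\<^bsub>deg M\<^esub>\<alpha>\<in>E. sca (ca a \<alpha>) \<odot>\<^bsub>M\<^esub> (arr \<alpha> \<odot>\<^bsub>M\<^esub> x)) =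
          (\<Oplus>\<^bsub>M\<^esub>\<alpha>\<in>E. sca (ca a \<alpha>) \<odot>\<^bsub>M\<^esub> (arr \<alpha> \<odot>\<^bsub>M\<^esub> x))"
        by (simp add: finsum_def deg_def)
      ultimately have "a \<odot>\<^bsub>M\<^esub> x \<in> U"
        unfolding arr_decomp[OF assms(1) xc a] using Ud(4) by simp
      then show "a \<odot>\<^bsub>M\<^esub> x \<in> ?U" using arr by blast
    qed
    moreover have "X \<subseteq> ?U" using U(2) by auto
    ultimately have "?U = carrier M" by (intro X(3)[rule_format] conjI)
    then show "U = carrier (deg M)" using Uc by auto
  qed
qed

end

text \<open>Dimension vectors of a module, its radical and its socle; \<open>om\<close> turns out to be the dimension
  vector of the syzygy, and \<open>mu\<close> counts the simple direct summands.\<close>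

definition (in rad_square_zero) dvec :: "('r, 'm) module \<Rightarrow> 'v \<Rightarrow> int" where
  "dvec M i = int (dimv (deg M) i)"

definition (in rad_square_zero) rvec :: "('r, 'm) module \<Rightarrow> 'v \<Rightarrow> int" where
  "rvec M i = int (dimv ((deg M)\<lparr>carrier := rad M\<rparr>) i)"

definition (in rad_square_zero) svec :: "('r, 'm) module \<Rightarrow> 'v \<Rightarrow> int" where
  "svec M i = int (dimv ((deg M)\<lparr>carrier := soc M\<rparr>) i)"

definition (in rad_square_zero) om :: "('r, 'm) module \<Rightarrow> 'v \<Rightarrow> int" where
  "om M i = (\<Sum>\<alpha>\<in>E. if tgt \<alpha> = i then dvec M (src \<alpha>) - rvec M (src \<alpha>) else 0) - rvec M i"

definition (in rad_square_zero) mu :: "('r, 'm) module \<Rightarrow> 'v \<Rightarrow> int" where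
  "mu M i = svec M i - rvec M i"

section \<open>Invariance and additivity of the dimension vectors\<close>

context rad_square_zero
begin

lemma dimv_sub_iso:
  assumes "right_module R M" "right_module R N" "finitely_generated R M"
    "h \<in> mod_hom R M N" "bij_betw h (carrier M) (carrier N)"
    "submodule U R M" "submodule W R N" "h ` U = W" "i \<in> V"
  shows "dimv ((deg N)\<lparr>carrier := W\<rparr>) i = dimv ((deg M)\<lparr>carrier := U\<rparr>) i"
proof (rule dimv_iso[OF ss_sub[OF ss_deg[OF assms(1)] submodule_deg[OF assms(1,6)]]
      ss_sub_fg[OF ss_deg[OF assms(1)] finitely_generated_deg[OF assms(1,3)] submodule_deg[OF assms(1,6)]]
      right_module_sub[OF right_module_deg[OF assms(2)] submodule_deg[OF assms(2,7)]] _ assms(9)])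
  have "h \<in> mod_hom R ((deg M)\<lparr>carrier := U\<rparr>) (deg N)"
    by (rule mod_hom_sub[OF mod_hom_deg[OF assms(4)] submodule_deg[OF assms(1,6)]])
  then have "h \<in> mod_hom R ((deg M)\<lparr>carrier := U\<rparr>) ((deg N)\<lparr>carrier := W\<rparr>)"
    using assms(8) by (intro mod_hom_into_sub) auto
  moreover have "bij_betw h U W"
    using assms(5,8) submoduleD(1)[OF assms(6)] by (auto simp: bij_betw_def intro: inj_on_subset)
  ultimately show "mod_iso R ((deg M)\<lparr>carrier := U\<rparr>) ((deg N)\<lparr>carrier := W\<rparr>)"
    unfolding mod_iso_def by (intro bexI[of _ h]) auto
qed

lemma vec_iso:
  assumes "right_module R M" "right_module R N" "finitely_generated R M" "mod_iso R M N" "i \<in> V"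
  shows "dvec N i = dvec M i" "rvec N i = rvec M i" "svec N i = svec M i"
proof -
  obtain h where h: "h \<in> mod_hom R M N" "bij_betw h (carrier M) (carrier N)"
    using assms(4) unfolding mod_iso_def by blast
  have surj: "h ` carrier M = carrier N" using h(2) by (simp add: bij_betw_def)
  show "rvec N i = rvec M i" unfolding rvec_def
    using dimv_sub_iso[OF assms(1-3) h submodule_rad[OF assms(1)] submodule_rad[OF assms(2)]
        surj_rad[OF h(1) assms(1,2) surj] assms(5)] by simp
  show "svec N i = svec M i" unfolding svec_def
    using dimv_sub_iso[OF assms(1-3) h submodule_soc[OF assms(1)] submodule_soc[OF assms(2)]
        bij_soc[OF h(1) assms(1,2) h(2)] assms(5)] by simp
  show "dvec N i = dvec M i" unfolding dvec_def
    using dimv_iso[OF ss_deg[OF assms(1)] finitely_generated_deg[OF assms(1,3)]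
        right_module_deg[OF assms(2)] mod_iso_deg[OF assms(4)] assms(5)] by simp
qed

lemma dimv_sub_sum2:
  assumes "right_module R M" "right_module R N" "finitely_generated R M" "finitely_generated R N"
    "submodule U R M" "submodule W R N" "i \<in> V"
  shows "dimv ((deg (mod_sum2 M N))\<lparr>carrier := U \<times> W\<rparr>) i =
    dimv ((deg M)\<lparr>carrier := U\<rparr>) i + dimv ((deg N)\<lparr>carrier := W\<rparr>) i"
proof -
  let ?M = "(deg M)\<lparr>carrier := U\<rparr>" and ?N = "(deg N)\<lparr>carrier := W\<rparr>"
  have M: "ss ?M" "finitely_generated R ?M"
    by (rule ss_sub[OF ss_deg[OF assms(1)] submodule_deg[OF assms(1,5)]],
        rule ss_sub_fg[OF ss_deg[OF assms(1)] finitely_generated_deg[OF assms(1,3)] submodule_deg[OF assms(1,5)]])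
  have N: "ss ?N" "finitely_generated R ?N"
    by (rule ss_sub[OF ss_deg[OF assms(2)] submodule_deg[OF assms(2,6)]],
        rule ss_sub_fg[OF ss_deg[OF assms(2)] finitely_generated_deg[OF assms(2,4)] submodule_deg[OF assms(2,6)]])
  have S: "ss (mod_sum2 ?M ?N)" "finitely_generated R (mod_sum2 ?M ?N)"
    by (rule ss_mod_sum2[OF M(1) N(1)],
        rule finitely_generated_mod_sum2[OF ssD(1)[OF M(1)] ssD(1)[OF N(1)] M(2) N(2)])
  have rm: "right_module R (mod_sum2 M N)" by (rule right_module_mod_sum2[OF assms(1,2)])
  have "submodule (U \<times> W) R (mod_sum2 M N)"
    by (rule submoduleI[OF rm]) (use submoduleD[OF assms(5)] submoduleD[OF assms(6)] in auto)
  then have rU: "right_module R ((deg (mod_sum2 M N))\<lparr>carrier := U \<times> W\<rparr>)"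
    by (intro right_module_sub[OF right_module_deg[OF rm]] submodule_deg[OF rm])
  have "mod_iso R (mod_sum2 ?M ?N) ((deg (mod_sum2 M N))\<lparr>carrier := U \<times> W\<rparr>)"
    by (rule mod_iso_identity) auto
  from dimv_iso[OF S rU this assms(7)] dimv_sum2[OF M N assms(7)] show ?thesis by simp
qed

lemma vec_sum2:
  assumes "right_module R M" "right_module R N" "finitely_generated R M" "finitely_generated R N" "i \<in> V"
  shows "dvec (mod_sum2 M N) i = dvec M i + dvec N i" "rvec (mod_sum2 M N) i = rvec M i + rvec N i"
    "svec (mod_sum2 M N) i = svec M i + svec N i"
proof -
  have c: "(deg M)\<lparr>carrier := carrier M\<rparr> = deg M" for M :: "('r, 'z) module" by (simp add: deg_def)
  have cs: "(deg (mod_sum2 M N))\<lparr>carrier := carrier M \<times> carrier N\<rparr> = deg (mod_sum2 M N)"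
    using c[of "mod_sum2 M N"] by simp
  have c1: "(deg M)\<lparr>carrier := carrier M\<rparr> = deg M" "(deg N)\<lparr>carrier := carrier N\<rparr> = deg N"
    by (simp_all add: deg_def)
  show "dvec (mod_sum2 M N) i = dvec M i + dvec N i"
    unfolding dvec_def using dimv_sub_sum2[OF assms(1-4) submodule_UNIV[OF assms(1)] submodule_UNIV[OF assms(2)] assms(5)]
    unfolding cs c1 by simp
  show "rvec (mod_sum2 M N) i = rvec M i + rvec N i"
    unfolding rvec_def rad_sum2[OF assms(1,2)]
    using dimv_sub_sum2[OF assms(1-4) submodule_rad[OF assms(1)] submodule_rad[OF assms(2)] assms(5)] by simp
  show "svec (mod_sum2 M N) i = svec M i + svec N i"
    unfolding svec_def soc_sum2
    using dimv_sub_sum2[OF assms(1-4) submodule_soc[OF assms(1)] submodule_soc[OF assms(2)] assms(5)] by simp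
qed

lemma om_mu_iso:
  assumes "right_module R M" "right_module R N" "finitely_generated R M" "mod_iso R M N" "i \<in> V"
  shows "om N i = om M i" "mu N i = mu M i"
proof -
  have "(\<Sum>\<alpha>\<in>E. if tgt \<alpha> = i then dvec N (src \<alpha>) - rvec N (src \<alpha>) else 0) =
      (\<Sum>\<alpha>\<in>E. if tgt \<alpha> = i then dvec M (src \<alpha>) - rvec M (src \<alpha>) else 0)"
    by (rule sum.cong) (auto simp: vec_iso[OF assms(1-4)])
  then show "om N i = om M i" by (simp add: om_def vec_iso[OF assms])
  show "mu N i = mu M i" by (simp add: mu_def vec_iso[OF assms])
qed

lemma om_mu_sum2:
  assumes "right_module R M" "right_module R N" "finitely_generated R M" "finitely_generated R N" "i \<in> V"
  shows "om (mod_sum2 M N) i = om M i + om N i" "mu (mod_sum2 M N) i = mu M i + mu N i"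
proof -
  let ?t = "\<lambda>M \<alpha>. if tgt \<alpha> = i then dvec M (src \<alpha>) - rvec M (src \<alpha>) else 0"
  have "(\<Sum>\<alpha>\<in>E. if tgt \<alpha> = i then dvec (mod_sum2 M N) (src \<alpha>) - rvec (mod_sum2 M N) (src \<alpha>) else 0) =
      (\<Sum>\<alpha>\<in>E. (if tgt \<alpha> = i then dvec M (src \<alpha>) - rvec M (src \<alpha>) else 0) +
        (if tgt \<alpha> = i then dvec N (src \<alpha>) - rvec N (src \<alpha>) else 0))"
    by (rule sum.cong) (auto simp: vec_sum2[OF assms(1-4)])
  then show "om (mod_sum2 M N) i = om M i + om N i"
    by (simp add: om_def vec_sum2[OF assms] sum.distrib)
  show "mu (mod_sum2 M N) i = mu M i + mu N i" by (simp add: mu_def vec_sum2[OF assms])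
qed

end

text \<open>Only the action is replaced, so the additive group of a known direct sum is reused when
  a twisted action is put on it.\<close>

lemma right_module_change_smult:
  assumes B: "right_module R B"
    and "\<And>a x. \<lbrakk>a \<in> carrier R; x \<in> carrier B\<rbrakk> \<Longrightarrow> s a x \<in> carrier B"
    and "\<And>a b x. \<lbrakk>a \<in> carrier R; b \<in> carrier R; x \<in> carrier B\<rbrakk> \<Longrightarrow> s (a \<oplus>\<^bsub>R\<^esub> b) x = s a x \<oplus>\<^bsub>B\<^esub> s b x"
    and "\<And>a x y. \<lbrakk>a \<in> carrier R; x \<in> carrier B; y \<in> carrier B\<rbrakk> \<Longrightarrow> s a (x \<oplus>\<^bsub>B\<^esub> y) = s a x \<oplus>\<^bsub>B\<^esub> s a y"
    and "\<And>a b x. \<lbrakk>a \<in> carrier R; b \<in> carrier R; x \<in> carrier B\<rbrakk> \<Longrightarrow> s (a \<otimes>\<^bsub>R\<^esub> b) x = s b (s a x)"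
    and "\<And>x. x \<in> carrier B \<Longrightarrow> s \<one>\<^bsub>R\<^esub> x = x"
  shows "right_module R (B\<lparr>smult := s\<rparr>)"
proof -
  interpret B: right_module R B by (rule B)
  show ?thesis
  proof (rule right_moduleI)
    show "\<exists>y\<in>carrier (B\<lparr>smult := s\<rparr>). y \<oplus>\<^bsub>B\<lparr>smult := s\<rparr>\<^esub> x = \<zero>\<^bsub>B\<lparr>smult := s\<rparr>\<^esub>"
      if "x \<in> carrier (B\<lparr>smult := s\<rparr>)" for x
      by (rule bexI[of _ "\<ominus>\<^bsub>B\<^esub> x"]) (use that B.M.l_neg in auto)
  qed (use assms B.R.ring_axioms in \<open>simp_all add: B.M.add.m_ac\<close>)
qed

lemma submodule_equalizer:
  assumes "h \<in> mod_hom R M N" "g \<in> mod_hom R M N" "right_module R M" "right_module R N"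
  shows "submodule {x \<in> carrier M. h x = g x} R M"
proof -
  interpret M: right_module R M by fact
  show ?thesis
    by (rule submoduleI[OF assms(3)])
      (use mod_homD[OF assms(1)] mod_homD[OF assms(2)] mod_hom_zero[OF assms(1,3,4)]
        mod_hom_zero[OF assms(2,3,4)] in \<open>auto simp: M.smult_closed\<close>)
qed

section \<open>Components at vertices and induced modules\<close>

context rad_square_zero
begin

lemma ss_mod_sum:
  assumes "\<And>i. i \<in> I \<Longrightarrow> ss (F i)"
  shows "ss (mod_sum I F)"
proof (rule ssI)
  show "right_module R (mod_sum I F)" by (intro right_module_mod_sum ring_axioms ssD(1) assms)
  fix a x assume a: "a \<in> carrier R" and x: "x \<in> carrier (mod_sum I F)"
  then have "x i \<in> carrier (F i)" if "i \<in> I" for i using that by auto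
  then show "a \<odot>\<^bsub>mod_sum I F\<^esub> x = diag a \<odot>\<^bsub>mod_sum I F\<^esub> x"
    unfolding mod_sum_simps by (intro restrict_ext ssD(2)[OF assms a])
qed

lemma dimv_mod_sum:
  assumes "finite I" "\<And>j. j \<in> I \<Longrightarrow> ss (F j) \<and> finitely_generated R (F j)" "i \<in> V"
  shows "dimv (mod_sum I F) i = (\<Sum>j\<in>I. dimv (F j) i)"
  using assms(1,2)
proof (induction I)
  case empty
  have rm: "ss (mod_sum {} F)" by (rule ss_mod_sum) auto
  have "carrier (mod_sum {} F) = {\<zero>\<^bsub>mod_sum {} F\<^esub>}" by (auto simp: restrict_def)
  from zero_iso_std[OF ssD(1)[OF rm] this] show ?case
    using dimv_eq[OF ssD(1)[OF rm] _ assms(3)] by simp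
next
  case (insert j I)
  have I: "ss (mod_sum I F)" "finitely_generated R (mod_sum I F)"
    using insert.prems insert.hyps by (auto intro!: ss_mod_sum finitely_generated_mod_sum ring_axioms ssD(1))
  have J: "ss (F j)" "finitely_generated R (F j)" using insert.prems by auto
  have rm: "right_module R (mod_sum (insert j I) F)"
    using insert.prems by (intro ssD(1) ss_mod_sum) auto
  have "dimv (mod_sum (insert j I) F) i = dimv (mod_sum2 (F j) (mod_sum I F)) i"
    by (rule dimv_iso[OF ss_mod_sum2[OF J(1) I(1)] finitely_generated_mod_sum2[OF ssD(1)[OF J(1)] ssD(1)[OF I(1)] J(2) I(2)]
          rm mod_sum_insert[OF insert.hyps(2)] assms(3)])
  also have "\<dots> = dimv (F j) i + dimv (mod_sum I F) i" by (rule dimv_sum2[OF J I assms(3)])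
  finally show ?case using insert by simp
qed

lemma ss_idem_commute:
  assumes "ss T" "a \<in> carrier R" "x \<in> carrier T"
  shows "idem k \<odot>\<^bsub>T\<^esub> (a \<odot>\<^bsub>T\<^esub> x) = a \<odot>\<^bsub>T\<^esub> (idem k \<odot>\<^bsub>T\<^esub> x)"
proof -
  interpret T: right_module R T by (rule ssD(1)[OF assms(1)])
  have eq: "diag a \<otimes> idem k = idem k \<otimes> diag a"
    unfolding elem_defs by (rule coeff_eqI) auto
  have "idem k \<odot>\<^bsub>T\<^esub> (diag a \<odot>\<^bsub>T\<^esub> x) = diag a \<odot>\<^bsub>T\<^esub> (idem k \<odot>\<^bsub>T\<^esub> x)"
    unfolding T.smult_mult[OF elem_closed(1) elem_closed(3) assms(3), symmetric]
      T.smult_mult[OF elem_closed(3) elem_closed(1) assms(3), symmetric] eq ..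
  then show ?thesis
    unfolding ssD(2)[OF assms(1-3)] ssD(2)[OF assms(1,2) T.smult_closed[OF elem_closed(3) assms(3)]] .
qed

definition comp :: "('r, 'm) module \<Rightarrow> 'v \<Rightarrow> 'm set" where
  "comp T k = {x \<in> carrier T. idem k \<odot>\<^bsub>T\<^esub> x = x}"

lemma submodule_comp:
  assumes "ss T"
  shows "submodule (comp T k) R T"
proof -
  interpret T: right_module R T by (rule ssD(1)[OF assms])
  show ?thesis
    by (rule submoduleI[OF T.right_module_axioms])
      (auto simp: comp_def T.smult_closed T.smult_add_right ss_idem_commute[OF assms])
qed

lemma idem_in_comp: "right_module R T \<Longrightarrow> x \<in> carrier T \<Longrightarrow> idem k \<odot>\<^bsub>T\<^esub> x \<in> comp T k"
  by (simp add: comp_def idem_idem right_module.smult_closed)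

end

text \<open>The component of T at \<open>k\<close>, regarded as a multiple of the simple module at
  \<open>l\<close>. Each arrow from \<open>k\<close> to \<open>l\<close> contributes such a block to
  the radical of the induced module; with source and target exchanged it contributes to the
  coinduced module.\<close>

definition (in rad_square_zero) shift :: "('r, 'm) module \<Rightarrow> 'v \<Rightarrow> 'v \<Rightarrow> ('r, 'm) module" where
  "shift T k l = T\<lparr>carrier := comp T k, smult := \<lambda>a x. sca (cv a l) \<odot>\<^bsub>T\<^esub> x\<rparr>"

text \<open>The induced module \<open>T \<otimes> A\<close> over the semisimple part: \<open>(m, f)\<close> stands for
  \<open>m + \<Sum>\<alpha>. f \<alpha> \<otimes> \<alpha>\<close>.\<close>

definition (in rad_square_zero) ind_mod :: "('r, 'm) module \<Rightarrow> ('r, 'm \<times> ('a \<Rightarrow> 'm)) module" where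
  "ind_mod T = (mod_sum2 T (mod_sum E (\<lambda>\<alpha>. shift T (src \<alpha>) (tgt \<alpha>))))\<lparr>smult := \<lambda>a p.
     (a \<odot>\<^bsub>T\<^esub> fst p, \<lambda>\<alpha>\<in>E. sca (ca a \<alpha>) \<odot>\<^bsub>T\<^esub> (idem (src \<alpha>) \<odot>\<^bsub>T\<^esub> fst p) \<oplus>\<^bsub>T\<^esub>
        sca (cv a (tgt \<alpha>)) \<odot>\<^bsub>T\<^esub> snd p \<alpha>)\<rparr>"

context rad_square_zero
begin

lemma shift_simps [simp]:
  "carrier (shift T k l) = comp T k" "\<zero>\<^bsub>shift T k l\<^esub> = \<zero>\<^bsub>T\<^esub>" "x \<oplus>\<^bsub>shift T k l\<^esub> y = x \<oplus>\<^bsub>T\<^esub> y"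
  "a \<odot>\<^bsub>shift T k l\<^esub> x = sca (cv a l) \<odot>\<^bsub>T\<^esub> x"
  by (auto simp: shift_def)

lemma ss_shift:
  assumes T: "ss T" and l: "l \<in> V"
  shows "ss (shift T k l)"
proof (rule ssI)
  interpret T: right_module R T by (rule ssD(1)[OF T])
  let ?B = "T\<lparr>carrier := comp T k\<rparr>"
  have B: "right_module R ?B" by (rule right_module_sub[OF T.right_module_axioms submodule_comp[OF T]])
  note C = submoduleD[OF submodule_comp[OF T, of k]]
  have "right_module R (?B\<lparr>smult := \<lambda>a x. sca (cv a l) \<odot>\<^bsub>T\<^esub> x\<rparr>)"
  proof (rule right_module_change_smult[OF B])
    fix a x assume a: "a \<in> carrier R" and x: "x \<in> carrier ?B"
    show "sca (cv a l) \<odot>\<^bsub>T\<^esub> x \<in> carrier ?B" using C(6) x by simp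
    fix b assume b: "b \<in> carrier R"
    show "sca (cv (a \<oplus> b) l) \<odot>\<^bsub>T\<^esub> x = (sca (cv a l) \<odot>\<^bsub>T\<^esub> x) \<oplus>\<^bsub>?B\<^esub> (sca (cv b l) \<odot>\<^bsub>T\<^esub> x)"
      using a b l C(2) x by (simp add: sca_add T.smult_add_left)
    show "sca (cv (a \<otimes> b) l) \<odot>\<^bsub>T\<^esub> x = sca (cv b l) \<odot>\<^bsub>T\<^esub> (sca (cv a l) \<odot>\<^bsub>T\<^esub> x)"
      using a b l C(2) x by (simp add: sca_sca[OF T.right_module_axioms])
  next
    fix a x y assume "a \<in> carrier R" "x \<in> carrier ?B" "y \<in> carrier ?B"
    then show "sca (cv a l) \<odot>\<^bsub>T\<^esub> (x \<oplus>\<^bsub>?B\<^esub> y) = (sca (cv a l) \<odot>\<^bsub>T\<^esub> x) \<oplus>\<^bsub>?B\<^esub> (sca (cv a l) \<odot>\<^bsub>T\<^esub> y)"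
      using C(2) by (simp add: T.smult_add_right)
  next
    fix x assume "x \<in> carrier ?B"
    then show "sca (cv \<one> l) \<odot>\<^bsub>T\<^esub> x = x" using C(2) l by (simp add: sca_one T.smult_one)
  qed
  then show "right_module R (shift T k l)" by (simp add: shift_def)
qed (use l in \<open>simp add: diag_def\<close>)

text \<open>On the component at \<open>k\<close> the algebra acts by scalars, and these act alike
  after the shift, so a submodule of the shifted component is one of the component itself.\<close>

lemma shift_fg:
  assumes T: "ss T" "finitely_generated R T" and V: "l \<in> V" "k \<in> V"
  shows "finitely_generated R (shift T k l)"
proof -
  let ?B = "T\<lparr>carrier := comp T k\<rparr>"
  have rm: "right_module R T" by (rule ssD(1)[OF T(1)])
  have B: "right_module R ?B" by (rule right_module_sub[OF rm submodule_comp[OF T(1)]])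
  have "finitely_generated R ?B" by (rule ss_sub_fg[OF T submodule_comp[OF T(1)]])
  then obtain X where X: "finite X" "X \<subseteq> carrier ?B"
    "\<forall>U. submodule U R ?B \<and> X \<subseteq> U \<longrightarrow> U = carrier ?B"
    unfolding finitely_generated_def by blast
  have "submodule U R ?B" if U: "submodule U R (shift T k l)" for U
  proof (rule submoduleI[OF B])
    note Ud = submoduleD[OF U]
    fix a x assume a: "a \<in> carrier R" and x: "x \<in> U"
    have xc: "x \<in> carrier T" "idem k \<odot>\<^bsub>T\<^esub> x = x" using Ud(2)[OF x] by (auto simp: comp_def)
    have "a \<odot>\<^bsub>T\<^esub> x = sca (cv (sca (cv a k)) l) \<odot>\<^bsub>T\<^esub> x"
      using homogeneous_smult[OF T(1) xc V(2) a] V(1) by (simp add: sca_def)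
    then show "a \<odot>\<^bsub>?B\<^esub> x \<in> U" using Ud(6)[OF elem_closed(2) x, of "cv a k"] by simp
  qed (use submoduleD[OF U] in auto)
  then show ?thesis
    using X by (intro finitely_generatedI[OF X(1)]) auto
qed

lemma dimv_shift:
  assumes T: "ss T" "finitely_generated R T" and V: "k \<in> V" "l \<in> V" "i \<in> V"
  shows "dimv (shift T k l) i = (if i = l then dimv T k else 0)"
proof (cases "i = l")
  case False
  have "idem i \<odot>\<^bsub>shift T k l\<^esub> x = \<zero>\<^bsub>shift T k l\<^esub>" if "x \<in> carrier (shift T k l)" for x
    using that False V right_module.smult_zero_left[OF ssD(1)[OF T(1)], of x]
    by (simp add: comp_def idem_def sca_zero)
  then show ?thesis
    using dimv_zero_iff[OF ss_shift[OF T(1) V(2)] shift_fg[OF T V(2,1)] V(3)] False by simp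
next
  case True
  let ?S = "std_mod (dimv T)" and ?N = "std_mod (\<lambda>i. if i = l then dimv T k else 0)"
  have rm: "right_module R T" by (rule ssD(1)[OF T(1)])
  obtain h where h: "h \<in> mod_hom R T ?S" "bij_betw h (carrier T) (carrier ?S)"
    using dimv_std[OF T] unfolding mod_iso_def by blast
  note hD = mod_homD[OF h(1)]
  define g where "g x = (\<lambda>(j, n). if j = l then h x (k, n) else 0)" for x
  have g: "g x (j, n) = (if j = l then h x (k, n) else 0)" for x j n by (simp add: g_def)
  have hom: "h x (j, n) = 0" if x: "x \<in> comp T k" and "j \<noteq> k" for x j n
  proof (cases "j \<in> V")
    case True
    have xc: "x \<in> carrier T" "idem k \<odot>\<^bsub>T\<^esub> x = x" using x by (auto simp: comp_def)
    have "h x = idem k \<odot>\<^bsub>?S\<^esub> h x" using hD(3)[OF elem_closed(3) xc(1), of k] unfolding xc(2) .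
    then have "h x (j, n) = h x (j, n) * cv (idem k) j" by (metis fst_conv std_mod_simps(4))
    then show ?thesis using True \<open>j \<noteq> k\<close> by (simp add: idem_def)
  next
    case False
    have "x \<in> carrier T" using x by (simp add: comp_def)
    then show ?thesis using std_mod_zero_outside[OF hD(1)] False by blast
  qed
  have mem: "g x \<in> carrier ?N" if x: "x \<in> comp T k" for x
  proof -
    have "x \<in> carrier T" using x by (simp add: comp_def)
    then have "h x (k, n) \<noteq> 0 \<Longrightarrow> n < dimv T k" for n using hD(1)[of x] by auto
    then show ?thesis using V(2) by (auto simp: g split: if_splits)
  qed
  have "mod_iso R (shift T k l) ?N"
  proof (rule mod_isoI[of g])
    show "g \<in> mod_hom R (shift T k l) ?N"
    proof (rule mod_homI)
      fix x assume x: "x \<in> carrier (shift T k l)"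
      show "g x \<in> carrier ?N" using mem x by simp
      fix a assume a: "a \<in> carrier R"
      have xc: "x \<in> carrier T" using x by (simp add: comp_def)
      have hs: "h (sca c \<odot>\<^bsub>T\<^esub> x) (k, n) = h x (k, n) * c" for c n
        using hD(3)[OF elem_closed(2) xc, of c] V(1) by (simp add: sca_def)
      show "g (a \<odot>\<^bsub>shift T k l\<^esub> x) = a \<odot>\<^bsub>?N\<^esub> g x"
        by (auto simp: fun_eq_iff g hs)
    next
      fix x y assume "x \<in> carrier (shift T k l)" "y \<in> carrier (shift T k l)"
      then have "x \<in> carrier T" "y \<in> carrier T" by (auto simp: comp_def)
      then show "g (x \<oplus>\<^bsub>shift T k l\<^esub> y) = g x \<oplus>\<^bsub>?N\<^esub> g y"
        using hD(2)[of x y] by (auto simp: fun_eq_iff g)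
    qed
    show "x = \<zero>\<^bsub>shift T k l\<^esub>" if x: "x \<in> carrier (shift T k l)" "g x = \<zero>\<^bsub>?N\<^esub>" for x
    proof -
      have xc: "x \<in> carrier T" "x \<in> comp T k" using x by (auto simp: comp_def)
      have "h x (j, n) = 0" for j n
        using hom[OF xc(2), of j n] fun_cong[OF x(2), of "(l, n)"] by (cases "j = k") (auto simp: g)
      then have "h x = \<zero>\<^bsub>?S\<^esub>" by auto
      also have "\<dots> = h \<zero>\<^bsub>T\<^esub>" by (rule mod_hom_zero[OF h(1) rm right_module_std_mod, symmetric])
      finally show ?thesis
        using inj_on_eq_iff[OF bij_betw_imp_inj_on[OF h(2)] xc(1) submoduleD(3)[OF submodule_UNIV[OF rm]]]
        by simp
    qed
    show "g ` carrier (shift T k l) = carrier ?N"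
    proof
      show "g ` carrier (shift T k l) \<subseteq> carrier ?N" using mem by auto
      show "carrier ?N \<subseteq> g ` carrier (shift T k l)"
      proof
        fix f assume f: "f \<in> carrier ?N"
        define f' where "f' = (\<lambda>(j, n). if j = k then f (l, n) else 0)"
        have "f (l, n) \<noteq> 0 \<Longrightarrow> n < dimv T k" for n using f by (auto split: if_splits)
        then have f': "f' \<in> carrier ?S" using V(1) by (auto simp: f'_def split: if_splits)
        then obtain x where x: "x \<in> carrier T" "h x = f'" using h(2) unfolding bij_betw_def by (metis imageE)
        have "idem k \<odot>\<^bsub>?S\<^esub> f' = f'" using V(1) by (auto simp: fun_eq_iff f'_def idem_def)
        then have "h (idem k \<odot>\<^bsub>T\<^esub> x) = h x" using hD(3)[OF elem_closed(3) x(1), of k] x(2) by simp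
        then have "x \<in> comp T k"
          using inj_on_eq_iff[OF bij_betw_imp_inj_on[OF h(2)] right_module.smult_closed[OF rm elem_closed(3) x(1)] x(1)] x(1)
          by (simp add: comp_def)
        moreover have "f = g x"
          using std_mod_zero_outside[OF f] by (fastforce simp: fun_eq_iff g x(2) f'_def)
        ultimately show "f \<in> g ` carrier (shift T k l)" by simp
      qed
    qed
  qed (intro ssD(1)[OF ss_shift[OF T(1) V(2)]] right_module_std_mod)+
  then show ?thesis
    using dimv_eq[OF ssD(1)[OF ss_shift[OF T(1) V(2)]] _ V(3)] True by simp
qed

lemma ind_mod_simps [simp]:
  "carrier (ind_mod T) = carrier T \<times> (\<Pi>\<^sub>E \<alpha>\<in>E. comp T (src \<alpha>))"
  "\<zero>\<^bsub>ind_mod T\<^esub> = (\<zero>\<^bsub>T\<^esub>, \<lambda>\<alpha>\<in>E. \<zero>\<^bsub>T\<^esub>)"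
  "p \<oplus>\<^bsub>ind_mod T\<^esub> q = (fst p \<oplus>\<^bsub>T\<^esub> fst q, \<lambda>\<alpha>\<in>E. snd p \<alpha> \<oplus>\<^bsub>T\<^esub> snd q \<alpha>)"
  "a \<odot>\<^bsub>ind_mod T\<^esub> p = (a \<odot>\<^bsub>T\<^esub> fst p, \<lambda>\<alpha>\<in>E. sca (ca a \<alpha>) \<odot>\<^bsub>T\<^esub> (idem (src \<alpha>) \<odot>\<^bsub>T\<^esub> fst p) \<oplus>\<^bsub>T\<^esub>
        sca (cv a (tgt \<alpha>)) \<odot>\<^bsub>T\<^esub> snd p \<alpha>)"
  by (simp_all add: ind_mod_def cong: PiE_cong)

lemma right_module_ind_mod:
  assumes T: "ss T"
  shows "right_module R (ind_mod T)"
proof -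
  have rm: "right_module R T" by (rule ssD(1)[OF T])
  interpret T: right_module R T by (rule rm)
  let ?B = "mod_sum2 T (mod_sum E (\<lambda>\<alpha>. shift T (src \<alpha>) (tgt \<alpha>)))"
  have B: "right_module R ?B"
    by (intro right_module_mod_sum2 rm right_module_mod_sum ring_axioms ssD(1) ss_shift T tgt_V)
  note C = submoduleD[OF submodule_comp[OF T]]
  have memB: "fst p \<in> carrier T" "\<alpha> \<in> E \<Longrightarrow> snd p \<alpha> \<in> comp T (src \<alpha>)"
    if "p \<in> carrier ?B" for p \<alpha>
    using that by auto
  have memT: "snd p \<alpha> \<in> carrier T" if "p \<in> carrier ?B" "\<alpha> \<in> E" for p \<alpha>
    by (rule C(2)[OF memB(2)[OF that]])
  show ?thesis
    unfolding ind_mod_def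
  proof (rule right_module_change_smult[OF B])
    fix a p assume a: "a \<in> carrier R" and p: "p \<in> carrier ?B"
    have pc: "fst p \<in> carrier T" "\<And>\<alpha>. \<alpha> \<in> E \<Longrightarrow> snd p \<alpha> \<in> comp T (src \<alpha>)" using memB[OF p] by blast+
    have pT: "snd p \<alpha> \<in> carrier T" if "\<alpha> \<in> E" for \<alpha> by (rule memT[OF p that])
    have e: "idem (src \<alpha>) \<odot>\<^bsub>T\<^esub> fst p \<in> carrier T" "idem (src \<alpha>) \<odot>\<^bsub>T\<^esub> fst p \<in> comp T (src \<alpha>)" for \<alpha>
      using pc(1) idem_in_comp[OF rm pc(1)] by (auto simp: T.smult_closed)
    let ?u = "\<lambda>a p \<alpha>. sca (ca a \<alpha>) \<odot>\<^bsub>T\<^esub> (idem (src \<alpha>) \<odot>\<^bsub>T\<^esub> fst p) \<oplus>\<^bsub>T\<^esub> sca (cv a (tgt \<alpha>)) \<odot>\<^bsub>T\<^esub> snd p \<alpha>"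
    show "(a \<odot>\<^bsub>T\<^esub> fst p, \<lambda>\<alpha>\<in>E. ?u a p \<alpha>) \<in> carrier ?B"
      using a pc e C(4,6) by (simp add: T.smult_closed)
    fix b assume b: "b \<in> carrier R"
    have "?u (a \<oplus> b) p \<alpha> = ?u a p \<alpha> \<oplus>\<^bsub>T\<^esub> ?u b p \<alpha>" if "\<alpha> \<in> E" for \<alpha>
      using a b e(1)[of \<alpha>] pT[OF that] that by (simp add: sca_add T.smult_add_left T.smult_closed T.M.add.m_ac)
    then show "((a \<oplus> b) \<odot>\<^bsub>T\<^esub> fst p, \<lambda>\<alpha>\<in>E. ?u (a \<oplus> b) p \<alpha>) =
        (a \<odot>\<^bsub>T\<^esub> fst p, \<lambda>\<alpha>\<in>E. ?u a p \<alpha>) \<oplus>\<^bsub>?B\<^esub> (b \<odot>\<^bsub>T\<^esub> fst p, \<lambda>\<alpha>\<in>E. ?u b p \<alpha>)"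
      using T.smult_add_left[OF a b pc(1)] by (simp cong: restrict_cong)
    \<comment> \<open>Compatibility with products at the arrow \<alpha>: the coefficients that arise
      in front of the top part of \<open>p\<close> are the two terms of
      \<open>ca_mult\<close>.\<close>
    have "?u (a \<otimes> b) p \<alpha> = ?u b (a \<odot>\<^bsub>T\<^esub> fst p, \<lambda>\<alpha>\<in>E. ?u a p \<alpha>) \<alpha>" if \<alpha>: "\<alpha> \<in> E" for \<alpha>
    proof -
      let ?e = "idem (src \<alpha>) \<odot>\<^bsub>T\<^esub> fst p"
      have "idem (src \<alpha>) \<odot>\<^bsub>T\<^esub> (a \<odot>\<^bsub>T\<^esub> fst p) = a \<odot>\<^bsub>T\<^esub> ?e" by (rule ss_idem_commute[OF T a pc(1)])
      also have "\<dots> = sca (cv a (src \<alpha>)) \<odot>\<^bsub>T\<^esub> ?e"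
        using e(2)[of \<alpha>] \<alpha> a by (intro homogeneous_smult[OF T]) (auto simp: comp_def)
      finally have 1: "idem (src \<alpha>) \<odot>\<^bsub>T\<^esub> (a \<odot>\<^bsub>T\<^esub> fst p) = sca (cv a (src \<alpha>)) \<odot>\<^bsub>T\<^esub> ?e" .
      have "?u b (a \<odot>\<^bsub>T\<^esub> fst p, \<lambda>\<alpha>\<in>E. ?u a p \<alpha>) \<alpha> = sca (ca b \<alpha>) \<odot>\<^bsub>T\<^esub> (sca (cv a (src \<alpha>)) \<odot>\<^bsub>T\<^esub> ?e) \<oplus>\<^bsub>T\<^esub>
          sca (cv b (tgt \<alpha>)) \<odot>\<^bsub>T\<^esub> (sca (ca a \<alpha>) \<odot>\<^bsub>T\<^esub> ?e \<oplus>\<^bsub>T\<^esub> sca (cv a (tgt \<alpha>)) \<odot>\<^bsub>T\<^esub> snd p \<alpha>)"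
        using \<alpha> by (simp add: 1)
      also have "\<dots> = sca (cv a (src \<alpha>) * ca b \<alpha>) \<odot>\<^bsub>T\<^esub> ?e \<oplus>\<^bsub>T\<^esub> (sca (ca a \<alpha> * cv b (tgt \<alpha>)) \<odot>\<^bsub>T\<^esub> ?e \<oplus>\<^bsub>T\<^esub>
          sca (cv a (tgt \<alpha>) * cv b (tgt \<alpha>)) \<odot>\<^bsub>T\<^esub> snd p \<alpha>)"
        using e(1)[of \<alpha>] pT[OF \<alpha>] by (simp add: T.smult_add_right T.smult_closed sca_sca[OF rm])
      also have "\<dots> = ?u (a \<otimes> b) p \<alpha>"
        using a b e(1)[of \<alpha>] pT[OF \<alpha>] \<alpha> by (simp add: sca_add T.smult_add_left T.smult_closed T.M.a_assoc)
      finally show ?thesis by simp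
    qed
    then show "((a \<otimes> b) \<odot>\<^bsub>T\<^esub> fst p, \<lambda>\<alpha>\<in>E. ?u (a \<otimes> b) p \<alpha>) =
        (b \<odot>\<^bsub>T\<^esub> fst (a \<odot>\<^bsub>T\<^esub> fst p, \<lambda>\<alpha>\<in>E. ?u a p \<alpha>),
          \<lambda>\<alpha>\<in>E. ?u b (a \<odot>\<^bsub>T\<^esub> fst p, \<lambda>\<alpha>\<in>E. ?u a p \<alpha>) \<alpha>)"
      using T.smult_mult[OF a b pc(1)] by (simp cong: restrict_cong)
  next
    fix a p q assume a: "a \<in> carrier R" and pq: "p \<in> carrier ?B" "q \<in> carrier ?B"
    have pc: "fst p \<in> carrier T" "\<And>\<alpha>. \<alpha> \<in> E \<Longrightarrow> snd p \<alpha> \<in> carrier T"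
      "fst q \<in> carrier T" "\<And>\<alpha>. \<alpha> \<in> E \<Longrightarrow> snd q \<alpha> \<in> carrier T"
      using memB(1)[OF pq(1)] memT[OF pq(1)] memB(1)[OF pq(2)] memT[OF pq(2)] by blast+
    let ?u = "\<lambda>a p \<alpha>. sca (ca a \<alpha>) \<odot>\<^bsub>T\<^esub> (idem (src \<alpha>) \<odot>\<^bsub>T\<^esub> fst p) \<oplus>\<^bsub>T\<^esub> sca (cv a (tgt \<alpha>)) \<odot>\<^bsub>T\<^esub> snd p \<alpha>"
    have "?u a (p \<oplus>\<^bsub>?B\<^esub> q) \<alpha> = ?u a p \<alpha> \<oplus>\<^bsub>T\<^esub> ?u a q \<alpha>" if "\<alpha> \<in> E" for \<alpha>
      using pc that by (simp add: T.smult_add_right T.smult_closed T.M.add.m_ac)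
    then show "(a \<odot>\<^bsub>T\<^esub> fst (p \<oplus>\<^bsub>?B\<^esub> q), \<lambda>\<alpha>\<in>E. ?u a (p \<oplus>\<^bsub>?B\<^esub> q) \<alpha>) =
        (a \<odot>\<^bsub>T\<^esub> fst p, \<lambda>\<alpha>\<in>E. ?u a p \<alpha>) \<oplus>\<^bsub>?B\<^esub> (a \<odot>\<^bsub>T\<^esub> fst q, \<lambda>\<alpha>\<in>E. ?u a q \<alpha>)"
      using T.smult_add_right[OF a pc(1,3)] by (simp cong: restrict_cong)
  next
    fix p assume p: "p \<in> carrier ?B"
    have pc: "fst p \<in> carrier T" "\<And>\<alpha>. \<alpha> \<in> E \<Longrightarrow> snd p \<alpha> \<in> carrier T"
      using memB(1)[OF p] memT[OF p] by blast+
    have "(\<lambda>\<alpha>\<in>E. sca (ca \<one> \<alpha>) \<odot>\<^bsub>T\<^esub> (idem (src \<alpha>) \<odot>\<^bsub>T\<^esub> fst p) \<oplus>\<^bsub>T\<^esub> sca (cv \<one> (tgt \<alpha>)) \<odot>\<^bsub>T\<^esub> snd p \<alpha>) = restrict (snd p) E"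
      using pc by (intro restrict_ext) (simp add: sca_zero sca_one T.smult_one T.smult_closed)
    also have "\<dots> = snd p" using p by (intro extensional_restrict) (auto simp: PiE_def)
    finally show "(\<one> \<odot>\<^bsub>T\<^esub> fst p, \<lambda>\<alpha>\<in>E. sca (ca \<one> \<alpha>) \<odot>\<^bsub>T\<^esub> (idem (src \<alpha>) \<odot>\<^bsub>T\<^esub> fst p) \<oplus>\<^bsub>T\<^esub>
        sca (cv \<one> (tgt \<alpha>)) \<odot>\<^bsub>T\<^esub> snd p \<alpha>) = p"
      using T.smult_one[OF pc(1)] by (simp add: prod_eq_iff)
  qed
qed

lemma ind_mod_memD:
  assumes "ss T" "p \<in> carrier (ind_mod T)"
  shows "fst p \<in> carrier T" "\<And>\<alpha>. \<alpha> \<in> E \<Longrightarrow> snd p \<alpha> \<in> carrier T"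
    "\<And>\<alpha>. \<alpha> \<in> E \<Longrightarrow> idem (src \<alpha>) \<odot>\<^bsub>T\<^esub> snd p \<alpha> = snd p \<alpha>" "\<And>\<alpha>. \<alpha> \<in> E \<Longrightarrow> snd p \<alpha> \<in> comp T (src \<alpha>)"
    "restrict (snd p) E = snd p"
  using assms(2) by (auto simp: comp_def PiE_iff intro!: extensional_restrict)

lemma ind_mod_deg:
  assumes T: "ss T"
  shows "mod_iso R (deg (ind_mod T)) (mod_sum2 T (mod_sum E (\<lambda>\<alpha>. shift T (src \<alpha>) (tgt \<alpha>))))"
proof (rule mod_iso_identity)
  interpret T: right_module R T by (rule ssD(1)[OF T])
  let ?B = "mod_sum2 T (mod_sum E (\<lambda>\<alpha>. shift T (src \<alpha>) (tgt \<alpha>)))"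
  show c: "carrier (deg (ind_mod T)) = carrier ?B" by (simp cong: PiE_cong)
  show "x \<oplus>\<^bsub>deg (ind_mod T)\<^esub> y = x \<oplus>\<^bsub>?B\<^esub> y" for x y by simp
  fix a p assume a: "a \<in> carrier R" and p: "p \<in> carrier ?B"
  have p': "p \<in> carrier (ind_mod T)" using p c by simp
  note pc = ind_mod_memD[OF T p']
  have "(\<lambda>\<alpha>\<in>E. sca (ca (diag a) \<alpha>) \<odot>\<^bsub>T\<^esub> (idem (src \<alpha>) \<odot>\<^bsub>T\<^esub> fst p) \<oplus>\<^bsub>T\<^esub> sca (cv (diag a) (tgt \<alpha>)) \<odot>\<^bsub>T\<^esub> snd p \<alpha>) =
      (\<lambda>\<alpha>\<in>E. sca (cv a (tgt \<alpha>)) \<odot>\<^bsub>T\<^esub> snd p \<alpha>)"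
    using pc by (intro restrict_ext) (simp add: diag_def sca_zero T.smult_closed)
  then show "a \<odot>\<^bsub>deg (ind_mod T)\<^esub> p = a \<odot>\<^bsub>?B\<^esub> p"
    unfolding deg_simps ind_mod_simps mod_sum2_simps mod_sum_simps shift_simps
    using ssD(2)[OF T a pc(1)] by simp
qed

lemma ind_mod_fg:
  assumes T: "ss T" "finitely_generated R T"
  shows "finitely_generated R (ind_mod T)"
proof -
  let ?C = "mod_sum E (\<lambda>\<alpha>. shift T (src \<alpha>) (tgt \<alpha>))"
  have rm: "right_module R T" by (rule ssD(1)[OF T(1)])
  have rC: "right_module R ?C"
    by (intro right_module_mod_sum ring_axioms ssD(1) ss_shift T tgt_V)
  have fC: "finitely_generated R ?C"
    by (intro finitely_generated_mod_sum ring_axioms finite_E conjI ssD(1) ss_shift shift_fg T tgt_V src_V)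
  have "mod_iso R (mod_sum2 T ?C) (deg (ind_mod T))"
    by (rule mod_iso_sym[OF ind_mod_deg[OF T(1)] right_module_deg[OF right_module_ind_mod[OF T(1)]]])
  then have "finitely_generated R (deg (ind_mod T))"
    by (rule finitely_generated_iso[OF right_module_mod_sum2[OF rm rC] right_module_deg[OF right_module_ind_mod[OF T(1)]]
          _ finitely_generated_mod_sum2[OF rm rC T(2) fC]])
  then show ?thesis by (rule finitely_generated_from_deg[OF right_module_ind_mod[OF T(1)]])
qed

lemma arr_ind_mod:
  assumes T: "ss T" and p: "p \<in> carrier (ind_mod T)" and \<beta>: "\<beta> \<in> E"
  shows "arr \<beta> \<odot>\<^bsub>ind_mod T\<^esub> p = (\<zero>\<^bsub>T\<^esub>, \<lambda>\<alpha>\<in>E. if \<alpha> = \<beta> then idem (src \<alpha>) \<odot>\<^bsub>T\<^esub> fst p else \<zero>\<^bsub>T\<^esub>)"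
proof -
  interpret T: right_module R T by (rule ssD(1)[OF T])
  note pc = ind_mod_memD[OF T p]
  have "arr \<beta> \<odot>\<^bsub>T\<^esub> fst p = \<zero>\<^bsub>T\<^esub>" using ss_soc[OF T] pc(1) \<beta> by (auto simp: soc_def)
  moreover have "(\<lambda>\<alpha>\<in>E. sca (ca (arr \<beta>) \<alpha>) \<odot>\<^bsub>T\<^esub> (idem (src \<alpha>) \<odot>\<^bsub>T\<^esub> fst p) \<oplus>\<^bsub>T\<^esub> sca (cv (arr \<beta>) (tgt \<alpha>)) \<odot>\<^bsub>T\<^esub> snd p \<alpha>) =
      (\<lambda>\<alpha>\<in>E. if \<alpha> = \<beta> then idem (src \<alpha>) \<odot>\<^bsub>T\<^esub> fst p else \<zero>\<^bsub>T\<^esub>)"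
    using pc by (intro restrict_ext) (simp add: arr_def sca_zero sca_one T.smult_one T.smult_closed)
  ultimately show ?thesis by simp
qed

text \<open>Arrows produce only elements with zero top. Conversely, the slot of \<beta> is reached
  by letting \<beta> act on the same vector placed in the top.\<close>

lemma rad_ind_mod:
  assumes T: "ss T"
  shows "rad (ind_mod T) = {p \<in> carrier (ind_mod T). fst p = \<zero>\<^bsub>T\<^esub>}"
proof
  let ?F = "ind_mod T"
  interpret T: right_module R T by (rule ssD(1)[OF T])
  have rF: "right_module R ?F" by (rule right_module_ind_mod[OF T])
  have fst: "fst \<in> mod_hom R ?F T" by (rule mod_homI) auto
  have ker: "{p \<in> carrier ?F. fst p = \<zero>\<^bsub>T\<^esub>} = a_kernel ?F T fst" by (simp add: a_kernel_def')
  have arrF: "arr \<alpha> \<odot>\<^bsub>?F\<^esub> p \<in> carrier ?F" if "p \<in> carrier ?F" for \<alpha> p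
    by (rule right_module.smult_closed[OF rF elem_closed(4) that])
  show "rad ?F \<subseteq> {p \<in> carrier ?F. fst p = \<zero>\<^bsub>T\<^esub>}"
  proof (rule rad_least)
    show "submodule {p \<in> carrier ?F. fst p = \<zero>\<^bsub>T\<^esub>} R ?F"
      unfolding ker by (rule submodule_kernel[OF fst rF T.right_module_axioms])
    show "arr \<alpha> \<odot>\<^bsub>?F\<^esub> p \<in> {p \<in> carrier ?F. fst p = \<zero>\<^bsub>T\<^esub>}" if "\<alpha> \<in> E" "p \<in> carrier ?F" for \<alpha> p
      using arrF[OF that(2), of \<alpha>] arr_ind_mod[OF T that(2,1)] by (simp del: ind_mod_simps)
  qed
  show "{p \<in> carrier ?F. fst p = \<zero>\<^bsub>T\<^esub>} \<subseteq> rad ?F"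
  proof
    fix p assume p: "p \<in> {p \<in> carrier ?F. fst p = \<zero>\<^bsub>T\<^esub>}"
    then have pF: "p \<in> carrier ?F" and p0: "fst p = \<zero>\<^bsub>T\<^esub>" by blast+
    note pc = ind_mod_memD[OF T pF]
    note rd = submoduleD[OF submodule_rad[OF rF]]
    have "(\<zero>\<^bsub>T\<^esub>, \<lambda>\<alpha>\<in>E. if \<alpha> \<in> B then snd p \<alpha> else \<zero>\<^bsub>T\<^esub>) \<in> rad ?F" if "finite B" "B \<subseteq> E" for B
      using that
    proof (induction B)
      case empty
      have "(\<lambda>\<alpha>\<in>E. if \<alpha> \<in> {} then snd p \<alpha> else \<zero>\<^bsub>T\<^esub>) = (\<lambda>\<alpha>\<in>E. \<zero>\<^bsub>T\<^esub>)"
        by (rule restrict_ext) simp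
      then show ?case using rd(3) unfolding ind_mod_simps(2) by (simp only:)
    next
      case (insert \<beta> B)
      have \<beta>: "\<beta> \<in> E" using insert.prems by simp
      have z: "\<zero>\<^bsub>T\<^esub> \<in> comp T k" for k using submoduleD(3)[OF submodule_comp[OF T]] .
      \<comment> \<open>The entry at \<beta>, placed in the top, is sent back to its slot by
        \<open>arr \<beta>\<close> because it is homogeneous of degree
        \<open>src \<beta>\<close>.\<close>
      have q: "(snd p \<beta>, \<lambda>\<alpha>\<in>E. \<zero>\<^bsub>T\<^esub>) \<in> carrier ?F" using pc(2)[OF \<beta>] z by simp
      have "(\<lambda>\<alpha>\<in>E. (\<lambda>\<alpha>\<in>E. if \<alpha> = \<beta> then idem (src \<alpha>) \<odot>\<^bsub>T\<^esub> snd p \<beta> else \<zero>\<^bsub>T\<^esub>) \<alpha> \<oplus>\<^bsub>T\<^esub>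
            (\<lambda>\<alpha>\<in>E. if \<alpha> \<in> B then snd p \<alpha> else \<zero>\<^bsub>T\<^esub>) \<alpha>) = (\<lambda>\<alpha>\<in>E. if \<alpha> \<in> insert \<beta> B then snd p \<alpha> else \<zero>\<^bsub>T\<^esub>)"
        using pc(2,3) insert.hyps(2) by (intro restrict_ext) auto
      then have "(\<zero>\<^bsub>T\<^esub>, \<lambda>\<alpha>\<in>E. if \<alpha> \<in> insert \<beta> B then snd p \<alpha> else \<zero>\<^bsub>T\<^esub>) =
          (arr \<beta> \<odot>\<^bsub>?F\<^esub> (snd p \<beta>, \<lambda>\<alpha>\<in>E. \<zero>\<^bsub>T\<^esub>)) \<oplus>\<^bsub>?F\<^esub> (\<zero>\<^bsub>T\<^esub>, \<lambda>\<alpha>\<in>E. if \<alpha> \<in> B then snd p \<alpha> else \<zero>\<^bsub>T\<^esub>)"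
        unfolding arr_ind_mod[OF T q \<beta>] ind_mod_simps(3) fst_conv snd_conv
        by (simp only: T.M.l_zero[OF T.M.zero_closed])
      moreover have "(\<zero>\<^bsub>T\<^esub>, \<lambda>\<alpha>\<in>E. if \<alpha> \<in> B then snd p \<alpha> else \<zero>\<^bsub>T\<^esub>) \<in> rad ?F"
        using insert.IH insert.prems by blast
      ultimately show ?case using rd(4)[OF arr_in_rad[OF rF \<beta> q]] by (simp only:)
    qed
    from this[of E] have "(\<zero>\<^bsub>T\<^esub>, \<lambda>\<alpha>\<in>E. if \<alpha> \<in> E then snd p \<alpha> else \<zero>\<^bsub>T\<^esub>) \<in> rad ?F" by simp
    moreover have "(\<zero>\<^bsub>T\<^esub>, \<lambda>\<alpha>\<in>E. if \<alpha> \<in> E then snd p \<alpha> else \<zero>\<^bsub>T\<^esub>) = p"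
      using p0 pc(5) by (simp add: prod_eq_iff cong: restrict_cong)
    ultimately show "p \<in> rad ?F" by simp
  qed
qed

text \<open>The top is T, and the radical has one copy of the component of T at the source for each
  arrow into \<open>i\<close>. The two terms of \<open>om\<close> therefore cancel.\<close>

lemma vec_ind_mod:
  assumes T: "ss T" "finitely_generated R T" and i: "i \<in> V"
  shows "dvec (ind_mod T) i = int (dimv T i) + rvec (ind_mod T) i"
    "rvec (ind_mod T) i = (\<Sum>\<alpha>\<in>E. if tgt \<alpha> = i then int (dimv T (src \<alpha>)) else 0)"
    "om (ind_mod T) i = 0"
proof -
  let ?F = "ind_mod T" and ?C = "mod_sum E (\<lambda>\<alpha>. shift T (src \<alpha>) (tgt \<alpha>))"
  interpret T: right_module R T by (rule ssD(1)[OF T(1)])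
  have rF: "right_module R ?F" by (rule right_module_ind_mod[OF T(1)])
  have fF: "finitely_generated R (deg ?F)" by (rule finitely_generated_deg[OF rF ind_mod_fg[OF T]])
  have z: "\<zero>\<^bsub>T\<^esub> \<in> comp T k" for k using submoduleD(3)[OF submodule_comp[OF T(1)]] .
  have fst: "fst \<in> mod_hom R (deg ?F) T"
  proof (rule mod_homI)
    fix a x assume "a \<in> carrier R" "x \<in> carrier (deg ?F)"
    then show "fst (a \<odot>\<^bsub>deg ?F\<^esub> x) = a \<odot>\<^bsub>T\<^esub> fst x" using ssD(2)[OF T(1), of a "fst x"] by auto
  qed auto
  have surj: "fst ` carrier (deg ?F) = carrier T"
  proof
    show "carrier T \<subseteq> fst ` carrier (deg ?F)"
    proof
      fix x assume "x \<in> carrier T"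
      then have "(x, \<lambda>\<alpha>\<in>E. \<zero>\<^bsub>T\<^esub>) \<in> carrier (deg ?F)" using z by simp
      then show "x \<in> fst ` carrier (deg ?F)" by (metis fst_conv imageI)
    qed
  qed auto
  have ker: "a_kernel (deg ?F) T fst = rad ?F" unfolding rad_ind_mod[OF T(1)] by (simp add: a_kernel_def')
  have d: "dvec ?F j = int (dimv T j) + rvec ?F j" if "j \<in> V" for j
    unfolding dvec_def rvec_def
    using dimv_surj[OF ss_deg[OF rF] fF T.right_module_axioms fst surj that] unfolding ker by simp
  then show "dvec ?F i = int (dimv T i) + rvec ?F i" using i by blast
  let ?R = "(deg ?F)\<lparr>carrier := rad ?F\<rparr>"
  have ssC: "ss ?C" by (intro ss_mod_sum ss_shift T tgt_V)
  have fC: "finitely_generated R ?C"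
    by (intro finitely_generated_mod_sum ring_axioms finite_E conjI ssD(1) ss_shift shift_fg T tgt_V src_V)
  have rR: "right_module R ?R"
    by (rule right_module_sub[OF right_module_deg[OF rF] submodule_deg[OF rF submodule_rad[OF rF]]])
  have cong: "(\<lambda>\<alpha>\<in>E. sca (ca (diag a) \<alpha>) \<odot>\<^bsub>T\<^esub> (idem (src \<alpha>) \<odot>\<^bsub>T\<^esub> \<zero>\<^bsub>T\<^esub>) \<oplus>\<^bsub>T\<^esub> sca (cv (diag a) (tgt \<alpha>)) \<odot>\<^bsub>T\<^esub> f \<alpha>) =
      (\<lambda>\<alpha>\<in>E. sca (cv a (tgt \<alpha>)) \<odot>\<^bsub>T\<^esub> f \<alpha>)" if "f \<in> carrier ?C" for a f
  proof (rule restrict_ext)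
    fix \<alpha> assume \<alpha>: "\<alpha> \<in> E"
    then have "f \<alpha> \<in> carrier T" using that by (auto simp: comp_def)
    then show "sca (ca (diag a) \<alpha>) \<odot>\<^bsub>T\<^esub> (idem (src \<alpha>) \<odot>\<^bsub>T\<^esub> \<zero>\<^bsub>T\<^esub>) \<oplus>\<^bsub>T\<^esub> sca (cv (diag a) (tgt \<alpha>)) \<odot>\<^bsub>T\<^esub> f \<alpha> =
        sca (cv a (tgt \<alpha>)) \<odot>\<^bsub>T\<^esub> f \<alpha>"
      using \<alpha> by (simp add: diag_def T.smult_closed)
  qed
  have "mod_iso R ?C ?R" unfolding mod_iso_def
  proof (rule bexI[of _ "\<lambda>f. (\<zero>\<^bsub>T\<^esub>, f)"])
    show "(\<lambda>f. (\<zero>\<^bsub>T\<^esub>, f)) \<in> mod_hom R ?C ?R"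
    proof (rule mod_homI)
      fix f assume f: "f \<in> carrier ?C"
      then show "(\<zero>\<^bsub>T\<^esub>, f) \<in> carrier ?R" by (simp add: rad_ind_mod[OF T(1)])
      fix a assume "a \<in> carrier R"
      then show "(\<zero>\<^bsub>T\<^esub>, a \<odot>\<^bsub>?C\<^esub> f) = a \<odot>\<^bsub>?R\<^esub> (\<zero>\<^bsub>T\<^esub>, f)"
        using cong[OF f, of a] by simp
    qed simp
    show "bij_betw (\<lambda>f. (\<zero>\<^bsub>T\<^esub>, f)) (carrier ?C) (carrier ?R)"
      by (rule bij_betw_byWitness[where f' = snd]) (auto simp: rad_ind_mod[OF T(1)])
  qed
  from dimv_iso[OF ssC fC rR this i] have "dimv ?R i = dimv ?C i" .
  also have "\<dots> = (\<Sum>\<alpha>\<in>E. dimv (shift T (src \<alpha>) (tgt \<alpha>)) i)"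
    by (rule dimv_mod_sum[OF finite_E _ i]) (intro conjI ss_shift shift_fg T tgt_V src_V)
  also have "\<dots> = (\<Sum>\<alpha>\<in>E. if tgt \<alpha> = i then dimv T (src \<alpha>) else 0)"
    by (rule sum.cong) (auto simp: dimv_shift[OF T _ _ i])
  finally show r: "rvec ?F i = (\<Sum>\<alpha>\<in>E. if tgt \<alpha> = i then int (dimv T (src \<alpha>)) else 0)"
    unfolding rvec_def by (simp add: int_sum if_distrib cong: if_cong)
  have "(\<Sum>\<alpha>\<in>E. if tgt \<alpha> = i then dvec ?F (src \<alpha>) - rvec ?F (src \<alpha>) else 0) =
      (\<Sum>\<alpha>\<in>E. if tgt \<alpha> = i then int (dimv T (src \<alpha>)) else 0)"
    by (rule sum.cong) (auto simp: d)
  then show "om ?F i = 0" unfolding om_def r by simp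
qed

text \<open>An arrow leaving \<open>i\<close> is injective on the top in degree \<open>i\<close>, so
  in this degree the socle lies in the radical. At a sink this fails, the simple module there being
  projective.\<close>

lemma mu_ind_mod:
  assumes T: "ss T" "finitely_generated R T" and i: "i \<in> V" and \<beta>: "\<beta> \<in> E" "src \<beta> = i"
  shows "mu (ind_mod T) i = 0"
proof -
  let ?F = "ind_mod T"
  interpret T: right_module R T by (rule ssD(1)[OF T(1)])
  have rF: "right_module R ?F" by (rule right_module_ind_mod[OF T(1)])
  have fF: "finitely_generated R (deg ?F)" by (rule finitely_generated_deg[OF rF ind_mod_fg[OF T]])
  have sS: "submodule (soc ?F) R (deg ?F)" by (rule submodule_deg[OF rF submodule_soc[OF rF]])
  have sR: "submodule (rad ?F) R (deg ?F)" by (rule submodule_deg[OF rF submodule_rad[OF rF]])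
  let ?S = "(deg ?F)\<lparr>carrier := soc ?F\<rparr>"
  have S: "ss ?S" "finitely_generated R ?S"
    by (rule ss_sub[OF ss_deg[OF rF] sS], rule ss_sub_fg[OF ss_deg[OF rF] fF sS])
  have "submodule (rad ?F) R ?S"
    using submoduleD[OF sR] rad_le_soc[OF rF] by (intro submoduleI[OF ssD(1)[OF S(1)]]) auto
  then have "dimv (?S\<lparr>carrier := rad ?F\<rparr>) i = dimv ?S i"
  proof (rule dimv_sub_eq[OF S _ i])
    fix p assume "p \<in> carrier ?S"
    then have p: "p \<in> carrier ?F" "arr \<beta> \<odot>\<^bsub>?F\<^esub> p = \<zero>\<^bsub>?F\<^esub>" using \<beta>(1) by (auto simp: soc_def simp del: ind_mod_simps)
    have "snd (arr \<beta> \<odot>\<^bsub>?F\<^esub> p) \<beta> = \<zero>\<^bsub>T\<^esub>" unfolding p(2) using \<beta>(1) by simp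
    then have "idem i \<odot>\<^bsub>T\<^esub> fst p = \<zero>\<^bsub>T\<^esub>" unfolding arr_ind_mod[OF T(1) p(1) \<beta>(1)] using \<beta> by simp
    moreover have "idem i \<odot>\<^bsub>?F\<^esub> p \<in> carrier ?F" by (rule right_module.smult_closed[OF rF elem_closed(3) p(1)])
    ultimately show "idem i \<odot>\<^bsub>?S\<^esub> p \<in> rad ?F" unfolding rad_ind_mod[OF T(1)] by simp
  qed
  then show ?thesis by (simp add: mu_def svec_def rvec_def)
qed

end

lemma fg_modulesD:
  assumes "M \<in> fg_modules R"
  shows "right_module R M" "finitely_generated R M"
  using assms by (auto simp: fg_modules_def)

lemma fg_modulesI: "right_module R M \<Longrightarrow> finitely_generated R M \<Longrightarrow> M \<in> fg_modules R"
  by (simp add: fg_modules_def)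

context rad_square_zero
begin

section \<open>Projective covers and syzygies\<close>

text \<open>Such a module is finite-dimensional: an element is determined by finitely many
  coordinates in the field, and these are numbered.\<close>

lemma fg_copy:
  assumes "right_module R M" "finitely_generated R M"
  shows "\<exists>N :: ('r, nat \<Rightarrow> 'k) module. N \<in> fg_modules R \<and> mod_iso R M N"
proof -
  obtain d where "mod_iso R (deg M) (std_mod d)"
    using ss_classify[OF ss_deg[OF assms(1)] finitely_generated_deg[OF assms]] by blast
  then obtain h where h: "bij_betw h (carrier M) (carrier (std_mod d))" by (auto simp: mod_iso_def)
  define S where "S = (SIGMA i:V. {..<d i})"
  have "finite S" by (simp add: S_def)
  then obtain e :: "'v \<times> nat \<Rightarrow> nat" where e: "inj_on e S"
    by (meson finite_imp_inj_to_nat_seg)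
  \<comment> \<open>Numbers outside the image of \<open>e\<close> receive arbitrary coordinates,
    which does no harm to injectivity.\<close>
  define \<phi> where "\<phi> g m = g (inv_into S e m)" for g :: "'v \<times> nat \<Rightarrow> 'k" and m
  have "inj_on \<phi> (carrier (std_mod d))"
  proof (rule inj_onI)
    fix f g assume f: "f \<in> carrier (std_mod d)" and g: "g \<in> carrier (std_mod d)" and eq: "\<phi> f = \<phi> g"
    show "f = g"
    proof
      fix p :: "'v \<times> nat"
      obtain i n where p: "p = (i, n)" by (cases p)
      show "f p = g p"
      proof (cases "i \<in> V \<and> n < d i")
        case True
        then have "inv_into S e (e p) = p" using e by (simp add: S_def p)
        then show ?thesis using fun_cong[OF eq, of "e p"] by (simp add: \<phi>_def)
      next
        case False
        then show ?thesis unfolding p using std_mod_zero_outside[OF f] std_mod_zero_outside[OF g] by metis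
      qed
    qed
  qed
  then have "inj_on (\<phi> \<circ> h) (carrier M)"
    using h by (intro comp_inj_on) (auto simp: bij_betw_def)
  from right_module_copy[OF assms(1) this] obtain N :: "('r, nat \<Rightarrow> 'k) module"
    where N: "right_module R N" "mod_iso R M N" by blast
  then show ?thesis
    using finitely_generated_iso[OF assms(1) N(1,2) assms(2)] fg_modulesI by blast
qed

text \<open>The adjoint of a graded map \<open>g\<close> on T: it sends m in the top to
  \<open>g m\<close>, and m \<otimes> \<alpha> to the product of \<open>g m\<close> with
  \<alpha>.\<close>

definition ind_ext :: "('r, 'n) module \<Rightarrow> ('m \<Rightarrow> 'n) \<Rightarrow> 'm \<times> ('a \<Rightarrow> 'm) \<Rightarrow> 'n" where
  "ind_ext X g p = g (fst p) \<oplus>\<^bsub>X\<^esub> (\<Oplus>\<^bsub>X\<^esub>\<alpha>\<in>E. arr \<alpha> \<odot>\<^bsub>X\<^esub> g (snd p \<alpha>))"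

lemma ind_ext_hom:
  assumes T: "ss T" and X: "right_module R X" and g: "g \<in> mod_hom R T (deg X)"
  shows "ind_ext X g \<in> mod_hom R (ind_mod T) X"
proof -
  interpret T: right_module R T by (rule ssD(1)[OF T])
  interpret X: right_module R X by (rule X)
  have gD: "\<And>x. x \<in> carrier T \<Longrightarrow> g x \<in> carrier X"
    "\<And>x y. x \<in> carrier T \<Longrightarrow> y \<in> carrier T \<Longrightarrow> g (x \<oplus>\<^bsub>T\<^esub> y) = g x \<oplus>\<^bsub>X\<^esub> g y"
    "\<And>a x. a \<in> carrier R \<Longrightarrow> x \<in> carrier T \<Longrightarrow> g (a \<odot>\<^bsub>T\<^esub> x) = diag a \<odot>\<^bsub>X\<^esub> g x"
    using mod_homD[OF g] by simp_all
  have arrg: "arr \<alpha> \<odot>\<^bsub>X\<^esub> g x \<in> carrier X" if "x \<in> carrier T" for \<alpha> x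
    using gD(1)[OF that] by (simp add: X.smult_closed)
  show ?thesis
  proof (rule mod_homI)
    fix p assume p: "p \<in> carrier (ind_mod T)"
    note pc = ind_mod_memD[OF T p]
    have fin: "(\<lambda>\<alpha>. arr \<alpha> \<odot>\<^bsub>X\<^esub> g (snd p \<alpha>)) \<in> E \<rightarrow> carrier X" using arrg[OF pc(2)] by blast
    show "ind_ext X g p \<in> carrier X"
      unfolding ind_ext_def by (intro X.M.a_closed gD(1) pc(1) X.M.finsum_closed fin)
    fix a assume a: "a \<in> carrier R"
    have 1: "a \<odot>\<^bsub>X\<^esub> g (fst p) = diag a \<odot>\<^bsub>X\<^esub> g (fst p) \<oplus>\<^bsub>X\<^esub>
        (\<Oplus>\<^bsub>X\<^esub>\<alpha>\<in>E. sca (ca a \<alpha>) \<odot>\<^bsub>X\<^esub> (arr \<alpha> \<odot>\<^bsub>X\<^esub> g (fst p)))"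
      by (rule arr_decomp[OF X gD(1)[OF pc(1)] a])
    have 2: "a \<odot>\<^bsub>X\<^esub> (\<Oplus>\<^bsub>X\<^esub>\<alpha>\<in>E. arr \<alpha> \<odot>\<^bsub>X\<^esub> g (snd p \<alpha>)) =
        (\<Oplus>\<^bsub>X\<^esub>\<alpha>\<in>E. a \<odot>\<^bsub>X\<^esub> (arr \<alpha> \<odot>\<^bsub>X\<^esub> g (snd p \<alpha>)))"
      by (rule X.smult_finsum[OF a finite_E fin])
    \<comment> \<open>Besides acting on the old entry, \<open>a\<close> contributes in slot \<alpha>
      exactly the \<alpha>-term of \<open>arr_decomp\<close> at \<open>g (fst p)\<close>.\<close>
    have u: "arr \<alpha> \<odot>\<^bsub>X\<^esub> g (snd (a \<odot>\<^bsub>ind_mod T\<^esub> p) \<alpha>) =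
        sca (ca a \<alpha>) \<odot>\<^bsub>X\<^esub> (arr \<alpha> \<odot>\<^bsub>X\<^esub> g (fst p)) \<oplus>\<^bsub>X\<^esub> a \<odot>\<^bsub>X\<^esub> (arr \<alpha> \<odot>\<^bsub>X\<^esub> g (snd p \<alpha>))"
      if \<alpha>: "\<alpha> \<in> E" for \<alpha>
    proof -
      let ?e = "idem (src \<alpha>) \<odot>\<^bsub>T\<^esub> fst p"
      have e: "?e \<in> carrier T" using pc(1) by (simp add: T.smult_closed)
      have ge: "g ?e = idem (src \<alpha>) \<odot>\<^bsub>X\<^esub> g (fst p)" using gD(3)[OF elem_closed(3) pc(1)] by simp
      have "arr \<alpha> \<odot>\<^bsub>X\<^esub> g ?e = sca (cv (idem (src \<alpha>)) (src \<alpha>)) \<odot>\<^bsub>X\<^esub> (arr \<alpha> \<odot>\<^bsub>X\<^esub> g (fst p))"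
        unfolding ge by (rule arr_smult(1)[OF X elem_closed(3) gD(1)[OF pc(1)]])
      then have 3: "arr \<alpha> \<odot>\<^bsub>X\<^esub> g ?e = arr \<alpha> \<odot>\<^bsub>X\<^esub> g (fst p)"
        using \<alpha> arrg[OF pc(1)] by (simp add: idem_def sca_one X.smult_one)
      have "g (snd (a \<odot>\<^bsub>ind_mod T\<^esub> p) \<alpha>) = sca (ca a \<alpha>) \<odot>\<^bsub>X\<^esub> g ?e \<oplus>\<^bsub>X\<^esub> sca (cv a (tgt \<alpha>)) \<odot>\<^bsub>X\<^esub> g (snd p \<alpha>)"
        using \<alpha> e pc(2)[OF \<alpha>] gD by (simp add: T.smult_closed)
      then have "arr \<alpha> \<odot>\<^bsub>X\<^esub> g (snd (a \<odot>\<^bsub>ind_mod T\<^esub> p) \<alpha>) =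
          sca (ca a \<alpha>) \<odot>\<^bsub>X\<^esub> (arr \<alpha> \<odot>\<^bsub>X\<^esub> g ?e) \<oplus>\<^bsub>X\<^esub> sca (cv a (tgt \<alpha>)) \<odot>\<^bsub>X\<^esub> (arr \<alpha> \<odot>\<^bsub>X\<^esub> g (snd p \<alpha>))"
        using gD(1)[OF e] gD(1)[OF pc(2)[OF \<alpha>]]
        by (simp add: X.smult_add_right X.smult_closed sca_smult[OF X elem_closed(4)])
      then show ?thesis unfolding 3 arr_smult(2)[OF X a gD(1)[OF pc(2)[OF \<alpha>]]] .
    qed
    have "(\<Oplus>\<^bsub>X\<^esub>\<alpha>\<in>E. arr \<alpha> \<odot>\<^bsub>X\<^esub> g (snd (a \<odot>\<^bsub>ind_mod T\<^esub> p) \<alpha>)) =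
        (\<Oplus>\<^bsub>X\<^esub>\<alpha>\<in>E. sca (ca a \<alpha>) \<odot>\<^bsub>X\<^esub> (arr \<alpha> \<odot>\<^bsub>X\<^esub> g (fst p)) \<oplus>\<^bsub>X\<^esub> a \<odot>\<^bsub>X\<^esub> (arr \<alpha> \<odot>\<^bsub>X\<^esub> g (snd p \<alpha>)))"
      using u arrg[OF pc(1)] arrg[OF pc(2)] a by (intro X.M.finsum_cong') (auto simp: X.smult_closed)
    also have "\<dots> = (\<Oplus>\<^bsub>X\<^esub>\<alpha>\<in>E. sca (ca a \<alpha>) \<odot>\<^bsub>X\<^esub> (arr \<alpha> \<odot>\<^bsub>X\<^esub> g (fst p))) \<oplus>\<^bsub>X\<^esub>
        (\<Oplus>\<^bsub>X\<^esub>\<alpha>\<in>E. a \<odot>\<^bsub>X\<^esub> (arr \<alpha> \<odot>\<^bsub>X\<^esub> g (snd p \<alpha>)))"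
      using arrg[OF pc(1)] arrg[OF pc(2)] a by (intro X.M.finsum_addf) (auto simp: X.smult_closed)
    finally have 4: "(\<Oplus>\<^bsub>X\<^esub>\<alpha>\<in>E. arr \<alpha> \<odot>\<^bsub>X\<^esub> g (snd (a \<odot>\<^bsub>ind_mod T\<^esub> p) \<alpha>)) =
        (\<Oplus>\<^bsub>X\<^esub>\<alpha>\<in>E. sca (ca a \<alpha>) \<odot>\<^bsub>X\<^esub> (arr \<alpha> \<odot>\<^bsub>X\<^esub> g (fst p))) \<oplus>\<^bsub>X\<^esub>
        (\<Oplus>\<^bsub>X\<^esub>\<alpha>\<in>E. a \<odot>\<^bsub>X\<^esub> (arr \<alpha> \<odot>\<^bsub>X\<^esub> g (snd p \<alpha>)))" .
    have c: "(\<Oplus>\<^bsub>X\<^esub>\<alpha>\<in>E. sca (ca a \<alpha>) \<odot>\<^bsub>X\<^esub> (arr \<alpha> \<odot>\<^bsub>X\<^esub> g (fst p))) \<in> carrier X"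
      "(\<Oplus>\<^bsub>X\<^esub>\<alpha>\<in>E. a \<odot>\<^bsub>X\<^esub> (arr \<alpha> \<odot>\<^bsub>X\<^esub> g (snd p \<alpha>))) \<in> carrier X" "diag a \<odot>\<^bsub>X\<^esub> g (fst p) \<in> carrier X"
      using arrg[OF pc(1)] arrg[OF pc(2)] a gD(1)[OF pc(1)]
      by (auto intro!: X.M.finsum_closed simp: X.smult_closed)
    have "a \<odot>\<^bsub>X\<^esub> ind_ext X g p = a \<odot>\<^bsub>X\<^esub> g (fst p) \<oplus>\<^bsub>X\<^esub> a \<odot>\<^bsub>X\<^esub> (\<Oplus>\<^bsub>X\<^esub>\<alpha>\<in>E. arr \<alpha> \<odot>\<^bsub>X\<^esub> g (snd p \<alpha>))"
      unfolding ind_ext_def by (rule X.smult_add_right[OF a gD(1)[OF pc(1)] X.M.finsum_closed[OF fin]])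
    also have "\<dots> = diag a \<odot>\<^bsub>X\<^esub> g (fst p) \<oplus>\<^bsub>X\<^esub> (\<Oplus>\<^bsub>X\<^esub>\<alpha>\<in>E. arr \<alpha> \<odot>\<^bsub>X\<^esub> g (snd (a \<odot>\<^bsub>ind_mod T\<^esub> p) \<alpha>))"
      unfolding 1 2 4 by (rule X.M.a_assoc[OF c(3,1,2)])
    also have "\<dots> = ind_ext X g (a \<odot>\<^bsub>ind_mod T\<^esub> p)"
      unfolding ind_ext_def using gD(3)[OF a pc(1)] by simp
    finally show "ind_ext X g (a \<odot>\<^bsub>ind_mod T\<^esub> p) = a \<odot>\<^bsub>X\<^esub> ind_ext X g p" by simp
  next
    fix p q assume p: "p \<in> carrier (ind_mod T)" and q: "q \<in> carrier (ind_mod T)"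
    note pc = ind_mod_memD[OF T p] and qc = ind_mod_memD[OF T q]
    have fin: "(\<lambda>\<alpha>. arr \<alpha> \<odot>\<^bsub>X\<^esub> g (snd p \<alpha>)) \<in> E \<rightarrow> carrier X" "(\<lambda>\<alpha>. arr \<alpha> \<odot>\<^bsub>X\<^esub> g (snd q \<alpha>)) \<in> E \<rightarrow> carrier X"
      using arrg[OF pc(2)] arrg[OF qc(2)] by blast+
    have "(\<Oplus>\<^bsub>X\<^esub>\<alpha>\<in>E. arr \<alpha> \<odot>\<^bsub>X\<^esub> g (snd (p \<oplus>\<^bsub>ind_mod T\<^esub> q) \<alpha>)) =
        (\<Oplus>\<^bsub>X\<^esub>\<alpha>\<in>E. arr \<alpha> \<odot>\<^bsub>X\<^esub> g (snd p \<alpha>) \<oplus>\<^bsub>X\<^esub> arr \<alpha> \<odot>\<^bsub>X\<^esub> g (snd q \<alpha>))"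
      using fin gD(1,2) pc(2) qc(2) by (intro X.M.finsum_cong') (auto simp: X.smult_add_right Pi_iff)
    also have "\<dots> = (\<Oplus>\<^bsub>X\<^esub>\<alpha>\<in>E. arr \<alpha> \<odot>\<^bsub>X\<^esub> g (snd p \<alpha>)) \<oplus>\<^bsub>X\<^esub> (\<Oplus>\<^bsub>X\<^esub>\<alpha>\<in>E. arr \<alpha> \<odot>\<^bsub>X\<^esub> g (snd q \<alpha>))"
      by (rule X.M.finsum_addf[OF fin])
    finally show "ind_ext X g (p \<oplus>\<^bsub>ind_mod T\<^esub> q) = ind_ext X g p \<oplus>\<^bsub>X\<^esub> ind_ext X g q"
      using gD(1,2)[OF pc(1)] gD(1,2)[OF qc(1)] pc(1) qc(1) X.M.finsum_closed[OF fin(1)] X.M.finsum_closed[OF fin(2)]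
      unfolding ind_ext_def by (simp add: gD X.M.add.m_ac)
  qed
qed

lemma ind_mod_top:
  assumes T: "ss T"
  shows "(\<lambda>m. (m, \<lambda>\<alpha>\<in>E. \<zero>\<^bsub>T\<^esub>)) \<in> mod_hom R T (deg (ind_mod T))"
proof (rule mod_homI)
  interpret T: right_module R T by (rule ssD(1)[OF T])
  have z: "\<zero>\<^bsub>T\<^esub> \<in> comp T k" for k using submoduleD(3)[OF submodule_comp[OF T]] .
  fix m assume m: "m \<in> carrier T"
  show "(m, \<lambda>\<alpha>\<in>E. \<zero>\<^bsub>T\<^esub>) \<in> carrier (deg (ind_mod T))" using m z by simp
  fix a assume a: "a \<in> carrier R"
  have "(\<lambda>\<alpha>\<in>E. \<zero>\<^bsub>T\<^esub>) = (\<lambda>\<alpha>\<in>E. sca (ca (diag a) \<alpha>) \<odot>\<^bsub>T\<^esub> (idem (src \<alpha>) \<odot>\<^bsub>T\<^esub> m) \<oplus>\<^bsub>T\<^esub>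
        sca (cv (diag a) (tgt \<alpha>)) \<odot>\<^bsub>T\<^esub> (\<lambda>\<alpha>\<in>E. \<zero>\<^bsub>T\<^esub>) \<alpha>)"
    using m by (intro restrict_ext) (simp add: diag_def sca_zero T.smult_closed)
  then show "(a \<odot>\<^bsub>T\<^esub> m, \<lambda>\<alpha>\<in>E. \<zero>\<^bsub>T\<^esub>) = a \<odot>\<^bsub>deg (ind_mod T)\<^esub> (m, \<lambda>\<alpha>\<in>E. \<zero>\<^bsub>T\<^esub>)"
    unfolding deg_simps ind_mod_simps fst_conv snd_conv ssD(2)[OF T a m, symmetric]
    by (rule arg_cong)
next
  interpret T: right_module R T by (rule ssD(1)[OF T])
  fix x y
  have "(\<lambda>\<alpha>\<in>E. (\<lambda>\<alpha>\<in>E. \<zero>\<^bsub>T\<^esub>) \<alpha> \<oplus>\<^bsub>T\<^esub> (\<lambda>\<alpha>\<in>E. \<zero>\<^bsub>T\<^esub>) \<alpha>) = (\<lambda>\<alpha>\<in>E. \<zero>\<^bsub>T\<^esub>)"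
    by (rule restrict_ext) simp
  then show "(x \<oplus>\<^bsub>T\<^esub> y, \<lambda>\<alpha>\<in>E. \<zero>\<^bsub>T\<^esub>) = (x, \<lambda>\<alpha>\<in>E. \<zero>\<^bsub>T\<^esub>) \<oplus>\<^bsub>deg (ind_mod T)\<^esub> (y, \<lambda>\<alpha>\<in>E. \<zero>\<^bsub>T\<^esub>)"
    unfolding deg_simps ind_mod_simps fst_conv snd_conv by (simp only:)
qed

text \<open>The products of arrows with the top fill the radical.\<close>

lemma ind_mod_generated:
  assumes T: "ss T" and U: "submodule U R (ind_mod T)" and top: "\<And>m. m \<in> carrier T \<Longrightarrow> (m, \<lambda>\<alpha>\<in>E. \<zero>\<^bsub>T\<^esub>) \<in> U"
  shows "U = carrier (ind_mod T)"
proof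
  let ?F = "ind_mod T"
  interpret T: right_module R T by (rule ssD(1)[OF T])
  have rF: "right_module R ?F" by (rule right_module_ind_mod[OF T])
  note Ud = submoduleD[OF U]
  show "U \<subseteq> carrier ?F" by (rule Ud(1))
  have "rad ?F \<subseteq> U"
  proof (rule rad_least[OF U])
    fix \<beta> p assume \<beta>: "\<beta> \<in> E" and p: "p \<in> carrier ?F"
    have m: "fst p \<in> carrier T" by (rule ind_mod_memD(1)[OF T p])
    have q: "(fst p, \<lambda>\<alpha>\<in>E. \<zero>\<^bsub>T\<^esub>) \<in> U" by (rule top[OF m])
    have "arr \<beta> \<odot>\<^bsub>?F\<^esub> p = arr \<beta> \<odot>\<^bsub>?F\<^esub> (fst p, \<lambda>\<alpha>\<in>E. \<zero>\<^bsub>T\<^esub>)"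
      unfolding arr_ind_mod[OF T p \<beta>] arr_ind_mod[OF T Ud(2)[OF q] \<beta>] by (simp only: fst_conv)
    then show "arr \<beta> \<odot>\<^bsub>?F\<^esub> p \<in> U" using Ud(6)[OF elem_closed(4) q] by simp
  qed
  show "carrier ?F \<subseteq> U"
  proof
    fix p assume p: "p \<in> carrier ?F"
    note pc = ind_mod_memD[OF T p]
    have "(\<zero>\<^bsub>T\<^esub>, snd p) \<in> carrier ?F" using p by auto
    then have "(\<zero>\<^bsub>T\<^esub>, snd p) \<in> U" using \<open>rad ?F \<subseteq> U\<close> rad_ind_mod[OF T] by auto
    then have "(fst p, \<lambda>\<alpha>\<in>E. \<zero>\<^bsub>T\<^esub>) \<oplus>\<^bsub>?F\<^esub> (\<zero>\<^bsub>T\<^esub>, snd p) \<in> U" by (rule Ud(4)[OF top[OF pc(1)]])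
    moreover have "(\<lambda>\<alpha>\<in>E. (\<lambda>\<alpha>\<in>E. \<zero>\<^bsub>T\<^esub>) \<alpha> \<oplus>\<^bsub>T\<^esub> snd p \<alpha>) = restrict (snd p) E"
      using pc(2) by (intro restrict_ext) simp
    ultimately show "p \<in> U"
      unfolding ind_mod_simps fst_conv snd_conv using pc(1) unfolding pc(5) by simp
  qed
qed

lemma ind_ext_top:
  assumes T: "ss T" and X: "right_module R X" and g: "g \<in> mod_hom R T (deg X)" and m: "m \<in> carrier T"
  shows "ind_ext X g (m, \<lambda>\<alpha>\<in>E. \<zero>\<^bsub>T\<^esub>) = g m"
proof -
  interpret T: right_module R T by (rule ssD(1)[OF T])
  interpret X: right_module R X by (rule X)
  have g0: "g \<zero>\<^bsub>T\<^esub> = \<zero>\<^bsub>X\<^esub>" using mod_hom_zero[OF g ssD(1)[OF T] right_module_deg[OF X]] by simp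
  have "(\<Oplus>\<^bsub>X\<^esub>\<alpha>\<in>E. arr \<alpha> \<odot>\<^bsub>X\<^esub> g ((\<lambda>\<alpha>\<in>E. \<zero>\<^bsub>T\<^esub>) \<alpha>)) = (\<Oplus>\<^bsub>X\<^esub>\<alpha>\<in>E. \<zero>\<^bsub>X\<^esub>)"
    by (rule X.M.finsum_cong') (auto simp: g0)
  then show ?thesis using mod_homD(1)[OF g m] by (simp add: ind_ext_def)
qed

text \<open>Projectivity of induced modules: the top is lifted by a graded section of
  \<open>p\<close>, the lift is extended by adjunction, and the two maps agree because their
  equalizer contains the generating top.\<close>

lemma ind_mod_lift:
  assumes T: "ss T" and X: "right_module R X" "finitely_generated R X" and Y: "right_module R Y"
    and p: "p \<in> mod_hom R X Y" "p ` carrier X = carrier Y" and g: "g \<in> mod_hom R (ind_mod T) Y"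
  shows "\<exists>h\<in>mod_hom R (ind_mod T) X. \<forall>x\<in>carrier (ind_mod T). p (h x) = g x"
proof -
  let ?F = "ind_mod T"
  have rF: "right_module R ?F" by (rule right_module_ind_mod[OF T])
  obtain s where s: "s \<in> mod_hom R (deg Y) (deg X)" "\<forall>n\<in>carrier (deg Y). p (s n) = n"
    using ss_section[OF ss_deg[OF X(1)] finitely_generated_deg[OF X] right_module_deg[OF Y] mod_hom_deg[OF p(1)]]
      p(2) by auto
  define g0 where "g0 m = s (g (m, \<lambda>\<alpha>\<in>E. \<zero>\<^bsub>T\<^esub>))" for m
  have g0: "g0 \<in> mod_hom R T (deg X)"
    unfolding g0_def[abs_def] by (rule mod_hom_comp[OF mod_hom_comp[OF ind_mod_top[OF T] mod_hom_deg[OF g]] s(1)])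
  have h: "ind_ext X g0 \<in> mod_hom R ?F X" by (rule ind_ext_hom[OF T X(1) g0])
  have "{x \<in> carrier ?F. p (ind_ext X g0 x) = g x} = carrier ?F"
  proof (rule ind_mod_generated[OF T submodule_equalizer[OF mod_hom_comp[OF h p(1)] g rF Y]])
    fix m assume m: "m \<in> carrier T"
    have c: "(m, \<lambda>\<alpha>\<in>E. \<zero>\<^bsub>T\<^esub>) \<in> carrier ?F" using mod_homD(1)[OF ind_mod_top[OF T] m] by simp
    have "p (ind_ext X g0 (m, \<lambda>\<alpha>\<in>E. \<zero>\<^bsub>T\<^esub>)) = p (g0 m)" by (simp only: ind_ext_top[OF T X(1) g0 m])
    also have "\<dots> = g (m, \<lambda>\<alpha>\<in>E. \<zero>\<^bsub>T\<^esub>)" using s(2) mod_homD(1)[OF g c] by (simp add: g0_def)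
    finally show "(m, \<lambda>\<alpha>\<in>E. \<zero>\<^bsub>T\<^esub>) \<in> {x \<in> carrier ?F. p (ind_ext X g0 x) = g x}" using c by blast
  qed
  then show ?thesis using h by (intro bexI[of _ "ind_ext X g0"]) blast+
qed

lemma projective_copy:
  fixes P :: "('r, 'n) module"
  assumes T: "ss T" and P: "right_module R P" and iso: "mod_iso R (ind_mod T) P"
  shows "projective_mod R P"
  unfolding projective_mod_def
proof (intro ballI impI)
  let ?F = "ind_mod T"
  fix X Y :: "('r, 'n) module" and p g
  assume X: "X \<in> fg_modules R" and Y: "Y \<in> fg_modules R" and p: "p \<in> mod_hom R X Y"
    and g: "g \<in> mod_hom R P Y" and surj: "p ` carrier X = carrier Y"
  obtain u where u: "u \<in> mod_hom R ?F P" "bij_betw u (carrier ?F) (carrier P)"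
    using iso unfolding mod_iso_def by blast
  obtain h where h: "h \<in> mod_hom R ?F X" "\<forall>x\<in>carrier ?F. p (h x) = g (u x)"
    using ind_mod_lift[OF T fg_modulesD[OF X] fg_modulesD(1)[OF Y] p surj mod_hom_comp[OF u(1) g]] by blast
  let ?v = "inv_into (carrier ?F) u"
  have v: "?v \<in> mod_hom R P ?F" by (rule mod_hom_inv[OF u right_module_ind_mod[OF T]])
  have "p (h (?v x)) = g x" if x: "x \<in> carrier P" for x
  proof -
    have "p (h (?v x)) = g (u (?v x))" using h(2) mod_homD(1)[OF v x] by blast
    also have "u (?v x) = x" by (rule f_inv_into_f) (use u(2) x in \<open>simp add: bij_betw_def\<close>)
    finally show ?thesis .
  qed
  then show "\<exists>h\<in>mod_hom R P X. \<forall>x\<in>carrier P. p (h x) = g x"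
    by (intro bexI[OF _ mod_hom_comp[OF v h(1)]] ballI)
qed

text \<open>Nakayama's lemma for J^2 = 0: arrows kill the radical, so the products of arrows with P
  = N + K are already products with N. Hence the radical, and with it P, lies in N.\<close>

lemma superfluous_rad:
  assumes P: "right_module R P" and N: "submodule N R P" and K: "K \<subseteq> rad P" and sum: "N <+>\<^bsub>P\<^esub> K = carrier P"
  shows "N = carrier P"
proof
  interpret P: right_module R P by (rule P)
  note Nd = submoduleD[OF N]
  have dec: "\<exists>n\<in>N. \<exists>k\<in>rad P. x = n \<oplus>\<^bsub>P\<^esub> k" if "x \<in> carrier P" for x
  proof -
    have "x \<in> N <+>\<^bsub>P\<^esub> K" using that sum by simp
    then obtain n k where "n \<in> N" "k \<in> K" "x = n \<oplus>\<^bsub>P\<^esub> k" by (rule set_addE)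
    then show ?thesis using K by blast
  qed
  have "rad P \<subseteq> N"
  proof (rule rad_least[OF N])
    fix \<alpha> x assume \<alpha>: "\<alpha> \<in> E" and "x \<in> carrier P"
    then obtain n k where nk: "n \<in> N" "k \<in> rad P" "x = n \<oplus>\<^bsub>P\<^esub> k" using dec by blast
    have k: "k \<in> carrier P" "arr \<alpha> \<odot>\<^bsub>P\<^esub> k = \<zero>\<^bsub>P\<^esub>" using rad_le_soc[OF P] nk(2) \<alpha> by (auto simp: soc_def)
    have "arr \<alpha> \<odot>\<^bsub>P\<^esub> x = arr \<alpha> \<odot>\<^bsub>P\<^esub> n"
      unfolding nk(3) P.smult_add_right[OF elem_closed(4) Nd(2)[OF nk(1)] k(1)] k(2)
      using Nd(2)[OF nk(1)] by (simp add: P.smult_closed)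
    then show "arr \<alpha> \<odot>\<^bsub>P\<^esub> x \<in> N" using Nd(6)[OF elem_closed(4) nk(1)] by simp
  qed
  then show "carrier P \<subseteq> N" using dec Nd(4) by blast
  show "N \<subseteq> carrier P" by (rule Nd(1))
qed

text \<open>The top T is a graded complement of the radical of M, and the cover extends its
  inclusion. The image contains all products of arrows with T, which are all products of arrows with
  M because arrows kill the radical.\<close>

lemma ind_cover:
  assumes M: "right_module R M" "finitely_generated R M"
  shows "\<exists>T q. ss T \<and> finitely_generated R T \<and> (T :: ('r, 'm) module) = (deg M)\<lparr>carrier := carrier T\<rparr> \<and>
    q \<in> mod_hom R (ind_mod T) M \<and> q ` carrier (ind_mod T) = carrier M \<and>
    a_kernel (ind_mod T) M q \<subseteq> rad (ind_mod T)"
proof -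
  interpret M: right_module R M by (rule M(1))
  have sR: "submodule (rad M) R (deg M)" by (rule submodule_deg[OF M(1) submodule_rad[OF M(1)]])
  obtain W where W: "submodule W R (deg M)" "rad M <+>\<^bsub>deg M\<^esub> W = carrier (deg M)" "rad M \<inter> W \<subseteq> {\<zero>\<^bsub>deg M\<^esub>}"
    using ss_complement[OF ss_deg[OF M(1)] finitely_generated_deg[OF M] sR] by blast
  let ?T = "(deg M)\<lparr>carrier := W\<rparr>"
  have T: "ss ?T" "finitely_generated R ?T"
    by (rule ss_sub[OF ss_deg[OF M(1)] W(1)],
        rule ss_sub_fg[OF ss_deg[OF M(1)] finitely_generated_deg[OF M] W(1)])
  let ?F = "ind_mod ?T"
  have rF: "right_module R ?F" by (rule right_module_ind_mod[OF T(1)])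
  have id: "id \<in> mod_hom R ?T (deg M)" by (rule mod_hom_sub[OF mod_hom_id W(1)])
  let ?q = "ind_ext M id"
  have q: "?q \<in> mod_hom R ?F M" by (rule ind_ext_hom[OF T(1) M(1) id])
  have WM: "w \<in> carrier M" if "w \<in> W" for w using submoduleD(2)[OF W(1) that] by simp
  have dec: "\<exists>r\<in>rad M. \<exists>w\<in>W. x = r \<oplus>\<^bsub>M\<^esub> w" if "x \<in> carrier M" for x
  proof -
    have "x \<in> rad M <+>\<^bsub>deg M\<^esub> W" using that W(2) by simp
    then obtain r w where "r \<in> rad M" "w \<in> W" "x = r \<oplus>\<^bsub>deg M\<^esub> w" by (rule set_addE)
    then show ?thesis by auto
  qed
  have sub: "submodule (?q ` carrier ?F) R M" by (rule submodule_image[OF q rF M(1) submodule_UNIV[OF rF]])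
  have Wq: "w \<in> ?q ` carrier ?F" if w: "w \<in> W" for w
  proof -
    have "?q (w, \<lambda>\<alpha>\<in>E. \<zero>\<^bsub>?T\<^esub>) = id w" by (rule ind_ext_top[OF T(1) M(1) id]) (use w in simp)
    moreover have "(w, \<lambda>\<alpha>\<in>E. \<zero>\<^bsub>?T\<^esub>) \<in> carrier ?F" using mod_homD(1)[OF ind_mod_top[OF T(1)], of w] w by simp
    ultimately show ?thesis by (metis id_apply imageI)
  qed
  have "rad M \<subseteq> ?q ` carrier ?F"
  proof (rule rad_least[OF sub])
    fix \<alpha> x assume \<alpha>: "\<alpha> \<in> E" and "x \<in> carrier M"
    then obtain r w where rw: "r \<in> rad M" "w \<in> W" "x = r \<oplus>\<^bsub>M\<^esub> w" using dec by blast
    have r: "r \<in> carrier M" "arr \<alpha> \<odot>\<^bsub>M\<^esub> r = \<zero>\<^bsub>M\<^esub>" using rad_le_soc[OF M(1)] rw(1) \<alpha> by (auto simp: soc_def)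
    have "arr \<alpha> \<odot>\<^bsub>M\<^esub> x = arr \<alpha> \<odot>\<^bsub>M\<^esub> w"
      unfolding rw(3) M.smult_add_right[OF elem_closed(4) r(1) WM[OF rw(2)]] r(2)
      using WM[OF rw(2)] by (simp add: M.smult_closed)
    then show "arr \<alpha> \<odot>\<^bsub>M\<^esub> x \<in> ?q ` carrier ?F"
      using submoduleD(6)[OF sub elem_closed(4) Wq[OF rw(2)]] by simp
  qed
  then have radq: "r \<in> ?q ` carrier ?F" if "r \<in> rad M" for r using that by (rule subsetD)
  have surj: "?q ` carrier ?F = carrier M"
  proof (rule equalityI[OF submoduleD(1)[OF sub] subsetI])
    fix x assume "x \<in> carrier M"
    then obtain r w where rw: "r \<in> rad M" "w \<in> W" "x = r \<oplus>\<^bsub>M\<^esub> w" using dec by blast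
    show "x \<in> ?q ` carrier ?F" unfolding rw(3) by (rule submoduleD(4)[OF sub radq[OF rw(1)] Wq[OF rw(2)]])
  qed
  have "a_kernel ?F M ?q \<subseteq> rad ?F"
  proof
    fix p assume "p \<in> a_kernel ?F M ?q"
    then have p: "p \<in> carrier ?F" "?q p = \<zero>\<^bsub>M\<^esub>" by (simp_all only: a_kernel_def' mem_Collect_eq)
    note pc = ind_mod_memD[OF T(1) p(1)]
    let ?s = "\<Oplus>\<^bsub>M\<^esub>\<alpha>\<in>E. arr \<alpha> \<odot>\<^bsub>M\<^esub> id (snd p \<alpha>)"
    have fW: "fst p \<in> W" using pc(1) by simp
    have s: "?s \<in> rad M"
      by (rule finsum_in_submodule[OF M(1) submodule_rad[OF M(1)] finite_E])
        (use pc(2) WM in \<open>auto intro!: arr_in_rad[OF M(1)]\<close>)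
    have sM: "?s \<in> carrier M" by (rule submoduleD(2)[OF submodule_rad[OF M(1)] s])
    \<comment> \<open>The top part of a kernel element is minus a sum of products with arrows, so it
      lies in the radical as well as in its complement W.\<close>
    have "fst p \<oplus>\<^bsub>M\<^esub> ?s = \<zero>\<^bsub>M\<^esub>" using p(2) by (simp add: ind_ext_def)
    then have "fst p = \<ominus>\<^bsub>M\<^esub> ?s" using WM[OF fW] sM M.M.add.inv_equality by (simp add: M.M.minus_equality)
    then have "fst p \<in> rad M" using submoduleD(5)[OF submodule_rad[OF M(1)] s] by simp
    then have "fst p = \<zero>\<^bsub>?T\<^esub>" using fW W(3) by auto
    then show "p \<in> rad ?F" unfolding rad_ind_mod[OF T(1)] using p(1) by blast
  qed
  then show ?thesis using T q surj by (intro exI[of _ ?T] exI[of _ ?q]) simp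
qed

text \<open>The arrow terms of \<open>arr_decomp\<close> lie in the radical of P and act as zero on
  N, so a graded map that kills the radical does not see them.\<close>

lemma hom_from_deg:
  assumes P: "right_module R P" and N: "ss N" and h: "h \<in> mod_hom R (deg P) N" "\<And>r. r \<in> rad P \<Longrightarrow> h r = \<zero>\<^bsub>N\<^esub>"
  shows "h \<in> mod_hom R P N"
proof (rule mod_homI)
  interpret P: right_module R P by (rule P)
  interpret N: right_module R N by (rule ssD(1)[OF N])
  note hD = mod_homD[OF h(1)]
  show "h x \<in> carrier N" if "x \<in> carrier P" for x using hD(1) that by simp
  show "h (x \<oplus>\<^bsub>P\<^esub> y) = h x \<oplus>\<^bsub>N\<^esub> h y" if "x \<in> carrier P" "y \<in> carrier P" for x y using hD(2) that by simp
  fix a x assume a: "a \<in> carrier R" and x: "x \<in> carrier P"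
  let ?s = "\<Oplus>\<^bsub>P\<^esub>\<alpha>\<in>E. sca (ca a \<alpha>) \<odot>\<^bsub>P\<^esub> (arr \<alpha> \<odot>\<^bsub>P\<^esub> x)"
  have s: "?s \<in> rad P"
    by (rule finsum_in_submodule[OF P submodule_rad[OF P] finite_E])
      (intro submoduleD(6)[OF submodule_rad[OF P]] elem_closed arr_in_rad[OF P] x)
  have sP: "?s \<in> carrier P" by (rule submoduleD(2)[OF submodule_rad[OF P] s])
  have d: "diag a \<odot>\<^bsub>P\<^esub> x \<in> carrier P" using x by (simp add: P.smult_closed)
  have "h (a \<odot>\<^bsub>P\<^esub> x) = h (diag a \<odot>\<^bsub>P\<^esub> x) \<oplus>\<^bsub>N\<^esub> h ?s"
    unfolding arr_decomp[OF P x a] using hD(2) d sP by simp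
  also have "\<dots> = h (diag a \<odot>\<^bsub>P\<^esub> x)" unfolding h(2)[OF s] using hD(1) d by simp
  also have "\<dots> = a \<odot>\<^bsub>N\<^esub> h x" using hD(3)[OF a, of x] x by simp
  finally show "h (a \<odot>\<^bsub>P\<^esub> x) = a \<odot>\<^bsub>N\<^esub> h x" .
qed

lemma functional_off_rad:
  assumes M: "right_module R M" "finitely_generated R M"
    and b: "b \<in> carrier M" "idem i \<odot>\<^bsub>M\<^esub> b = b" "i \<in> V" "b \<notin> rad M"
  shows "\<exists>h\<in>mod_hom R M (simp_mod i). h b = 1"
proof -
  have sR: "submodule (rad M) R (deg M)" by (rule submodule_deg[OF M(1) submodule_rad[OF M(1)]])
  obtain h where h: "h \<in> mod_hom R (deg M) (simp_mod i)" "\<forall>u\<in>rad M. h u = 0" "h b = 1"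
    using ss_hyperplane[OF ss_deg[OF M(1)] finitely_generated_deg[OF M] sR, of b i] b by auto
  have "h \<in> mod_hom R M (simp_mod i)"
    by (rule hom_from_deg[OF M(1) ss_simp_mod[OF b(3)] h(1)]) (use h(2) in simp)
  then show ?thesis using h(3) by blast
qed

text \<open>A homogeneous socle element spans a simple submodule; being outside the radical, it has
  a functional with value 1 on it, and this splits the line off.\<close>

lemma split_simple:
  assumes M: "right_module R M" "finitely_generated R M"
    and b: "b \<in> soc M" "idem i \<odot>\<^bsub>M\<^esub> b = b" "i \<in> V" "b \<notin> rad M"
  shows "\<exists>U. submodule U R M \<and> mod_iso R M (mod_sum2 (simp_mod i) (M\<lparr>carrier := U\<rparr>))"
proof -
  have bM: "b \<in> carrier M" using b(1) by (simp add: soc_def)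
  obtain h where h: "h \<in> mod_hom R M (simp_mod i)" "h b = 1"
    using functional_off_rad[OF M bM b(2-4)] by blast
  let ?S = "M\<lparr>carrier := soc M\<rparr>"
  have "(\<lambda>k. sca k \<odot>\<^bsub>?S\<^esub> b) \<in> mod_hom R (simp_mod i) ?S"
    by (rule line_hom[OF ss_sub_soc[OF M(1) submodule_soc[OF M(1)] order_refl]]) (use b in simp_all)
  then have g: "(\<lambda>k. sca k \<odot>\<^bsub>M\<^esub> b) \<in> mod_hom R (simp_mod i) M"
    using mod_homD[of "\<lambda>k. sca k \<odot>\<^bsub>?S\<^esub> b" R "simp_mod i" ?S] submoduleD(2)[OF submodule_soc[OF M(1)]]
    by (intro mod_homI) auto
  have rS: "right_module R (simp_mod i)" by (rule right_module_simp_mod[OF b(3)])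
  have "mod_iso R M (mod_sum2 (simp_mod i) (M\<lparr>carrier := a_kernel M (simp_mod i) h\<rparr>))"
  proof (rule mod_iso_sum2_split[OF M(1) rS h(1) g])
    fix n :: 'k
    have "h (sca n \<odot>\<^bsub>M\<^esub> b) = sca n \<odot>\<^bsub>simp_mod i\<^esub> h b" by (rule mod_homD(3)[OF h(1) elem_closed(2) bM])
    then show "h (sca n \<odot>\<^bsub>M\<^esub> b) = n" using h(2) b(3) by (simp add: sca_def)
  qed
  then show ?thesis using submodule_kernel[OF h(1) M(1) rS] by blast
qed

lemma cover_exists:
  fixes M :: "('r, nat \<Rightarrow> 'k) module"
  assumes "M \<in> fg_modules R"
  shows "\<exists>P f. projective_cover R P f M"
proof -
  note M = fg_modulesD[OF assms]
  obtain T :: "('r, nat \<Rightarrow> 'k) module" and q where T: "ss T" "finitely_generated R T"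
    and q: "q \<in> mod_hom R (ind_mod T) M" "q ` carrier (ind_mod T) = carrier M"
      "a_kernel (ind_mod T) M q \<subseteq> rad (ind_mod T)"
    using ind_cover[OF M] by blast
  let ?F = "ind_mod T"
  have rF: "right_module R ?F" by (rule right_module_ind_mod[OF T(1)])
  obtain P :: "('r, nat \<Rightarrow> 'k) module" where P: "P \<in> fg_modules R" "mod_iso R ?F P"
    using fg_copy[OF rF ind_mod_fg[OF T]] by blast
  note rP = fg_modulesD(1)[OF P(1)]
  obtain u where u: "u \<in> mod_hom R ?F P" "bij_betw u (carrier ?F) (carrier P)"
    using P(2) unfolding mod_iso_def by blast
  let ?v = "inv_into (carrier ?F) u"
  have v: "?v \<in> mod_hom R P ?F" by (rule mod_hom_inv[OF u rF])
  have vb: "bij_betw ?v (carrier P) (carrier ?F)" by (rule bij_betw_inv_into[OF u(2)])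
  let ?f = "\<lambda>x. q (?v x)"
  have f: "?f \<in> mod_hom R P M" by (rule mod_hom_comp[OF v q(1)])
  have surj: "?f ` carrier P = carrier M"
    unfolding image_image[of q ?v, symmetric] bij_betw_imp_surj_on[OF vb] by (rule q(2))
  have ker: "a_kernel P M ?f \<subseteq> rad P"
  proof
    fix x assume "x \<in> a_kernel P M ?f"
    then have x: "x \<in> carrier P" "?f x = \<zero>\<^bsub>M\<^esub>" by (simp_all add: a_kernel_def')
    have "?v x \<in> carrier ?F" by (rule mod_homD(1)[OF v x(1)])
    then have "?v x \<in> a_kernel ?F M q" using x(2) by (simp only: a_kernel_def' mem_Collect_eq)
    then have "?v x \<in> rad ?F" using q(3) by blast
    then have "u (?v x) \<in> rad P" by (rule hom_rad[OF u(1) rF rP])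
    moreover have "u (?v x) = x" by (rule f_inv_into_f) (use u(2) x(1) in \<open>simp add: bij_betw_def\<close>)
    ultimately show "x \<in> rad P" by simp
  qed
  have "projective_cover R P ?f M"
    unfolding projective_cover_def
  proof (intro conjI allI impI)
    show "projective_mod R P" by (rule projective_copy[OF T(1) rP P(2)])
    fix N assume "submodule N R P \<and> N <+>\<^bsub>P\<^esub> a_kernel P M ?f = carrier P"
    then show "N = carrier P" using superfluous_rad[OF rP _ ker, of N] by simp
  qed (rule P(1) f surj)+
  then show ?thesis by (intro exI)
qed

text \<open>\<open>syzygy\<close> selects an arbitrary projective cover, so all of them have to be
  controlled. A homogeneous kernel element outside the radical would have a functional with value 1
  on it, whose kernel is proper and yet spans P together with the kernel of
  \<open>f\<close>.\<close>

lemma cover_kernel: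
  fixes M :: "('r, nat \<Rightarrow> 'k) module"
  assumes M: "M \<in> fg_modules R" and cov: "projective_cover R P f M"
  shows "a_kernel P M f \<subseteq> rad P"
proof
  have PF: "P \<in> fg_modules R" and f: "f \<in> mod_hom R P M"
    and sf: "\<And>N. submodule N R P \<Longrightarrow> N <+>\<^bsub>P\<^esub> a_kernel P M f = carrier P \<Longrightarrow> N = carrier P"
    using cov by (auto simp: projective_cover_def)
  note P = fg_modulesD[OF PF]
  interpret P: right_module R P by (rule P(1))
  let ?K = "a_kernel P M f"
  have K: "submodule ?K R P" by (rule submodule_kernel[OF f P(1) fg_modulesD(1)[OF M]])
  fix z assume z: "z \<in> ?K"
  have zP: "z \<in> carrier P" by (rule submoduleD(2)[OF K z])
  show "z \<in> rad P"
  proof (rule in_submodule_components[OF P(1) submodule_rad[OF P(1)] zP])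
    fix i assume i: "i \<in> V"
    let ?b = "idem i \<odot>\<^bsub>P\<^esub> z"
    have b: "?b \<in> carrier P" "idem i \<odot>\<^bsub>P\<^esub> ?b = ?b" "?b \<in> ?K"
      using zP idem_idem[OF P(1) zP, of i i] submoduleD(6)[OF K elem_closed(3) z] by (auto simp: P.smult_closed)
    show "?b \<in> rad P"
    proof (rule ccontr)
      assume "?b \<notin> rad P"
      then obtain h where h: "h \<in> mod_hom R P (simp_mod i)" "h ?b = 1"
        using functional_off_rad[OF P b(1,2) i] by blast
      have rS: "right_module R (simp_mod i)" by (rule right_module_simp_mod[OF i])
      let ?N = "a_kernel P (simp_mod i) h"
      have N: "submodule ?N R P" by (rule submodule_kernel[OF h(1) P(1) rS])
      have "x \<in> ?N <+>\<^bsub>P\<^esub> ?K" if x: "x \<in> carrier P" for x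
      proof (rule set_addI)
        let ?l = "sca (h x) \<odot>\<^bsub>P\<^esub> ?b"
        have l: "?l \<in> carrier P" using b(1) by (simp add: P.smult_closed)
        have hl: "h ?l = h x" using mod_homD(3)[OF h(1) elem_closed(2)[of "h x"] b(1)] h(2) i by (simp add: sca_def)
        have "h (x \<ominus>\<^bsub>P\<^esub> ?l) = h x \<ominus>\<^bsub>simp_mod i\<^esub> h ?l" by (rule mod_hom_diff[OF h(1) P(1) rS x l])
        also have "\<dots> = \<zero>\<^bsub>simp_mod i\<^esub>"
          unfolding hl a_minus_def by (rule abelian_group.r_neg[OF right_module.axioms(2)[OF rS]]) simp
        finally show "x \<ominus>\<^bsub>P\<^esub> ?l \<in> ?N" using x l by (simp add: a_kernel_def')
        show "?l \<in> ?K" by (rule submoduleD(6)[OF K elem_closed(2) b(3)])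
        show "x = (x \<ominus>\<^bsub>P\<^esub> ?l) \<oplus>\<^bsub>P\<^esub> ?l" using x l by (simp add: a_minus_def P.M.a_assoc P.M.l_neg)
      qed
      moreover have "?N <+>\<^bsub>P\<^esub> ?K \<subseteq> carrier P"
        by (rule submoduleD(1)[OF submodule_set_add[OF P(1) N K]])
      ultimately have "?N <+>\<^bsub>P\<^esub> ?K = carrier P" by (intro equalityI subsetI) auto
      then have "?N = carrier P" by (rule sf[OF N])
      then have "h ?b = 0" using b(1) by (auto simp: a_kernel_def')
      then show False using h(2) by simp
    qed
  qed
qed

lemma projective_ind:
  fixes P :: "('r, nat \<Rightarrow> 'k) module"
  assumes PF: "P \<in> fg_modules R" and proj: "projective_mod R P"
  shows "\<exists>T :: ('r, nat \<Rightarrow> 'k) module. ss T \<and> finitely_generated R T \<and> mod_iso R (ind_mod T) P"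
proof -
  note P = fg_modulesD[OF PF]
  obtain T :: "('r, nat \<Rightarrow> 'k) module" and q where T: "ss T" "finitely_generated R T"
    and q: "q \<in> mod_hom R (ind_mod T) P" "q ` carrier (ind_mod T) = carrier P"
      "a_kernel (ind_mod T) P q \<subseteq> rad (ind_mod T)"
    using ind_cover[OF P] by blast
  let ?F = "ind_mod T"
  have rF: "right_module R ?F" by (rule right_module_ind_mod[OF T(1)])
  obtain F' :: "('r, nat \<Rightarrow> 'k) module" where F': "F' \<in> fg_modules R" "mod_iso R ?F F'"
    using fg_copy[OF rF ind_mod_fg[OF T]] by blast
  note rF' = fg_modulesD(1)[OF F'(1)]
  obtain u where u: "u \<in> mod_hom R ?F F'" "bij_betw u (carrier ?F) (carrier F')"
    using F'(2) unfolding mod_iso_def by blast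
  let ?v = "inv_into (carrier ?F) u"
  have v: "?v \<in> mod_hom R F' ?F" by (rule mod_hom_inv[OF u rF])
  have vb: "bij_betw ?v (carrier F') (carrier ?F)" by (rule bij_betw_inv_into[OF u(2)])
  have qv: "(\<lambda>x. q (?v x)) ` carrier F' = carrier P"
    unfolding image_image[of q ?v, symmetric] bij_betw_imp_surj_on[OF vb] by (rule q(2))
  obtain h' where h': "h' \<in> mod_hom R P F'" "\<forall>x\<in>carrier P. q (?v (h' x)) = id x"
    using proj[unfolded projective_mod_def, rule_format, OF F'(1) PF mod_hom_comp[OF v q(1)] mod_hom_id qv]
    by blast
  define h where "h x = ?v (h' x)" for x
  have h: "h \<in> mod_hom R P ?F" unfolding h_def[abs_def] by (rule mod_hom_comp[OF h'(1) v])
  have qh: "q (h x) = x" if "x \<in> carrier P" for x using h'(2) that by (simp add: h_def)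
  interpret F: right_module R ?F by (rule rF)
  have im: "submodule (h ` carrier P) R ?F" by (rule submodule_image[OF h P(1) rF submodule_UNIV[OF P(1)]])
  have K: "submodule (a_kernel ?F P q) R ?F" by (rule submodule_kernel[OF q(1) rF P(1)])
  have "x \<in> (h ` carrier P) <+>\<^bsub>?F\<^esub> a_kernel ?F P q" if x: "x \<in> carrier ?F" for x
  proof (rule set_addI)
    have qx: "q x \<in> carrier P" by (rule mod_homD(1)[OF q(1) x])
    have hq: "h (q x) \<in> carrier ?F" by (rule mod_homD(1)[OF h qx])
    show "h (q x) \<in> h ` carrier P" using qx by blast
    have "q (x \<ominus>\<^bsub>?F\<^esub> h (q x)) = q x \<ominus>\<^bsub>P\<^esub> q (h (q x))" by (rule mod_hom_diff[OF q(1) rF P(1) x hq])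
    also have "\<dots> = \<zero>\<^bsub>P\<^esub>"
      unfolding qh[OF qx] a_minus_def by (rule abelian_group.r_neg[OF right_module.axioms(2)[OF P(1)] qx])
    finally show "x \<ominus>\<^bsub>?F\<^esub> h (q x) \<in> a_kernel ?F P q"
      using F.M.minus_closed[OF x hq] by (simp only: a_kernel_def' mem_Collect_eq)
    have "h (q x) \<oplus>\<^bsub>?F\<^esub> (x \<oplus>\<^bsub>?F\<^esub> (\<ominus>\<^bsub>?F\<^esub> h (q x))) = x \<oplus>\<^bsub>?F\<^esub> (h (q x) \<oplus>\<^bsub>?F\<^esub> (\<ominus>\<^bsub>?F\<^esub> h (q x)))"
      by (rule F.M.add.m_lcomm[OF hq x F.M.a_inv_closed[OF hq]])
    also have "\<dots> = x" unfolding F.M.r_neg[OF hq] by (rule F.M.r_zero[OF x])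
    finally show "x = h (q x) \<oplus>\<^bsub>?F\<^esub> (x \<ominus>\<^bsub>?F\<^esub> h (q x))" unfolding a_minus_def by (rule sym)
  qed
  moreover have "(h ` carrier P) <+>\<^bsub>?F\<^esub> a_kernel ?F P q \<subseteq> carrier ?F"
    by (rule submoduleD(1)[OF submodule_set_add[OF rF im K]])
  ultimately have sum: "(h ` carrier P) <+>\<^bsub>?F\<^esub> a_kernel ?F P q = carrier ?F" by (intro equalityI subsetI) blast+
  have surj: "h ` carrier P = carrier ?F" by (rule superfluous_rad[OF rF im q(3) sum])
  have "bij_betw h (carrier P) (carrier ?F)"
    unfolding bij_betw_def using surj inj_on_inverseI[of "carrier P" q h, OF qh] by simp
  then have "mod_iso R P ?F" unfolding mod_iso_def using h by blast
  then show ?thesis using T mod_iso_sym[OF _ P(1)] by blast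
qed

lemma om_mu_projective:
  fixes P :: "('r, nat \<Rightarrow> 'k) module"
  assumes "P \<in> fg_modules R" "projective_mod R P" "i \<in> V"
  shows "om P i = 0" "\<beta> \<in> E \<Longrightarrow> src \<beta> = i \<Longrightarrow> mu P i = 0"
proof -
  obtain T :: "('r, nat \<Rightarrow> 'k) module" where T: "ss T" "finitely_generated R T" "mod_iso R (ind_mod T) P"
    using projective_ind[OF assms(1,2)] by blast
  note om_mu = om_mu_iso[OF right_module_ind_mod[OF T(1)] fg_modulesD(1)[OF assms(1)] ind_mod_fg[OF T(1,2)] T(3) assms(3)]
  show "om P i = 0" unfolding om_mu(1) by (rule vec_ind_mod(3)[OF T(1,2) assms(3)])
  show "\<beta> \<in> E \<Longrightarrow> src \<beta> = i \<Longrightarrow> mu P i = 0" unfolding om_mu(2) by (rule mu_ind_mod[OF T(1,2) assms(3)])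
qed

text \<open>Shown for every projective cover P of M, because of the choice in \<open>syzygy\<close>.
  The kernel lies in the radical and is thus semisimple; it adds equally to \<open>dvec\<close> and
  \<open>rvec\<close>, so P and M have the same top, and \<open>om P = 0\<close> can be solved for
  its dimension.\<close>

lemma syzygy_props:
  fixes M :: "('r, nat \<Rightarrow> 'k) module"
  assumes MF: "M \<in> fg_modules R"
  shows "syzygy R M \<in> fg_modules R" "ss (syzygy R M)" "i \<in> V \<Longrightarrow> int (dimv (syzygy R M) i) = om M i"
proof -
  note M = fg_modulesD[OF MF]
  have main: "P\<lparr>carrier := a_kernel P M f\<rparr> \<in> fg_modules R \<and> ss (P\<lparr>carrier := a_kernel P M f\<rparr>) \<and>
      (\<forall>i\<in>V. int (dimv (P\<lparr>carrier := a_kernel P M f\<rparr>) i) = om M i)"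
    if cov: "projective_cover R P f M" for P f
  proof -
    have PF: "P \<in> fg_modules R" and f: "f \<in> mod_hom R P M" "f ` carrier P = carrier M"
      and proj: "projective_mod R P" using cov by (auto simp: projective_cover_def)
    note P = fg_modulesD[OF PF]
    let ?K = "a_kernel P M f" and ?N = "P\<lparr>carrier := a_kernel P M f\<rparr>"
    have K: "submodule ?K R P" by (rule submodule_kernel[OF f(1) P(1) M(1)])
    have Kr: "?K \<subseteq> rad P" by (rule cover_kernel[OF MF cov])
    have rN: "right_module R ?N" by (rule right_module_sub[OF P(1) K])
    have ssN: "ss ?N" using rad_le_soc[OF P(1)] Kr by (intro ss_sub_soc[OF P(1) K]) blast
    have degN: "deg ?N = (deg P)\<lparr>carrier := ?K\<rparr>" by (simp add: deg_def)
    have fdN: "finitely_generated R (deg ?N)"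
      unfolding degN by (rule ss_sub_fg[OF ss_deg[OF P(1)] finitely_generated_deg[OF P] submodule_deg[OF P(1) K]])
    have fN: "finitely_generated R ?N" by (rule finitely_generated_from_deg[OF rN fdN])
    have dN: "dimv (deg ?N) i = dimv ?N i" if "i \<in> V" for i
      by (rule dimv_iso[OF ssN fN right_module_deg[OF rN] mod_iso_sym[OF deg_ss[OF ssN] right_module_deg[OF rN]] that])
    \<comment> \<open>The kernel is counted once in P, which maps onto M, and once in the radical of
      P, which maps onto the radical of M.\<close>
    have rK: "rvec P i = rvec M i + int (dimv ?N i)" and dK: "dvec P i = dvec M i + int (dimv ?N i)"
      if i: "i \<in> V" for i
    proof -
      have "a_kernel (deg P) (deg M) f = ?K" by (simp add: a_kernel_def')
      then have "dimv (deg P) i = dimv (deg M) i + dimv (deg ?N) i"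
        using dimv_surj[OF ss_deg[OF P(1)] finitely_generated_deg[OF P] right_module_deg[OF M(1)] mod_hom_deg[OF f(1)] _ i] f(2)
        unfolding degN by simp
      then show "dvec P i = dvec M i + int (dimv ?N i)" using dN[OF i] by (simp add: dvec_def)
      let ?RP = "(deg P)\<lparr>carrier := rad P\<rparr>" and ?RM = "(deg M)\<lparr>carrier := rad M\<rparr>"
      have sP: "submodule (rad P) R (deg P)" by (rule submodule_deg[OF P(1) submodule_rad[OF P(1)]])
      have sM: "submodule (rad M) R (deg M)" by (rule submodule_deg[OF M(1) submodule_rad[OF M(1)]])
      have im: "f ` rad P = rad M" by (rule surj_rad[OF f(1) P(1) M(1) f(2)])
      have fR: "f \<in> mod_hom R ?RP ?RM"
        by (rule mod_hom_into_sub[OF mod_hom_sub[OF mod_hom_deg[OF f(1)] sP]]) (use im in auto)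
      have ker: "a_kernel ?RP ?RM f = ?K"
        using Kr submoduleD(2)[OF submodule_rad[OF P(1)]] by (auto simp: a_kernel_def')
      have "dimv ?RP i = dimv ?RM i + dimv (?RP\<lparr>carrier := ?K\<rparr>) i"
        using dimv_surj[OF ss_sub[OF ss_deg[OF P(1)] sP] ss_sub_fg[OF ss_deg[OF P(1)] finitely_generated_deg[OF P] sP]
            right_module_sub[OF right_module_deg[OF M(1)] sM] fR _ i] im unfolding ker by simp
      moreover have "?RP\<lparr>carrier := ?K\<rparr> = deg ?N" unfolding degN by simp
      ultimately show "rvec P i = rvec M i + int (dimv ?N i)" using dN[OF i] by (simp add: rvec_def)
    qed
    have "int (dimv ?N i) = om M i" if i: "i \<in> V" for i
    proof -
      have "(\<Sum>\<alpha>\<in>E. if tgt \<alpha> = i then dvec P (src \<alpha>) - rvec P (src \<alpha>) else 0) =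
          (\<Sum>\<alpha>\<in>E. if tgt \<alpha> = i then dvec M (src \<alpha>) - rvec M (src \<alpha>) else 0)"
        by (rule sum.cong) (auto simp: rK dK)
      then show ?thesis
        using om_mu_projective(1)[OF PF proj i] rK[OF i] unfolding om_def by simp
    qed
    then show ?thesis using fg_modulesI[OF rN fN] ssN by blast
  qed
  obtain P f where "projective_cover R P f M" using cover_exists[OF MF] by blast
  then have "\<exists>N. N \<in> fg_modules R \<and> (\<exists>P f. projective_cover R P f M \<and> N = P\<lparr>carrier := a_kernel P M f\<rparr>)"
    using main by blast
  then have "\<exists>P f. projective_cover R P f M \<and> syzygy R M = P\<lparr>carrier := a_kernel P M f\<rparr>"
    unfolding syzygy_def by (rule someI2_ex) blast
  then obtain P f where "projective_cover R P f M" "syzygy R M = P\<lparr>carrier := a_kernel P M f\<rparr>" by blast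
  then show "syzygy R M \<in> fg_modules R" "ss (syzygy R M)" "i \<in> V \<Longrightarrow> int (dimv (syzygy R M) i) = om M i"
    using main by simp_all
qed

end

section \<open>Injective envelopes of semisimple modules\<close>

text \<open>The arrow part of \<open>a\<close>, evaluated when \<open>f\<close> prescribes the
  images of the arrows.\<close>

definition (in rad_square_zero) arr_sum :: "('r, 'm) module \<Rightarrow> 'r \<Rightarrow> ('a \<Rightarrow> 'm) \<Rightarrow> 'm" where
  "arr_sum M a f = (\<Oplus>\<^bsub>M\<^esub>\<alpha>\<in>E. sca (ca a \<alpha>) \<odot>\<^bsub>M\<^esub> f \<alpha>)"

text \<open>The coinduced module of \<open>M\<close> over the semisimple part: \<open>(m, f)\<close> stands for the map sending
  the unit to \<open>m\<close> and the arrow \<open>\<alpha>\<close> to \<open>f \<alpha>\<close>.\<close>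

definition (in rad_square_zero) coind_mod :: "('r, 'm) module \<Rightarrow> ('r, 'm \<times> ('a \<Rightarrow> 'm)) module" where
  "coind_mod M = (mod_sum2 M (mod_sum E (\<lambda>\<alpha>. shift M (tgt \<alpha>) (src \<alpha>))))\<lparr>smult := \<lambda>a p.
     (a \<odot>\<^bsub>M\<^esub> fst p \<oplus>\<^bsub>M\<^esub> arr_sum M a (snd p), \<lambda>\<alpha>\<in>E. sca (cv a (src \<alpha>)) \<odot>\<^bsub>M\<^esub> snd p \<alpha>)\<rparr>"

context rad_square_zero
begin

lemma coind_mod_simps [simp]:
  "carrier (coind_mod M) = carrier M \<times> (\<Pi>\<^sub>E \<alpha>\<in>E. comp M (tgt \<alpha>))"
  "\<zero>\<^bsub>coind_mod M\<^esub> = (\<zero>\<^bsub>M\<^esub>, \<lambda>\<alpha>\<in>E. \<zero>\<^bsub>M\<^esub>)"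
  "p \<oplus>\<^bsub>coind_mod M\<^esub> q = (fst p \<oplus>\<^bsub>M\<^esub> fst q, \<lambda>\<alpha>\<in>E. snd p \<alpha> \<oplus>\<^bsub>M\<^esub> snd q \<alpha>)"
  "a \<odot>\<^bsub>coind_mod M\<^esub> p = (a \<odot>\<^bsub>M\<^esub> fst p \<oplus>\<^bsub>M\<^esub> arr_sum M a (snd p),
     \<lambda>\<alpha>\<in>E. sca (cv a (src \<alpha>)) \<odot>\<^bsub>M\<^esub> snd p \<alpha>)"
  by (simp_all add: coind_mod_def cong: PiE_cong)

lemma coind_mod_memD:
  assumes "ss M" "p \<in> carrier (coind_mod M)"
  shows "fst p \<in> carrier M" "\<And>\<alpha>. \<alpha> \<in> E \<Longrightarrow> snd p \<alpha> \<in> carrier M"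
    "\<And>\<alpha>. \<alpha> \<in> E \<Longrightarrow> idem (tgt \<alpha>) \<odot>\<^bsub>M\<^esub> snd p \<alpha> = snd p \<alpha>" "\<And>\<alpha>. \<alpha> \<in> E \<Longrightarrow> snd p \<alpha> \<in> comp M (tgt \<alpha>)"
    "restrict (snd p) E = snd p" "snd p \<in> (\<Pi> \<alpha>\<in>E. comp M (tgt \<alpha>))" "snd p \<in> E \<rightarrow> carrier M"
  using assms(2) by (auto simp: comp_def PiE_iff intro!: extensional_restrict)

lemma arr_sum_props:
  assumes M: "ss M" and f: "f \<in> (\<Pi> \<alpha>\<in>E. comp M (tgt \<alpha>))"
    and a: "a \<in> carrier R" and b: "b \<in> carrier R"
  shows "arr_sum M a f \<in> carrier M"
    "arr_sum M (a \<oplus> b) f = arr_sum M a f \<oplus>\<^bsub>M\<^esub> arr_sum M b f"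
    "arr_sum M (a \<otimes> b) f = b \<odot>\<^bsub>M\<^esub> arr_sum M a f \<oplus>\<^bsub>M\<^esub>
      arr_sum M b (\<lambda>\<alpha>\<in>E. sca (cv a (src \<alpha>)) \<odot>\<^bsub>M\<^esub> f \<alpha>)"
    "(\<And>\<alpha>. \<alpha> \<in> E \<Longrightarrow> ca a \<alpha> = 0) \<Longrightarrow> arr_sum M a f = \<zero>\<^bsub>M\<^esub>"
    "\<beta> \<in> E \<Longrightarrow> arr_sum M (arr \<beta>) f = f \<beta>"
proof -
  have rm: "right_module R M" by (rule ssD(1)[OF M])
  interpret M: right_module R M by (rule rm)
  have fM: "f \<alpha> \<in> carrier M" "idem (tgt \<alpha>) \<odot>\<^bsub>M\<^esub> f \<alpha> = f \<alpha>" if "\<alpha> \<in> E" for \<alpha>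
    using f that by (auto simp: comp_def)
  have t: "sca k \<odot>\<^bsub>M\<^esub> f \<alpha> \<in> carrier M" if "\<alpha> \<in> E" for k \<alpha>
    using fM(1)[OF that] by (simp add: M.smult_closed)
  show "arr_sum M a f \<in> carrier M" unfolding arr_sum_def by (rule M.M.finsum_closed) (use t in blast)
  have "arr_sum M (a \<oplus> b) f = (\<Oplus>\<^bsub>M\<^esub>\<alpha>\<in>E. sca (ca a \<alpha>) \<odot>\<^bsub>M\<^esub> f \<alpha> \<oplus>\<^bsub>M\<^esub> sca (ca b \<alpha>) \<odot>\<^bsub>M\<^esub> f \<alpha>)"
    unfolding arr_sum_def using t fM a b
    by (intro M.M.finsum_cong') (auto simp: sca_add M.smult_add_left)
  also have "\<dots> = arr_sum M a f \<oplus>\<^bsub>M\<^esub> arr_sum M b f"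
    unfolding arr_sum_def by (rule M.M.finsum_addf) (use t in blast)+
  finally show "arr_sum M (a \<oplus> b) f = arr_sum M a f \<oplus>\<^bsub>M\<^esub> arr_sum M b f" .
  \<comment> \<open>\<open>f \<alpha>\<close> has degree \<open>tgt \<alpha>\<close>, so
    \<open>b\<close> acts on it by its coefficient at the target. The two terms are those of
    \<open>ca_mult\<close>.\<close>
  have u: "sca (ca (a \<otimes> b) \<alpha>) \<odot>\<^bsub>M\<^esub> f \<alpha> = b \<odot>\<^bsub>M\<^esub> (sca (ca a \<alpha>) \<odot>\<^bsub>M\<^esub> f \<alpha>) \<oplus>\<^bsub>M\<^esub>
      sca (ca b \<alpha>) \<odot>\<^bsub>M\<^esub> ((\<lambda>\<alpha>\<in>E. sca (cv a (src \<alpha>)) \<odot>\<^bsub>M\<^esub> f \<alpha>) \<alpha>)" if \<alpha>: "\<alpha> \<in> E" for \<alpha>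
  proof -
    have "b \<odot>\<^bsub>M\<^esub> (sca (ca a \<alpha>) \<odot>\<^bsub>M\<^esub> f \<alpha>) = sca (ca a \<alpha>) \<odot>\<^bsub>M\<^esub> (b \<odot>\<^bsub>M\<^esub> f \<alpha>)"
      by (rule sca_smult[OF rm b fM(1)[OF \<alpha>]])
    also have "b \<odot>\<^bsub>M\<^esub> f \<alpha> = sca (cv b (tgt \<alpha>)) \<odot>\<^bsub>M\<^esub> f \<alpha>"
      by (rule homogeneous_smult[OF M fM[OF \<alpha>] tgt_V[OF \<alpha>] b])
    finally have "b \<odot>\<^bsub>M\<^esub> (sca (ca a \<alpha>) \<odot>\<^bsub>M\<^esub> f \<alpha>) = sca (cv b (tgt \<alpha>) * ca a \<alpha>) \<odot>\<^bsub>M\<^esub> f \<alpha>"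
      by (simp only: sca_sca[OF rm fM(1)[OF \<alpha>]])
    moreover have "sca (ca b \<alpha>) \<odot>\<^bsub>M\<^esub> ((\<lambda>\<alpha>\<in>E. sca (cv a (src \<alpha>)) \<odot>\<^bsub>M\<^esub> f \<alpha>) \<alpha>) = sca (cv a (src \<alpha>) * ca b \<alpha>) \<odot>\<^bsub>M\<^esub> f \<alpha>"
      using \<alpha> by (simp add: sca_sca[OF rm fM(1)[OF \<alpha>]])
    moreover have "sca (ca (a \<otimes> b) \<alpha>) = sca (cv b (tgt \<alpha>) * ca a \<alpha>) \<oplus> sca (cv a (src \<alpha>) * ca b \<alpha>)"
      using \<alpha> a b by (simp add: algebra_simps flip: sca_add)
    ultimately show ?thesis using fM(1)[OF \<alpha>] by (simp add: M.smult_add_left)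
  qed
  have "arr_sum M (a \<otimes> b) f = (\<Oplus>\<^bsub>M\<^esub>\<alpha>\<in>E. b \<odot>\<^bsub>M\<^esub> (sca (ca a \<alpha>) \<odot>\<^bsub>M\<^esub> f \<alpha>) \<oplus>\<^bsub>M\<^esub>
      sca (ca b \<alpha>) \<odot>\<^bsub>M\<^esub> ((\<lambda>\<alpha>\<in>E. sca (cv a (src \<alpha>)) \<odot>\<^bsub>M\<^esub> f \<alpha>) \<alpha>))"
    unfolding arr_sum_def by (rule M.M.finsum_cong'[OF refl _ u]) (use t b in \<open>auto simp: M.smult_closed\<close>)
  also have "\<dots> = (\<Oplus>\<^bsub>M\<^esub>\<alpha>\<in>E. b \<odot>\<^bsub>M\<^esub> (sca (ca a \<alpha>) \<odot>\<^bsub>M\<^esub> f \<alpha>)) \<oplus>\<^bsub>M\<^esub>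
      arr_sum M b (\<lambda>\<alpha>\<in>E. sca (cv a (src \<alpha>)) \<odot>\<^bsub>M\<^esub> f \<alpha>)"
    unfolding arr_sum_def by (rule M.M.finsum_addf) (use t b in \<open>auto simp: M.smult_closed\<close>)
  also have "(\<Oplus>\<^bsub>M\<^esub>\<alpha>\<in>E. b \<odot>\<^bsub>M\<^esub> (sca (ca a \<alpha>) \<odot>\<^bsub>M\<^esub> f \<alpha>)) = b \<odot>\<^bsub>M\<^esub> arr_sum M a f"
    unfolding arr_sum_def by (rule M.smult_finsum[OF b finite_E, symmetric]) (use t in blast)
  finally show "arr_sum M (a \<otimes> b) f = b \<odot>\<^bsub>M\<^esub> arr_sum M a f \<oplus>\<^bsub>M\<^esub>
      arr_sum M b (\<lambda>\<alpha>\<in>E. sca (cv a (src \<alpha>)) \<odot>\<^bsub>M\<^esub> f \<alpha>)" .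
  show "arr_sum M a f = \<zero>\<^bsub>M\<^esub>" if "\<And>\<alpha>. \<alpha> \<in> E \<Longrightarrow> ca a \<alpha> = 0"
  proof -
    have "arr_sum M a f = (\<Oplus>\<^bsub>M\<^esub>\<alpha>\<in>E. \<zero>\<^bsub>M\<^esub>)"
      unfolding arr_sum_def using fM by (intro M.M.finsum_cong') (auto simp: that sca_zero)
    then show ?thesis by simp
  qed
  show "arr_sum M (arr \<beta>) f = f \<beta>" if \<beta>: "\<beta> \<in> E"
  proof -
    have "arr_sum M (arr \<beta>) f = (\<Oplus>\<^bsub>M\<^esub>\<alpha>\<in>E. if \<beta> = \<alpha> then f \<alpha> else \<zero>\<^bsub>M\<^esub>)"
      unfolding arr_sum_def using fM
      by (intro M.M.finsum_cong') (auto simp: arr_def sca_zero sca_one M.smult_one)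
    also have "\<dots> = f \<beta>" by (rule M.M.finsum_singleton[OF \<beta> finite_E]) (use fM in blast)
    finally show ?thesis .
  qed
qed

lemma arr_sum_add:
  assumes M: "ss M" and fg: "f \<in> E \<rightarrow> carrier M" "g \<in> E \<rightarrow> carrier M"
  shows "arr_sum M a (\<lambda>\<alpha>\<in>E. f \<alpha> \<oplus>\<^bsub>M\<^esub> g \<alpha>) = arr_sum M a f \<oplus>\<^bsub>M\<^esub> arr_sum M a g"
proof -
  interpret M: right_module R M by (rule ssD(1)[OF M])
  have f: "f \<alpha> \<in> carrier M" and g: "g \<alpha> \<in> carrier M" if "\<alpha> \<in> E" for \<alpha> using fg that by auto
  have "arr_sum M a (\<lambda>\<alpha>\<in>E. f \<alpha> \<oplus>\<^bsub>M\<^esub> g \<alpha>) =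
      (\<Oplus>\<^bsub>M\<^esub>\<alpha>\<in>E. sca (ca a \<alpha>) \<odot>\<^bsub>M\<^esub> f \<alpha> \<oplus>\<^bsub>M\<^esub> sca (ca a \<alpha>) \<odot>\<^bsub>M\<^esub> g \<alpha>)"
    unfolding arr_sum_def using f g
    by (intro M.M.finsum_cong') (auto simp: M.smult_add_right M.smult_closed)
  also have "\<dots> = arr_sum M a f \<oplus>\<^bsub>M\<^esub> arr_sum M a g"
    unfolding arr_sum_def by (rule M.M.finsum_addf) (use f g in \<open>auto simp: M.smult_closed\<close>)
  finally show ?thesis .
qed

lemma right_module_coind_mod:
  assumes M: "ss M"
  shows "right_module R (coind_mod M)"
proof -
  have rm: "right_module R M" by (rule ssD(1)[OF M])
  interpret M: right_module R M by (rule rm)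
  let ?B = "mod_sum2 M (mod_sum E (\<lambda>\<alpha>. shift M (tgt \<alpha>) (src \<alpha>)))"
  have B: "right_module R ?B"
    by (intro right_module_mod_sum2 rm right_module_mod_sum ring_axioms ssD(1) ss_shift M src_V)
  note C = submoduleD[OF submodule_comp[OF M]]
  have memB: "p \<in> carrier (coind_mod M)" if "p \<in> carrier ?B" for p
    using that by (simp cong: PiE_cong)
  show ?thesis
    unfolding coind_mod_def
  proof (rule right_module_change_smult[OF B])
    fix a p assume a: "a \<in> carrier R" and p: "p \<in> carrier ?B"
    note pc = coind_mod_memD[OF M memB[OF p]]
    note S = arr_sum_props[OF M pc(6)]
    show "(a \<odot>\<^bsub>M\<^esub> fst p \<oplus>\<^bsub>M\<^esub> arr_sum M a (snd p), \<lambda>\<alpha>\<in>E. sca (cv a (src \<alpha>)) \<odot>\<^bsub>M\<^esub> snd p \<alpha>) \<in> carrier ?B"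
      using a pc S(1)[OF a a] C(6)[OF elem_closed(2) pc(4)] by (simp add: M.smult_closed)
    fix b assume b: "b \<in> carrier R"
    have "(a \<oplus> b) \<odot>\<^bsub>M\<^esub> fst p \<oplus>\<^bsub>M\<^esub> arr_sum M (a \<oplus> b) (snd p) =
        (a \<odot>\<^bsub>M\<^esub> fst p \<oplus>\<^bsub>M\<^esub> arr_sum M a (snd p)) \<oplus>\<^bsub>M\<^esub> (b \<odot>\<^bsub>M\<^esub> fst p \<oplus>\<^bsub>M\<^esub> arr_sum M b (snd p))"
      unfolding S(2)[OF a b] using a b pc(1) S(1)[OF a b] S(1)[OF b a]
      by (simp add: M.smult_add_left M.smult_closed M.M.add.m_ac)
    moreover have "(\<lambda>\<alpha>\<in>E. sca (cv (a \<oplus> b) (src \<alpha>)) \<odot>\<^bsub>M\<^esub> snd p \<alpha>) =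
        (\<lambda>\<alpha>\<in>E. (\<lambda>\<alpha>\<in>E. sca (cv a (src \<alpha>)) \<odot>\<^bsub>M\<^esub> snd p \<alpha>) \<alpha> \<oplus>\<^bsub>M\<^esub> (\<lambda>\<alpha>\<in>E. sca (cv b (src \<alpha>)) \<odot>\<^bsub>M\<^esub> snd p \<alpha>) \<alpha>)"
      using a b pc(2) by (intro restrict_ext) (simp add: sca_add M.smult_add_left)
    ultimately show "((a \<oplus> b) \<odot>\<^bsub>M\<^esub> fst p \<oplus>\<^bsub>M\<^esub> arr_sum M (a \<oplus> b) (snd p),
          \<lambda>\<alpha>\<in>E. sca (cv (a \<oplus> b) (src \<alpha>)) \<odot>\<^bsub>M\<^esub> snd p \<alpha>) =
        (a \<odot>\<^bsub>M\<^esub> fst p \<oplus>\<^bsub>M\<^esub> arr_sum M a (snd p), \<lambda>\<alpha>\<in>E. sca (cv a (src \<alpha>)) \<odot>\<^bsub>M\<^esub> snd p \<alpha>) \<oplus>\<^bsub>?B\<^esub>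
        (b \<odot>\<^bsub>M\<^esub> fst p \<oplus>\<^bsub>M\<^esub> arr_sum M b (snd p), \<lambda>\<alpha>\<in>E. sca (cv b (src \<alpha>)) \<odot>\<^bsub>M\<^esub> snd p \<alpha>)"
      unfolding mod_sum2_simps mod_sum_simps shift_simps fst_conv snd_conv by (simp only:)
    let ?f = "\<lambda>\<alpha>\<in>E. sca (cv a (src \<alpha>)) \<odot>\<^bsub>M\<^esub> snd p \<alpha>"
    have fc: "?f \<in> (\<Pi> \<alpha>\<in>E. comp M (tgt \<alpha>))"
      using C(6)[OF elem_closed(2) pc(4)] by simp
    have "(a \<otimes> b) \<odot>\<^bsub>M\<^esub> fst p \<oplus>\<^bsub>M\<^esub> arr_sum M (a \<otimes> b) (snd p) =
        b \<odot>\<^bsub>M\<^esub> (a \<odot>\<^bsub>M\<^esub> fst p \<oplus>\<^bsub>M\<^esub> arr_sum M a (snd p)) \<oplus>\<^bsub>M\<^esub> arr_sum M b ?f"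
      unfolding S(3)[OF a b] using a b pc(1) S(1)[OF a b] arr_sum_props(1)[OF M fc b b]
      by (simp add: M.smult_mult M.smult_add_right M.smult_closed M.M.a_assoc)
    moreover have "(\<lambda>\<alpha>\<in>E. sca (cv (a \<otimes> b) (src \<alpha>)) \<odot>\<^bsub>M\<^esub> snd p \<alpha>) = (\<lambda>\<alpha>\<in>E. sca (cv b (src \<alpha>)) \<odot>\<^bsub>M\<^esub> ?f \<alpha>)"
      using a b pc(2) by (intro restrict_ext) (simp add: sca_sca[OF rm])
    ultimately show "((a \<otimes> b) \<odot>\<^bsub>M\<^esub> fst p \<oplus>\<^bsub>M\<^esub> arr_sum M (a \<otimes> b) (snd p),
          \<lambda>\<alpha>\<in>E. sca (cv (a \<otimes> b) (src \<alpha>)) \<odot>\<^bsub>M\<^esub> snd p \<alpha>) =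
        (b \<odot>\<^bsub>M\<^esub> fst (a \<odot>\<^bsub>M\<^esub> fst p \<oplus>\<^bsub>M\<^esub> arr_sum M a (snd p), ?f) \<oplus>\<^bsub>M\<^esub>
          arr_sum M b (snd (a \<odot>\<^bsub>M\<^esub> fst p \<oplus>\<^bsub>M\<^esub> arr_sum M a (snd p), ?f)),
         \<lambda>\<alpha>\<in>E. sca (cv b (src \<alpha>)) \<odot>\<^bsub>M\<^esub> snd (a \<odot>\<^bsub>M\<^esub> fst p \<oplus>\<^bsub>M\<^esub> arr_sum M a (snd p), ?f) \<alpha>)"
      unfolding fst_conv snd_conv by (simp only:)
  next
    fix a p q assume a: "a \<in> carrier R" and p: "p \<in> carrier ?B" and q: "q \<in> carrier ?B"
    note pc = coind_mod_memD[OF M memB[OF p]] and qc = coind_mod_memD[OF M memB[OF q]]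
    have "a \<odot>\<^bsub>M\<^esub> (fst p \<oplus>\<^bsub>M\<^esub> fst q) \<oplus>\<^bsub>M\<^esub> arr_sum M a (\<lambda>\<alpha>\<in>E. snd p \<alpha> \<oplus>\<^bsub>M\<^esub> snd q \<alpha>) =
        (a \<odot>\<^bsub>M\<^esub> fst p \<oplus>\<^bsub>M\<^esub> arr_sum M a (snd p)) \<oplus>\<^bsub>M\<^esub> (a \<odot>\<^bsub>M\<^esub> fst q \<oplus>\<^bsub>M\<^esub> arr_sum M a (snd q))"
      unfolding arr_sum_add[OF M pc(7) qc(7)]
      using a pc(1) qc(1) arr_sum_props(1)[OF M pc(6) a a] arr_sum_props(1)[OF M qc(6) a a]
      by (simp add: M.smult_add_right M.smult_closed M.M.add.m_ac)
    moreover have "(\<lambda>\<alpha>\<in>E. sca (cv a (src \<alpha>)) \<odot>\<^bsub>M\<^esub> (\<lambda>\<alpha>\<in>E. snd p \<alpha> \<oplus>\<^bsub>M\<^esub> snd q \<alpha>) \<alpha>) =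
        (\<lambda>\<alpha>\<in>E. (\<lambda>\<alpha>\<in>E. sca (cv a (src \<alpha>)) \<odot>\<^bsub>M\<^esub> snd p \<alpha>) \<alpha> \<oplus>\<^bsub>M\<^esub> (\<lambda>\<alpha>\<in>E. sca (cv a (src \<alpha>)) \<odot>\<^bsub>M\<^esub> snd q \<alpha>) \<alpha>)"
      using pc(2) qc(2) by (intro restrict_ext) (simp add: M.smult_add_right)
    ultimately show "(a \<odot>\<^bsub>M\<^esub> fst (p \<oplus>\<^bsub>?B\<^esub> q) \<oplus>\<^bsub>M\<^esub> arr_sum M a (snd (p \<oplus>\<^bsub>?B\<^esub> q)),
          \<lambda>\<alpha>\<in>E. sca (cv a (src \<alpha>)) \<odot>\<^bsub>M\<^esub> snd (p \<oplus>\<^bsub>?B\<^esub> q) \<alpha>) =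
        (a \<odot>\<^bsub>M\<^esub> fst p \<oplus>\<^bsub>M\<^esub> arr_sum M a (snd p), \<lambda>\<alpha>\<in>E. sca (cv a (src \<alpha>)) \<odot>\<^bsub>M\<^esub> snd p \<alpha>) \<oplus>\<^bsub>?B\<^esub>
        (a \<odot>\<^bsub>M\<^esub> fst q \<oplus>\<^bsub>M\<^esub> arr_sum M a (snd q), \<lambda>\<alpha>\<in>E. sca (cv a (src \<alpha>)) \<odot>\<^bsub>M\<^esub> snd q \<alpha>)"
      unfolding mod_sum2_simps mod_sum_simps shift_simps fst_conv snd_conv by (simp only:)
  next
    fix p assume p: "p \<in> carrier ?B"
    note pc = coind_mod_memD[OF M memB[OF p]]
    have "arr_sum M \<one> (snd p) = \<zero>\<^bsub>M\<^esub>"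
      by (rule arr_sum_props(4)[OF M pc(6) one_closed one_closed]) simp
    then have 1: "\<one> \<odot>\<^bsub>M\<^esub> fst p \<oplus>\<^bsub>M\<^esub> arr_sum M \<one> (snd p) = fst p" using pc(1) by (simp add: M.smult_one)
    have "(\<lambda>\<alpha>\<in>E. sca (cv \<one> (src \<alpha>)) \<odot>\<^bsub>M\<^esub> snd p \<alpha>) = restrict (snd p) E"
      using pc(2) by (intro restrict_ext) (simp add: sca_one M.smult_one)
    then show "(\<one> \<odot>\<^bsub>M\<^esub> fst p \<oplus>\<^bsub>M\<^esub> arr_sum M \<one> (snd p), \<lambda>\<alpha>\<in>E. sca (cv \<one> (src \<alpha>)) \<odot>\<^bsub>M\<^esub> snd p \<alpha>) = p"
      unfolding 1 pc(5) by simp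
  qed
qed

lemma coind_fst_hom:
  assumes M: "ss M"
  shows "fst \<in> mod_hom R (deg (coind_mod M)) M"
proof (rule mod_homI)
  interpret M: right_module R M by (rule ssD(1)[OF M])
  fix a p assume a: "a \<in> carrier R" and "p \<in> carrier (deg (coind_mod M))"
  then have p: "p \<in> carrier (coind_mod M)" by simp
  note pc = coind_mod_memD[OF M p]
  have "arr_sum M (diag a) (snd p) = \<zero>\<^bsub>M\<^esub>"
    by (rule arr_sum_props(4)[OF M pc(6) elem_closed(1) elem_closed(1)]) (simp add: diag_def)
  then have "fst (a \<odot>\<^bsub>deg (coind_mod M)\<^esub> p) = diag a \<odot>\<^bsub>M\<^esub> fst p" using pc(1) by (simp add: M.smult_closed)
  then show "fst (a \<odot>\<^bsub>deg (coind_mod M)\<^esub> p) = a \<odot>\<^bsub>M\<^esub> fst p" using ssD(2)[OF M a pc(1)] by simp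
qed auto

lemma coind_snd_hom:
  "snd \<in> mod_hom R (coind_mod M) (mod_sum E (\<lambda>\<alpha>. shift M (tgt \<alpha>) (src \<alpha>)))"
  by (rule mod_homI) (auto cong: PiE_cong)

lemma fst_arr_coind:
  assumes M: "ss M" and p: "p \<in> carrier (coind_mod M)" and \<beta>: "\<beta> \<in> E"
  shows "fst (arr \<beta> \<odot>\<^bsub>coind_mod M\<^esub> p) = snd p \<beta>"
proof -
  interpret M: right_module R M by (rule ssD(1)[OF M])
  note pc = coind_mod_memD[OF M p]
  have "arr \<beta> \<odot>\<^bsub>M\<^esub> fst p = \<zero>\<^bsub>M\<^esub>" using ss_soc[OF M] pc(1) \<beta> by (auto simp: soc_def)
  moreover have "arr_sum M (arr \<beta>) (snd p) = snd p \<beta>"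
    by (rule arr_sum_props(5)[OF M pc(6) elem_closed(4) elem_closed(4) \<beta>])
  ultimately show ?thesis using pc(2)[OF \<beta>] by simp
qed

text \<open>Injectivity of coinduced modules. Only the first component has to be extended, as a
  graded map; the slot of \<alpha> at y is then forced to be the first component at the product of y
  with \<alpha>.\<close>

lemma coind_extend:
  assumes M: "ss M" and X: "right_module R X" and Y: "right_module R Y" "finitely_generated R Y"
    and j: "j \<in> mod_hom R X Y" "inj_on j (carrier X)" and g: "g \<in> mod_hom R X (coind_mod M)"
  shows "\<exists>h\<in>mod_hom R Y (coind_mod M). \<forall>x\<in>carrier X. h (j x) = g x"
proof -
  have rm: "right_module R M" by (rule ssD(1)[OF M])
  interpret M: right_module R M by (rule rm)
  interpret Y: right_module R Y by (rule Y(1))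
  let ?I = "coind_mod M"
  have rI: "right_module R ?I" by (rule right_module_coind_mod[OF M])
  have g1: "(\<lambda>x. fst (g x)) \<in> mod_hom R (deg X) M"
    by (rule mod_hom_comp[OF mod_hom_deg[OF g] coind_fst_hom[OF M]])
  let ?U = "j ` carrier X"
  have U: "submodule ?U R (deg Y)" by (rule submodule_deg[OF Y(1) submodule_image[OF j(1) X Y(1) submodule_UNIV[OF X]]])
  have jd: "j \<in> mod_hom R (deg X) ((deg Y)\<lparr>carrier := ?U\<rparr>)"
    by (rule mod_hom_into_sub[OF mod_hom_deg[OF j(1)]]) simp
  have jinv: "inv_into (carrier (deg X)) j \<in> mod_hom R ((deg Y)\<lparr>carrier := ?U\<rparr>) (deg X)"
    by (rule mod_hom_inv[OF jd _ right_module_deg[OF X]]) (use j(2) in \<open>simp add: bij_betw_def\<close>)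
  \<comment> \<open>The first component of \<open>g\<close>, moved to the image of \<open>j\<close>,
    extends because \<open>deg Y\<close> is semisimple.\<close>
  obtain h1 where h1: "h1 \<in> mod_hom R (deg Y) M" "\<forall>u\<in>?U. h1 u = fst (g (inv_into (carrier (deg X)) j u))"
    using ss_extension[OF ss_deg[OF Y(1)] finitely_generated_deg[OF Y] U mod_hom_comp[OF jinv g1]] by blast
  have h1D: "\<And>y. y \<in> carrier Y \<Longrightarrow> h1 y \<in> carrier M"
    "\<And>y z. y \<in> carrier Y \<Longrightarrow> z \<in> carrier Y \<Longrightarrow> h1 (y \<oplus>\<^bsub>Y\<^esub> z) = h1 y \<oplus>\<^bsub>M\<^esub> h1 z"
    "\<And>a y. a \<in> carrier R \<Longrightarrow> y \<in> carrier Y \<Longrightarrow> h1 (diag a \<odot>\<^bsub>Y\<^esub> y) = a \<odot>\<^bsub>M\<^esub> h1 y"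
    using mod_homD[OF h1(1)] by simp_all
  have h1j: "h1 (j x) = fst (g x)" if x: "x \<in> carrier X" for x
    using h1(2) x inv_into_f_f[OF j(2) x] by simp
  have h1s: "h1 (sca c \<odot>\<^bsub>Y\<^esub> y) = sca c \<odot>\<^bsub>M\<^esub> h1 y" if "y \<in> carrier Y" for c y
    using h1D(3)[OF elem_closed(2) that, of c] by simp
  have aY: "arr \<alpha> \<odot>\<^bsub>Y\<^esub> y \<in> carrier Y" if "y \<in> carrier Y" for \<alpha> y using that by (simp add: Y.smult_closed)
  have hc: "h1 (arr \<alpha> \<odot>\<^bsub>Y\<^esub> y) \<in> comp M (tgt \<alpha>)" if \<alpha>: "\<alpha> \<in> E" and y: "y \<in> carrier Y" for \<alpha> y
  proof -
    have "idem (tgt \<alpha>) \<odot>\<^bsub>Y\<^esub> (arr \<alpha> \<odot>\<^bsub>Y\<^esub> y) = arr \<alpha> \<odot>\<^bsub>Y\<^esub> y"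
      using arr_smult(2)[OF Y(1) elem_closed(3) y, of "tgt \<alpha>" \<alpha>] \<alpha> aY[OF y] by (simp add: idem_def sca_one Y.smult_one)
    then have "idem (tgt \<alpha>) \<odot>\<^bsub>M\<^esub> h1 (arr \<alpha> \<odot>\<^bsub>Y\<^esub> y) = h1 (arr \<alpha> \<odot>\<^bsub>Y\<^esub> y)"
      using h1D(3)[OF elem_closed(3) aY[OF y], of "tgt \<alpha>" \<alpha>] by simp
    then show ?thesis using h1D(1)[OF aY[OF y]] by (simp add: comp_def)
  qed
  define h where "h y = (h1 y, \<lambda>\<alpha>\<in>E. h1 (arr \<alpha> \<odot>\<^bsub>Y\<^esub> y))" for y
  have "h \<in> mod_hom R Y ?I"
  proof (rule mod_homI)
    fix y assume y: "y \<in> carrier Y"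
    show "h y \<in> carrier ?I" unfolding h_def using h1D(1)[OF y] hc y by simp
    fix a assume a: "a \<in> carrier R"
    let ?t = "\<lambda>\<alpha>. sca (ca a \<alpha>) \<odot>\<^bsub>Y\<^esub> (arr \<alpha> \<odot>\<^bsub>Y\<^esub> y)"
    have t: "?t \<in> E \<rightarrow> carrier Y" using aY[OF y] by (auto simp: Y.smult_closed)
    have "h1 (\<Oplus>\<^bsub>Y\<^esub>\<alpha>\<in>E. ?t \<alpha>) = h1 (\<Oplus>\<^bsub>deg Y\<^esub>\<alpha>\<in>E. ?t \<alpha>)" by (simp add: finsum_def deg_def)
    also have "\<dots> = (\<Oplus>\<^bsub>M\<^esub>\<alpha>\<in>E. h1 (?t \<alpha>))"
      using mod_hom_finsum[OF h1(1) right_module_deg[OF Y(1)] rm finite_E, of ?t] t by simp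
    also have "\<dots> = arr_sum M a (\<lambda>\<alpha>\<in>E. h1 (arr \<alpha> \<odot>\<^bsub>Y\<^esub> y))"
      unfolding arr_sum_def using h1D(1)[OF aY[OF y]]
      by (intro M.M.finsum_cong') (auto simp: h1s[OF aY[OF y]] M.smult_closed)
    finally have s: "h1 (\<Oplus>\<^bsub>Y\<^esub>\<alpha>\<in>E. ?t \<alpha>) = arr_sum M a (\<lambda>\<alpha>\<in>E. h1 (arr \<alpha> \<odot>\<^bsub>Y\<^esub> y))" .
    have 1: "h1 (a \<odot>\<^bsub>Y\<^esub> y) = a \<odot>\<^bsub>M\<^esub> h1 y \<oplus>\<^bsub>M\<^esub> arr_sum M a (\<lambda>\<alpha>\<in>E. h1 (arr \<alpha> \<odot>\<^bsub>Y\<^esub> y))"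
      unfolding arr_decomp[OF Y(1) y a] s[symmetric] h1D(3)[OF a y, symmetric]
      by (rule h1D(2)) (use y t in \<open>auto simp: Y.smult_closed\<close>)
    have 2: "(\<lambda>\<alpha>\<in>E. h1 (arr \<alpha> \<odot>\<^bsub>Y\<^esub> (a \<odot>\<^bsub>Y\<^esub> y))) = (\<lambda>\<alpha>\<in>E. sca (cv a (src \<alpha>)) \<odot>\<^bsub>M\<^esub> (\<lambda>\<alpha>\<in>E. h1 (arr \<alpha> \<odot>\<^bsub>Y\<^esub> y)) \<alpha>)"
      by (rule restrict_ext) (simp add: arr_smult(1)[OF Y(1) a y] h1s[OF aY[OF y]])
    show "h (a \<odot>\<^bsub>Y\<^esub> y) = a \<odot>\<^bsub>?I\<^esub> h y"
      unfolding h_def coind_mod_simps fst_conv snd_conv 1 2 ..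
  next
    fix y z assume y: "y \<in> carrier Y" and z: "z \<in> carrier Y"
    have "(\<lambda>\<alpha>\<in>E. h1 (arr \<alpha> \<odot>\<^bsub>Y\<^esub> (y \<oplus>\<^bsub>Y\<^esub> z))) =
        (\<lambda>\<alpha>\<in>E. (\<lambda>\<alpha>\<in>E. h1 (arr \<alpha> \<odot>\<^bsub>Y\<^esub> y)) \<alpha> \<oplus>\<^bsub>M\<^esub> (\<lambda>\<alpha>\<in>E. h1 (arr \<alpha> \<odot>\<^bsub>Y\<^esub> z)) \<alpha>)"
      using y z by (intro restrict_ext) (simp add: Y.smult_add_right h1D(2) aY)
    then show "h (y \<oplus>\<^bsub>Y\<^esub> z) = h y \<oplus>\<^bsub>?I\<^esub> h z"
      unfolding h_def coind_mod_simps fst_conv snd_conv h1D(2)[OF y z] by (simp only:)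
  qed
  moreover have "h (j x) = g x" if x: "x \<in> carrier X" for x
  proof -
    have gx: "g x \<in> carrier ?I" by (rule mod_homD(1)[OF g x])
    have "(\<lambda>\<alpha>\<in>E. h1 (arr \<alpha> \<odot>\<^bsub>Y\<^esub> j x)) = restrict (snd (g x)) E"
    proof (rule restrict_ext)
      fix \<alpha> assume \<alpha>: "\<alpha> \<in> E"
      have ax: "arr \<alpha> \<odot>\<^bsub>X\<^esub> x \<in> carrier X" by (rule right_module.smult_closed[OF X elem_closed(4) x])
      have "h1 (arr \<alpha> \<odot>\<^bsub>Y\<^esub> j x) = fst (g (arr \<alpha> \<odot>\<^bsub>X\<^esub> x))"
        using mod_homD(3)[OF j(1) elem_closed(4) x, of \<alpha>] h1j[OF ax] by simp
      also have "\<dots> = snd (g x) \<alpha>"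
        unfolding mod_homD(3)[OF g elem_closed(4) x] by (rule fst_arr_coind[OF M gx \<alpha>])
      finally show "h1 (arr \<alpha> \<odot>\<^bsub>Y\<^esub> j x) = snd (g x) \<alpha>" .
    qed
    then show ?thesis unfolding h_def h1j[OF x] coind_mod_memD(5)[OF M gx] by simp
  qed
  ultimately show ?thesis by blast
qed

lemma coind_mod_fg:
  assumes M: "ss M" "finitely_generated R M"
  shows "finitely_generated R (coind_mod M)"
proof -
  let ?C = "mod_sum E (\<lambda>\<alpha>. shift M (tgt \<alpha>) (src \<alpha>))"
  have rm: "right_module R M" by (rule ssD(1)[OF M(1)])
  have rC: "right_module R ?C"
    by (intro right_module_mod_sum ring_axioms ssD(1) ss_shift M src_V)
  have fC: "finitely_generated R ?C"
    by (intro finitely_generated_mod_sum ring_axioms finite_E conjI ssD(1) ss_shift shift_fg M tgt_V src_V)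
  have "mod_iso R (deg (coind_mod M)) (mod_sum2 M ?C)"
    unfolding mod_iso_def
  proof (rule bexI[of _ id])
    show "id \<in> mod_hom R (deg (coind_mod M)) (mod_sum2 M ?C)"
    proof (rule mod_homI)
      fix a p assume a: "a \<in> carrier R" and p: "p \<in> carrier (deg (coind_mod M))"
      have 1: "fst (a \<odot>\<^bsub>deg (coind_mod M)\<^esub> p) = a \<odot>\<^bsub>M\<^esub> fst p" by (rule mod_homD(3)[OF coind_fst_hom[OF M(1)] a p])
      have "snd (a \<odot>\<^bsub>deg (coind_mod M)\<^esub> p) = (\<lambda>\<alpha>\<in>E. sca (cv a (src \<alpha>)) \<odot>\<^bsub>M\<^esub> snd p \<alpha>)"
        by (simp add: diag_def cong: restrict_cong)
      with 1 show "id (a \<odot>\<^bsub>deg (coind_mod M)\<^esub> p) = a \<odot>\<^bsub>mod_sum2 M ?C\<^esub> id p"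
        by (intro prod_eqI) simp_all
    qed (simp_all cong: PiE_cong)
    show "bij_betw id (carrier (deg (coind_mod M))) (carrier (mod_sum2 M ?C))"
      by (simp cong: PiE_cong)
  qed
  then have "mod_iso R (mod_sum2 M ?C) (deg (coind_mod M))"
    by (rule mod_iso_sym[OF _ right_module_deg[OF right_module_coind_mod[OF M(1)]]])
  then have "finitely_generated R (deg (coind_mod M))"
    by (rule finitely_generated_iso[OF right_module_mod_sum2[OF rm rC] right_module_deg[OF right_module_coind_mod[OF M(1)]]
          _ finitely_generated_mod_sum2[OF rm rC M(2) fC]])
  then show ?thesis by (rule finitely_generated_from_deg[OF right_module_coind_mod[OF M(1)]])
qed

text \<open>M sits in its coinduced module as the elements with zero slots, and the quotient is the
  sum of the slots. This makes the choice in \<open>cosyzygy\<close> meaningful.\<close>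

lemma cosyzygy_exists:
  fixes M :: "('r, nat \<Rightarrow> 'k) module"
  assumes M: "ss M" "M \<in> fg_modules R"
  shows "\<exists>(N :: ('r, nat \<Rightarrow> 'k) module) I f g. N \<in> fg_modules R \<and> injective_envelope R M f I \<and> g \<in> mod_hom R I N \<and>
    g ` carrier I = carrier N \<and> a_kernel I N g = f ` carrier M"
proof -
  have rm: "right_module R M" by (rule ssD(1)[OF M(1)])
  interpret M: right_module R M by (rule rm)
  have fM: "finitely_generated R M" by (rule fg_modulesD(2)[OF M(2)])
  let ?I = "coind_mod M" and ?C = "mod_sum E (\<lambda>\<alpha>. shift M (tgt \<alpha>) (src \<alpha>))"
  have rI: "right_module R ?I" by (rule right_module_coind_mod[OF M(1)])
  have rC: "right_module R ?C"
    by (intro right_module_mod_sum ring_axioms ssD(1) ss_shift M src_V)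
  have fC: "finitely_generated R ?C"
    by (intro finitely_generated_mod_sum ring_axioms finite_E conjI ssD(1) ss_shift shift_fg M fM tgt_V src_V)
  obtain I :: "('r, nat \<Rightarrow> 'k) module" where I: "I \<in> fg_modules R" "mod_iso R ?I I"
    using fg_copy[OF rI coind_mod_fg[OF M(1) fM]] by blast
  obtain N :: "('r, nat \<Rightarrow> 'k) module" where N: "N \<in> fg_modules R" "mod_iso R ?C N"
    using fg_copy[OF rC fC] by blast
  obtain u where u: "u \<in> mod_hom R ?I I" "bij_betw u (carrier ?I) (carrier I)" using I(2) unfolding mod_iso_def by blast
  obtain w where w: "w \<in> mod_hom R ?C N" "bij_betw w (carrier ?C) (carrier N)" using N(2) unfolding mod_iso_def by blast
  let ?v = "inv_into (carrier ?I) u"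
  have v: "?v \<in> mod_hom R I ?I" by (rule mod_hom_inv[OF u rI])
  have vb: "bij_betw ?v (carrier I) (carrier ?I)" by (rule bij_betw_inv_into[OF u(2)])
  have uv: "u (?v x) = x" if "x \<in> carrier I" for x by (rule f_inv_into_f) (use u(2) that in \<open>simp add: bij_betw_def\<close>)
  have vu: "?v (u x) = x" if "x \<in> carrier ?I" for x by (rule inv_into_f_f[OF bij_betw_imp_inj_on[OF u(2)] that])
  have z: "\<zero>\<^bsub>M\<^esub> \<in> comp M k" for k using submoduleD(3)[OF submodule_comp[OF M(1)]] .
  let ?e = "\<lambda>m. (m, \<lambda>\<alpha>\<in>E. \<zero>\<^bsub>M\<^esub>)"
  have ec: "?e m \<in> carrier ?I" if "m \<in> carrier M" for m using that z by simp
  have e: "?e \<in> mod_hom R M ?I"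
  proof (rule mod_homI[OF ec])
    fix x y assume "x \<in> carrier M" "y \<in> carrier M"
    have "(\<lambda>\<alpha>\<in>E. (\<lambda>\<alpha>\<in>E. \<zero>\<^bsub>M\<^esub>) \<alpha> \<oplus>\<^bsub>M\<^esub> (\<lambda>\<alpha>\<in>E. \<zero>\<^bsub>M\<^esub>) \<alpha>) = (\<lambda>\<alpha>\<in>E. \<zero>\<^bsub>M\<^esub>)" by (rule restrict_ext) simp
    then show "?e (x \<oplus>\<^bsub>M\<^esub> y) = ?e x \<oplus>\<^bsub>?I\<^esub> ?e y" unfolding coind_mod_simps fst_conv snd_conv by (simp only:)
  next
    fix a m assume a: "a \<in> carrier R" and m: "m \<in> carrier M"
    have "(\<lambda>\<alpha>\<in>E. sca (cv a (src \<alpha>)) \<odot>\<^bsub>M\<^esub> (\<lambda>\<alpha>\<in>E. \<zero>\<^bsub>M\<^esub>) \<alpha>) = (\<lambda>\<alpha>\<in>E. \<zero>\<^bsub>M\<^esub>)" by (rule restrict_ext) simp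
    moreover have "arr_sum M a (\<lambda>\<alpha>\<in>E. \<zero>\<^bsub>M\<^esub>) = (\<Oplus>\<^bsub>M\<^esub>\<alpha>\<in>E. \<zero>\<^bsub>M\<^esub>)"
      unfolding arr_sum_def by (rule M.M.finsum_cong') auto
    moreover have "a \<odot>\<^bsub>M\<^esub> m \<in> carrier M" using a m by (simp add: M.smult_closed)
    ultimately show "?e (a \<odot>\<^bsub>M\<^esub> m) = a \<odot>\<^bsub>?I\<^esub> ?e m" unfolding coind_mod_simps fst_conv snd_conv by simp
  qed
  let ?f = "\<lambda>m. u (?e m)" and ?g = "\<lambda>x. w (snd (?v x))"
  have f: "?f \<in> mod_hom R M I" by (rule mod_hom_comp[OF e u(1)])
  have g: "?g \<in> mod_hom R I N" by (rule mod_hom_comp[OF mod_hom_comp[OF v coind_snd_hom] w(1)])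
  have fI: "?f m \<in> carrier I" if "m \<in> carrier M" for m by (rule mod_homD(1)[OF f that])
  have inj: "inj_on ?f (carrier M)"
  proof (rule inj_onI)
    fix x y assume xy: "x \<in> carrier M" "y \<in> carrier M" "?f x = ?f y"
    then have "?e x = ?e y" using inj_onD[OF bij_betw_imp_inj_on[OF u(2)] xy(3) ec ec] by blast
    then show "x = y" by simp
  qed
  have injI: "injective_mod R I"
    unfolding injective_mod_def
  proof (intro ballI impI)
    fix X Y :: "('r, nat \<Rightarrow> 'k) module" and j g
    assume X: "X \<in> fg_modules R" and Y: "Y \<in> fg_modules R" and j: "j \<in> mod_hom R X Y"
      and g: "g \<in> mod_hom R X I" and inj: "inj_on j (carrier X)"
    obtain h where h: "h \<in> mod_hom R Y ?I" "\<forall>x\<in>carrier X. h (j x) = ?v (g x)"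
      using coind_extend[OF M(1) fg_modulesD(1)[OF X] fg_modulesD[OF Y] j inj mod_hom_comp[OF g v]] by blast
    have "u (h (j x)) = g x" if x: "x \<in> carrier X" for x
      using h(2) x uv[OF mod_homD(1)[OF g x]] by simp
    then show "\<exists>h\<in>mod_hom R Y I. \<forall>x\<in>carrier X. h (j x) = g x"
      by (intro bexI[OF _ mod_hom_comp[OF h(1) u(1)]] ballI)
  qed
  \<comment> \<open>An arrow moves its slot of \<open>x\<close> into the first component. A
    submodule meeting M trivially therefore has only elements with zero slots, which means that it
    lies in M.\<close>
  have ess: "K = {\<zero>\<^bsub>I\<^esub>}" if K: "submodule K R I" "K \<inter> ?f ` carrier M = {\<zero>\<^bsub>I\<^esub>}" for K
  proof -
    note Kd = submoduleD[OF K(1)]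
    have v0: "?v \<zero>\<^bsub>I\<^esub> = \<zero>\<^bsub>?I\<^esub>" by (rule mod_hom_zero[OF v fg_modulesD(1)[OF I(1)] rI])
    have key: "x = \<zero>\<^bsub>I\<^esub>" if x: "x \<in> K" "snd (?v x) = (\<lambda>\<alpha>\<in>E. \<zero>\<^bsub>M\<^esub>)" for x
    proof -
      have c: "?v x \<in> carrier ?I" by (rule mod_homD(1)[OF v Kd(2)[OF x(1)]])
      have "?v x = ?e (fst (?v x))" by (intro prod_eqI) (use x(2) in simp_all)
      then have "x = ?f (fst (?v x))" using uv[OF Kd(2)[OF x(1)]] by metis
      moreover have "fst (?v x) \<in> carrier M" by (rule coind_mod_memD(1)[OF M(1) c])
      ultimately have "x \<in> ?f ` carrier M" by (rule image_eqI)
      then have "x \<in> K \<inter> ?f ` carrier M" using x(1) by (rule IntI[rotated])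
      then show ?thesis unfolding K(2) by simp
    qed
    have "x = \<zero>\<^bsub>I\<^esub>" if x: "x \<in> K" for x
    proof (rule key[OF x])
      have xI: "x \<in> carrier I" by (rule Kd(2)[OF x])
      have c: "?v x \<in> carrier ?I" by (rule mod_homD(1)[OF v xI])
      have "snd (?v x) \<beta> = \<zero>\<^bsub>M\<^esub>" if \<beta>: "\<beta> \<in> E" for \<beta>
      proof -
        have K2: "arr \<beta> \<odot>\<^bsub>I\<^esub> x \<in> K" by (rule Kd(6)[OF elem_closed(4) x])
        have va: "?v (arr \<beta> \<odot>\<^bsub>I\<^esub> x) = arr \<beta> \<odot>\<^bsub>?I\<^esub> ?v x" by (rule mod_homD(3)[OF v elem_closed(4) xI])
        have "snd (arr \<beta> \<odot>\<^bsub>?I\<^esub> ?v x) = (\<lambda>\<alpha>\<in>E. \<zero>\<^bsub>M\<^esub>)"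
          unfolding coind_mod_simps snd_conv using coind_mod_memD(2)[OF M(1) c]
          by (intro restrict_ext) (simp add: arr_def sca_zero)
        then have "arr \<beta> \<odot>\<^bsub>I\<^esub> x = \<zero>\<^bsub>I\<^esub>" using key[OF K2] va by simp
        then have "arr \<beta> \<odot>\<^bsub>?I\<^esub> ?v x = \<zero>\<^bsub>?I\<^esub>" using va v0 by simp
        then have "snd (?v x) \<beta> = fst \<zero>\<^bsub>?I\<^esub>" using fst_arr_coind[OF M(1) c \<beta>] by metis
        then show ?thesis by simp
      qed
      then have "restrict (snd (?v x)) E = (\<lambda>\<alpha>\<in>E. \<zero>\<^bsub>M\<^esub>)" by (intro restrict_ext)
      then show "snd (?v x) = (\<lambda>\<alpha>\<in>E. \<zero>\<^bsub>M\<^esub>)" unfolding coind_mod_memD(5)[OF M(1) c] .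
    qed
    then show ?thesis using Kd(3) by blast
  qed
  have env: "injective_envelope R M ?f I"
    unfolding injective_envelope_def
  proof (intro conjI allI impI)
    fix K assume "submodule K R I \<and> K \<inter> ?f ` carrier M = {\<zero>\<^bsub>I\<^esub>}"
    then show "K = {\<zero>\<^bsub>I\<^esub>}" using ess[of K] by simp
  qed (rule I(1) injI f inj)+
  have surj: "?g ` carrier I = carrier N"
  proof (intro equalityI subsetI)
    fix n assume "n \<in> carrier N"
    then have "n \<in> w ` carrier ?C" unfolding bij_betw_imp_surj_on[OF w(2)] .
    then obtain c where c: "c \<in> carrier ?C" "n = w c" by (rule imageE)
    have "(\<zero>\<^bsub>M\<^esub>, c) \<in> carrier ?I" using c(1) by (simp cong: PiE_cong)
    then have "?g (u (\<zero>\<^bsub>M\<^esub>, c)) = n" "u (\<zero>\<^bsub>M\<^esub>, c) \<in> carrier I"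
      using vu[of "(\<zero>\<^bsub>M\<^esub>, c)"] mod_homD(1)[OF u(1)] c(2) by (simp_all del: coind_mod_simps)
    then show "n \<in> ?g ` carrier I" by (intro image_eqI[of n ?g "u (\<zero>\<^bsub>M\<^esub>, c)"]) simp_all
  next
    fix n assume "n \<in> ?g ` carrier I"
    then show "n \<in> carrier N" using mod_homD(1)[OF g] by blast
  qed
  have w0: "w \<zero>\<^bsub>?C\<^esub> = \<zero>\<^bsub>N\<^esub>" by (rule mod_hom_zero[OF w(1) rC fg_modulesD(1)[OF N(1)]])
  have ker: "a_kernel I N ?g = ?f ` carrier M"
  proof (intro equalityI subsetI)
    fix x assume "x \<in> a_kernel I N ?g"
    then have x: "x \<in> carrier I" "w (snd (?v x)) = \<zero>\<^bsub>N\<^esub>" by (simp_all add: a_kernel_def')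
    have c: "?v x \<in> carrier ?I" by (rule mod_homD(1)[OF v x(1)])
    have "snd (?v x) = \<zero>\<^bsub>?C\<^esub>"
      by (rule inj_onD[OF bij_betw_imp_inj_on[OF w(2)]])
        (use x(2) w0 mod_homD(1)[OF coind_snd_hom c] submoduleD(3)[OF submodule_UNIV[OF rC]] in simp_all)
    then have "?v x = ?e (fst (?v x))" by (intro prod_eqI) simp_all
    then have "x = ?f (fst (?v x))" by (rule subst[of _ _ "\<lambda>y. x = u y"]) (rule uv[OF x(1), symmetric])
    then show "x \<in> ?f ` carrier M"
      by (intro image_eqI[of x ?f "fst (?v x)"] coind_mod_memD(1)[OF M(1) c])
  next
    fix x assume "x \<in> ?f ` carrier M"
    then obtain m where m: "x = ?f m" "m \<in> carrier M" by (rule imageE)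
    note m = m(2,1)
    have "?g (?f m) = w \<zero>\<^bsub>?C\<^esub>" unfolding vu[OF ec[OF m(1)]] by simp
    then show "x \<in> a_kernel I N ?g" unfolding a_kernel_def' using fI[OF m(1)] m(2) w0 by simp
  qed
  show ?thesis
    by (intro exI[of _ N] exI[of _ I] exI[of _ "?f"] exI[of _ "?g"] conjI N(1) env g surj ker)
qed

section \<open>Full support is preserved by syzygies and cosyzygies\<close>

lemma soc_line_hom:
  assumes "right_module R M" "b \<in> soc M" "idem i \<odot>\<^bsub>M\<^esub> b = b" "i \<in> V"
  shows "(\<lambda>k. sca k \<odot>\<^bsub>M\<^esub> b) \<in> mod_hom R (simp_mod i) M"
proof -
  let ?S = "M\<lparr>carrier := soc M\<rparr>"
  have "(\<lambda>k. sca k \<odot>\<^bsub>?S\<^esub> b) \<in> mod_hom R (simp_mod i) ?S"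
    by (rule line_hom[OF ss_sub_soc[OF assms(1) submodule_soc[OF assms(1)] order_refl]]) (use assms in simp_all)
  then show ?thesis
    using mod_homD[of "\<lambda>k. sca k \<odot>\<^bsub>?S\<^esub> b" R "simp_mod i" ?S] submoduleD(2)[OF submodule_soc[OF assms(1)]]
    by (intro mod_homI) auto
qed

lemma simp_mod_fg:
  assumes "i \<in> V"
  shows "finitely_generated R (simp_mod i)"
proof (rule finitely_generatedI[of "{1}"])
  fix U assume U: "submodule U R (simp_mod i)" "{1} \<subseteq> U"
  have "k \<in> U" for k
    using submoduleD(6)[OF U(1) elem_closed(2), of 1 k] U(2) assms by (simp add: sca_def)
  then show "U = carrier (simp_mod i)" by auto
qed auto

lemma ssI_soc:
  assumes "right_module R N" "\<And>\<alpha> x. \<alpha> \<in> E \<Longrightarrow> x \<in> carrier N \<Longrightarrow> arr \<alpha> \<odot>\<^bsub>N\<^esub> x = \<zero>\<^bsub>N\<^esub>"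
  shows "ss N"
proof (rule ssI[OF assms(1)])
  fix a x assume "a \<in> carrier R" "x \<in> carrier N"
  then show "a \<odot>\<^bsub>N\<^esub> x = diag a \<odot>\<^bsub>N\<^esub> x"
    using assms(2) by (intro soc_smult[OF assms(1)]) (auto simp: soc_def)
qed

definition full :: "('r, 'm) module \<Rightarrow> bool" where
  "full M \<longleftrightarrow> (\<forall>i\<in>V. \<exists>x\<in>carrier M. idem i \<odot>\<^bsub>M\<^esub> x \<noteq> \<zero>\<^bsub>M\<^esub>)"

text \<open>Holds for every injective envelope I of M. Arrows carry I into M, so the cokernel is
  semisimple. For a vertex \<open>k\<close> take an arrow \<alpha> from \<open>k\<close> to
  \<open>i\<close>: injectivity yields an element of I of degree \<open>k\<close> that \<alpha>
  sends to a nonzero element of M in degree \<open>i\<close>, and such an element survives in the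
  cokernel.\<close>

lemma cosyzygy_full:
  fixes M :: "('r, nat \<Rightarrow> 'k) module"
  assumes M: "ss M" "M \<in> fg_modules R" "full M" and nosink: "\<And>i. i \<in> V \<Longrightarrow> \<exists>\<alpha>\<in>E. src \<alpha> = i"
  shows "cosyzygy R M \<in> fg_modules R \<and> ss (cosyzygy R M) \<and> full (cosyzygy R M)"
  unfolding cosyzygy_def
proof (rule someI2_ex)
  show "\<exists>N :: ('r, nat \<Rightarrow> 'k) module. N \<in> fg_modules R \<and> (\<exists>I f g. injective_envelope R M f I \<and> g \<in> mod_hom R I N \<and>
      g ` carrier I = carrier N \<and> a_kernel I N g = f ` carrier M)"
  proof -
    obtain N :: "('r, nat \<Rightarrow> 'k) module" and I f g where *: "N \<in> fg_modules R" "injective_envelope R M f I" "g \<in> mod_hom R I N"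
      "g ` carrier I = carrier N" "a_kernel I N g = f ` carrier M"
      using cosyzygy_exists[OF M(1,2)] by (elim exE conjE)
    then show ?thesis by (intro exI[of _ N] exI[of _ I] exI[of _ f] exI[of _ g] conjI)
  qed
  fix N :: "('r, nat \<Rightarrow> 'k) module"
  assume "N \<in> fg_modules R \<and> (\<exists>I f g. injective_envelope R M f I \<and> g \<in> mod_hom R I N \<and>
      g ` carrier I = carrier N \<and> a_kernel I N g = f ` carrier M)"
  then obtain I f g where NF: "N \<in> fg_modules R" and env: "injective_envelope R M f I"
    and g: "g \<in> mod_hom R I N" "g ` carrier I = carrier N" "a_kernel I N g = f ` carrier M" by (elim exE conjE)
  have IF: "I \<in> fg_modules R" and inj: "injective_mod R I" and f: "f \<in> mod_hom R M I" "inj_on f (carrier M)"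
    and ess: "\<And>K. submodule K R I \<Longrightarrow> K \<inter> f ` carrier M = {\<zero>\<^bsub>I\<^esub>} \<Longrightarrow> K = {\<zero>\<^bsub>I\<^esub>}"
    using env by (auto simp: injective_envelope_def)
  have rM: "right_module R M" and rI: "right_module R I" and rN: "right_module R N"
    using fg_modulesD(1) M(2) IF NF by auto
  interpret I: right_module R I by (rule rI)
  have im: "submodule (f ` carrier M) R I" by (rule submodule_image[OF f(1) rM rI submodule_UNIV[OF rM]])
  have f0: "f \<zero>\<^bsub>M\<^esub> = \<zero>\<^bsub>I\<^esub>" by (rule mod_hom_zero[OF f(1) rM rI])
  \<comment> \<open>A product with an arrow lies in the socle. Outside the image of M its line would
    meet that image trivially, against essentiality.\<close>
  have arrI: "arr \<alpha> \<odot>\<^bsub>I\<^esub> y \<in> f ` carrier M" if \<alpha>: "\<alpha> \<in> E" and y: "y \<in> carrier I" for \<alpha> y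
  proof (rule ccontr)
    let ?z = "arr \<alpha> \<odot>\<^bsub>I\<^esub> y"
    assume nz: "?z \<notin> f ` carrier M"
    have zI: "?z \<in> carrier I" using y by (simp add: I.smult_closed)
    have zs: "?z \<in> soc I" using rad_le_soc[OF rI] arr_in_rad[OF rI \<alpha> y] by blast
    have zi: "idem (tgt \<alpha>) \<odot>\<^bsub>I\<^esub> ?z = ?z"
      using arr_smult(2)[OF rI elem_closed(3) y, of "tgt \<alpha>" \<alpha>] \<alpha> zI by (simp add: idem_def sca_one I.smult_one)
    have rS: "right_module R (simp_mod (tgt \<alpha>))" by (rule right_module_simp_mod[OF tgt_V[OF \<alpha>]])
    have K: "submodule ((\<lambda>k. sca k \<odot>\<^bsub>I\<^esub> ?z) ` carrier (simp_mod (tgt \<alpha>))) R I"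
      by (rule submodule_image[OF soc_line_hom[OF rI zs zi tgt_V[OF \<alpha>]] rS rI submodule_UNIV[OF rS]])
    have "(\<lambda>k. sca k \<odot>\<^bsub>I\<^esub> ?z) ` carrier (simp_mod (tgt \<alpha>)) \<inter> f ` carrier M = {\<zero>\<^bsub>I\<^esub>}"
    proof (intro equalityI subsetI)
      fix x assume "x \<in> (\<lambda>k. sca k \<odot>\<^bsub>I\<^esub> ?z) ` carrier (simp_mod (tgt \<alpha>)) \<inter> f ` carrier M"
      then obtain k where k: "x = sca k \<odot>\<^bsub>I\<^esub> ?z" "sca k \<odot>\<^bsub>I\<^esub> ?z \<in> f ` carrier M" by auto
      have "k = 0" using sca_cancel[OF rI im zI k(2)] nz by blast
      then show "x \<in> {\<zero>\<^bsub>I\<^esub>}" using k(1) zI by (simp add: sca_zero)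
    next
      fix x assume "x \<in> {\<zero>\<^bsub>I\<^esub>}"
      then show "x \<in> (\<lambda>k. sca k \<odot>\<^bsub>I\<^esub> ?z) ` carrier (simp_mod (tgt \<alpha>)) \<inter> f ` carrier M"
        using submoduleD(3)[OF K] submoduleD(3)[OF im] by blast
    qed
    then have "(\<lambda>k. sca k \<odot>\<^bsub>I\<^esub> ?z) ` carrier (simp_mod (tgt \<alpha>)) = {\<zero>\<^bsub>I\<^esub>}" by (rule ess[OF K])
    moreover have "?z \<in> (\<lambda>k. sca k \<odot>\<^bsub>I\<^esub> ?z) ` carrier (simp_mod (tgt \<alpha>))"
      by (rule image_eqI[of _ _ 1]) (use zI in \<open>simp_all add: sca_one I.smult_one\<close>)
    ultimately have "?z = \<zero>\<^bsub>I\<^esub>" by blast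
    then show False using nz submoduleD(3)[OF im] by simp
  qed
  have ssN: "ss N"
  proof (rule ssI_soc[OF rN])
    fix \<alpha> n assume \<alpha>: "\<alpha> \<in> E" and "n \<in> carrier N"
    then obtain y where y: "y \<in> carrier I" "n = g y" using g(2) by blast
    have "arr \<alpha> \<odot>\<^bsub>I\<^esub> y \<in> a_kernel I N g" unfolding g(3) by (rule arrI[OF \<alpha> y(1)])
    then show "arr \<alpha> \<odot>\<^bsub>N\<^esub> n = \<zero>\<^bsub>N\<^esub>"
      using mod_homD(3)[OF g(1) elem_closed(4) y(1), of \<alpha>] y(2) by (simp add: a_kernel_def')
  qed
  have "full N"
    unfolding full_def
  proof
    fix k assume k: "k \<in> V"
    obtain \<alpha> where \<alpha>: "\<alpha> \<in> E" "src \<alpha> = k" using nosink[OF k] by blast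
    let ?i = "tgt \<alpha>"
    obtain x0 where x0: "x0 \<in> carrier M" "idem ?i \<odot>\<^bsub>M\<^esub> x0 \<noteq> \<zero>\<^bsub>M\<^esub>"
      using bspec[OF M(3)[unfolded full_def] tgt_V[OF \<alpha>(1)]] by (elim bexE)
    let ?x = "idem ?i \<odot>\<^bsub>M\<^esub> x0"
    have x: "?x \<in> carrier M" "idem ?i \<odot>\<^bsub>M\<^esub> ?x = ?x"
      using x0(1) idem_idem[OF rM x0(1), of ?i ?i] right_module.smult_closed[OF rM elem_closed(3) x0(1)] by auto
    have fx: "f ?x \<in> carrier I" "f ?x \<noteq> \<zero>\<^bsub>I\<^esub>" "idem ?i \<odot>\<^bsub>I\<^esub> f ?x = f ?x"
      using mod_homD(1)[OF f(1) x(1)] inj_on_eq_iff[OF f(2) x(1) submoduleD(3)[OF submodule_UNIV[OF rM]]] x0(2) f0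
        mod_homD(3)[OF f(1) elem_closed(3) x(1), of ?i] x(2) by auto
    have fsoc: "f m \<in> soc I" if m: "m \<in> carrier M" for m
    proof -
      have "m \<in> soc M" using ss_soc[OF M(1)] m by simp
      then have "arr \<beta> \<odot>\<^bsub>I\<^esub> f m = \<zero>\<^bsub>I\<^esub>" if "\<beta> \<in> E" for \<beta>
        using mod_homD(3)[OF f(1) elem_closed(4) m, of \<beta>] that f0 by (simp add: soc_def)
      then show ?thesis using mod_homD(1)[OF f(1) m] by (simp add: soc_def)
    qed
    let ?S = "simp_mod k"
    have S: "ss ?S" "right_module R ?S" "finitely_generated R ?S"
      using ss_simp_mod[OF k] right_module_simp_mod[OF k] simp_mod_fg[OF k] by auto
    \<comment> \<open>The indecomposable projective module at \<open>k\<close>: its generator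
      \<open>?p\<close> has degree \<open>k\<close> and is not killed by \<alpha>.\<close>
    let ?F = "ind_mod ?S"
    have rF: "right_module R ?F" by (rule right_module_ind_mod[OF S(1)])
    obtain Y :: "('r, nat \<Rightarrow> 'k) module" where Y: "Y \<in> fg_modules R" "mod_iso R ?F Y"
      using fg_copy[OF rF ind_mod_fg[OF S(1,3)]] by blast
    have rY: "right_module R Y" by (rule fg_modulesD(1)[OF Y(1)])
    obtain u where u: "u \<in> mod_hom R ?F Y" "bij_betw u (carrier ?F) (carrier Y)" using Y(2) unfolding mod_iso_def by blast
    let ?p = "(1, \<lambda>\<alpha>\<in>E. \<zero>\<^bsub>?S\<^esub>)"
    have pd: "?p \<in> carrier (deg ?F)" by (rule mod_homD(1)[OF ind_mod_top[OF S(1)]]) simp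
    then have p: "?p \<in> carrier ?F" unfolding deg_simps .
    have "idem k \<odot>\<^bsub>deg ?F\<^esub> ?p = (idem k \<odot>\<^bsub>?S\<^esub> 1, \<lambda>\<alpha>\<in>E. \<zero>\<^bsub>?S\<^esub>)"
      by (rule mod_homD(3)[OF ind_mod_top[OF S(1)] elem_closed(3), symmetric]) simp
    moreover have "idem k \<odot>\<^bsub>?S\<^esub> 1 = 1" using k by (simp add: idem_def)
    ultimately have pk: "idem k \<odot>\<^bsub>?F\<^esub> ?p = ?p" unfolding deg_simps diag_elem by (simp only:)
    have a1: "snd (arr \<alpha> \<odot>\<^bsub>?F\<^esub> ?p) \<alpha> = 1"
      unfolding arr_ind_mod[OF S(1) p \<alpha>(1)] using \<alpha> k by (simp add: idem_def)
    have ap: "arr \<alpha> \<odot>\<^bsub>?F\<^esub> ?p \<noteq> \<zero>\<^bsub>?F\<^esub>"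
    proof
      assume "arr \<alpha> \<odot>\<^bsub>?F\<^esub> ?p = \<zero>\<^bsub>?F\<^esub>"
      then show False using a1 \<alpha>(1) by (simp del: ind_mod_simps(4))
    qed
    let ?y = "u ?p"
    have y: "?y \<in> carrier Y" "idem k \<odot>\<^bsub>Y\<^esub> ?y = ?y"
      using mod_homD(1)[OF u(1) p] mod_homD(3)[OF u(1) elem_closed(3) p, of k] pk by auto
    let ?z = "arr \<alpha> \<odot>\<^bsub>Y\<^esub> ?y"
    have apF: "arr \<alpha> \<odot>\<^bsub>?F\<^esub> ?p \<in> carrier ?F" by (rule right_module.smult_closed[OF rF elem_closed(4) p])
    have "?z = u (arr \<alpha> \<odot>\<^bsub>?F\<^esub> ?p)" by (rule mod_homD(3)[OF u(1) elem_closed(4) p, symmetric])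
    then have z0: "?z \<noteq> \<zero>\<^bsub>Y\<^esub>"
      using inj_on_eq_iff[OF bij_betw_imp_inj_on[OF u(2)] apF submoduleD(3)[OF submodule_UNIV[OF rF]]] ap
        mod_hom_zero[OF u(1) rF rY] by metis
    have zY: "?z \<in> carrier Y" by (rule right_module.smult_closed[OF rY elem_closed(4) y(1)])
    have zs: "?z \<in> soc Y" using rad_le_soc[OF rY] arr_in_rad[OF rY \<alpha>(1) y(1)] by blast
    have zi: "idem ?i \<odot>\<^bsub>Y\<^esub> ?z = ?z"
      using arr_smult(2)[OF rY elem_closed(3) y(1), of ?i \<alpha>] \<alpha>(1) right_module.smult_one[OF rY zY]
      by (simp add: idem_def sca_one)
    have i: "?i \<in> V" using \<alpha>(1) by simp
    have rSi: "right_module R (simp_mod ?i)" by (rule right_module_simp_mod[OF i])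
    obtain X :: "('r, nat \<Rightarrow> 'k) module" where X: "X \<in> fg_modules R" "mod_iso R (simp_mod ?i) X"
      using fg_copy[OF rSi simp_mod_fg[OF i]] by blast
    obtain w where w: "w \<in> mod_hom R X (simp_mod ?i)" "bij_betw w (carrier X) (carrier (simp_mod ?i))"
      using mod_iso_sym[OF X(2) rSi] unfolding mod_iso_def by blast
    \<comment> \<open>A copy of the simple module at \<open>?i\<close> is embedded in Y as the line
      of \<open>?z\<close> and mapped to I as the line of \<open>f ?x\<close>. The extension to Y
      sends \<open>?y\<close> to the element wanted.\<close>
    let ?j = "\<lambda>x. sca (w x) \<odot>\<^bsub>Y\<^esub> ?z" and ?q = "\<lambda>x. sca (w x) \<odot>\<^bsub>I\<^esub> f ?x"
    have j: "?j \<in> mod_hom R X Y" by (rule mod_hom_comp[OF w(1) soc_line_hom[OF rY zs zi i]])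
    have q: "?q \<in> mod_hom R X I" by (rule mod_hom_comp[OF w(1) soc_line_hom[OF rI fsoc[OF x(1)] fx(3) i]])
    have jinj: "inj_on ?j (carrier X)"
    proof (rule inj_onI)
      fix s t assume st: "s \<in> carrier X" "t \<in> carrier X" "?j s = ?j t"
      interpret Y: right_module R Y by (rule rY)
      have "sca (w s - w t) \<odot>\<^bsub>Y\<^esub> ?z \<oplus>\<^bsub>Y\<^esub> ?j t = \<zero>\<^bsub>Y\<^esub> \<oplus>\<^bsub>Y\<^esub> ?j t"
        using zY st(3) sca_add[of "w s - w t" "w t"] by (simp add: Y.smult_closed flip: Y.smult_add_left)
      then have "sca (w s - w t) \<odot>\<^bsub>Y\<^esub> ?z = \<zero>\<^bsub>Y\<^esub>" using zY by (simp add: Y.smult_closed)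
      then have "w s = w t"
        using sca_cancel[OF rY submodule_zero[OF rY] zY, of "w s - w t"] z0 by auto
      then show "s = t" by (rule inj_onD[OF bij_betw_imp_inj_on[OF w(2)] _ st(1,2)])
    qed
    obtain h where h: "h \<in> mod_hom R Y I" "\<forall>x\<in>carrier X. h (?j x) = ?q x"
      using inj[unfolded injective_mod_def, rule_format, OF X(1) Y(1) j q jinj] by (elim bexE)
    obtain s where s: "s \<in> carrier X" "w s = 1" proof -
      have "1 \<in> w ` carrier X" using bij_betw_imp_surj_on[OF w(2)] by simp
      then show thesis using that by force
    qed
    have "h ?z = f ?x"
      using h(2) s fx(1) right_module.smult_one[OF rY zY] by (auto simp: sca_one I.smult_one)
    then have ah: "arr \<alpha> \<odot>\<^bsub>I\<^esub> h ?y = f ?x" using mod_homD(3)[OF h(1) elem_closed(4) y(1), of \<alpha>] by simp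
    have hy: "h ?y \<in> carrier I" by (rule mod_homD(1)[OF h(1) y(1)])
    \<comment> \<open>Arrows kill the image of the semisimple module M, but \<alpha> does not kill
      \<open>h ?y\<close>.\<close>
    have "h ?y \<notin> f ` carrier M"
      using fsoc ah fx(2) \<alpha>(1) by (auto simp: soc_def)
    then have "g (h ?y) \<noteq> \<zero>\<^bsub>N\<^esub>" unfolding g(3)[symmetric] using hy by (simp add: a_kernel_def')
    moreover have "idem k \<odot>\<^bsub>N\<^esub> g (h ?y) = g (h ?y)"
      using mod_homD(3)[OF g(1) elem_closed(3) hy, of k] mod_homD(3)[OF h(1) elem_closed(3) y(1), of k] y(2) by simp
    ultimately show "\<exists>n\<in>carrier N. idem k \<odot>\<^bsub>N\<^esub> n \<noteq> \<zero>\<^bsub>N\<^esub>"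
      using mod_homD(1)[OF g(1) hy] by (intro bexI[of _ "g (h ?y)"]) simp_all
  qed
  then show "N \<in> fg_modules R \<and> ss N \<and> full N" using NF ssN by blast
qed

lemma vec_ss:
  assumes "ss M" "finitely_generated R M" "i \<in> V"
  shows "dvec M i = int (dimv M i)" "rvec M i = 0" "svec M i = int (dimv M i)"
proof -
  have rm: "right_module R M" by (rule ssD(1)[OF assms(1)])
  have d: "dimv (deg M) i = dimv M i"
    by (rule dimv_iso[OF assms(1,2) right_module_deg[OF rm] mod_iso_sym[OF deg_ss[OF assms(1)] right_module_deg[OF rm]] assms(3)])
  then show "dvec M i = int (dimv M i)" by (simp add: dvec_def)
  have "(deg M)\<lparr>carrier := soc M\<rparr> = deg M" unfolding ss_soc[OF assms(1)] by (simp add: deg_def)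
  then show "svec M i = int (dimv M i)" using d by (simp add: svec_def)
  have s: "submodule (rad M) R (deg M)" by (rule submodule_deg[OF rm submodule_rad[OF rm]])
  have "dimv ((deg M)\<lparr>carrier := rad M\<rparr>) i = 0"
    using dimv_zero_iff[OF ss_sub[OF ss_deg[OF rm] s] ss_sub_fg[OF ss_deg[OF rm] finitely_generated_deg[OF rm assms(2)] s] assms(3)]
      right_module.smult_zero_right[OF rm] by (simp add: rad_ss[OF assms(1)])
  then show "rvec M i = 0" by (simp add: rvec_def)
qed

text \<open>For semisimple M the radical vanishes, so \<open>om M i\<close> adds up the dimensions
  of M at the sources of the arrows into \<open>i\<close>, and there is at least one such
  arrow.\<close>

lemma syzygy_full:
  fixes M :: "('r, nat \<Rightarrow> 'k) module"
  assumes M: "ss M" "M \<in> fg_modules R" "full M" and nosource: "\<And>i. i \<in> V \<Longrightarrow> \<exists>\<alpha>\<in>E. tgt \<alpha> = i"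
  shows "syzygy R M \<in> fg_modules R \<and> ss (syzygy R M) \<and> full (syzygy R M)"
proof -
  note s = syzygy_props[OF M(2)]
  have fM: "finitely_generated R M" by (rule fg_modulesD(2)[OF M(2)])
  have "\<exists>x\<in>carrier (syzygy R M). idem i \<odot>\<^bsub>syzygy R M\<^esub> x \<noteq> \<zero>\<^bsub>syzygy R M\<^esub>" if i: "i \<in> V" for i
  proof -
    obtain \<alpha> where \<alpha>: "\<alpha> \<in> E" "tgt \<alpha> = i" using nosource[OF i] by blast
    have "om M i = (\<Sum>\<alpha>\<in>E. if tgt \<alpha> = i then int (dimv M (src \<alpha>)) else 0)"
      unfolding om_def vec_ss(2)[OF M(1) fM i] using vec_ss[OF M(1) fM] by (simp cong: if_cong)
    also have "\<dots> > 0"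
    proof (rule sum_pos2[OF finite_E \<alpha>(1)])
      have "dimv M (src \<alpha>) \<noteq> 0"
        using dimv_zero_iff[OF M(1) fM src_V[OF \<alpha>(1)]] M(3) src_V[OF \<alpha>(1)] unfolding full_def by blast
      then show "0 < (if tgt \<alpha> = i then int (dimv M (src \<alpha>)) else 0)" using \<alpha>(2) by simp
    qed simp
    finally have d: "dimv (syzygy R M) i \<noteq> 0" using s(3)[OF i] by simp
    show ?thesis using d unfolding dimv_zero_iff[OF s(2) fg_modulesD(2)[OF s(1)] i] by simp
  qed
  then show ?thesis using s by (simp add: full_def)
qed

lemma iterated_full:
  fixes M :: "('r, nat \<Rightarrow> 'k) module"
  assumes M: "ss M" "M \<in> fg_modules R" "full M"
    and nosink: "\<And>i. i \<in> V \<Longrightarrow> \<exists>\<alpha>\<in>E. src \<alpha> = i" and nosource: "\<And>i. i \<in> V \<Longrightarrow> \<exists>\<alpha>\<in>E. tgt \<alpha> = i"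
  shows "full ((syzygy R ^^ n) M)" "full ((cosyzygy R ^^ n) M)"
proof -
  have "(syzygy R ^^ n) M \<in> fg_modules R \<and> ss ((syzygy R ^^ n) M) \<and> full ((syzygy R ^^ n) M)"
    using M nosource by (induction n) (auto simp: syzygy_full)
  then show "full ((syzygy R ^^ n) M)" by blast
  have "(cosyzygy R ^^ n) M \<in> fg_modules R \<and> ss ((cosyzygy R ^^ n) M) \<and> full ((cosyzygy R ^^ n) M)"
    using M nosink by (induction n) (auto simp: cosyzygy_full)
  then show "full ((cosyzygy R ^^ n) M)" by blast
qed

lemma sum_of_simples:
  fixes M :: "('r, nat \<Rightarrow> 'k) module"
  shows "\<exists>M :: ('r, nat \<Rightarrow> 'k) module. M \<in> fg_modules R \<and> mod_iso R M (mod_sum V simp_mod)"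
    "M \<in> fg_modules R \<Longrightarrow> mod_iso R M (mod_sum V simp_mod) \<Longrightarrow> ss M \<and> full M"
proof -
  let ?S = "mod_sum V simp_mod"
  have S: "ss ?S" "right_module R ?S" by (auto intro!: ss_mod_sum ss_simp_mod intro: ssD(1))
  have fS: "finitely_generated R ?S"
    by (intro finitely_generated_mod_sum ring_axioms finite_V conjI right_module_simp_mod simp_mod_fg)
  show "\<exists>M :: ('r, nat \<Rightarrow> 'k) module. M \<in> fg_modules R \<and> mod_iso R M ?S"
    using fg_copy[OF S(2) fS] mod_iso_sym[OF _ S(2)] by blast
  assume M: "M \<in> fg_modules R" "mod_iso R M ?S"
  have iso: "mod_iso R ?S M" by (rule mod_iso_sym[OF M(2) fg_modulesD(1)[OF M(1)]])
  have ssM: "ss M" by (rule ss_iso[OF S(1) fg_modulesD(1)[OF M(1)] iso])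
  have "\<exists>x\<in>carrier M. idem i \<odot>\<^bsub>M\<^esub> x \<noteq> \<zero>\<^bsub>M\<^esub>" if i: "i \<in> V" for i
  proof -
    have "dimv M i = dimv ?S i" by (rule dimv_iso[OF S(1) fS fg_modulesD(1)[OF M(1)] iso i])
    also have "\<dots> = (\<Sum>j\<in>V. dimv (simp_mod j) i)"
      by (rule dimv_mod_sum[OF finite_V _ i]) (intro conjI ss_simp_mod simp_mod_fg)
    also have "\<dots> \<noteq> 0" using dimv_simp_mod[OF i i] i by (auto intro!: bexI[of _ i])
    finally have d: "dimv M i \<noteq> 0" .
    show ?thesis using d unfolding dimv_zero_iff[OF ssM fg_modulesD(2)[OF M(1)] i] by simp
  qed
  then show "ss M \<and> full M" using ssM by (simp add: full_def)
qed

end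

section \<open>Homomorphisms from the group \<open>K\<^sub>0\<close>\<close>

lemma iso_class_self: "M \<in> fg_modules R \<Longrightarrow> M \<in> iso_class R M"
  by (simp add: iso_class_def mod_iso_refl)

lemma iso_class_eqI:
  assumes "M \<in> fg_modules R" "N \<in> fg_modules R" "mod_iso R M N"
  shows "iso_class R M = iso_class R N"
proof -
  have "mod_iso R N M" using mod_iso_sym[OF assms(3)] assms(1) by (auto simp: fg_modules_def)
  then show ?thesis using assms by (auto simp: iso_class_def intro: mod_iso_trans)
qed

lemma comm_group_K0_free: "comm_group (K0_free R)"
  unfolding K0_free_def by (rule abelian_free_Abelian_group)

lemma K0_free_simps [simp]:
  "x \<in> carrier (K0_free R) \<longleftrightarrow> Poly_Mapping.keys x \<subseteq> iso_class R ` fg_modules R"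
  "x \<otimes>\<^bsub>K0_free R\<^esub> y = x + y" "\<one>\<^bsub>K0_free R\<^esub> = 0"
  by (simp_all add: K0_free_def)

lemma K0_free_inv: "x \<in> carrier (K0_free R) \<Longrightarrow> inv\<^bsub>K0_free R\<^esub> x = - x"
  by (simp add: K0_free_def)

abbreviation K0_generators :: "('r, 'x) ring_scheme \<Rightarrow> (('r, 'm) module set \<Rightarrow>\<^sub>0 int) set" where
  "K0_generators R \<equiv> {frag_of (iso_class R M) - frag_of (iso_class R M') - frag_of (iso_class R M'') | M M' M''.
      M \<in> fg_modules R \<and> M' \<in> fg_modules R \<and> M'' \<in> fg_modules R \<and> mod_iso R M (mod_sum2 M' M'')}
    \<union> {frag_of (iso_class R P) | P. P \<in> fg_modules R \<and> projective_mod R P}"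

lemma K0_generators_closed: "K0_generators R \<subseteq> carrier (K0_free R)"
  using keys_diff by (auto simp: dest!: subsetD[OF keys_diff])

lemma subgroup_K0_relations: "subgroup (K0_relations R) (K0_free R)"
  unfolding K0_relations_def
  by (intro group.generate_is_subgroup comm_group.axioms(2) comm_group_K0_free K0_generators_closed)

lemma normal_K0_relations: "K0_relations R \<lhd> K0_free R"
  using comm_group.normal_iff_subgroup[OF comm_group_K0_free] subgroup_K0_relations by blast

lemma comm_group_K0: "comm_group (K0 R)"
  unfolding K0_def by (rule comm_group.abelian_FactGroup[OF comm_group_K0_free subgroup_K0_relations])

lemma K0_projection: "(\<lambda>x. K0_relations R #>\<^bsub>K0_free R\<^esub> x) \<in> hom (K0_free R) (K0 R)"
  unfolding K0_def by (rule normal.r_coset_hom_Mod[OF normal_K0_relations])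

lemma K0_class_closed [simp]: "M \<in> fg_modules R \<Longrightarrow> K0_class R M \<in> carrier (K0 R)"
  using hom_in_carrier[OF K0_projection, of "frag_of (iso_class R M)" R] by (simp add: K0_class_def)

lemma K0_class_iso:
  assumes "M \<in> fg_modules R" "N \<in> fg_modules R" "mod_iso R M N"
  shows "K0_class R M = K0_class R N"
  using iso_class_eqI[OF assms] by (simp add: K0_class_def)

lemma K0_relation_one:
  assumes "x \<in> K0_relations R"
  shows "K0_relations R #>\<^bsub>K0_free R\<^esub> x = \<one>\<^bsub>K0 R\<^esub>"
proof -
  interpret comm_group "K0_free R" by (rule comm_group_K0_free)
  show ?thesis
    using subgroup.rcos_const[OF subgroup_K0_relations group_axioms assms] by (simp add: K0_def)
qed

lemma K0_class_projective:
  assumes "P \<in> fg_modules R" "projective_mod R P"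
  shows "K0_class R P = \<one>\<^bsub>K0 R\<^esub>"
  unfolding K0_class_def
  by (rule K0_relation_one) (use assms in \<open>auto simp: K0_relations_def intro!: generate.incl\<close>)

lemma K0_class_sum:
  fixes M :: "('a, 'c) module"
  assumes "M \<in> fg_modules R" "M' \<in> fg_modules R" "M'' \<in> fg_modules R" "mod_iso R M (mod_sum2 M' M'')"
  shows "K0_class R M = K0_class R M' \<otimes>\<^bsub>K0 R\<^esub> K0_class R M''"
proof -
  interpret comm_group "K0 R" by (rule comm_group_K0)
  let ?f = "\<lambda>M. frag_of (iso_class R M)" and ?p = "\<lambda>x. K0_relations R #>\<^bsub>K0_free R\<^esub> x"
  have "?f M - ?f M' - ?f M'' \<in> K0_relations R"
    unfolding K0_relations_def by (rule generate.incl) (use assms in blast)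
  then have 1: "?p (?f M - ?f M' - ?f M'') = \<one>\<^bsub>K0 R\<^esub>" by (rule K0_relation_one)
  have c: "?f M - ?f M' - ?f M'' \<in> carrier (K0_free R)"
    using subgroup.subset[OF subgroup_K0_relations] \<open>_ \<in> K0_relations R\<close> by blast
  interpret F: comm_group "K0_free R :: (('a, 'c) module set \<Rightarrow>\<^sub>0 int) monoid" by (rule comm_group_K0_free)
  have d: "?f M' \<in> carrier (K0_free R)" "?f M'' \<in> carrier (K0_free R)" using assms by simp_all
  have "?p ((?f M - ?f M' - ?f M'') \<otimes>\<^bsub>K0_free R\<^esub> (?f M' \<otimes>\<^bsub>K0_free R\<^esub> ?f M'')) =
      \<one>\<^bsub>K0 R\<^esub> \<otimes>\<^bsub>K0 R\<^esub> (?p (?f M') \<otimes>\<^bsub>K0 R\<^esub> ?p (?f M''))"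
    unfolding hom_mult[OF K0_projection c F.m_closed[OF d]] hom_mult[OF K0_projection d] 1 ..
  also have "\<dots> = ?p (?f M') \<otimes>\<^bsub>K0 R\<^esub> ?p (?f M'')"
    using hom_in_carrier[OF K0_projection d(1)] hom_in_carrier[OF K0_projection d(2)] by simp
  finally show ?thesis by (simp add: K0_class_def)
qed

text \<open>The free group is generated by isomorphism classes, and \<open>K0\<close> is a quotient
  of it. Homomorphisms out of \<open>K0\<close> are thus determined by their values on
  modules.\<close>

lemma K0_generated:
  fixes R :: "('r, 'x) ring_scheme"
  defines "K \<equiv> K0 R :: (('r, 'm) module set \<Rightarrow>\<^sub>0 int) set monoid"
  shows "carrier K = generate K (K0_class R ` fg_modules R)"
proof
  let ?F = "K0_free R :: (('r, 'm) module set \<Rightarrow>\<^sub>0 int) monoid"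
  let ?p = "\<lambda>x. K0_relations R #>\<^bsub>?F\<^esub> x"
  interpret K: comm_group K unfolding K_def by (rule comm_group_K0)
  interpret F: comm_group ?F by (rule comm_group_K0_free)
  have hp: "?p \<in> hom ?F K" unfolding K_def by (rule K0_projection)
  interpret p: group_hom ?F K ?p
    by (intro group_hom.intro group_hom_axioms.intro hp K.group_axioms F.group_axioms)
  let ?G = "generate K (K0_class R ` fg_modules R)"
  have inc: "K0_class R ` fg_modules R \<subseteq> carrier K" unfolding K_def by auto
  show "?G \<subseteq> carrier K" by (rule K.generate_incl[OF inc])
  show "carrier K \<subseteq> ?G"
  proof
    fix y assume "y \<in> carrier K"
    then obtain x where x: "x \<in> carrier ?F" "y = ?p x"
      unfolding K_def K0_def carrier_FactGroup by blast
    have "?p x \<in> ?G"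
    proof (rule free_Abelian_group_induct[of x "iso_class R ` fg_modules R"])
      show "Poly_Mapping.keys x \<subseteq> iso_class R ` fg_modules R" using x(1) by simp
      show "?p 0 \<in> ?G" using p.hom_one generate.one[of K] by simp
    next
      fix u v :: "('r, 'm) module set \<Rightarrow>\<^sub>0 int"
      assume uv: "Poly_Mapping.keys u \<subseteq> iso_class R ` fg_modules R" "Poly_Mapping.keys v \<subseteq> iso_class R ` fg_modules R"
        "?p u \<in> ?G" "?p v \<in> ?G"
      have c: "u \<in> carrier ?F" "v \<in> carrier ?F" using uv(1,2) by simp_all
      have "u - v = u \<otimes>\<^bsub>?F\<^esub> inv\<^bsub>?F\<^esub> v" unfolding K0_free_inv[OF c(2)] by simp
      then have "?p (u - v) = ?p u \<otimes>\<^bsub>K\<^esub> inv\<^bsub>K\<^esub> ?p v"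
        using p.hom_mult[OF c(1) F.inv_closed[OF c(2)]] p.hom_inv[OF c(2)] by (simp only:)
      then show "?p (u - v) \<in> ?G"
        using generate.eng[OF uv(3) K.generate_m_inv_closed[OF inc uv(4)]] by (simp only:)
    next
      fix a assume "a \<in> iso_class R ` (fg_modules R :: ('r, 'm) module set)"
      then show "?p (frag_of a) \<in> ?G" by (auto simp: K0_class_def intro!: generate.incl)
    qed
    then show "y \<in> ?G" using x(2) by (simp only:)
  qed
qed

lemma hom_eq_on_generate:
  assumes "group G" "group H" "h \<in> hom G H" "h' \<in> hom G H" "X \<subseteq> carrier G" "\<And>x. x \<in> X \<Longrightarrow> h x = h' x"
    and g: "g \<in> generate G X"
  shows "h g = h' g"
proof -
  interpret h: group_hom G H h using assms by (intro group_hom.intro group_hom_axioms.intro)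
  interpret h': group_hom G H h' using assms by (intro group_hom.intro group_hom_axioms.intro)
  show ?thesis
    using g
  proof (induction rule: generate.induct)
    case (eng a b)
    then show ?case using group.generate_in_carrier[OF assms(1,5)] by simp
  next
    case (inv a)
    then have "a \<in> carrier G" using assms(5) by blast
    then show ?case using assms(6) inv by simp
  qed (use assms(6) in auto)
qed

text \<open>The universal property of \<open>K0\<close>: \<open>f\<close> descends to isomorphism
  classes, extends to the free group and kills the generators of the relations. The endomorphism
  \<Omega> and the functionals on \<open>K0\<close> are all obtained from it.\<close>

lemma K0_hom_exists:
  fixes R :: "('r, 'x) ring_scheme" and f :: "('r, 'm) module \<Rightarrow> 'h"
  assumes H: "comm_group H" and f: "\<And>M. M \<in> fg_modules R \<Longrightarrow> f M \<in> carrier H"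
    and iso: "\<And>M N. \<lbrakk>M \<in> fg_modules R; N \<in> fg_modules R; mod_iso R M N\<rbrakk> \<Longrightarrow> f N = f M"
    and add: "\<And>M M' M''. \<lbrakk>M \<in> fg_modules R; M' \<in> fg_modules R; M'' \<in> fg_modules R; mod_iso R M (mod_sum2 M' M'')\<rbrakk>
      \<Longrightarrow> f M = f M' \<otimes>\<^bsub>H\<^esub> f M''"
    and proj: "\<And>P. \<lbrakk>P \<in> fg_modules R; projective_mod R P\<rbrakk> \<Longrightarrow> f P = \<one>\<^bsub>H\<^esub>"
  shows "\<exists>h. h \<in> hom (K0 R) H \<and> (\<forall>M\<in>fg_modules R. h (K0_class R M) = f M)"
proof -
  interpret H: comm_group H by (rule H)
  interpret F: comm_group "K0_free R :: (('r, 'm) module set \<Rightarrow>\<^sub>0 int) monoid" by (rule comm_group_K0_free)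
  \<comment> \<open>The value is read off from some representative; invariance under isomorphism
    makes the choice irrelevant.\<close>
  define f' where "f' c = f (SOME M. M \<in> fg_modules R \<and> iso_class R M = c)" for c :: "('r, 'm) module set"
  have f': "f' (iso_class R M) = f M" if M: "M \<in> fg_modules R" for M
  proof -
    let ?N = "SOME N. N \<in> fg_modules R \<and> iso_class R N = iso_class R M"
    have N: "?N \<in> fg_modules R \<and> iso_class R ?N = iso_class R M" by (rule someI[of _ M]) (simp add: M)
    then have "M \<in> iso_class R ?N" using iso_class_self[OF M] by simp
    then show ?thesis unfolding f'_def using iso[of ?N M] N M by (simp add: iso_class_def)
  qed
  have "f' ` iso_class R ` fg_modules R \<subseteq> carrier H" using f' f by auto
  then obtain g where g: "g \<in> hom (K0_free R) H"
      "\<And>c. c \<in> iso_class R ` fg_modules R \<Longrightarrow> g (frag_of c) = f' c"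
    unfolding K0_free_def using H.free_Abelian_group_universal by blast
  interpret g: group_hom "K0_free R" H g
    by (intro group_hom.intro group_hom_axioms.intro g(1) F.group_axioms H.group_axioms)
  have gf: "g (frag_of (iso_class R M)) = f M" if "M \<in> fg_modules R" for M
    using g(2) f' that by simp
  have ker: "K0_relations R \<subseteq> kernel (K0_free R) H g"
    unfolding K0_relations_def
  proof (rule F.generate_subgroup_incl[OF _ g.subgroup_kernel], rule subsetI)
    fix x :: "('r, 'm) module set \<Rightarrow>\<^sub>0 int" assume x: "x \<in> K0_generators R"
    have xc: "x \<in> carrier (K0_free R)" using K0_generators_closed[of R] x by blast
    have "g x = \<one>\<^bsub>H\<^esub>"
      using x
    proof
      assume "x \<in> {frag_of (iso_class R P) | P. P \<in> fg_modules R \<and> projective_mod R (P :: ('r, 'm) module)}"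
      then show ?thesis using gf proj by auto
    next
      assume "x \<in> {frag_of (iso_class R M) - frag_of (iso_class R M') - frag_of (iso_class R M'') | M M' (M'' :: ('r, 'm) module).
         M \<in> fg_modules R \<and> M' \<in> fg_modules R \<and> M'' \<in> fg_modules R \<and> mod_iso R M (mod_sum2 M' M'')}"
      then obtain M M' M'' :: "('r, 'm) module" where M: "M \<in> fg_modules R" "M' \<in> fg_modules R" "M'' \<in> fg_modules R"
        "mod_iso R M (mod_sum2 M' M'')"
        and xe: "x = frag_of (iso_class R M) - frag_of (iso_class R M') - frag_of (iso_class R M'')" by blast
      have c: "frag_of (iso_class R M') \<in> carrier (K0_free R)" "frag_of (iso_class R M'') \<in> carrier (K0_free R)"
        using M by simp_all
      have "f M = g (x \<otimes>\<^bsub>K0_free R\<^esub> (frag_of (iso_class R M') \<otimes>\<^bsub>K0_free R\<^esub> frag_of (iso_class R M'')))"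
        using gf[OF M(1)] by (simp add: xe)
      also have "\<dots> = g x \<otimes>\<^bsub>H\<^esub> (f M' \<otimes>\<^bsub>H\<^esub> f M'')"
        unfolding g.hom_mult[OF xc F.m_closed[OF c]] g.hom_mult[OF c] gf[OF M(2)] gf[OF M(3)] ..
      finally have "g x \<otimes>\<^bsub>H\<^esub> f M = f M" using add[OF M] by simp
      then show ?thesis using H.r_cancel_one f[OF M(1)] g.hom_closed[OF xc] by simp
    qed
    then show "x \<in> kernel (K0_free R) H g" using xc by (simp add: kernel_def)
  qed
  obtain h where h: "h \<in> hom (K0 R) H"
      "\<And>x. x \<in> carrier (K0_free R) \<Longrightarrow> h (K0_relations R #>\<^bsub>K0_free R\<^esub> x) = g x"
    using g.FactGroup_universal_kernel[OF normal_K0_relations ker] unfolding K0_def by metis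
  have "h (K0_class R M) = f M" if "M \<in> fg_modules R" for M
    unfolding K0_class_def using h(2)[of "frag_of (iso_class R M)"] gf[OF that] that by simp
  then show ?thesis using h(1) by blast
qed

section \<open>Relations killed by a power of an endomorphism\<close>

lemma rat_clear_denominators:
  fixes x :: "'j \<Rightarrow> rat"
  assumes "finite J"
  shows "\<exists>d y. d > 0 \<and> (\<forall>j\<in>J. of_int (y j) = of_int d * x j)"
  using assms
proof (induction J rule: finite_induct)
  case empty
  show ?case by (rule exI[of _ 1]) simp
next
  case (insert j J)
  then obtain d y where d: "d > 0" "\<forall>j\<in>J. of_int (y j) = of_int d * x j" by blast
  obtain a b where ab: "quotient_of (x j) = (a, b)" by force
  have b: "b > 0" using quotient_of_denom_pos[OF ab] .
  have xj: "x j = of_int a / of_int b" by (rule quotient_of_div[OF ab])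
  have "of_int ((y(j := 0)) k * b + (if k = j then d * a else 0)) = of_int (d * b) * x k" if "k \<in> insert j J" for k
    using that d(2) insert.hyps(2) b by (auto simp: xj)
  then show ?case using d(1) b
    by (intro exI[of _ "d * b"] exI[of _ "\<lambda>k. (y(j := 0)) k * b + (if k = j then d * a else 0)"]) auto
qed

lemma hom_finprod_sum:
  assumes "comm_group G" "h \<in> hom G integer_group" "finite A" "f \<in> A \<rightarrow> carrier G"
  shows "h (finprod G f A) = (\<Sum>a\<in>A. h (f a))"
proof -
  interpret G: comm_group G by fact
  have one: "h \<one>\<^bsub>G\<^esub> = 0" using hom_one[OF assms(2) G.group_axioms group_integer_group] by simp
  show ?thesis
    using assms(3,4)
  proof (induction A rule: finite_induct)
    case (insert a A)
    then show ?case
      using hom_mult[OF assms(2), of "f a" "finprod G f A"] by (simp add: G.finprod_closed)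
  qed (simp add: one)
qed

lemma (in comm_group) hom_finprod:
  assumes "h \<in> hom G G" "finite A" "f \<in> A \<rightarrow> carrier G"
  shows "h (finprod G f A) = finprod G (\<lambda>a. h (f a)) A"
proof -
  have one: "h \<one> = \<one>" by (rule hom_one[OF assms(1) group_axioms group_axioms])
  show ?thesis
    using assms(2,3)
  proof (induction A rule: finite_induct)
    case (insert a A)
    then have "(\<lambda>a. h (f a)) \<in> A \<rightarrow> carrier G" "h (f a) \<in> carrier G"
      using hom_in_carrier[OF assms(1)] by auto
    then show ?case using insert hom_mult[OF assms(1)] by (simp add: finprod_closed)
  qed (simp add: one)
qed

lemma (in group) funpow_hom:
  assumes "h \<in> hom G G"
  shows "h ^^ n \<in> hom G G"
proof (induction n)
  case 0
  show ?case by (simp add: hom_def id_def)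
next
  case (Suc n)
  then show ?case using assms by (simp add: hom_def Pi_iff)
qed

text \<open>\<open>K0\<close> enters the counting only through these axioms:
  \<open>\<sigma> i\<close> stands for the class of the simple module at \<open>i\<close>, and W for
  the vertices that are neither sinks nor sources. The functionals \<open>mu\<close> make the
  elements \<open>\<sigma> i\<close> independent although G is not known to be free.\<close>

locale omega_group = comm_group G
  for G :: "('g, 'x) monoid_scheme" (structure) +
  fixes W :: "'v set" and \<sigma> :: "'v \<Rightarrow> 'g" and om mu :: "'v \<Rightarrow> 'g \<Rightarrow> int" and Om :: "'g \<Rightarrow> 'g"
  assumes finite_W: "finite W" and sigma_closed: "i \<in> W \<Longrightarrow> \<sigma> i \<in> carrier G"
    and om_hom: "i \<in> W \<Longrightarrow> om i \<in> hom G integer_group" and mu_hom: "i \<in> W \<Longrightarrow> mu i \<in> hom G integer_group"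
    and mu_sigma: "i \<in> W \<Longrightarrow> j \<in> W \<Longrightarrow> mu i (\<sigma> j) = (if i = j then 1 else 0)"
    and Om_hom: "Om \<in> hom G G"
    and Om_eq: "g \<in> carrier G \<Longrightarrow> Om g = (\<Otimes>i\<in>W. \<sigma> i [^] om i g)"
begin

lemma Om_pow_hom: "Om ^^ n \<in> hom G G"
  by (rule funpow_hom[OF Om_hom])

lemma Om_pow_closed [simp]: "g \<in> carrier G \<Longrightarrow> (Om ^^ n) g \<in> carrier G"
  by (rule hom_in_carrier[OF Om_pow_hom])

lemma Om_pow_mult: "g \<in> carrier G \<Longrightarrow> h \<in> carrier G \<Longrightarrow> (Om ^^ n) (g \<otimes> h) = (Om ^^ n) g \<otimes> (Om ^^ n) h"
  by (rule hom_mult[OF Om_pow_hom])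

lemma Om_pow_int_pow: "g \<in> carrier G \<Longrightarrow> (Om ^^ n) (g [^] (k :: int)) = (Om ^^ n) g [^] k"
  by (rule hom_int_pow[OF Om_pow_hom _ group_axioms group_axioms])

lemma Om_pow_one [simp]: "(Om ^^ n) \<one> = \<one>"
  by (rule hom_one[OF Om_pow_hom group_axioms group_axioms])

lemma Om_one [simp]: "Om \<one> = \<one>"
  using Om_pow_one[of 1] by simp

lemma Om_pow_pow: "(Om ^^ m) ((Om ^^ n) g) = (Om ^^ (m + n)) g"
  by (simp add: funpow_add)

lemma Om_pow_quotient_one:
  assumes "a \<in> carrier G" "b \<in> carrier G"
  shows "(Om ^^ n) (a \<otimes> inv b) = \<one> \<longleftrightarrow> (Om ^^ n) a = (Om ^^ n) b"
proof -
  have "(Om ^^ n) (inv b) = inv ((Om ^^ n) b)"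
    using Om_pow_int_pow[OF assms(2), of n "-1"] assms by (simp add: int_pow_neg)
  then have "(Om ^^ n) (a \<otimes> inv b) = (Om ^^ n) a \<otimes> inv ((Om ^^ n) b)"
    using Om_pow_mult assms by simp
  then show ?thesis
    using right_cancel[of "inv ((Om ^^ n) b)" "(Om ^^ n) a" "(Om ^^ n) b"] assms by simp
qed

lemma int_hom_pow: "h \<in> hom G integer_group \<Longrightarrow> g \<in> carrier G \<Longrightarrow> h (g [^] (k :: int)) = k * h g"
  using hom_int_pow[of h G integer_group g k] group_axioms by simp

lemma mu_Om:
  assumes "i \<in> W" "g \<in> carrier G"
  shows "mu i (Om g) = om i g"
proof -
  have "mu i (Om g) = (\<Sum>j\<in>W. mu i (\<sigma> j [^] om j g))"
    unfolding Om_eq[OF assms(2)]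
    by (rule hom_finprod_sum[OF comm_group_axioms mu_hom[OF assms(1)] finite_W]) (use sigma_closed in auto)
  also have "\<dots> = (\<Sum>j\<in>W. if j = i then om i g else 0)"
    by (rule sum.cong[OF refl]) (use int_hom_pow[OF mu_hom[OF assms(1)] sigma_closed] mu_sigma[OF assms(1)] in auto)
  also have "\<dots> = om i g" using assms(1) finite_W by simp
  finally show ?thesis .
qed

text \<open>By duality with \<open>mu\<close>, the kernel of \<open>Om\<close> is the solution set
  of card W homogeneous integral equations.\<close>

lemma Om_one_iff:
  assumes "g \<in> carrier G"
  shows "Om g = \<one> \<longleftrightarrow> (\<forall>i\<in>W. om i g = 0)"
proof
  assume "Om g = \<one>"
  then show "\<forall>i\<in>W. om i g = 0"
    using mu_Om[OF _ assms] hom_one[OF mu_hom group_axioms group_integer_group] by auto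
next
  assume "\<forall>i\<in>W. om i g = 0"
  then show "Om g = \<one>" unfolding Om_eq[OF assms] by (intro finprod_one_eqI) simp
qed

text \<open>Homogeneous equations hold for an element as soon as they hold for a nonzero multiple.
  The positive exponent matters: G itself may have torsion, the image of \<open>Om\<close> may
  not.\<close>

lemma Om_torsion_free:
  assumes "g \<in> carrier G" "(Om ^^ Suc n) g [^] (k :: int) = \<one>" "k \<noteq> 0"
  shows "(Om ^^ Suc n) g = \<one>"
proof -
  let ?h = "(Om ^^ n) g"
  have h: "?h \<in> carrier G" using assms(1) by simp
  have "Om (?h [^] k) = \<one>" using hom_int_pow[OF Om_hom h group_axioms group_axioms, of k] assms(2) by simp
  then have "\<forall>i\<in>W. om i (?h [^] k) = 0" using Om_one_iff[of "?h [^] k"] h by simp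
  then have "\<forall>i\<in>W. om i ?h = 0" using int_hom_pow[OF om_hom h] assms(3) by simp
  then show ?thesis using Om_one_iff[OF h] by simp
qed

text \<open>There are more unknown exponents than equations \<open>om i = 0\<close>, so a rational
  solution exists; its denominators are cleared.\<close>

lemma integer_relation:
  assumes "finite J" "card W < card J" "g \<in> J \<rightarrow> carrier G"
  shows "\<exists>x :: 'j \<Rightarrow> int. (\<exists>j\<in>J. x j \<noteq> 0) \<and> Om (\<Otimes>j\<in>J. g j [^] x j) = \<one>"
proof -
  obtain x :: "'j \<Rightarrow> rat" where x: "\<exists>j\<in>J. x j \<noteq> 0" "\<forall>i\<in>W. (\<Sum>j\<in>J. of_int (om i (g j)) * x j) = 0"
    using nontrivial_solution[OF finite_W assms(1,2), of "\<lambda>i j. of_int (om i (g j)) :: rat"] by blast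
  obtain d y where d: "d > (0 :: int)" "\<forall>j\<in>J. of_int (y j) = of_int d * x j"
    using rat_clear_denominators[OF assms(1)] by blast
  have c: "(\<lambda>j. g j [^] y j) \<in> J \<rightarrow> carrier G" using assms(3) by auto
  have "om i (\<Otimes>j\<in>J. g j [^] y j) = 0" if i: "i \<in> W" for i
  proof -
    have "(of_int (om i (\<Otimes>j\<in>J. g j [^] y j)) :: rat) = of_int (\<Sum>j\<in>J. y j * om i (g j))"
      unfolding hom_finprod_sum[OF comm_group_axioms om_hom[OF i] assms(1) c]
      using assms(3) by (intro arg_cong[of _ _ of_int] sum.cong refl int_hom_pow[OF om_hom[OF i]]) auto
    also have "\<dots> = (\<Sum>j\<in>J. of_int d * (of_int (om i (g j)) * x j))"
      unfolding of_int_sum of_int_mult by (rule sum.cong[OF refl]) (use d(2) in simp)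
    also have "\<dots> = 0" unfolding sum_distrib_left[symmetric] using x(2) i by simp
    finally show ?thesis by simp
  qed
  then have "Om (\<Otimes>j\<in>J. g j [^] y j) = \<one>" using Om_one_iff[OF finprod_closed[OF c]] by blast
  moreover obtain j where "j \<in> J" "x j \<noteq> 0" using x(1) by blast
  then have "j \<in> J" "(of_int (y j) :: rat) \<noteq> 0" using d by auto
  ultimately show ?thesis by (intro exI[of _ y]) auto
qed

text \<open>Applying the power of \<open>Om\<close> that kills all but the first nontrivial term of a relation isolates that term.\<close>

lemma orbit_relation:
  fixes x :: "nat \<Rightarrow> int"
  assumes v: "v \<in> carrier G" "(Om ^^ Suc m) v = \<one>" and x: "j < m" "x j \<noteq> 0"
    and rel: "Om (\<Otimes>j\<in>{..<m}. (Om ^^ j) v [^] x j) = \<one>"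
  shows "(Om ^^ m) v = \<one>"
proof -
  define k where "k = (LEAST j. x j \<noteq> 0)"
  have k: "x k \<noteq> 0" "k \<le> j" unfolding k_def by (rule LeastI[of _ j], rule x(2)) (rule Least_le, rule x(2))
  have below: "x j = 0" if "j < k" for j using not_less_Least[OF that[unfolded k_def]] by simp
  have km: "k < m" using k(2) x(1) by simp
  have big: "(Om ^^ n) v = \<one>" if "Suc m \<le> n" for n
  proof -
    have "(Om ^^ n) v = (Om ^^ (n - Suc m)) ((Om ^^ Suc m) v)"
      unfolding Om_pow_pow using that by (simp del: funpow.simps)
    then show ?thesis using v(2) by simp
  qed
  \<comment> \<open>\<open>Suc ?t\<close> is m - k: this power carries the term at k to the m-th
    iterate of v and every later term beyond it. One of the applications is supplied by
    \<open>rel\<close>.\<close>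
  let ?P = "\<lambda>n. (Om ^^ n)" and ?t = "m - 1 - k"
  have c: "(\<lambda>j. (Om ^^ j) v [^] x j) \<in> {..<m} \<rightarrow> carrier G" using v(1) by auto
  have "\<one> = (Om ^^ Suc ?t) (\<Otimes>j\<in>{..<m}. (Om ^^ j) v [^] x j)"
    unfolding funpow_Suc_right comp_def rel by simp
  also have "\<dots> = (\<Otimes>j\<in>{..<m}. (Om ^^ Suc ?t) ((Om ^^ j) v [^] x j))"
    by (rule hom_finprod[OF Om_pow_hom _ c]) simp
  also have "\<dots> = (\<Otimes>j\<in>{..<m}. if k = j then (Om ^^ m) v [^] x k else \<one>)"
  proof (rule finprod_cong')
    fix j assume j: "j \<in> {..<m}"
    have "(Om ^^ Suc ?t) ((Om ^^ j) v [^] x j) = (Om ^^ (Suc ?t + j)) v [^] x j"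
      using v(1) by (simp only: Om_pow_int_pow Om_pow_closed Om_pow_pow)
    also have "\<dots> = (if k = j then (Om ^^ m) v [^] x k else \<one>)"
    proof (cases j k rule: linorder_cases)
      case less then show ?thesis using below by simp
    next
      case equal then show ?thesis using km by simp
    next
      case greater
      then have "Suc m \<le> Suc ?t + j" using km by simp
      then show ?thesis using big[of "Suc ?t + j"] greater by (simp del: funpow.simps)
    qed
    finally show "(Om ^^ Suc ?t) ((Om ^^ j) v [^] x j) = (if k = j then (Om ^^ m) v [^] x k else \<one>)" .
  qed (use v(1) in auto)
  also have "\<dots> = (Om ^^ m) v [^] x k"
    using finprod_singleton[of k "{..<m}" "\<lambda>_. (Om ^^ m) v [^] x k"] km v(1) by (simp add: Pi_iff)
  finally have "(Om ^^ m) v [^] x k = \<one>" by simp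
  \<comment> \<open>Torsion-freeness requires a positive exponent, and m is positive because k <
    m.\<close>
  moreover obtain m' where "m = Suc m'" using km by (cases m) auto
  ultimately show ?thesis using Om_torsion_free[OF v(1) _ k(1), of m'] by simp
qed

text \<open>The iterates of v with exponent below m are more than card W, so they satisfy a
  relation. The kernels of the powers of \<open>Om\<close> are therefore stationary from the
  exponent card W + 1 on.\<close>

lemma kernel_chain:
  assumes "v \<in> carrier G" "(Om ^^ Suc m) v = \<one>" "card W < m"
  shows "(Om ^^ m) v = \<one>"
proof -
  obtain x :: "nat \<Rightarrow> int" where "\<exists>j\<in>{..<m}. x j \<noteq> 0" "Om (\<Otimes>j\<in>{..<m}. (Om ^^ j) v [^] x j) = \<one>"
    using integer_relation[of "{..<m}" "\<lambda>j. (Om ^^ j) v"] assms(1,3) by auto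
  then show ?thesis using orbit_relation[OF assms(1,2)] by auto
qed

text \<open>Guarantees that the minimum in the definition of \<phi> is taken over a nonempty
  set.\<close>

lemma Om_pow_inj_on:
  assumes H: "subgroup H G" and n: "card W < n"
  shows "inj_on Om ((Om ^^ n) ` H)"
proof (rule inj_onI)
  fix x y assume "x \<in> (Om ^^ n) ` H" "y \<in> (Om ^^ n) ` H" and eq: "Om x = Om y"
  then obtain a b where ab: "a \<in> H" "b \<in> H" "x = (Om ^^ n) a" "y = (Om ^^ n) b" by blast
  have c: "a \<in> carrier G" "b \<in> carrier G" using ab subgroup.mem_carrier[OF H] by auto
  have "(Om ^^ Suc n) (a \<otimes> inv b) = \<one>"
    unfolding Om_pow_quotient_one[OF c] using eq ab by simp
  then have "(Om ^^ n) (a \<otimes> inv b) = \<one>" using kernel_chain[of "a \<otimes> inv b" n] c n by simp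
  then show "x = y" unfolding Om_pow_quotient_one[OF c] using ab by simp
qed

lemma generate_pair_pow:
  assumes "a \<in> carrier G" "b \<in> carrier G"
  shows "a [^] (p :: int) \<otimes> b [^] (q :: int) \<in> generate G {a, b}"
proof -
  interpret H: subgroup "generate G {a, b}" G by (rule generate_is_subgroup) (use assms in simp)
  have "a [^] p \<in> generate G {a, b}" "b [^] q \<in> generate G {a, b}"
    using subgroup_int_pow_closed[OF H.subgroup_axioms] generate.incl[of _ "{a, b}" G] by auto
  then show ?thesis by simp
qed

text \<open>Here D is \<open>Suc (Suc d)\<close>. Since D - 1 is positive, torsion-freeness is
  available for both powers of \<open>Om\<close> involved.\<close>

lemma two_generators_large:
  assumes W: "card W \<le> Suc (Suc d)" and X: "X \<subseteq> carrier G"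
    and v: "v \<in> generate G X" "(Om ^^ Suc (Suc d)) v = \<one>" "(Om ^^ Suc d) v \<noteq> \<one>"
  shows "\<exists>a\<in>X. \<exists>b\<in>X. \<exists>w\<in>generate G {a, b}. (Om ^^ Suc (Suc d)) w = \<one> \<and> (Om ^^ Suc d) w \<noteq> \<one>"
proof (rule ccontr)
  assume neg: "\<not> ?thesis"
  have no: False if "a \<in> X" "b \<in> X" "(Om ^^ Suc (Suc d)) (a [^] p \<otimes> b [^] q) = \<one>"
    "(Om ^^ Suc d) (a [^] p \<otimes> b [^] q) \<noteq> \<one>" for a b and p q :: int
    using neg that generate_pair_pow[of a b p q] X by blast
  have vc: "v \<in> carrier G" by (rule generate_in_carrier[OF X v(1)])
  \<comment> \<open>If the power D - 1 killed all generators, it would kill v.\<close>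
  have "\<exists>y1\<in>X. (Om ^^ Suc d) y1 \<noteq> \<one>"
  proof (rule ccontr)
    assume n: "\<not> (\<exists>y1\<in>X. (Om ^^ Suc d) y1 \<noteq> \<one>)"
    have "(Om ^^ Suc d) v = (\<lambda>_. \<one>) v"
      by (rule hom_eq_on_generate[OF group_axioms group_axioms Om_pow_hom _ X _ v(1)]) (use n in \<open>auto simp: hom_def\<close>)
    then show False using v(3) by simp
  qed
  then obtain y1 where y1: "y1 \<in> X" "(Om ^^ Suc d) y1 \<noteq> \<one>" by blast
  have y1c: "y1 \<in> carrier G" using y1(1) X by blast
  \<comment> \<open>Taking y1 for both generators, the negated claim forbids that the power D kills
    it.\<close>
  have y1': "(Om ^^ Suc (Suc d)) y1 \<noteq> \<one>"
    using no[of y1 y1 1 0] y1 y1c by auto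
  have pair: "\<exists>(p :: int) (q :: int). q \<noteq> 0 \<and> (Om ^^ Suc d) (y1 [^] p \<otimes> y [^] q) = \<one>" if y: "y \<in> X" for y
  proof -
    have yc: "y \<in> carrier G" using y X by blast
    \<comment> \<open>Positions 0 to d hold the iterates of v, and the last two hold y1 and y. These
      are D + 1 elements, more than card W.\<close>
    define g where "g j = (if j = Suc d then y1 else if j = Suc (Suc d) then y else (Om ^^ j) v)" for j
    have gc: "g \<in> {..<Suc (Suc (Suc d))} \<rightarrow> carrier G" unfolding g_def using yc y1c vc by auto
    obtain x :: "nat \<Rightarrow> int" where x: "\<exists>j\<in>{..<Suc (Suc (Suc d))}. x j \<noteq> 0"
      "Om (\<Otimes>j\<in>{..<Suc (Suc (Suc d))}. g j [^] x j) = \<one>"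
      using integer_relation[OF _ _ gc] W by auto
    let ?r = "\<Otimes>j\<in>{..<Suc d}. (Om ^^ j) v [^] x j" and ?p = "x (Suc d)" and ?q = "x (Suc (Suc d))"
    have rc: "?r \<in> carrier G" using vc by (intro finprod_closed) auto
    have c0: "(\<lambda>j. g j [^] x j) \<in> {..<Suc d} \<rightarrow> carrier G" using gc by auto
    have r: "(\<Otimes>j\<in>{..<Suc d}. g j [^] x j) = ?r"
      by (rule finprod_cong') (use vc in \<open>auto simp: g_def\<close>)
    have s: "(\<Otimes>j\<in>{..<Suc (Suc (Suc d))}. g j [^] x j) = y1 [^] ?p \<otimes> y [^] ?q \<otimes> ?r"
    proof -
      have "(\<Otimes>j\<in>{..<Suc (Suc (Suc d))}. g j [^] x j) = g (Suc (Suc d)) [^] ?q \<otimes> (g (Suc d) [^] ?p \<otimes> (\<Otimes>j\<in>{..<Suc d}. g j [^] x j))"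
        unfolding lessThan_Suc[of "Suc (Suc d)"] lessThan_Suc[of "Suc d"]
        using gc by (subst finprod_insert, simp, simp, force, force)
          (subst finprod_insert, simp, simp, force, force, simp)
      also have "\<dots> = y1 [^] ?p \<otimes> y [^] ?q \<otimes> ?r"
        unfolding r using yc y1c rc by (simp add: g_def m_ac)
      finally show ?thesis .
    qed
    let ?w = "y1 [^] ?p \<otimes> y [^] ?q"
    have wc: "?w \<in> carrier G" using yc y1c by simp
    \<comment> \<open>The power D removes the part of the relation coming from v, leaving a
      statement about y1 and y alone.\<close>
    have killr: "(Om ^^ Suc (Suc d)) ?r = \<one>"
    proof -
      have "(Om ^^ Suc (Suc d)) ?r = (\<Otimes>j\<in>{..<Suc d}. (Om ^^ Suc (Suc d)) ((Om ^^ j) v [^] x j))"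
        by (rule hom_finprod[OF Om_pow_hom]) (use vc in auto)
      also have "\<dots> = \<one>"
      proof (rule finprod_one_eqI)
        fix j
        have "(Om ^^ Suc (Suc d)) ((Om ^^ j) v) = (Om ^^ j) ((Om ^^ Suc (Suc d)) v)"
          unfolding Om_pow_pow by (simp only: add.commute)
        then show "(Om ^^ Suc (Suc d)) ((Om ^^ j) v [^] x j) = \<one>"
          using vc v(2) by (simp add: Om_pow_int_pow del: funpow.simps)
      qed
      finally show ?thesis .
    qed
    have "(Om ^^ Suc (Suc d)) (?w \<otimes> ?r) = \<one>"
      unfolding funpow_Suc_right[of "Suc d"] comp_def using x(2) s by simp
    then have w1: "(Om ^^ Suc (Suc d)) ?w = \<one>"
      unfolding Om_pow_mult[OF wc rc] killr r_one[OF Om_pow_closed[OF wc]] .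
    then have w2: "(Om ^^ Suc d) ?w = \<one>" using no[OF y1(1) y] by blast
    \<comment> \<open>With q = 0 torsion-freeness gives p = 0, and what remains is a nontrivial
      relation among the iterates of v, excluded by \<open>orbit_relation\<close>.\<close>
    have "?q \<noteq> 0"
    proof
      assume q: "?q = 0"
      then have "(Om ^^ Suc (Suc d)) y1 [^] ?p = \<one>"
        using w1 y1c yc by (simp add: Om_pow_mult Om_pow_int_pow del: funpow.simps)
      then have p: "?p = 0" using Om_torsion_free[OF y1c, of "Suc d" ?p] y1' by blast
      have rel: "Om ?r = \<one>" using x(2) s p q rc yc y1c by simp
      have "\<exists>j<Suc d. x j \<noteq> 0" using x(1) p q by (auto simp: less_Suc_eq)
      then show False using orbit_relation[OF vc v(2) _ _ rel] v(3) by blast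
    qed
    then show ?thesis using w2 by blast
  qed
  \<comment> \<open>After applying the power D - 1 every generator is a rational multiple of y1,
    hence so is every element of the generated group. The exponents q stay nonzero when two
    relations are brought to the common exponent q q'.\<close>
  have "\<exists>(p :: int) (q :: int). q \<noteq> 0 \<and> (Om ^^ Suc d) (y1 [^] p \<otimes> g [^] q) = \<one>" if "g \<in> generate G X" for g
    using that
  proof (induction rule: generate.induct)
    case one
    show ?case by (rule exI[of _ 0], rule exI[of _ 1]) (use y1c in \<open>simp del: funpow.simps\<close>)
  next
    case (incl h)
    then show ?case by (rule pair)
  next
    case (inv h)
    then obtain p q :: int where "q \<noteq> 0" "(Om ^^ Suc d) (y1 [^] p \<otimes> h [^] q) = \<one>" using pair by blast
    moreover have "h \<in> carrier G" using inv X by blast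
    then have "(inv h) [^] (- q) = h [^] q" by (simp add: int_pow_inv int_pow_neg)
    ultimately show ?case by (intro exI[of _ p] exI[of _ "- q"]) (simp del: funpow.simps)
  next
    case (eng g h)
    then obtain p q p' q' :: int where 1: "q \<noteq> 0" "(Om ^^ Suc d) (y1 [^] p \<otimes> g [^] q) = \<one>"
      "q' \<noteq> 0" "(Om ^^ Suc d) (y1 [^] p' \<otimes> h [^] q') = \<one>" by blast
    have c: "g \<in> carrier G" "h \<in> carrier G" using eng generate_in_carrier[OF X] by auto
    have "y1 [^] (p * q' + p' * q) \<otimes> (g \<otimes> h) [^] (q * q') =
        (y1 [^] p \<otimes> g [^] q) [^] q' \<otimes> (y1 [^] p' \<otimes> h [^] q') [^] q"
      using c y1c by (simp add: int_pow_distrib int_pow_pow int_pow_mult m_ac mult.commute)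
    also have "(Om ^^ Suc d) \<dots> = \<one>"
      using c y1c 1 by (simp add: Om_pow_mult[of "_ [^] q'" "_ [^] q"] Om_pow_int_pow del: funpow.simps)
    finally show ?case using 1 by (intro exI[of _ "p * q' + p' * q"] exI[of _ "q * q'"]) simp
  qed
  from this[OF v(1)] obtain p q :: int where q: "q \<noteq> 0" "(Om ^^ Suc d) (y1 [^] p \<otimes> v [^] q) = \<one>" by blast
  \<comment> \<open>One more application of \<open>Om\<close> kills v but no nonzero multiple of y1,
    so p = 0. Then the image of v under the power D - 1 is torsion, hence trivial.\<close>
  have "(Om ^^ Suc (Suc d)) (y1 [^] p \<otimes> v [^] q) = \<one>"
    using q(2) Om_pow_one[of 1] by (simp only: funpow.simps(2)[of "Suc d"] comp_apply) simp
  then have "(Om ^^ Suc (Suc d)) y1 [^] p = \<one>"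
    using y1c vc v(2) by (simp add: Om_pow_mult Om_pow_int_pow del: funpow.simps)
  then have p: "p = 0" using Om_torsion_free[OF y1c, of "Suc d" p] y1' by blast
  have "(Om ^^ Suc d) v [^] q = \<one>"
    using q(2) vc y1c unfolding p by (simp add: Om_pow_int_pow del: funpow.simps)
  then show False using Om_torsion_free[OF vc _ q(1)] v(3) by blast
qed

text \<open>With D = 1 the lower power of \<open>Om\<close> is the identity, and in G a nonzero
  multiple may be trivial without the element being so. The functionals \<open>mu\<close> take over:
  by \<open>indec\<close>, \<open>mu i\<close> vanishes on every generator other than
  \<open>\<sigma> i\<close>.\<close>

lemma two_generators_one:
  assumes W: "card W \<le> 1" and X: "X \<subseteq> carrier G"
    and v: "v \<in> generate G X" "Om v = \<one>" "v \<noteq> \<one>"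
    and indec: "\<And>i y. i \<in> W \<Longrightarrow> y \<in> X \<Longrightarrow> mu i y \<noteq> 0 \<Longrightarrow> y = \<sigma> i"
  shows "\<exists>a\<in>X \<union> \<sigma> ` W. \<exists>b\<in>X \<union> \<sigma> ` W. \<exists>w\<in>generate G {a, b}. Om w = \<one> \<and> w \<noteq> \<one>"
proof -
  have vc: "v \<in> carrier G" by (rule generate_in_carrier[OF X v(1)])
  have single: ?thesis if y: "y \<in> X \<union> \<sigma> ` W" "Om y = \<one>" "y \<noteq> \<one>" for y
    by (intro bexI[of _ y] conjI y generate.incl) simp
  show ?thesis
  proof (cases "\<exists>y\<in>X. Om y = \<one> \<and> y \<noteq> \<one>")
    case True
    then obtain y where y: "y \<in> X" "Om y = \<one>" "y \<noteq> \<one>" by (elim bexE conjE)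
    show ?thesis by (rule single[OF UnI1[OF y(1)] y(2,3)])
  next
    case False
    have notall: "\<not> X \<subseteq> {\<one>}"
    proof
      assume X1: "X \<subseteq> {\<one>}"
      have "id v = (\<lambda>_. \<one>) v"
        by (rule hom_eq_on_generate[where h = id and h' = "\<lambda>_. \<one>", OF group_axioms group_axioms _ _ X _ v(1)])
          (use X1 in \<open>auto simp: hom_def\<close>)
      then show False using v(3) by simp
    qed
    then obtain y0 where y0: "y0 \<in> X" "y0 \<noteq> \<one>" by blast
    then have "Om y0 \<noteq> \<one>" "y0 \<in> carrier G" using False X by auto
    \<comment> \<open>With empty W the map \<open>Om\<close> would be trivial, so W consists of
      exactly one vertex.\<close>
    then have "W \<noteq> {}" using Om_one_iff[of y0] by blast
    then have "card W \<noteq> 0" using finite_W by simp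
    then have "card W = 1" using W by linarith
    then obtain i where i: "W = {i}" by (rule card_1_singletonE)
    have sc: "\<sigma> i \<in> carrier G" using sigma_closed i by simp
    have s1: "\<sigma> i \<noteq> \<one>" using mu_sigma[of i i] hom_one[OF mu_hom group_axioms group_integer_group, of i] i by auto
    show ?thesis
    proof (cases "Om (\<sigma> i) = \<one>")
      case True
      show ?thesis by (rule single[OF _ True s1]) (simp add: i)
    next
      case s2: False
      \<comment> \<open>If only the unit and \<open>\<sigma> i\<close> occurred, v would be a power
        of \<open>\<sigma> i\<close>; as \<open>Om (\<sigma> i)\<close> is not torsion, v would be
        trivial.\<close>
      have "\<exists>y\<in>X. y \<noteq> \<one> \<and> y \<noteq> \<sigma> i"
      proof (rule ccontr)
        assume n: "\<not> ?thesis"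
        have "\<exists>c :: int. g = \<sigma> i [^] c" if "g \<in> generate G X" for g
          using that
        proof (induction rule: generate.induct)
          case one
          show ?case by (rule exI[of _ 0]) simp
        next
          case (incl h)
          then have "h = \<sigma> i [^] (0 :: int) \<or> h = \<sigma> i [^] (1 :: int)" using n sc by auto
          then show ?case by blast
        next
          case (inv h)
          then have "inv h = \<sigma> i [^] (0 :: int) \<or> inv h = \<sigma> i [^] (- 1 :: int)" using n sc by (auto simp: int_pow_neg)
          then show ?case by blast
        next
          case (eng g h)
          then obtain c d :: int where "g = \<sigma> i [^] c" "h = \<sigma> i [^] d" by blast
          then have "g \<otimes> h = \<sigma> i [^] (c + d)" using sc by (simp add: int_pow_mult)
          then show ?case by blast
        qed
        from this[OF v(1)] obtain c :: int where c: "v = \<sigma> i [^] c" by blast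
        then have "(Om ^^ Suc 0) (\<sigma> i) [^] c = \<one>" using v(2) Om_pow_int_pow[OF sc, of 1 c] by simp
        then have "c = 0" using Om_torsion_free[OF sc, of 0 c] s2 by auto
        then show False using c v(3) by simp
      qed
      then obtain y where y: "y \<in> X" "y \<noteq> \<one>" "y \<noteq> \<sigma> i" by blast
      have yc: "y \<in> carrier G" using y(1) X by blast
      have my: "mu i y = 0" using indec[of i y] y i by blast
      define g where "g j = (if j then \<sigma> i else y)" for j
      \<comment> \<open>Two elements and one equation give a relation between
        \<open>\<sigma> i\<close> and y modulo the kernel of \<open>Om\<close>.\<close>
      obtain x :: "bool \<Rightarrow> int" where x: "\<exists>j\<in>UNIV. x j \<noteq> 0" "Om (\<Otimes>j\<in>UNIV. g j [^] x j) = \<one>"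
        using integer_relation[of UNIV g] i sc yc by (auto simp: g_def UNIV_bool)
      have "(\<Otimes>j\<in>UNIV. g j [^] x j) = y [^] x False \<otimes> \<sigma> i [^] x True"
        unfolding UNIV_bool using sc yc by (simp add: g_def)
      then have e: "(\<Otimes>j\<in>UNIV. g j [^] x j) = \<sigma> i [^] x True \<otimes> y [^] x False" using sc yc by (simp add: m_comm)
      let ?w = "\<sigma> i [^] x True \<otimes> y [^] x False"
      \<comment> \<open>\<open>mu i\<close> reads off the exponent of \<open>\<sigma> i\<close>,
        which is thus zero. The other exponent is then nonzero, so \<open>Om y\<close> is torsion
        and hence trivial, a case already dealt with.\<close>
      have "?w \<noteq> \<one>"
      proof
        assume w: "?w = \<one>"
        have mi: "mu i \<in> hom G integer_group" using mu_hom i by simp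
        have "mu i ?w = x True"
          using hom_mult[OF mi, of "\<sigma> i [^] x True" "y [^] x False"] int_hom_pow[OF mi] sc yc my mu_sigma[of i i] i by simp
        then have t: "x True = 0" using w hom_one[OF mi group_axioms group_integer_group] by simp
        then have "(Om ^^ Suc 0) y [^] x False = \<one>" using x(2) e yc Om_pow_int_pow[OF yc, of 1] by simp
        moreover have "x False \<noteq> 0" using x(1) t by (metis (full_types))
        ultimately show False using Om_torsion_free[OF yc, of 0] False y by auto
      qed
      then show ?thesis
        using generate_pair_pow[OF sc yc, of "x True" "x False"] x(2) e y(1) i
        by (intro bexI[of _ "\<sigma> i"] bexI[of _ y] bexI[of _ ?w]) auto
    qed
  qed
qed

text \<open>Translates the minimal index into elements: the quotient of two points identified by
  \<open>Om\<close> is killed by one power of \<open>Om\<close> and not by the preceding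
  one.\<close>

lemma least_injective:
  fixes H :: "'g set"
  assumes H: "subgroup H G"
  defines "L \<equiv> LEAST l. \<forall>s. inj_on Om ((Om ^^ (l + s)) ` H)"
  shows "\<lbrakk>v \<in> H; (Om ^^ Suc d) v = \<one>; (Om ^^ d) v \<noteq> \<one>\<rbrakk> \<Longrightarrow> Suc d \<le> L"
    and "L = Suc d \<Longrightarrow> \<exists>v\<in>H. (Om ^^ Suc d) v = \<one> \<and> (Om ^^ d) v \<noteq> \<one>"
proof -
  let ?P = "\<lambda>l. \<forall>s. inj_on Om ((Om ^^ (l + s)) ` H)"
  have "?P (Suc (card W))" by (intro allI Om_pow_inj_on[OF H]) simp
  then have L: "?P L" unfolding L_def by (rule LeastI[of ?P])
  show "Suc d \<le> L" if v: "v \<in> H" "(Om ^^ Suc d) v = \<one>" "(Om ^^ d) v \<noteq> \<one>"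
  proof (rule ccontr)
    assume "\<not> Suc d \<le> L"
    then have inj: "inj_on Om ((Om ^^ d) ` H)" using L[rule_format, of "d - L"] by simp
    have "(Om ^^ d) v = (Om ^^ d) \<one>"
      by (rule inj_onD[OF inj]) (use v imageI[OF subgroup.one_closed[OF H], of "Om ^^ d"] in auto)
    then show False using v(3) by simp
  qed
  assume d: "L = Suc d"
  have "\<not> ?P d" by (rule not_less_Least[of d ?P]) (use d in \<open>simp add: L_def\<close>)
  then obtain s where s: "\<not> inj_on Om ((Om ^^ (d + s)) ` H)" by blast
  \<comment> \<open>Injectivity fails at d + s for some s, but it holds from L = d + 1 on, so it
    fails at d itself.\<close>
  have "s = 0"
  proof (rule ccontr)
    assume "s \<noteq> 0"
    then have "L + (s - 1) = d + s" using d by simp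
    then show False using L[rule_format, of "s - 1"] s by simp
  qed
  then obtain a b where ab: "a \<in> H" "b \<in> H" "(Om ^^ d) a \<noteq> (Om ^^ d) b" "(Om ^^ Suc d) a = (Om ^^ Suc d) b"
    using s by (auto simp: inj_on_def)
  have c: "a \<in> carrier G" "b \<in> carrier G" using ab subgroup.mem_carrier[OF H] by auto
  have "(Om ^^ Suc d) (a \<otimes> inv b) = \<one> \<and> (Om ^^ d) (a \<otimes> inv b) \<noteq> \<one>"
    unfolding Om_pow_quotient_one[OF c] using ab by blast
  moreover have "a \<otimes> inv b \<in> H" using subgroup.m_closed[OF H ab(1) subgroup.m_inv_closed[OF H ab(2)]] .
  ultimately show "\<exists>v\<in>H. (Om ^^ Suc d) v = \<one> \<and> (Om ^^ d) v \<noteq> \<one>" by blast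
qed

end

section \<open>The group \<open>K\<^sub>0\<close> of a radical square zero algebra\<close>

context rad_square_zero
begin

abbreviation K0_group :: "(('r, nat \<Rightarrow> 'k) module set \<Rightarrow>\<^sub>0 int) set monoid" where
  "K0_group \<equiv> K0 R"

text \<open>\<open>simp_mod i\<close> lives on the field itself; the copy has the carrier type for
  which \<open>K0\<close> is formed.\<close>

definition simp_copy :: "'v \<Rightarrow> ('r, nat \<Rightarrow> 'k) module" where
  "simp_copy i = (SOME N. N \<in> fg_modules R \<and> mod_iso R (simp_mod i) N)"

definition simp_class :: "'v \<Rightarrow> (('r, nat \<Rightarrow> 'k) module set \<Rightarrow>\<^sub>0 int) set" where
  "simp_class i = K0_class R (simp_copy i)"

lemma simp_copy_props:
  assumes i: "i \<in> V"
  shows "simp_copy i \<in> fg_modules R" "mod_iso R (simp_mod i) (simp_copy i)" "ss (simp_copy i)"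
proof -
  have "\<exists>N :: ('r, nat \<Rightarrow> 'k) module. N \<in> fg_modules R \<and> mod_iso R (simp_mod i) N"
    by (rule fg_copy[OF right_module_simp_mod[OF i] simp_mod_fg[OF i]])
  then have *: "simp_copy i \<in> fg_modules R \<and> mod_iso R (simp_mod i) (simp_copy i)"
    unfolding simp_copy_def by (rule someI_ex)
  then show "simp_copy i \<in> fg_modules R" "mod_iso R (simp_mod i) (simp_copy i)" by blast+
  then show "ss (simp_copy i)"
    using ss_iso[OF ss_simp_mod[OF i] fg_modulesD(1)] by blast
qed

lemma dimv_simp_copy:
  assumes "i \<in> V" "j \<in> V"
  shows "dimv (simp_copy i) j = (if j = i then 1 else 0)"
  using dimv_iso[OF ss_simp_mod[OF assms(1)] simp_mod_fg[OF assms(1)] fg_modulesD(1)[OF simp_copy_props(1)[OF assms(1)]]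
      simp_copy_props(2)[OF assms(1)] assms(2)] dimv_simp_mod[OF assms] by simp

lemma simp_class_closed [simp]: "i \<in> V \<Longrightarrow> simp_class i \<in> carrier K0_group"
  unfolding simp_class_def by (rule K0_class_closed[OF simp_copy_props(1)])

definition simp_comb :: "('v \<Rightarrow> int) \<Rightarrow> (('r, nat \<Rightarrow> 'k) module set \<Rightarrow>\<^sub>0 int) set" where
  "simp_comb f = finprod K0_group (\<lambda>i. simp_class i [^]\<^bsub>K0_group\<^esub> f i) V"

lemma simp_comb_closed [simp]: "simp_comb f \<in> carrier K0_group"
proof -
  interpret K: comm_group K0_group by (rule comm_group_K0)
  show ?thesis unfolding simp_comb_def by (rule K.finprod_closed) auto
qed

lemma simp_comb_cong:
  assumes "\<And>i. i \<in> V \<Longrightarrow> f i = g i"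
  shows "simp_comb f = simp_comb g"
proof -
  interpret K: comm_group K0_group by (rule comm_group_K0)
  show ?thesis unfolding simp_comb_def by (rule K.finprod_cong') (use assms in auto)
qed

lemma simp_comb_add: "simp_comb (\<lambda>i. f i + g i) = simp_comb f \<otimes>\<^bsub>K0_group\<^esub> simp_comb g"
proof -
  interpret K: comm_group K0_group by (rule comm_group_K0)
  have "simp_comb (\<lambda>i. f i + g i) =
      finprod K0_group (\<lambda>i. simp_class i [^]\<^bsub>K0_group\<^esub> f i \<otimes>\<^bsub>K0_group\<^esub> simp_class i [^]\<^bsub>K0_group\<^esub> g i) V"
    unfolding simp_comb_def by (rule K.finprod_cong') (auto simp: K.int_pow_mult)
  also have "\<dots> = simp_comb f \<otimes>\<^bsub>K0_group\<^esub> simp_comb g"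
    unfolding simp_comb_def by (rule K.finprod_multf) auto
  finally show ?thesis .
qed

lemma simp_comb_zero:
  assumes "\<And>i. i \<in> V \<Longrightarrow> f i = 0"
  shows "simp_comb f = \<one>\<^bsub>K0_group\<^esub>"
proof -
  interpret K: comm_group K0_group by (rule comm_group_K0)
  show ?thesis unfolding simp_comb_def by (rule K.finprod_one_eqI) (use assms in auto)
qed

lemma simp_comb_unit:
  assumes i: "i \<in> V"
  shows "simp_comb (\<lambda>j. if j = i then 1 else 0) = simp_class i"
proof -
  interpret K: comm_group K0_group by (rule comm_group_K0)
  have "simp_comb (\<lambda>j. if j = i then 1 else 0) = finprod K0_group (\<lambda>j. if i = j then simp_class j else \<one>\<^bsub>K0_group\<^esub>) V"
    unfolding simp_comb_def by (rule K.finprod_cong') (auto intro: K.int_pow_1)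
  also have "\<dots> = simp_class i" by (rule K.finprod_singleton[OF i finite_V]) auto
  finally show ?thesis .
qed

text \<open>The zero module is isomorphic to the sum of two copies of itself, so its class is
  idempotent.\<close>

lemma K0_class_zero:
  fixes T :: "('r, nat \<Rightarrow> 'k) module"
  assumes "T \<in> fg_modules R" "carrier T = {\<zero>\<^bsub>T\<^esub>}"
  shows "K0_class R T = \<one>\<^bsub>K0_group\<^esub>"
proof -
  interpret K: comm_group K0_group by (rule comm_group_K0)
  note rT = fg_modulesD(1)[OF assms(1)]
  have "mod_iso R T (mod_sum2 T T)"
    by (rule mod_iso_sym[OF mod_iso_sum2_zero[OF rT rT assms(2)] right_module_mod_sum2[OF rT rT]])
  then have "K0_class R T = K0_class R T \<otimes>\<^bsub>K0_group\<^esub> K0_class R T"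
    by (rule K0_class_sum[OF assms(1) assms(1) assms(1)])
  then show ?thesis using K.l_cancel_one'[OF K0_class_closed[OF assms(1)] K0_class_closed[OF assms(1)]] by simp
qed

text \<open>Induction on the total dimension, splitting off one simple summand at a time.\<close>

lemma K0_class_ss:
  fixes T :: "('r, nat \<Rightarrow> 'k) module"
  assumes "T \<in> fg_modules R" "ss T"
  shows "K0_class R T = simp_comb (\<lambda>i. int (dimv T i))"
  using assms
proof (induction "\<Sum>i\<in>V. dimv T i" arbitrary: T rule: less_induct)
  case less
  note T = less.prems
  note rT = fg_modulesD(1)[OF T(1)] and fT = fg_modulesD(2)[OF T(1)]
  interpret T: right_module R T by (rule rT)
  show ?case
  proof (cases "\<exists>i\<in>V. dimv T i \<noteq> 0")
    case False
    then have z: "idem i \<odot>\<^bsub>T\<^esub> x = \<zero>\<^bsub>T\<^esub>" if "i \<in> V" "x \<in> carrier T" for i x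
      using dimv_zero_iff[OF T(2) fT] that by blast
    have "x = \<zero>\<^bsub>T\<^esub>" if x: "x \<in> carrier T" for x
    proof -
      have "x = mk (\<lambda>_. 1) (\<lambda>_. 0) \<odot>\<^bsub>T\<^esub> x" using T.smult_one[OF x] by (simp add: mk_one)
      also have "\<dots> = (\<Oplus>\<^bsub>T\<^esub>i\<in>V. sca 1 \<odot>\<^bsub>T\<^esub> (idem i \<odot>\<^bsub>T\<^esub> x))" by (rule idem_decomp[OF rT x])
      also have "\<dots> = \<zero>\<^bsub>T\<^esub>" by (rule T.M.add.finprod_one_eqI) (simp add: z x)
      finally show ?thesis .
    qed
    then have c: "carrier T = {\<zero>\<^bsub>T\<^esub>}" using submoduleD(3)[OF submodule_UNIV[OF rT]] by blast
    have "simp_comb (\<lambda>i. int (dimv T i)) = \<one>\<^bsub>K0_group\<^esub>" by (rule simp_comb_zero) (use False in simp)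
    then show ?thesis using K0_class_zero[OF T(1) c] by simp
  next
    case True
    then obtain i where i: "i \<in> V" "dimv T i \<noteq> 0" by blast
    have "\<exists>x\<in>carrier T. idem i \<odot>\<^bsub>T\<^esub> x \<noteq> \<zero>\<^bsub>T\<^esub>"
      using i(2) unfolding dimv_zero_iff[OF T(2) fT i(1)] by simp
    then obtain x where x: "x \<in> carrier T" "idem i \<odot>\<^bsub>T\<^esub> x \<noteq> \<zero>\<^bsub>T\<^esub>" by (elim bexE)
    let ?b = "idem i \<odot>\<^bsub>T\<^esub> x"
    have b: "?b \<in> soc T" "idem i \<odot>\<^bsub>T\<^esub> ?b = ?b" "?b \<notin> rad T"
      using x idem_idem[OF rT x(1), of i i] T.smult_closed[OF elem_closed(3) x(1)]
      unfolding ss_soc[OF T(2)] rad_ss[OF T(2)] by auto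
    obtain U where U: "submodule U R T" "mod_iso R T (mod_sum2 (simp_mod i) (T\<lparr>carrier := U\<rparr>))"
      using split_simple[OF rT fT b(1,2) i(1) b(3)] by (elim exE conjE)
    let ?U = "T\<lparr>carrier := U\<rparr>"
    have Uf: "?U \<in> fg_modules R" by (rule fg_modulesI[OF right_module_sub[OF rT U(1)] ss_sub_fg[OF T(2) fT U(1)]])
    have Us: "ss ?U" by (rule ss_sub[OF T(2) U(1)])
    note S = simp_copy_props[OF i(1)]
    have iso: "mod_iso R T (mod_sum2 (simp_copy i) ?U)"
      by (rule mod_iso_trans[OF U(2) mod_iso_sum2_cong[OF S(2) mod_iso_refl]])
    have d: "dimv T j = (if j = i then 1 else 0) + dimv ?U j" if j: "j \<in> V" for j
      using dimv_iso[OF T(2) fT right_module_mod_sum2[OF fg_modulesD(1)[OF S(1)] fg_modulesD(1)[OF Uf]] iso j]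
        dimv_sum2[OF S(3) fg_modulesD(2)[OF S(1)] Us fg_modulesD(2)[OF Uf] j] dimv_simp_copy[OF i(1) j] by simp
    have "(\<Sum>j\<in>V. dimv ?U j) < (\<Sum>j\<in>V. dimv T j)"
      by (rule sum_strict_mono_ex1) (use d i(1) in auto)
    then have "K0_class R ?U = simp_comb (\<lambda>j. int (dimv ?U j))" using Uf Us by (rule less.hyps)
    then have "K0_class R T = simp_comb (\<lambda>j. if j = i then 1 else 0) \<otimes>\<^bsub>K0_group\<^esub> simp_comb (\<lambda>j. int (dimv ?U j))"
      unfolding K0_class_sum[OF T(1) S(1) Uf iso] simp_comb_unit[OF i(1)] by (simp add: simp_class_def)
    also have "\<dots> = simp_comb (\<lambda>j. int (dimv T j))"
      unfolding simp_comb_add[symmetric] by (rule simp_comb_cong) (simp add: d)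
    finally show ?thesis .
  qed
qed

lemma om_mu_copy:
  fixes M N :: "('r, nat \<Rightarrow> 'k) module"
  assumes "M \<in> fg_modules R" "N \<in> fg_modules R" "mod_iso R M N" "i \<in> V"
  shows "om N i = om M i" "mu N i = mu M i"
  using om_mu_iso[OF fg_modulesD(1)[OF assms(1)] fg_modulesD(1)[OF assms(2)] fg_modulesD(2)[OF assms(1)] assms(3,4)]
  by simp_all

lemma om_mu_split:
  fixes M M' M'' :: "('r, nat \<Rightarrow> 'k) module"
  assumes "M \<in> fg_modules R" "M' \<in> fg_modules R" "M'' \<in> fg_modules R" "mod_iso R M (mod_sum2 M' M'')" "i \<in> V"
  shows "om M i = om M' i + om M'' i" "mu M i = mu M' i + mu M'' i"
  using om_mu_iso[OF fg_modulesD(1)[OF assms(1)] right_module_mod_sum2[OF fg_modulesD(1)[OF assms(2)] fg_modulesD(1)[OF assms(3)]]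
      fg_modulesD(2)[OF assms(1)] assms(4,5)]
    om_mu_sum2[OF fg_modulesD(1)[OF assms(2)] fg_modulesD(1)[OF assms(3)] fg_modulesD(2)[OF assms(2)] fg_modulesD(2)[OF assms(3)] assms(5)]
  by simp_all

lemma hom_eq_on_K0:
  assumes "group H" "h \<in> hom K0_group H" "h' \<in> hom K0_group H"
    "\<And>M. M \<in> fg_modules R \<Longrightarrow> h (K0_class R M) = h' (K0_class R M)" "g \<in> carrier K0_group"
  shows "h g = h' g"
  by (rule hom_eq_on_generate[OF comm_group.axioms(2)[OF comm_group_K0] assms(1-3), of "K0_class R ` fg_modules R"])
    (use assms(4,5) K0_generated in auto)

text \<open>Justifies the definite description: existence by the universal property, the class of
  the semisimple syzygy being a combination of simple classes with coefficients \<open>om\<close>;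
  uniqueness because classes of modules generate.\<close>

lemma Omega_bar_props:
  "Omega_bar R \<in> hom K0_group K0_group"
  "M \<in> fg_modules R \<Longrightarrow> Omega_bar R (K0_class R (M :: ('r, nat \<Rightarrow> 'k) module)) = simp_comb (om M)"
proof -
  interpret K: comm_group K0_group by (rule comm_group_K0)
  have syz: "K0_class R (syzygy R M) = simp_comb (om M)" if "M \<in> fg_modules R" for M :: "('r, nat \<Rightarrow> 'k) module"
    unfolding K0_class_ss[OF syzygy_props(1,2)[OF that]]
    by (rule simp_comb_cong) (rule syzygy_props(3)[OF that])
  have "\<exists>h. h \<in> hom K0_group K0_group \<and> (\<forall>M\<in>fg_modules R. h (K0_class R M) = simp_comb (om M))"
  proof (rule K0_hom_exists[OF comm_group_K0])
    fix M N :: "('r, nat \<Rightarrow> 'k) module" assume "M \<in> fg_modules R" "N \<in> fg_modules R" "mod_iso R M N"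
    then show "simp_comb (om N) = simp_comb (om M)"
      by (intro simp_comb_cong om_mu_copy(1))
  next
    fix M M' M'' :: "('r, nat \<Rightarrow> 'k) module"
    assume "M \<in> fg_modules R" "M' \<in> fg_modules R" "M'' \<in> fg_modules R" "mod_iso R M (mod_sum2 M' M'')"
    then show "simp_comb (om M) = simp_comb (om M') \<otimes>\<^bsub>K0_group\<^esub> simp_comb (om M'')"
      unfolding simp_comb_add[symmetric] by (intro simp_comb_cong om_mu_split(1))
  next
    fix P :: "('r, nat \<Rightarrow> 'k) module" assume "P \<in> fg_modules R" "projective_mod R P"
    then show "simp_comb (om P) = \<one>\<^bsub>K0_group\<^esub>" by (intro simp_comb_zero om_mu_projective(1))
  qed simp
  then obtain h where h: "h \<in> hom K0_group K0_group" "\<forall>M\<in>fg_modules R. h (K0_class R M) = simp_comb (om M)"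
    by (elim exE conjE)
  let ?Q = "\<lambda>h. h \<in> hom K0_group K0_group \<and> h \<in> extensional (carrier K0_group) \<and>
     (\<forall>M\<in>fg_modules R. h (K0_class R M) = K0_class R (syzygy R M))"
  have "?Q (Omega_bar R)"
    unfolding Omega_bar_def
  proof (rule theI[of ?Q "restrict h (carrier K0_group)"])
    show "?Q (restrict h (carrier K0_group))"
      using h syz by (auto simp: hom_def)
    fix h' assume h': "?Q h'"
    show "h' = restrict h (carrier K0_group)"
    proof (rule extensionalityI[of _ "carrier K0_group"])
      fix g assume g: "g \<in> carrier K0_group"
      have "h' g = h g" by (rule hom_eq_on_K0[OF K.group_axioms _ h(1) _ g]) (use h' h(2) syz in auto)
      then show "h' g = restrict h (carrier K0_group) g" using g by simp
    qed (use h' in auto)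
  qed
  then show "Omega_bar R \<in> hom K0_group K0_group"
    "M \<in> fg_modules R \<Longrightarrow> Omega_bar R (K0_class R (M :: ('r, nat \<Rightarrow> 'k) module)) = simp_comb (om M)"
    using syz by auto
qed

definition om_hom :: "'v \<Rightarrow> (('r, nat \<Rightarrow> 'k) module set \<Rightarrow>\<^sub>0 int) set \<Rightarrow> int" where
  "om_hom i = (SOME h. h \<in> hom K0_group integer_group \<and> (\<forall>M\<in>fg_modules R. h (K0_class R M) = om M i))"

definition mu_hom :: "'v \<Rightarrow> (('r, nat \<Rightarrow> 'k) module set \<Rightarrow>\<^sub>0 int) set \<Rightarrow> int" where
  "mu_hom i = (SOME h. h \<in> hom K0_group integer_group \<and> (\<forall>M\<in>fg_modules R. h (K0_class R M) = mu M i))"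

lemma om_hom_props:
  assumes i: "i \<in> V"
  shows "om_hom i \<in> hom K0_group integer_group \<and> (\<forall>M\<in>fg_modules R. om_hom i (K0_class R M) = om M i)"
proof -
  have "\<exists>h. h \<in> hom K0_group integer_group \<and> (\<forall>M\<in>fg_modules R. h (K0_class R M) = om M i)"
    by (rule K0_hom_exists[OF abelian_integer_group])
      (use om_mu_copy(1)[OF _ _ _ i] om_mu_split(1)[OF _ _ _ _ i] om_mu_projective(1)[OF _ _ i] in auto)
  then show ?thesis unfolding om_hom_def by (rule someI_ex)
qed

text \<open>An arrow leaving \<open>i\<close> is required: at a sink the simple module is
  projective, and \<open>mu\<close> would not respect the relations of \<open>K0\<close>.\<close>

lemma mu_hom_props:
  assumes i: "i \<in> V" "\<beta> \<in> E" "src \<beta> = i"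
  shows "mu_hom i \<in> hom K0_group integer_group \<and> (\<forall>M\<in>fg_modules R. mu_hom i (K0_class R M) = mu M i)"
proof -
  have "\<exists>h. h \<in> hom K0_group integer_group \<and> (\<forall>M\<in>fg_modules R. h (K0_class R M) = mu M i)"
    by (rule K0_hom_exists[OF abelian_integer_group])
      (use om_mu_copy(2)[OF _ _ _ i(1)] om_mu_split(2)[OF _ _ _ _ i(1)] om_mu_projective(2)[OF _ _ i] in auto)
  then show ?thesis unfolding mu_hom_def by (rule someI_ex)
qed

text \<open>When no arrow starts at \<open>i\<close>, the simple module there is its own induced
  module and hence projective.\<close>

lemma simp_class_sink:
  assumes i: "i \<in> V" "\<And>\<alpha>. \<alpha> \<in> E \<Longrightarrow> src \<alpha> \<noteq> i"
  shows "simp_class i = \<one>\<^bsub>K0_group\<^esub>"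
proof -
  let ?S = "simp_mod i"
  note S = ss_simp_mod[OF i(1)]
  have iso: "mod_iso R (ind_mod ?S) ?S"
  proof (rule mod_isoI[of fst])
    show "fst \<in> mod_hom R (ind_mod ?S) ?S" by (rule mod_homI) auto
    show "right_module R (ind_mod ?S)" by (rule right_module_ind_mod[OF S])
    show "right_module R ?S" by (rule right_module_simp_mod[OF i(1)])
    fix p assume p: "p \<in> carrier (ind_mod ?S)" "fst p = \<zero>\<^bsub>?S\<^esub>"
    have "snd p \<alpha> = 0" if \<alpha>: "\<alpha> \<in> E" for \<alpha>
    proof -
      have "idem (src \<alpha>) \<odot>\<^bsub>?S\<^esub> snd p \<alpha> = 0" using i \<alpha> by (auto simp: idem_def)
      with ind_mod_memD(3)[OF S p(1) \<alpha>, symmetric] show ?thesis by (rule trans)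
    qed
    then have "restrict (snd p) E = (\<lambda>\<alpha>\<in>E. \<zero>\<^bsub>?S\<^esub>)" by (intro restrict_ext) simp
    then show "p = \<zero>\<^bsub>ind_mod ?S\<^esub>" using ind_mod_memD(5)[OF S p(1)] p(2) by (intro prod_eqI) simp_all
  next
    have "x \<in> fst ` carrier (ind_mod ?S)" for x
      using mod_homD(1)[OF ind_mod_top[OF S], of x] unfolding deg_simps by (intro image_eqI[of _ _ "(x, \<lambda>\<alpha>\<in>E. \<zero>\<^bsub>?S\<^esub>)"]) auto
    then show "fst ` carrier (ind_mod ?S) = carrier ?S" by auto
  qed
  have "projective_mod R (simp_copy i)"
    by (rule projective_copy[OF S fg_modulesD(1)[OF simp_copy_props(1)[OF i(1)]] mod_iso_trans[OF iso simp_copy_props(2)[OF i(1)]]])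
  then show ?thesis unfolding simp_class_def by (rule K0_class_projective[OF simp_copy_props(1)[OF i(1)]])
qed

text \<open>Without arrows into \<open>i\<close> the formula for \<open>om\<close> leaves only the
  negative of a dimension, whereas as the dimension of a syzygy it is nonnegative.\<close>

lemma om_source:
  fixes M :: "('r, nat \<Rightarrow> 'k) module"
  assumes "M \<in> fg_modules R" "i \<in> V" "\<And>\<alpha>. \<alpha> \<in> E \<Longrightarrow> tgt \<alpha> \<noteq> i"
  shows "om M i = 0"
proof -
  have "(\<Sum>\<alpha>\<in>E. if tgt \<alpha> = i then dvec M (src \<alpha>) - rvec M (src \<alpha>) else 0) = 0"
    using assms(3) by (intro sum.neutral) simp
  then have "om M i \<le> 0" unfolding om_def rvec_def by simp
  moreover have "om M i \<ge> 0" using syzygy_props(3)[OF assms(1,2)] by (metis of_nat_0_le_iff)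
  ultimately show ?thesis by simp
qed

definition inner_verts :: "'v set" where
  "inner_verts = {i \<in> V. (\<exists>\<alpha>\<in>E. src \<alpha> = i) \<and> (\<exists>\<alpha>\<in>E. tgt \<alpha> = i)}"

lemma omega_group_K0: "omega_group K0_group inner_verts simp_class om_hom mu_hom (Omega_bar R)"
proof -
  interpret K: comm_group K0_group by (rule comm_group_K0)
  have W: "i \<in> V" if "i \<in> inner_verts" for i using that by (simp add: inner_verts_def)
  have mu: "mu_hom i \<in> hom K0_group integer_group \<and> (\<forall>M\<in>fg_modules R. mu_hom i (K0_class R M) = mu M i)"
    if i: "i \<in> inner_verts" for i
    using i mu_hom_props[OF W[OF i]] unfolding inner_verts_def by blast
  show ?thesis
  proof (intro omega_group.intro omega_group_axioms.intro K.comm_group_axioms)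
    show "finite inner_verts" by (simp add: inner_verts_def)
    fix i assume i: "i \<in> inner_verts"
    show "simp_class i \<in> carrier K0_group" using W[OF i] by simp
    show "om_hom i \<in> hom K0_group integer_group" using om_hom_props[OF W[OF i]] by blast
    show "mu_hom i \<in> hom K0_group integer_group" using mu[OF i] by blast
    fix j assume j: "j \<in> inner_verts"
    note S = simp_copy_props[OF W[OF j]]
    have "mu_hom i (simp_class j) = mu (simp_copy j) i"
      using mu[OF i] S(1) unfolding simp_class_def by blast
    also have "\<dots> = (if i = j then 1 else 0)"
      unfolding mu_def vec_ss[OF S(3) fg_modulesD(2)[OF S(1)] W[OF i]] using dimv_simp_copy[OF W[OF j] W[OF i]] by simp
    finally show "mu_hom i (simp_class j) = (if i = j then 1 else 0)" .
  next
    show "Omega_bar R \<in> hom K0_group K0_group" by (rule Omega_bar_props(1))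
    let ?F = "\<lambda>g. finprod K0_group (\<lambda>i. simp_class i [^]\<^bsub>K0_group\<^esub> om_hom i g) inner_verts"
    fix g assume g: "g \<in> carrier K0_group"
    show "Omega_bar R g = ?F g"
    proof (rule hom_eq_on_K0[OF K.group_axioms Omega_bar_props(1) _ _ g])
      show "?F \<in> hom K0_group K0_group"
      proof (rule homI)
        fix x assume "x \<in> carrier K0_group"
        show "?F x \<in> carrier K0_group" using W by (intro K.finprod_closed) auto
      next
        fix x y assume xy: "x \<in> carrier K0_group" "y \<in> carrier K0_group"
        have "?F (x \<otimes>\<^bsub>K0_group\<^esub> y) = finprod K0_group
            (\<lambda>i. simp_class i [^]\<^bsub>K0_group\<^esub> om_hom i x \<otimes>\<^bsub>K0_group\<^esub> simp_class i [^]\<^bsub>K0_group\<^esub> om_hom i y) inner_verts"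
        proof (rule K.finprod_cong')
          fix i assume i: "i \<in> inner_verts"
          have "om_hom i (x \<otimes>\<^bsub>K0_group\<^esub> y) = om_hom i x + om_hom i y"
            using hom_mult[of "om_hom i" K0_group integer_group x y] om_hom_props[OF W[OF i]] xy by simp
          then show "simp_class i [^]\<^bsub>K0_group\<^esub> om_hom i (x \<otimes>\<^bsub>K0_group\<^esub> y) =
              simp_class i [^]\<^bsub>K0_group\<^esub> om_hom i x \<otimes>\<^bsub>K0_group\<^esub> simp_class i [^]\<^bsub>K0_group\<^esub> om_hom i y"
            using W[OF i] by (simp add: K.int_pow_mult)
        qed (use W in auto)
        also have "\<dots> = ?F x \<otimes>\<^bsub>K0_group\<^esub> ?F y" using W by (intro K.finprod_multf) auto
        finally show "?F (x \<otimes>\<^bsub>K0_group\<^esub> y) = ?F x \<otimes>\<^bsub>K0_group\<^esub> ?F y" .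
      qed
      fix M :: "('r, nat \<Rightarrow> 'k) module" assume M: "M \<in> fg_modules R"
      have "simp_comb (om M) = ?F (K0_class R M)"
        unfolding simp_comb_def
      proof (rule K.finprod_mono_neutral_cong_right)
        \<comment> \<open>An omitted vertex contributes nothing: if no arrow leaves it, its class is
          trivial; otherwise no arrow enters it and \<open>om\<close> vanishes.\<close>
        fix i assume i: "i \<in> V - inner_verts"
        then show "simp_class i [^]\<^bsub>K0_group\<^esub> om M i = \<one>\<^bsub>K0_group\<^esub>"
        proof (cases "\<exists>\<alpha>\<in>E. src \<alpha> = i")
          case True
          then have "om M i = 0" using i by (intro om_source[OF M]) (auto simp: inner_verts_def)
          then show ?thesis by simp
        next
          case False
          then have "simp_class i = \<one>\<^bsub>K0_group\<^esub>" using i by (intro simp_class_sink) auto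
          then show ?thesis by simp
        qed
      next
        fix i assume "i \<in> inner_verts"
        then show "simp_class i [^]\<^bsub>K0_group\<^esub> om M i = simp_class i [^]\<^bsub>K0_group\<^esub> om_hom i (K0_class R M)"
          using om_hom_props[OF W] M by metis
      qed (use W in auto)
      then show "Omega_bar R (K0_class R M) = ?F (K0_class R M)" unfolding Omega_bar_props(2)[OF M] .
    qed
  qed
qed

section \<open>Indecomposable modules and the choice of the two summands\<close>

lemma indecomposable_simp_copy:
  assumes i: "i \<in> V"
  shows "indecomposable R (simp_copy i)"
  unfolding indecomposable_def
proof (intro conjI ballI impI)
  note S = simp_copy_props[OF i]
  have rS: "right_module R (simp_mod i)" by (rule right_module_simp_mod[OF i])
  show "carrier (simp_copy i) \<noteq> {\<zero>\<^bsub>simp_copy i\<^esub>}"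
  proof
    assume z: "carrier (simp_copy i) = {\<zero>\<^bsub>simp_copy i\<^esub>}"
    have "dimv (simp_copy i) i = 0"
      using dimv_zero_iff[OF S(3) fg_modulesD(2)[OF S(1)] i]
        right_module.smult_zero_right[OF fg_modulesD(1)[OF S(1)]] z by simp
    then show False using dimv_simp_copy[OF i i] by simp
  qed
  fix M M' :: "('r, nat \<Rightarrow> 'k) module"
  assume M: "M \<in> fg_modules R" "M' \<in> fg_modules R" "mod_iso R (simp_copy i) (mod_sum2 M M')"
  note r = fg_modulesD(1)[OF M(1)] fg_modulesD(1)[OF M(2)]
  interpret M: right_module R M by (rule r(1))
  interpret M': right_module R M' by (rule r(2))
  obtain h where h: "h \<in> mod_hom R (simp_mod i) (mod_sum2 M M')" "bij_betw h UNIV (carrier M \<times> carrier M')"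
    using mod_iso_trans[OF S(2) M(3)] unfolding mod_iso_def by auto
  have h0: "h 0 = (\<zero>\<^bsub>M\<^esub>, \<zero>\<^bsub>M'\<^esub>)"
    using mod_hom_zero[OF h(1) rS right_module_mod_sum2[OF r]] by simp
  show "carrier M = {\<zero>\<^bsub>M\<^esub>} \<or> carrier M' = {\<zero>\<^bsub>M'\<^esub>}"
  proof (rule ccontr)
    assume "\<not> ?thesis"
    then obtain m m' where m: "m \<in> carrier M" "m \<noteq> \<zero>\<^bsub>M\<^esub>" and m': "m' \<in> carrier M'" "m' \<noteq> \<zero>\<^bsub>M'\<^esub>"
      using submoduleD(3)[OF submodule_UNIV[OF r(1)]] submoduleD(3)[OF submodule_UNIV[OF r(2)]] by blast
    have "(m, \<zero>\<^bsub>M'\<^esub>) \<in> range h" "(\<zero>\<^bsub>M\<^esub>, m') \<in> range h"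
      unfolding bij_betw_imp_surj_on[OF h(2)] using m m' by auto
    then obtain x y where x: "(m, \<zero>\<^bsub>M'\<^esub>) = h x" and y: "(\<zero>\<^bsub>M\<^esub>, m') = h y" by (elim rangeE)
    have "x \<noteq> 0" using x h0 m(2) by auto
    then have "y = sca (y / x) \<odot>\<^bsub>simp_mod i\<^esub> x" using i by (simp add: sca_def)
    then have "h y = sca (y / x) \<odot>\<^bsub>mod_sum2 M M'\<^esub> h x"
      using mod_homD(3)[OF h(1) elem_closed(2), of x "y / x"] by simp
    then have "m' = sca (y / x) \<odot>\<^bsub>M'\<^esub> \<zero>\<^bsub>M'\<^esub>" unfolding x[symmetric] y[symmetric] by simp
    then show False using m'(2) M'.smult_zero_right[OF elem_closed(2)] by simp
  qed
qed

text \<open>A nonzero \<open>mu N i\<close> means that in degree \<open>i\<close> the socle is not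
  contained in the radical. Then the simple module at \<open>i\<close> splits off, and
  indecomposability leaves nothing else.\<close>

lemma indecomposable_mu:
  fixes N :: "('r, nat \<Rightarrow> 'k) module"
  assumes N: "N \<in> fg_modules R" "indecomposable R N" and i: "i \<in> V" and mu: "mu N i \<noteq> 0"
  shows "K0_class R N = simp_class i"
proof -
  note r = fg_modulesD(1)[OF N(1)] and f = fg_modulesD(2)[OF N(1)] and S = simp_copy_props[OF i]
  interpret N: right_module R N by (rule r)
  have "\<exists>x\<in>soc N. idem i \<odot>\<^bsub>N\<^esub> x \<notin> rad N"
  proof (rule ccontr)
    assume n: "\<not> ?thesis"
    let ?D = "deg N" and ?T = "(deg N)\<lparr>carrier := soc N\<rparr>"
    have s: "submodule (soc N) R ?D" by (rule submodule_deg[OF r submodule_soc[OF r]])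
    have T: "ss ?T" "finitely_generated R ?T"
      using ss_sub[OF ss_deg[OF r] s] ss_sub_fg[OF ss_deg[OF r] finitely_generated_deg[OF r f] s] by auto
    have "submodule (rad N) R ?D" by (rule submodule_deg[OF r submodule_rad[OF r]])
    note D = submoduleD[OF this]
    have "submodule (rad N) R ?T"
      by (rule submoduleI[OF ssD(1)[OF T(1)]]) (use rad_le_soc[OF r] D(3,4,6) in auto)
    then have "dimv (?T\<lparr>carrier := rad N\<rparr>) i = dimv ?T i"
      by (rule dimv_sub_eq[OF T _ i]) (use n in simp)
    then show False using mu by (simp add: mu_def svec_def rvec_def)
  qed
  then obtain x where x: "x \<in> soc N" "idem i \<odot>\<^bsub>N\<^esub> x \<notin> rad N" by blast
  let ?b = "idem i \<odot>\<^bsub>N\<^esub> x"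
  have xc: "x \<in> carrier N" using x(1) by (simp add: soc_def)
  have b: "?b \<in> soc N" "idem i \<odot>\<^bsub>N\<^esub> ?b = ?b"
    using submoduleD(6)[OF submodule_soc[OF r] elem_closed(3) x(1)] idem_idem[OF r xc, of i i] by auto
  obtain U where U: "submodule U R N" "mod_iso R N (mod_sum2 (simp_mod i) (N\<lparr>carrier := U\<rparr>))"
    using split_simple[OF r f b i x(2)] by (elim exE conjE)
  let ?U = "N\<lparr>carrier := U\<rparr>"
  have rU: "right_module R ?U" by (rule right_module_sub[OF r U(1)])
  have iso: "mod_iso R N (mod_sum2 (simp_copy i) ?U)"
    by (rule mod_iso_trans[OF U(2) mod_iso_sum2_cong[OF S(2) mod_iso_refl]])
  have "finitely_generated R (mod_sum2 (simp_copy i) ?U)"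
    by (rule finitely_generated_iso[OF r right_module_mod_sum2[OF fg_modulesD(1)[OF S(1)] rU] iso f])
  moreover have "snd \<in> mod_hom R (mod_sum2 (simp_copy i) ?U) ?U" by (rule mod_homI) auto
  moreover have "snd ` carrier (mod_sum2 (simp_copy i) ?U) = carrier ?U"
    using submoduleD(3)[OF submodule_UNIV[OF fg_modulesD(1)[OF S(1)]]] by force
  ultimately have "finitely_generated R ?U"
    using finitely_generated_image[OF right_module_mod_sum2[OF fg_modulesD(1)[OF S(1)] rU] rU] by blast
  then have UF: "?U \<in> fg_modules R" by (rule fg_modulesI[OF rU])
  have "carrier (simp_copy i) = {\<zero>\<^bsub>simp_copy i\<^esub>} \<or> carrier ?U = {\<zero>\<^bsub>?U\<^esub>}"
    using N(2) S(1) UF iso unfolding indecomposable_def by blast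
  then have "carrier ?U = {\<zero>\<^bsub>?U\<^esub>}" using indecomposable_simp_copy[OF i] unfolding indecomposable_def by blast
  then have "mod_iso R N (simp_copy i)" by (rule mod_iso_trans[OF iso mod_iso_sum2_zero[OF fg_modulesD(1)[OF S(1)] rU]])
  then show ?thesis unfolding simp_class_def by (rule K0_class_iso[OF N(1) S(1)])
qed

text \<open>The exact value of the supremum enters twice: through a module attaining it, and as the
  upper bound that makes the lower bound for the constructed pair sharp.\<close>

theorem two_summands:
  assumes sup: "(SUP M\<in>(fg_modules R :: ('r, nat \<Rightarrow> 'k) module set). enat (phi R M)) = enat D"
    and V: "V \<noteq> {}" and D: "card inner_verts \<le> D"
  shows "\<exists>(M :: ('r, nat \<Rightarrow> 'k) module) (M1 :: ('r, nat \<Rightarrow> 'k) module) (M2 :: ('r, nat \<Rightarrow> 'k) module).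
    M \<in> fg_modules R \<and> M1 \<in> fg_modules R \<and> M2 \<in> fg_modules R \<and>
    indecomposable R M1 \<and> indecomposable R M2 \<and> mod_iso R M (mod_sum2 M1 M2) \<and> phi R M = D"
proof -
  interpret O: omega_group K0_group inner_verts simp_class om_hom mu_hom "Omega_bar R" by (rule omega_group_K0)
  let ?F = "fg_modules R :: ('r, nat \<Rightarrow> 'k) module set"
  have le: "phi R M \<le> D" if "M \<in> ?F" for M
    using SUP_upper[OF that, of "\<lambda>M. enat (phi R M)"] unfolding sup by simp
  \<comment> \<open>A direct sum of two modules is carried by a product type, so M is a copy of
    it.\<close>
  have pair: "\<exists>M \<in> ?F. mod_iso R M (mod_sum2 M1 M2)" if F: "M1 \<in> ?F" "M2 \<in> ?F" for M1 M2
  proof -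
    note r = fg_modulesD(1)[OF F(1)] fg_modulesD(1)[OF F(2)]
    have rs: "right_module R (mod_sum2 M1 M2)" by (rule right_module_mod_sum2[OF r])
    obtain N :: "('r, nat \<Rightarrow> 'k) module" where N: "N \<in> fg_modules R" "mod_iso R (mod_sum2 M1 M2) N"
      using fg_copy[OF rs finitely_generated_mod_sum2[OF r fg_modulesD(2)[OF F(1)] fg_modulesD(2)[OF F(2)]]]
      by (elim exE conjE)
    show ?thesis by (rule bexI[of _ N]) (rule mod_iso_sym[OF N(2) rs], rule N(1))
  qed
  have inc: "{K0_class R N | N. N \<in> ?F \<and> indecomposable R N \<and> direct_summand R N M} \<subseteq> carrier K0_group" for M
    by auto
  have sub: "subgroup (add_span R M) K0_group" for M :: "('r, nat \<Rightarrow> 'k) module"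
    unfolding add_span_def by (rule O.generate_is_subgroup[OF inc])
  show ?thesis
  proof (cases D)
    \<comment> \<open>Every module has \<phi> = 0 here, so any two indecomposables will do; a vertex
      supplies a simple one.\<close>
    case 0
    obtain i where i: "i \<in> V" using V by blast
    note S = simp_copy_props(1)[OF i] indecomposable_simp_copy[OF i]
    obtain M where M: "M \<in> ?F" "mod_iso R M (mod_sum2 (simp_copy i) (simp_copy i))" using pair[OF S(1) S(1)] by (elim bexE)
    have "phi R M = D" using le[OF M(1)] 0 by simp
    then show ?thesis
      by (intro exI[of _ M] exI[of _ "simp_copy i"] conjI M S)
  next
    case (Suc d)
    \<comment> \<open>A positive finite supremum of natural numbers is attained.\<close>
    have "\<exists>M\<in>?F. phi R M = D"
    proof (rule ccontr)
      assume n: "\<not> ?thesis"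
      have "enat (phi R M) \<le> enat d" if "M \<in> ?F" for M
      proof -
        have "phi R M \<noteq> D" using n that by blast
        then show ?thesis using le[OF that] Suc by simp
      qed
      then have "(SUP M\<in>?F. enat (phi R M)) \<le> enat d" by (intro SUP_least)
      then show False unfolding sup Suc by simp
    qed
    then obtain M where M: "M \<in> ?F" "phi R M = Suc d" unfolding Suc by (elim bexE)
    obtain v where v: "v \<in> add_span R M" "(Omega_bar R ^^ Suc d) v = \<one>\<^bsub>K0_group\<^esub>" "(Omega_bar R ^^ d) v \<noteq> \<one>\<^bsub>K0_group\<^esub>"
      using O.least_injective(2)[OF sub M(2)[unfolded phi_def]] by (elim bexE conjE)
    define X where "X = {K0_class R N | N. N \<in> ?F \<and> indecomposable R N}"
    have X: "X \<subseteq> carrier K0_group" unfolding X_def by auto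
    have "add_span R M \<subseteq> generate K0_group X"
      unfolding add_span_def X_def by (rule O.mono_generate) blast
    then have vX: "v \<in> generate K0_group X" using v(1) by (rule subsetD)
    have sX: "X \<union> simp_class ` inner_verts \<subseteq> X"
    proof (rule Un_least[OF subset_refl], rule image_subsetI)
      fix i assume "i \<in> inner_verts"
      then have i: "i \<in> V" by (simp add: inner_verts_def)
      show "simp_class i \<in> X"
        unfolding X_def simp_class_def using simp_copy_props(1)[OF i] indecomposable_simp_copy[OF i] by blast
    qed
    have "\<exists>a\<in>X. \<exists>b\<in>X. \<exists>w\<in>generate K0_group {a, b}.
        (Omega_bar R ^^ Suc d) w = \<one>\<^bsub>K0_group\<^esub> \<and> (Omega_bar R ^^ d) w \<noteq> \<one>\<^bsub>K0_group\<^esub>"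
    proof (cases d)
      case 0
      have "\<exists>a\<in>X \<union> simp_class ` inner_verts. \<exists>b\<in>X \<union> simp_class ` inner_verts. \<exists>w\<in>generate K0_group {a, b}.
          Omega_bar R w = \<one>\<^bsub>K0_group\<^esub> \<and> w \<noteq> \<one>\<^bsub>K0_group\<^esub>"
      proof (rule O.two_generators_one[OF _ X vX])
        show "card inner_verts \<le> 1" using D Suc 0 by simp
        show "Omega_bar R v = \<one>\<^bsub>K0_group\<^esub>" "v \<noteq> \<one>\<^bsub>K0_group\<^esub>" using v(2,3) 0 by simp_all
        fix i y assume i: "i \<in> inner_verts" and y: "y \<in> X" "mu_hom i y \<noteq> 0"
        obtain N where N: "N \<in> ?F" "indecomposable R N" "y = K0_class R N" using y(1) unfolding X_def by blast
        obtain \<beta> where \<beta>: "i \<in> V" "\<beta> \<in> E" "src \<beta> = i" using i unfolding inner_verts_def by blast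
        have "mu N i \<noteq> 0" using mu_hom_props[OF \<beta>] N(1) y(2) unfolding N(3) by simp
        then show "y = simp_class i" unfolding N(3) by (rule indecomposable_mu[OF N(1,2) \<beta>(1)])
      qed
      then obtain a b w where "a \<in> X \<union> simp_class ` inner_verts" "b \<in> X \<union> simp_class ` inner_verts"
        and w: "w \<in> generate K0_group {a, b}" "Omega_bar R w = \<one>\<^bsub>K0_group\<^esub>" "w \<noteq> \<one>\<^bsub>K0_group\<^esub>"
        by (elim bexE conjE)
      then have "a \<in> X" "b \<in> X" using sX by auto
      then show ?thesis by (rule_tac bexI, rule_tac bexI, rule_tac bexI[OF _ w(1)]) (use w 0 in simp_all)
    next
      case (Suc d')
      show ?thesis unfolding Suc
        by (rule O.two_generators_large[OF _ X vX]) (use D \<open>D = Suc d\<close> v(2,3) Suc in simp_all)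
    qed
    then obtain a b w where a: "a \<in> X" and b: "b \<in> X" and w: "w \<in> generate K0_group {a, b}"
      "(Omega_bar R ^^ Suc d) w = \<one>\<^bsub>K0_group\<^esub>" "(Omega_bar R ^^ d) w \<noteq> \<one>\<^bsub>K0_group\<^esub>" by (elim bexE conjE)
    obtain M1 where M1: "M1 \<in> ?F" "indecomposable R M1" "a = K0_class R M1" using a unfolding X_def by blast
    obtain M2 where M2: "M2 \<in> ?F" "indecomposable R M2" "b = K0_class R M2" using b unfolding X_def by blast
    obtain N where N: "N \<in> ?F" "mod_iso R N (mod_sum2 M1 M2)" using pair[OF M1(1) M2(1)] by (elim bexE)
    have s1: "direct_summand R M1 N" unfolding direct_summand_def by (rule bexI[of _ M2]) (rule N(2), rule M2(1))
    have s2: "direct_summand R M2 N" unfolding direct_summand_def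
      by (rule bexI[of _ M1]) (rule mod_iso_trans[OF N(2) mod_iso_sum2_swap], rule M1(1))
    have "{a, b} \<subseteq> {K0_class R N' | N'. N' \<in> ?F \<and> indecomposable R N' \<and> direct_summand R N' N}"
      using M1 M2 s1 s2 by blast
    then have "generate K0_group {a, b} \<subseteq> add_span R N" unfolding add_span_def by (rule O.mono_generate)
    then have wN: "w \<in> add_span R N" using w(1) by (rule subsetD)
    have "Suc d \<le> phi R N" unfolding phi_def by (rule O.least_injective(1)[OF sub wN w(2,3)])
    then have "phi R N = D" using le[OF N(1)] Suc by simp
    then show ?thesis
      by (intro exI[of _ N] exI[of _ M1] exI[of _ M2] conjI N M1 M2)
  qed
qed

end

section \<open>The path algebra modulo the square of the arrow ideal\<close>

context fin_digraph
begin

lemma path_Nil: "(u, []) \<in> quiver_paths G \<longleftrightarrow> u \<in> verts G"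
  by (auto simp: quiver_paths_def awalk_Nil_iff)

lemma path_Cons: "(u, e # p) \<in> quiver_paths G \<longleftrightarrow> e \<in> arcs G \<and> u = tail G e \<and> (head G e, p) \<in> quiver_paths G"
  by (auto simp: quiver_paths_def awalk_Cons_iff)

lemma awlast_path_append: "last (awalk_verts u (p @ q)) = last (awalk_verts (last (awalk_verts u p)) q)"
  by (induction p arbitrary: u) auto

lemma path_append:
  "(u, p @ q) \<in> quiver_paths G \<longleftrightarrow> (u, p) \<in> quiver_paths G \<and> (last (awalk_verts u p), q) \<in> quiver_paths G"
proof (induction p arbitrary: u)
  case Nil
  show ?case using path_Nil path_Cons by (cases q) auto
next
  case (Cons e p)
  then show ?case by (auto simp: path_Cons)
qed

lemma path_last: "(u, p) \<in> quiver_paths G \<Longrightarrow> last (awalk_verts u p) \<in> verts G"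
  using path_append[of u p "[]"] path_Nil by simp

lemma path_arc: "\<alpha> \<in> arcs G \<Longrightarrow> (u, [\<alpha>]) \<in> quiver_paths G \<longleftrightarrow> u = tail G \<alpha>"
  by (simp add: path_Cons path_Nil)

end

locale quiver = fin_digraph Q for Q :: "('v, 'a) pre_digraph" +
  fixes K :: "'k::field itself"
begin

abbreviation PA :: "('v \<times> 'a list \<Rightarrow> 'k) ring" where "PA \<equiv> path_algebra K Q"

lemma PA_simps:
  "f \<in> carrier PA \<longleftrightarrow> finite {p. f p \<noteq> 0} \<and> {p. f p \<noteq> 0} \<subseteq> quiver_paths Q"
  "\<zero>\<^bsub>PA\<^esub> = (\<lambda>p. 0)" "f \<oplus>\<^bsub>PA\<^esub> g = (\<lambda>p. f p + g p)"
  "\<one>\<^bsub>PA\<^esub> = (\<lambda>(u, p). if u \<in> verts Q \<and> p = [] then 1 else 0)"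
  "(f \<otimes>\<^bsub>PA\<^esub> g) (u, p) = (\<Sum>k\<le>length p. f (u, take k p) * g (last (awalk_verts u (take k p)), drop k p))"
  by (simp_all add: path_algebra_def)

lemma PA_memD: "f \<in> carrier PA \<Longrightarrow> f p \<noteq> 0 \<Longrightarrow> p \<in> quiver_paths Q"
  by (auto simp: PA_simps)

lemma PA_add_closed: "f \<in> carrier PA \<Longrightarrow> g \<in> carrier PA \<Longrightarrow> f \<oplus>\<^bsub>PA\<^esub> g \<in> carrier PA"
proof -
  assume "f \<in> carrier PA" "g \<in> carrier PA"
  moreover have "{p. f p + g p \<noteq> 0} \<subseteq> {p. f p \<noteq> 0} \<union> {p. g p \<noteq> 0}" by auto
  ultimately show ?thesis unfolding PA_simps by (blast intro: finite_subset[OF _ finite_UnI])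
qed

lemma PA_mult_closed:
  assumes f: "f \<in> carrier PA" and g: "g \<in> carrier PA"
  shows "f \<otimes>\<^bsub>PA\<^esub> g \<in> carrier PA"
proof -
  have *: "\<exists>k\<le>length p. f (u, take k p) \<noteq> 0 \<and> g (last (awalk_verts u (take k p)), drop k p) \<noteq> 0"
    if nz: "(f \<otimes>\<^bsub>PA\<^esub> g) (u, p) \<noteq> 0" for u p
  proof (rule ccontr)
    assume "\<not> ?thesis"
    then have "(f \<otimes>\<^bsub>PA\<^esub> g) (u, p) = 0" unfolding PA_simps by (intro sum.neutral) auto
    then show False using nz by simp
  qed
  have "{x. (f \<otimes>\<^bsub>PA\<^esub> g) x \<noteq> 0} \<subseteq> (\<lambda>(x, y). (fst x, snd x @ snd y)) ` ({x. f x \<noteq> 0} \<times> {x. g x \<noteq> 0})"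
  proof
    fix x assume "x \<in> {x. (f \<otimes>\<^bsub>PA\<^esub> g) x \<noteq> 0}"
    moreover obtain u p where x: "x = (u, p)" by (cases x)
    ultimately obtain k where "f (u, take k p) \<noteq> 0" "g (last (awalk_verts u (take k p)), drop k p) \<noteq> 0"
      using *[of u p] by auto
    then show "x \<in> (\<lambda>(x, y). (fst x, snd x @ snd y)) ` ({x. f x \<noteq> 0} \<times> {x. g x \<noteq> 0})"
      by (intro image_eqI[of _ _ "((u, take k p), (last (awalk_verts u (take k p)), drop k p))"]) (auto simp: x)
  qed
  then have "finite {x. (f \<otimes>\<^bsub>PA\<^esub> g) x \<noteq> 0}"
    using f g by (rule_tac finite_subset) (auto simp: PA_simps)
  moreover have "(u, p) \<in> quiver_paths Q" if nz: "(f \<otimes>\<^bsub>PA\<^esub> g) (u, p) \<noteq> 0" for u p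
  proof -
    obtain k where "f (u, take k p) \<noteq> 0" "g (last (awalk_verts u (take k p)), drop k p) \<noteq> 0" using *[OF nz] by blast
    then show ?thesis using path_append[of u "take k p" "drop k p"] PA_memD[OF f] PA_memD[OF g] by simp
  qed
  ultimately show ?thesis unfolding PA_simps(1) by auto
qed

text \<open>Both sides sum over the ways of cutting a path into three pieces.\<close>

lemma PA_mult_assoc: "(f \<otimes>\<^bsub>PA\<^esub> g) \<otimes>\<^bsub>PA\<^esub> h = f \<otimes>\<^bsub>PA\<^esub> (g \<otimes>\<^bsub>PA\<^esub> h)"
proof
  fix x :: "'v \<times> 'a list"
  obtain u p where x: "x = (u, p)" by (cases x)
  let ?w = "\<lambda>k. last (awalk_verts u (take k p))"
  let ?t = "\<lambda>j m. f (u, take j p) * g (?w j, take m (drop j p)) * h (?w (j + m), drop (j + m) p)"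
  have w: "last (awalk_verts (?w j) (take m (drop j p))) = ?w (j + m)" for j m
    unfolding awlast_path_append[symmetric] by (simp add: take_add)
  have "((f \<otimes>\<^bsub>PA\<^esub> g) \<otimes>\<^bsub>PA\<^esub> h) (u, p) = (\<Sum>k\<le>length p. \<Sum>j\<le>k. ?t j (k - j))"
    unfolding PA_simps(5)
  proof (rule sum.cong[OF refl])
    fix k assume k: "k \<in> {..length p}"
    have "(\<Sum>j\<le>length (take k p). f (u, take j (take k p)) * g (last (awalk_verts u (take j (take k p))), drop j (take k p)))
        = (\<Sum>j\<le>k. f (u, take j p) * g (?w j, take (k - j) (drop j p)))"
      using k by (intro sum.cong) (auto simp: min_absorb1 min_absorb2 drop_take)
    then show "(\<Sum>j\<le>length (take k p). f (u, take j (take k p)) * g (last (awalk_verts u (take j (take k p))), drop j (take k p)))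
        * h (?w k, drop k p) = (\<Sum>j\<le>k. ?t j (k - j))"
      by (simp add: sum_distrib_right)
  qed
  also have "\<dots> = (\<Sum>(j, m)\<in>{(j, m). j + m \<le> length p}. ?t j m)"
    by (rule sum.triangle_reindex_eq[symmetric])
  also have "{(j, m). j + m \<le> length p} = Sigma {..length p} (\<lambda>j. {..length p - j})" by auto
  also have "(\<Sum>(j, m)\<in>Sigma {..length p} (\<lambda>j. {..length p - j}). ?t j m) = (\<Sum>j\<le>length p. \<Sum>m\<le>length p - j. ?t j m)"
    by (rule sum.Sigma[symmetric]) auto
  also have "\<dots> = (f \<otimes>\<^bsub>PA\<^esub> (g \<otimes>\<^bsub>PA\<^esub> h)) (u, p)"
    unfolding PA_simps(5) w by (simp add: sum_distrib_left mult.assoc add.commute)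
  finally show "((f \<otimes>\<^bsub>PA\<^esub> g) \<otimes>\<^bsub>PA\<^esub> h) x = (f \<otimes>\<^bsub>PA\<^esub> (g \<otimes>\<^bsub>PA\<^esub> h)) x" unfolding x .
qed

definition path_mono :: "'k \<Rightarrow> 'v \<times> 'a list \<Rightarrow> 'v \<times> 'a list \<Rightarrow> 'k" where
  "path_mono c p = (\<lambda>q. if q = p then c else 0)"

lemma path_mono_closed: "p \<in> quiver_paths Q \<Longrightarrow> path_mono c p \<in> carrier PA"
  by (auto simp: PA_simps path_mono_def)

text \<open>Among the cuts of a path only the one at \<open>length p\<close> can give a nonzero
  term.\<close>

lemma path_mono_mult:
  assumes "v = last (awalk_verts u p)"
  shows "path_mono c (u, p) \<otimes>\<^bsub>PA\<^esub> path_mono d (v, q) = path_mono (c * d) (u, p @ q)"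
proof
  fix x :: "'v \<times> 'a list"
  obtain w r where x: "x = (w, r)" by (cases x)
  let ?f = "\<lambda>k. path_mono c (u, p) (w, take k r) * path_mono d (v, q) (last (awalk_verts w (take k r)), drop k r)"
  have z: "?f k = (if k = length p then path_mono (c * d) (u, p @ q) (w, r) else 0)" if "k \<le> length r" for k
  proof (cases "w = u \<and> take k r = p")
    case True
    then have "k = length p" "r = p @ drop k r" using that append_take_drop_id[of k r] by auto
    then show ?thesis using True assms by (auto simp: path_mono_def)
  next
    case False
    have "path_mono c (u, p) (w, take k r) = 0" using False by (auto simp: path_mono_def)
    moreover have "k = length p \<Longrightarrow> path_mono (c * d) (u, p @ q) (w, r) = 0" using False by (auto simp: path_mono_def)
    ultimately show ?thesis by simp
  qed
  have "(path_mono c (u, p) \<otimes>\<^bsub>PA\<^esub> path_mono d (v, q)) (w, r) =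
      (\<Sum>k\<le>length r. if k = length p then path_mono (c * d) (u, p @ q) (w, r) else 0)"
    unfolding PA_simps(5) by (rule sum.cong[OF refl]) (use z in simp)
  also have "\<dots> = path_mono (c * d) (u, p @ q) (w, r)" by (auto simp: path_mono_def)
  finally show "(path_mono c (u, p) \<otimes>\<^bsub>PA\<^esub> path_mono d (v, q)) x = path_mono (c * d) (u, p @ q) x" unfolding x .
qed

lemma PA_one_closed: "\<one>\<^bsub>PA\<^esub> \<in> carrier PA"
proof -
  have "{p. \<one>\<^bsub>PA\<^esub> p \<noteq> 0} = (\<lambda>u. (u, [])) ` verts Q" by (auto simp: PA_simps(4) split: if_splits)
  then show ?thesis unfolding PA_simps(1) by (auto simp: path_Nil)
qed

lemma PA_one_left:
  assumes f: "f \<in> carrier PA"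
  shows "\<one>\<^bsub>PA\<^esub> \<otimes>\<^bsub>PA\<^esub> f = f"
proof
  fix x :: "'v \<times> 'a list"
  obtain u p where x: "x = (u, p)" by (cases x)
  have "(\<one>\<^bsub>PA\<^esub> \<otimes>\<^bsub>PA\<^esub> f) (u, p) = (\<Sum>k\<le>length p. if k = 0 then (if u \<in> verts Q then f (u, p) else 0) else 0)"
    unfolding PA_simps(5) by (rule sum.cong[OF refl]) (auto simp: PA_simps(4))
  also have "\<dots> = (if u \<in> verts Q then f (u, p) else 0)" by simp
  also have "\<dots> = f (u, p)"
    using PA_memD[OF f, of "(u, p)"] path_append[of u "[]" p] path_Nil by auto
  finally show "(\<one>\<^bsub>PA\<^esub> \<otimes>\<^bsub>PA\<^esub> f) x = f x" unfolding x .
qed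

lemma PA_one_right:
  assumes f: "f \<in> carrier PA"
  shows "f \<otimes>\<^bsub>PA\<^esub> \<one>\<^bsub>PA\<^esub> = f"
proof
  fix x :: "'v \<times> 'a list"
  obtain u p where x: "x = (u, p)" by (cases x)
  have "(f \<otimes>\<^bsub>PA\<^esub> \<one>\<^bsub>PA\<^esub>) (u, p) =
      (\<Sum>k\<le>length p. if k = length p then (if last (awalk_verts u p) \<in> verts Q then f (u, p) else 0) else 0)"
    unfolding PA_simps(5) by (rule sum.cong[OF refl]) (auto simp: PA_simps(4))
  also have "\<dots> = (if last (awalk_verts u p) \<in> verts Q then f (u, p) else 0)" by simp
  also have "\<dots> = f (u, p)" using PA_memD[OF f, of "(u, p)"] path_last[of u p] by auto
  finally show "(f \<otimes>\<^bsub>PA\<^esub> \<one>\<^bsub>PA\<^esub>) x = f x" unfolding x .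
qed

lemma ring_PA: "ring PA"
proof (rule ringI)
  show "abelian_group PA"
  proof (rule abelian_groupI)
    show "\<zero>\<^bsub>PA\<^esub> \<in> carrier PA" by (simp add: PA_simps)
    fix f assume f: "f \<in> carrier PA"
    show "\<exists>g\<in>carrier PA. g \<oplus>\<^bsub>PA\<^esub> f = \<zero>\<^bsub>PA\<^esub>"
      by (rule bexI[of _ "\<lambda>p. - f p"]) (use f in \<open>auto simp: PA_simps\<close>)
    show "\<zero>\<^bsub>PA\<^esub> \<oplus>\<^bsub>PA\<^esub> f = f" by (simp add: PA_simps(2,3))
    fix g assume g: "g \<in> carrier PA"
    show "f \<oplus>\<^bsub>PA\<^esub> g \<in> carrier PA" by (rule PA_add_closed[OF f g])
    show "f \<oplus>\<^bsub>PA\<^esub> g = g \<oplus>\<^bsub>PA\<^esub> f" by (simp add: PA_simps(3) add.commute)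
    show "f \<oplus>\<^bsub>PA\<^esub> g \<oplus>\<^bsub>PA\<^esub> h = f \<oplus>\<^bsub>PA\<^esub> (g \<oplus>\<^bsub>PA\<^esub> h)" for h by (simp add: PA_simps(3) add.assoc)
  qed
  show "Group.monoid PA"
    by (rule monoidI) (simp_all add: PA_mult_closed PA_one_closed PA_mult_assoc PA_one_left PA_one_right)
  fix f g h :: "'v \<times> 'a list \<Rightarrow> 'k"
  show "(f \<oplus>\<^bsub>PA\<^esub> g) \<otimes>\<^bsub>PA\<^esub> h = f \<otimes>\<^bsub>PA\<^esub> h \<oplus>\<^bsub>PA\<^esub> g \<otimes>\<^bsub>PA\<^esub> h"
    "h \<otimes>\<^bsub>PA\<^esub> (f \<oplus>\<^bsub>PA\<^esub> g) = h \<otimes>\<^bsub>PA\<^esub> f \<oplus>\<^bsub>PA\<^esub> h \<otimes>\<^bsub>PA\<^esub> g"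
    by (rule ext, clarsimp simp: PA_simps(3,5) algebra_simps sum.distrib)+
qed

sublocale PA: ring PA by (rule ring_PA)

lemma PA_minus: "f \<in> carrier PA \<Longrightarrow> \<ominus>\<^bsub>PA\<^esub> f = (\<lambda>p. - f p)"
  by (rule PA.minus_equality) (auto simp: PA_simps)

lemma PA_mult_Nil: "(f \<otimes>\<^bsub>PA\<^esub> g) (u, []) = f (u, []) * g (u, [])"
  by (simp add: PA_simps(5))

lemma PA_mult_arc: "(f \<otimes>\<^bsub>PA\<^esub> g) (u, [\<alpha>]) = f (u, []) * g (u, [\<alpha>]) + f (u, [\<alpha>]) * g (head Q \<alpha>, [])"
  by (simp add: PA_simps(5))

section \<open>The arrow ideal and its square\<close>

definition J1 :: "('v \<times> 'a list \<Rightarrow> 'k) set" where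
  "J1 = {f \<in> carrier PA. \<forall>u. f (u, []) = 0}"

definition J2 :: "('v \<times> 'a list \<Rightarrow> 'k) set" where
  "J2 = {f \<in> carrier PA. (\<forall>u. f (u, []) = 0) \<and> (\<forall>u \<alpha>. f (u, [\<alpha>]) = 0)}"

lemma ideal_J1: "ideal J1 PA"
proof (rule idealI[OF ring_PA])
  show "subgroup J1 (add_monoid PA)"
  proof (rule PA.add.subgroupI)
    fix f assume "f \<in> J1"
    then show "\<ominus>\<^bsub>PA\<^esub> f \<in> J1" using PA.a_inv_closed[of f] PA_minus[of f] unfolding J1_def by simp
  next
    fix f g assume "f \<in> J1" "g \<in> J1"
    then show "f \<oplus>\<^bsub>PA\<^esub> g \<in> J1" using PA.a_closed[of f g] by (simp add: J1_def PA_simps(3))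
  qed (use PA.zero_closed in \<open>auto simp: J1_def PA_simps(2)\<close>)
qed (auto simp: J1_def PA_mult_Nil PA_mult_closed)

lemma ideal_J2: "ideal J2 PA"
proof (rule idealI[OF ring_PA])
  show "subgroup J2 (add_monoid PA)"
  proof (rule PA.add.subgroupI)
    fix f assume "f \<in> J2"
    then show "\<ominus>\<^bsub>PA\<^esub> f \<in> J2" using PA.a_inv_closed[of f] PA_minus[of f] unfolding J2_def by simp
  next
    fix f g assume "f \<in> J2" "g \<in> J2"
    then show "f \<oplus>\<^bsub>PA\<^esub> g \<in> J2" using PA.a_closed[of f g] by (simp add: J2_def PA_simps(3))
  qed (use PA.zero_closed in \<open>auto simp: J2_def PA_simps(2)\<close>)
qed (auto simp: J2_def PA_mult_Nil PA_mult_arc PA_mult_closed)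

lemma arrow_paths_closed: "(\<lambda>\<alpha>. path_elem (tail Q \<alpha>, [\<alpha>])) ` arcs Q \<subseteq> carrier PA"
  using path_arc by (auto simp: PA_simps(1) path_elem_def)

lemma ideal_arrow: "ideal (arrow_ideal K Q) PA"
  unfolding arrow_ideal_def by (rule PA.genideal_ideal[OF arrow_paths_closed])

lemma arrow_ideal_le_J1: "arrow_ideal K Q \<subseteq> J1"
  unfolding arrow_ideal_def
  by (rule PA.genideal_minimal[OF ideal_J1]) (use arrow_paths_closed in \<open>auto simp: J1_def path_elem_def\<close>)

lemma arrow_ideal_path:
  assumes "(u, \<alpha> # p) \<in> quiver_paths Q"
  shows "path_mono c (u, \<alpha> # p) \<in> arrow_ideal K Q"
proof -
  have \<alpha>: "\<alpha> \<in> arcs Q" "u = tail Q \<alpha>" "(head Q \<alpha>, p) \<in> quiver_paths Q" using assms by (auto simp: path_Cons)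
  have "path_elem (tail Q \<alpha>, [\<alpha>]) \<in> arrow_ideal K Q"
    unfolding arrow_ideal_def using PA.genideal_self[OF arrow_paths_closed] \<alpha>(1) by blast
  moreover have "path_elem (tail Q \<alpha>, [\<alpha>]) = path_mono 1 (u, [\<alpha>])"
    by (simp add: path_elem_def path_mono_def \<alpha>(2))
  ultimately have "path_mono 1 (u, [\<alpha>]) \<in> arrow_ideal K Q" by simp
  then have "path_mono 1 (u, [\<alpha>]) \<otimes>\<^bsub>PA\<^esub> path_mono c (head Q \<alpha>, p) \<in> arrow_ideal K Q"
    using ideal.I_r_closed[OF ideal_arrow] path_mono_closed[OF \<alpha>(3)] by blast
  then show ?thesis using path_mono_mult[of "head Q \<alpha>" u "[\<alpha>]" 1 c p] by simp
qed

text \<open>A product of two elements without coefficients in length zero has none in length one.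
  Conversely, an element of \<open>J2\<close> is a finite sum of monomials on paths of length at
  least two, each the product of its first arrow and the rest.\<close>

lemma arrow_ideal_sq_eq: "arrow_ideal_sq K Q = J2"
proof
  show "arrow_ideal_sq K Q \<subseteq> J2"
  proof
    fix f assume "f \<in> arrow_ideal_sq K Q"
    then show "f \<in> J2"
      unfolding arrow_ideal_sq_def
    proof (induction rule: ideal_prod.induct)
      case (prod f g)
      then have "f \<in> J1" "g \<in> J1" using arrow_ideal_le_J1 by auto
      then show ?case by (simp add: J1_def J2_def PA_mult_closed PA_mult_Nil PA_mult_arc)
    next
      case (sum f g)
      then show ?case using ideal_J2 by (simp add: additive_subgroup.a_closed[OF ideal.axioms(1)])
    qed
  qed
  show "J2 \<subseteq> arrow_ideal_sq K Q"
  proof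
    interpret I: ideal "arrow_ideal_sq K Q" PA
      unfolding arrow_ideal_sq_def by (rule PA.ideal_prod_is_ideal[OF ideal_arrow ideal_arrow])
    have mono: "path_mono c x \<in> arrow_ideal_sq K Q" if x: "x \<in> quiver_paths Q" "length (snd x) \<ge> 2" for c x
    proof -
      obtain u \<alpha> \<beta> p where e: "x = (u, \<alpha> # \<beta> # p)"
        using x(2) by (metis Suc_le_length_iff numeral_2_eq_2 prod.collapse)
      have "(u, [\<alpha>]) \<in> quiver_paths Q" "(head Q \<alpha>, \<beta> # p) \<in> quiver_paths Q"
        using x(1) unfolding e by (auto simp: path_Cons path_Nil)
      then have "path_mono 1 (u, [\<alpha>]) \<otimes>\<^bsub>PA\<^esub> path_mono c (head Q \<alpha>, \<beta> # p) \<in> arrow_ideal_sq K Q"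
        unfolding arrow_ideal_sq_def by (intro ideal_prod.prod arrow_ideal_path)
      then show ?thesis using path_mono_mult[of "head Q \<alpha>" u "[\<alpha>]" 1 c "\<beta> # p"] e by simp
    qed
    \<comment> \<open>Induction on a finite set containing the support, removing one monomial at a
      time.\<close>
    have *: "f \<in> J2 \<Longrightarrow> {p. f p \<noteq> 0} \<subseteq> S \<Longrightarrow> f \<in> arrow_ideal_sq K Q" if "finite S" for S f
      using that
    proof (induction S arbitrary: f rule: finite_induct)
      case empty
      then have "f = \<zero>\<^bsub>PA\<^esub>" unfolding PA_simps(2) by auto
      then show ?case using I.zero_closed by simp
    next
      case (insert x S)
      show ?case
      proof (cases "f x = 0")
        case True
        then show ?thesis using insert by (intro insert.IH) auto
      next
        case False
        have fc: "f \<in> carrier PA" using insert.prems(1) by (simp add: J2_def)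
        have l: "length (snd x) \<ge> 2"
        proof (rule ccontr)
          assume "\<not> ?thesis"
          then have "snd x = [] \<or> (\<exists>\<alpha>. snd x = [\<alpha>])" by (cases "snd x") (auto simp: not_le less_Suc_eq numeral_2_eq_2)
          then show False using False insert.prems(1) by (cases x) (auto simp: J2_def)
        qed
        have xm: "path_mono (f x) x \<in> arrow_ideal_sq K Q" by (rule mono[OF PA_memD[OF fc False] l])
        have f0: "{p. (f(x := 0)) p \<noteq> 0} \<subseteq> {p. f p \<noteq> 0}" by auto
        have "finite {p. f p \<noteq> 0}" "{p. f p \<noteq> 0} \<subseteq> quiver_paths Q" using fc by (simp_all only: PA_simps(1))
        then have "f(x := 0) \<in> carrier PA" unfolding PA_simps(1) using finite_subset[OF f0] f0 by blast
        then have m: "f(x := 0) \<in> J2" using insert.prems(1) by (simp add: J2_def)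
        have "f(x := 0) \<in> arrow_ideal_sq K Q" by (rule insert.IH[OF m]) (use insert.prems(2) in auto)
        then have "path_mono (f x) x \<oplus>\<^bsub>PA\<^esub> f(x := 0) \<in> arrow_ideal_sq K Q" by (rule I.a_closed[OF xm])
        moreover have "path_mono (f x) x \<oplus>\<^bsub>PA\<^esub> f(x := 0) = f" by (auto simp: PA_simps(3) path_mono_def)
        ultimately show ?thesis by simp
      qed
    qed
    fix f assume "f \<in> J2"
    then show "f \<in> arrow_ideal_sq K Q" using *[of "{p. f p \<noteq> 0}" f] by (simp add: J2_def PA_simps(1))
  qed
qed

lemma J2_coeffs: "h \<in> J2 \<Longrightarrow> h (u, []) = 0" "h \<in> J2 \<Longrightarrow> h (u, [\<alpha>]) = 0"
  by (simp_all add: J2_def)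

sublocale J2: ideal J2 PA by (rule ideal_J2)

section \<open>The quotient algebra and its coefficients\<close>

abbreviation AQ :: "('v \<times> 'a list \<Rightarrow> 'k) set ring" where "AQ \<equiv> rad_sq_zero_algebra K Q"

lemma AQ_eq: "AQ = PA Quot J2"
  by (simp add: rad_sq_zero_algebra_def arrow_ideal_sq_eq)

text \<open>Written exactly as in \<open>simple_mod\<close>, so that the two descriptions of the
  simple modules coincide.\<close>

definition vcoeff :: "('v \<times> 'a list \<Rightarrow> 'k) set \<Rightarrow> 'v \<Rightarrow> 'k" where
  "vcoeff a i = the_elem ((\<lambda>f. f (i, [])) ` a)"

definition acoeff :: "('v \<times> 'a list \<Rightarrow> 'k) set \<Rightarrow> 'a \<Rightarrow> 'k" where
  "acoeff a \<alpha> = the_elem ((\<lambda>f. f (tail Q \<alpha>, [\<alpha>])) ` a)"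

definition short_elem :: "('v \<Rightarrow> 'k) \<Rightarrow> ('a \<Rightarrow> 'k) \<Rightarrow> 'v \<times> 'a list \<Rightarrow> 'k" where
  "short_elem f g = (\<lambda>(u, p). case p of [] \<Rightarrow> if u \<in> verts Q then f u else 0
     | \<alpha> # q \<Rightarrow> if q = [] \<and> \<alpha> \<in> arcs Q \<and> u = tail Q \<alpha> then g \<alpha> else 0)"

abbreviation coset :: "('v \<times> 'a list \<Rightarrow> 'k) \<Rightarrow> ('v \<times> 'a list \<Rightarrow> 'k) set" where
  "coset f \<equiv> J2 +>\<^bsub>PA\<^esub> f"

lemma coset_eq: "coset f = (\<lambda>h p. h p + f p) ` J2"
  by (auto simp: a_r_coset_def' PA_simps(3))

text \<open>Elements of \<open>J2\<close> vanish at paths of length at most one, so all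
  representatives of a coset agree there.\<close>

lemma coeff_coset: "vcoeff (coset f) i = f (i, [])" "acoeff (coset f) \<alpha> = f (tail Q \<alpha>, [\<alpha>])"
proof -
  have gen: "(\<lambda>g. g x) ` coset f = {f x}" if x: "\<And>h. h \<in> J2 \<Longrightarrow> h x = 0" for x
  proof -
    have "(\<lambda>g. g x) ` coset f = (\<lambda>h. f x) ` J2"
      unfolding coset_eq image_image by (rule image_cong) (simp_all add: x)
    also have "\<dots> = {f x}" by (rule image_constant[OF J2.zero_closed])
    finally show ?thesis .
  qed
  have "(\<lambda>g. g (i, [])) ` coset f = {f (i, [])}" "(\<lambda>g. g (tail Q \<alpha>, [\<alpha>])) ` coset f = {f (tail Q \<alpha>, [\<alpha>])}"
    by (rule gen, erule J2_coeffs)+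
  then show "vcoeff (coset f) i = f (i, [])" "acoeff (coset f) \<alpha> = f (tail Q \<alpha>, [\<alpha>])"
    by (simp_all add: vcoeff_def acoeff_def)
qed

lemma AQ_simps:
  "a \<in> carrier AQ \<longleftrightarrow> (\<exists>f\<in>carrier PA. a = coset f)" "\<one>\<^bsub>AQ\<^esub> = coset \<one>\<^bsub>PA\<^esub>"
  "f \<in> carrier PA \<Longrightarrow> g \<in> carrier PA \<Longrightarrow> coset f \<oplus>\<^bsub>AQ\<^esub> coset g = coset (f \<oplus>\<^bsub>PA\<^esub> g)"
  "f \<in> carrier PA \<Longrightarrow> g \<in> carrier PA \<Longrightarrow> coset f \<otimes>\<^bsub>AQ\<^esub> coset g = coset (f \<otimes>\<^bsub>PA\<^esub> g)"
  unfolding AQ_eq by (auto simp: FactRing_def A_RCOSETS_def' J2.a_rcos_sum J2.rcoset_mult_add)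

lemma short_elem_closed: "short_elem f g \<in> carrier PA"
proof -
  have "{x. short_elem f g x \<noteq> 0} \<subseteq> (\<lambda>u. (u, [])) ` verts Q \<union> (\<lambda>\<alpha>. (tail Q \<alpha>, [\<alpha>])) ` arcs Q"
    by (auto simp: short_elem_def split: list.splits if_splits)
  moreover have "finite \<dots>" by simp
  moreover have "\<dots> \<subseteq> quiver_paths Q" using path_Nil path_arc by auto
  ultimately show ?thesis unfolding PA_simps(1) by (blast intro: finite_subset)
qed

sublocale A: rad_square_zero AQ "verts Q" "arcs Q" "tail Q" "head Q" vcoeff acoeff "\<lambda>f g. coset (short_elem f g)"
proof (intro rad_square_zero.intro rad_square_zero_axioms.intro)
  show "ring AQ" unfolding AQ_eq by (rule J2.quotient_is_ring)
  fix a b assume "a \<in> carrier AQ" "b \<in> carrier AQ"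
  then obtain f g where fg: "f \<in> carrier PA" "g \<in> carrier PA" "a = coset f" "b = coset g" by (auto simp: AQ_simps(1))
  show "vcoeff (a \<oplus>\<^bsub>AQ\<^esub> b) i = vcoeff a i + vcoeff b i" for i
    unfolding fg AQ_simps(3)[OF fg(1,2)] coeff_coset by (simp add: PA_simps(3))
  show "acoeff (a \<oplus>\<^bsub>AQ\<^esub> b) \<alpha> = acoeff a \<alpha> + acoeff b \<alpha>" for \<alpha>
    unfolding fg AQ_simps(3)[OF fg(1,2)] coeff_coset by (simp add: PA_simps(3))
  show "vcoeff (a \<otimes>\<^bsub>AQ\<^esub> b) i = vcoeff a i * vcoeff b i" for i
    unfolding fg AQ_simps(4)[OF fg(1,2)] coeff_coset by (rule PA_mult_Nil)
  show "acoeff (a \<otimes>\<^bsub>AQ\<^esub> b) \<alpha> = vcoeff a (tail Q \<alpha>) * acoeff b \<alpha> + acoeff a \<alpha> * vcoeff b (head Q \<alpha>)" for \<alpha>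
    unfolding fg AQ_simps(4)[OF fg(1,2)] coeff_coset by (rule PA_mult_arc)
  assume v: "\<And>i. i \<in> verts Q \<Longrightarrow> vcoeff a i = vcoeff b i" and ar: "\<And>\<alpha>. \<alpha> \<in> arcs Q \<Longrightarrow> acoeff a \<alpha> = acoeff b \<alpha>"
  \<comment> \<open>At pairs that are not paths both functions vanish, so agreement on the vertices
    and arrows of Q gives agreement in lengths zero and one. The difference of the representatives
    then lies in \<open>J2\<close>.\<close>
  have 1: "f (u, []) = g (u, [])" for u
    using v[of u] PA_memD[OF fg(1), of "(u, [])"] PA_memD[OF fg(2), of "(u, [])"]
    unfolding fg coeff_coset path_Nil by metis
  have 2: "f (u, [\<alpha>]) = g (u, [\<alpha>])" for u \<alpha>
    using ar[of \<alpha>] PA_memD[OF fg(1), of "(u, [\<alpha>])"] PA_memD[OF fg(2), of "(u, [\<alpha>])"]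
    unfolding fg coeff_coset path_Cons by metis
  have d: "f \<ominus>\<^bsub>PA\<^esub> g = (\<lambda>p. f p - g p)"
    unfolding a_minus_def PA_minus[OF fg(2)] PA_simps(3) by simp
  have "(\<lambda>p. f p - g p) \<in> carrier PA" using PA.minus_closed[OF fg(1,2)] unfolding d .
  then have "f \<ominus>\<^bsub>PA\<^esub> g \<in> J2" unfolding d J2_def mem_Collect_eq using 1 2 by (intro conjI allI) simp_all
  then show "a = b" using PA.quotient_eq_iff_same_a_r_cos[OF ideal_J2 fg(1,2)] fg(3,4) by blast
qed (auto simp: AQ_simps(1,2) coeff_coset PA_simps(4) short_elem_def intro!: bexI[OF _ short_elem_closed])

lemma vertex_idem_eq:
  assumes "i \<in> verts Q"
  shows "vertex_idem K Q i = A.idem i"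
proof -
  have c: "path_elem (i, []) \<in> carrier PA" using assms by (auto simp: PA_simps(1) path_elem_def path_Nil)
  have v: "vertex_idem K Q i = coset (path_elem (i, []))" by (simp add: vertex_idem_def arrow_ideal_sq_eq)
  have idem: "A.idem i = coset (short_elem (\<lambda>j. if j = i then 1 else 0) (\<lambda>_. 0))" by (rule A.idem_def)
  show ?thesis
    unfolding v
  proof (rule A.coeff_eqI)
    show "coset (path_elem (i, [])) \<in> carrier AQ" using c unfolding AQ_simps(1) by blast
    show "A.idem i \<in> carrier AQ" by (rule A.elem_closed(3))
    show "vcoeff (coset (path_elem (i, []))) j = vcoeff (A.idem i) j" if "j \<in> verts Q" for j
      unfolding idem coeff_coset using that by (simp add: path_elem_def short_elem_def)
    show "acoeff (coset (path_elem (i, []))) \<alpha> = acoeff (A.idem i) \<alpha>" if "\<alpha> \<in> arcs Q" for \<alpha>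
      unfolding idem coeff_coset by (simp add: path_elem_def short_elem_def)
  qed
qed

lemma simple_mod_eq: "simple_mod K = A.simp_mod"
  by (rule ext) (simp add: simple_mod_def A.simp_mod_def vcoeff_def)

text \<open>With arrows into and out of every vertex, full support passes from the sum of all simple
  modules to its iterated syzygies and cosyzygies, so the heart is the whole quiver.\<close>

lemma member_empty:
  assumes out: "\<And>i. i \<in> verts Q \<Longrightarrow> \<exists>\<alpha>\<in>arcs Q. tail Q \<alpha> = i" and inc: "\<And>i. i \<in> verts Q \<Longrightarrow> \<exists>\<alpha>\<in>arcs Q. head Q \<alpha> = i"
  shows "verts (member_quiver K Q) = {}"
proof -
  let ?M = "A0_mod K Q" and ?n = "card (verts Q)"
  have "\<exists>M :: (('v \<times> 'a list \<Rightarrow> 'k) set, nat \<Rightarrow> 'k) module. M \<in> fg_modules AQ \<and> mod_iso AQ M (mod_sum (verts Q) (simple_mod K))"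
    unfolding simple_mod_eq by (rule A.sum_of_simples(1))
  then have M: "?M \<in> fg_modules AQ \<and> mod_iso AQ ?M (mod_sum (verts Q) (simple_mod K))"
    unfolding A0_mod_def by (rule someI_ex)
  then have s: "A.ss ?M \<and> A.full ?M" using A.sum_of_simples(2)[of ?M] unfolding simple_mod_eq by blast
  have supp: "module_support K Q N = verts Q" if "A.full N" for N
    using that by (auto simp: module_support_def A.full_def vertex_idem_eq)
  have "A.full ((syzygy AQ ^^ ?n) ?M)" "A.full ((cosyzygy AQ ^^ ?n) ?M)"
    using A.iterated_full[of ?M ?n] s M out inc by blast+
  then have "verts (heart_quiver K Q) = verts Q"
    by (simp add: heart_quiver_def Let_def supp)
  then show ?thesis by (simp add: member_quiver_def)
qed

text \<open>A nonempty member forces a sink or a source, and this vertex is missing from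
  \<open>inner_verts\<close>.\<close>

lemma card_inner_verts:
  "card A.inner_verts \<le> (if verts (member_quiver K Q) = {} then card (verts Q) else card (verts Q) - 1)"
proof (cases "verts (member_quiver K Q) = {}")
  case True
  then show ?thesis by (auto simp: A.inner_verts_def intro!: card_mono)
next
  case False
  have "A.inner_verts \<noteq> verts Q"
  proof
    assume e: "A.inner_verts = verts Q"
    have "verts (member_quiver K Q) = {}"
      by (rule member_empty) (use e in \<open>auto simp: A.inner_verts_def\<close>)
    then show False using False by simp
  qed
  moreover have "A.inner_verts \<subseteq> verts Q" by (auto simp: A.inner_verts_def)
  ultimately have "card A.inner_verts < card (verts Q)" by (intro psubset_card_mono) auto
  then show ?thesis using False by simp
qed

end

theorem corollary5p7:
  fixes Q :: "('v, 'a) pre_digraph"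
    and K :: "'k::field itself"
    and A :: "('v \<times> 'a list \<Rightarrow> 'k) set ring"
    and n :: nat
  assumes "fin_digraph Q" and "Digraph_Component.connected Q"
    and "A = rad_sq_zero_algebra K Q"
    and "n = card (verts Q)"
    and "phi_dim K Q = (if verts (member_quiver K Q) = {} then enat n else enat (n - 1))"
  shows "\<exists>(M :: ('v, 'a, 'k) quiver_module) (M1 :: ('v, 'a, 'k) quiver_module)
            (M2 :: ('v, 'a, 'k) quiver_module).
           M \<in> fg_modules A \<and> M1 \<in> fg_modules A \<and> M2 \<in> fg_modules A \<and>
           indecomposable A M1 \<and> indecomposable A M2 \<and> mod_iso A M (mod_sum2 M1 M2) \<and>
           enat (phi A M) = phi_dim K Q"
proof -
  interpret quiver Q K by (intro quiver.intro assms(1))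
  define D where "D = (if verts (member_quiver K Q) = {} then n else n - 1)"
  have D: "phi_dim K Q = enat D" unfolding assms(5) D_def by simp
  have "(SUP M\<in>(fg_modules AQ :: ('v, 'a, 'k) quiver_module set). enat (phi AQ M)) = enat D"
    using D unfolding phi_dim_def Let_def .
  \<comment> \<open>Connectedness includes that there is at least one vertex.\<close>
  moreover have "verts Q \<noteq> {}" using assms(2) by (auto simp: Digraph_Component.connected_def strongly_connected_def)
  moreover have "card A.inner_verts \<le> D" using card_inner_verts unfolding D_def assms(4) .
  ultimately have "\<exists>(M :: ('v, 'a, 'k) quiver_module) (M1 :: ('v, 'a, 'k) quiver_module) (M2 :: ('v, 'a, 'k) quiver_module).
    M \<in> fg_modules AQ \<and> M1 \<in> fg_modules AQ \<and> M2 \<in> fg_modules AQ \<and>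
    indecomposable AQ M1 \<and> indecomposable AQ M2 \<and> mod_iso AQ M (mod_sum2 M1 M2) \<and> phi AQ M = D"
    by (rule A.two_summands)
  then show ?thesis unfolding assms(3) D by simp
qed

end
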